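(* Let $R$ be a graded local ring and let $D$ be a differential $R$-module (of degree $a$ for some $a\in\mathbb{Z}$) such that its homology $H(D)$ is finitely generated. (a) If $H(D)$ has finite projective dimension, then $D$ admits a minimal free resolution $M\to D$ that is unique up to isomorphism of differential modules and such that $M$ has finite rank as an $R$-module. (b) If $R_0$ is a field, and the differential on $D$ is homogeneous of degree $0$ (i.e. $a=0$), then $D$ admits a minimal free resolution $M\to D$ that is unique up to isomorphism of differential modules. Any basis for $M$ as an $R$-module has finitely many elements of degree $j$ for any $j\in\mathbb{Z}$ and no degree $j$ elements for $j\ll 0$.
   Context: A graded local ring is an $\mathbb{N}$-graded Noetherian (not necessarily commutative) ring $R=\bigoplus_{i\ge 0}R_i$ with $R_0$ a (not necessarily commutative) local ring; $\mathfrak{m}$ denotes its maximal ideal, the sum of the maximal ideal of $R_0$ and $R_+=\bigoplus_{i>0}R_i$. All modules are graded left $R$-modules, and all maps are graded (homogeneous); $D(a)$ denotes the twist with $D(a)_j=D_{a+j}$. Bases of free modules are homogeneous. For $a\in\mathbb{Z}$, a degree $a$ differential $R$-module is a pair $(D,\partial)$ with $D$ an $R$-module and $\partial\colon D\to D(a)$ a homogeneous $R$-linear map with $\partial^2=0$. A morphism $D\to D'$ is a homogeneous (degree-preserving) $R$-linear map $f$ with $f\partial=\partial' f$. The homology of $D$ is $H(D)=\ker(\partial\colon D\to D(a))/\operatorname{im}(\partial\colon D(-a)\to D)$. A quasi-isomorphism is a morphism inducing an isomorphism on homology. A differential module is free if its underlying module is a free (graded) $R$-module. A free flag is a differential module of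 the form $F=\bigoplus_{i\ge 0}F_i$ where each $F_i$ is a free $R$-module and $\partial_F(F_i)\subseteq\bigoplus_{j<i}F_j$ (up to the twist by $a$) for all $i$. A free flag resolution of $D$ is a quasi-isomorphism $F\to D$ with $F$ a free flag. A free resolution of $D$ is a quasi-isomorphism $\epsilon\colon F\to D$ such that $F$ is a free differential module and $\epsilon$ factors as $F\to\widetilde F\to D$, where $\widetilde F\to D$ is a free flag resolution and $F\to\widetilde F$ is a split injection of differential modules. It is a minimal free resolution if moreover $\partial_F(F)\subseteq\mathfrak{m}F$. *)

theory Defs
  imports "HOL-Algebra.Module" "HOL-Algebra.AbelCoset"
begin

section \<open>Direct sums, linear combinations and one-sided ideals\<close>

definition internal_sum :: "('m, 'x) ring_scheme \<Rightarrow> 'i set \<Rightarrow> ('i \<Rightarrow> 'm set) \<Rightarrow> 'm set"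
  where "internal_sum M I G =
    {finsum M f J | f J. finite J \<and> J \<subseteq> I \<and> f \<in> (\<Pi> i\<in>J. G i)}"

definition is_direct_sum :: "('m, 'x) ring_scheme \<Rightarrow> ('i \<Rightarrow> 'm set) \<Rightarrow> bool"
  where "is_direct_sum M G \<longleftrightarrow>
    (\<forall>i. additive_subgroup (G i) M) \<and>
    (\<forall>x\<in>carrier M. \<exists>!f. (\<forall>i. f i \<in> G i) \<and> finite {i. f i \<noteq> \<zero>\<^bsub>M\<^esub>} \<and>
        x = finsum M f {i. f i \<noteq> \<zero>\<^bsub>M\<^esub>})"

definition lin_combs :: "('r, 'm, 'x) module_scheme \<Rightarrow> 'r set \<Rightarrow> 'm set \<Rightarrow> 'm set"
  where "lin_combs M I S =
    {(\<Oplus>\<^bsub>M\<^esub>x\<in>A. c x \<odot>\<^bsub>M\<^esub> x) | c A. finite A \<and> A \<subseteq> S \<and> c \<in> A \<rightarrow> I}"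

definition left_ideal :: "'r set \<Rightarrow> ('r, 'x) ring_scheme \<Rightarrow> bool"
  where "left_ideal I R \<longleftrightarrow>
    additive_subgroup I R \<and> (\<forall>r\<in>carrier R. \<forall>x\<in>I. r \<otimes>\<^bsub>R\<^esub> x \<in> I)"

definition right_ideal :: "'r set \<Rightarrow> ('r, 'x) ring_scheme \<Rightarrow> bool"
  where "right_ideal I R \<longleftrightarrow>
    additive_subgroup I R \<and> (\<forall>r\<in>carrier R. \<forall>x\<in>I. x \<otimes>\<^bsub>R\<^esub> r \<in> I)"

definition acc :: "('r set \<Rightarrow> bool) \<Rightarrow> bool"
  where "acc P \<longleftrightarrow>
    (\<forall>C :: nat \<Rightarrow> 'r set. (\<forall>n. P (C n) \<and> C n \<subseteq> C (Suc n)) \<longrightarrow> (\<exists>N. \<forall>n\<ge>N. C n = C N))"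

text \<open>A noncommutative ring is called Noetherian if it is both left and right Noetherian.
  (The library's \<open>noetherian_ring\<close> is about two-sided ideals.)\<close>

definition noncomm_noetherian :: "('r, 'x) ring_scheme \<Rightarrow> bool"
  where "noncomm_noetherian R \<longleftrightarrow>
    ring R \<and> acc (\<lambda>I. left_ideal I R) \<and> acc (\<lambda>I. right_ideal I R)"

definition maximal_left_ideal :: "'r set \<Rightarrow> ('r, 'x) ring_scheme \<Rightarrow> bool"
  where "maximal_left_ideal I R \<longleftrightarrow>
    left_ideal I R \<and> I \<noteq> carrier R \<and>
    (\<forall>J. left_ideal J R \<longrightarrow> I \<subseteq> J \<longrightarrow> J = I \<or> J = carrier R)"

text \<open>The unique maximal left ideal of a local ring is its Jacobson radical; it is two-sided and
  is also the unique maximal right ideal.\<close>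

definition local_ring :: "('r, 'x) ring_scheme \<Rightarrow> bool"
  where "local_ring R \<longleftrightarrow> ring R \<and> (\<exists>!I. maximal_left_ideal I R)"

definition max_ideal :: "('r, 'x) ring_scheme \<Rightarrow> 'r set"
  where "max_ideal R = (THE I. maximal_left_ideal I R)"


section \<open>Graded local rings\<close>

record 'r graded_ring = "'r ring" +
  rgrade :: "nat \<Rightarrow> 'r set"

locale graded_ring = ring R for R :: "('r, 'x) graded_ring_scheme" (structure) +
  assumes direct_sum: "is_direct_sum R (rgrade R)"
    and one_degree: "\<one> \<in> rgrade R 0"
    and mult_degree: "\<lbrakk>x \<in> rgrade R i; y \<in> rgrade R j\<rbrakk> \<Longrightarrow> x \<otimes> y \<in> rgrade R (i + j)"

definition degree_zero_ring :: "('r, 'x) graded_ring_scheme \<Rightarrow> ('r, 'x) graded_ring_scheme"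
  where "degree_zero_ring R = R\<lparr>carrier := rgrade R 0\<rparr>"

locale graded_local_ring = graded_ring R for R :: "('r, 'x) graded_ring_scheme" (structure) +
  assumes noetherian: "noncomm_noetherian R"
    and local_degree_zero: "local_ring (degree_zero_ring R)"

definition graded_max_ideal :: "('r, 'x) graded_ring_scheme \<Rightarrow> 'r set"
  where "graded_max_ideal R =
    max_ideal (degree_zero_ring R) <+>\<^bsub>R\<^esub> internal_sum R {0<..} (rgrade R)"


section \<open>Graded left modules\<close>

text \<open>The library's \<open>module\<close> locale requires a commutative ring.\<close>

locale left_module = R?: ring R + M?: abelian_group M
  for R :: "('r, 'x) ring_scheme" (structure) and M :: "('r, 'm, 'y) module_scheme" (structure) +
  assumes smult_closed:
      "\<lbrakk>a \<in> carrier R; x \<in> carrier M\<rbrakk> \<Longrightarrow> a \<odot>\<^bsub>M\<^esub> x \<in> carrier M"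
    and smult_l_distr:
      "\<lbrakk>a \<in> carrier R; b \<in> carrier R; x \<in> carrier M\<rbrakk> \<Longrightarrow>
        (a \<oplus>\<^bsub>R\<^esub> b) \<odot>\<^bsub>M\<^esub> x = a \<odot>\<^bsub>M\<^esub> x \<oplus>\<^bsub>M\<^esub> b \<odot>\<^bsub>M\<^esub> x"
    and smult_r_distr:
      "\<lbrakk>a \<in> carrier R; x \<in> carrier M; y \<in> carrier M\<rbrakk> \<Longrightarrow>
        a \<odot>\<^bsub>M\<^esub> (x \<oplus>\<^bsub>M\<^esub> y) = a \<odot>\<^bsub>M\<^esub> x \<oplus>\<^bsub>M\<^esub> a \<odot>\<^bsub>M\<^esub> y"
    and smult_assoc:
      "\<lbrakk>a \<in> carrier R; b \<in> carrier R; x \<in> carrier M\<rbrakk> \<Longrightarrow>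
        (a \<otimes>\<^bsub>R\<^esub> b) \<odot>\<^bsub>M\<^esub> x = a \<odot>\<^bsub>M\<^esub> (b \<odot>\<^bsub>M\<^esub> x)"
    and smult_one: "x \<in> carrier M \<Longrightarrow> \<one>\<^bsub>R\<^esub> \<odot>\<^bsub>M\<^esub> x = x"

record ('r, 'm) graded_module = "('r, 'm) module" +
  grade :: "int \<Rightarrow> 'm set"

locale graded_module = R?: graded_ring R + left_module R M
  for R :: "('r, 'x) graded_ring_scheme" (structure)
    and M :: "('r, 'm, 'y) graded_module_scheme" (structure) +
  assumes module_direct_sum: "is_direct_sum M (grade M)"
    and smult_degree:
      "\<lbrakk>a \<in> rgrade R i; x \<in> grade M j\<rbrakk> \<Longrightarrow> a \<odot>\<^bsub>M\<^esub> x \<in> grade M (int i + j)"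

definition twist :: "('r, 'm, 'y) graded_module_scheme \<Rightarrow> int \<Rightarrow> ('r, 'm, 'y) graded_module_scheme"
  where "twist M a = M\<lparr>grade := (\<lambda>j. grade M (a + j))\<rparr>"

definition graded_hom ::
    "('r, 'x) graded_ring_scheme \<Rightarrow> ('r, 'm, 'y) graded_module_scheme \<Rightarrow>
     ('r, 'n, 'z) graded_module_scheme \<Rightarrow> ('m \<Rightarrow> 'n) set"
  where "graded_hom R M N =
    {f. f \<in> carrier M \<rightarrow> carrier N \<and>
        (\<forall>x\<in>carrier M. \<forall>y\<in>carrier M. f (x \<oplus>\<^bsub>M\<^esub> y) = f x \<oplus>\<^bsub>N\<^esub> f y) \<and>
        (\<forall>a\<in>carrier R. \<forall>x\<in>carrier M. f (a \<odot>\<^bsub>M\<^esub> x) = a \<odot>\<^bsub>N\<^esub> f x) \<and>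
        (\<forall>j. f ` grade M j \<subseteq> grade N j)}"

definition graded_iso ::
    "('r, 'x) graded_ring_scheme \<Rightarrow> ('r, 'm, 'y) graded_module_scheme \<Rightarrow>
     ('r, 'n, 'z) graded_module_scheme \<Rightarrow> ('m \<Rightarrow> 'n) set"
  where "graded_iso R M N = {f \<in> graded_hom R M N. bij_betw f (carrier M) (carrier N)}"

definition finitely_generated ::
    "('r, 'x) graded_ring_scheme \<Rightarrow> ('r, 'm, 'y) graded_module_scheme \<Rightarrow> bool"
  where "finitely_generated R M \<longleftrightarrow>
    (\<exists>A. finite A \<and> A \<subseteq> carrier M \<and> carrier M = lin_combs M (carrier R) A)"

definition homogeneous_basis ::
    "('r, 'x) graded_ring_scheme \<Rightarrow> ('r, 'm, 'y) graded_module_scheme \<Rightarrow> 'm set \<Rightarrow> bool"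
  where "homogeneous_basis R M B \<longleftrightarrow>
    B \<subseteq> (\<Union>j. grade M j) \<and>
    (\<forall>x\<in>carrier M. \<exists>!c. c \<in> B \<rightarrow> carrier R \<and> (\<forall>b. b \<notin> B \<longrightarrow> c b = \<zero>\<^bsub>R\<^esub>) \<and>
        finite {b. c b \<noteq> \<zero>\<^bsub>R\<^esub>} \<and> x = (\<Oplus>\<^bsub>M\<^esub>b\<in>{b. c b \<noteq> \<zero>\<^bsub>R\<^esub>}. c b \<odot>\<^bsub>M\<^esub> b))"

definition graded_free ::
    "('r, 'x) graded_ring_scheme \<Rightarrow> ('r, 'm, 'y) graded_module_scheme \<Rightarrow> bool"
  where "graded_free R M \<longleftrightarrow> graded_module R M \<and> (\<exists>B. homogeneous_basis R M B)"

definition finite_rank ::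
    "('r, 'x) graded_ring_scheme \<Rightarrow> ('r, 'm, 'y) graded_module_scheme \<Rightarrow> bool"
  where "finite_rank R M \<longleftrightarrow> (\<exists>B. finite B \<and> homogeneous_basis R M B)"

definition restrict_module ::
    "('r, 'm, 'y) graded_module_scheme \<Rightarrow> 'm set \<Rightarrow> ('r, 'm, 'y) graded_module_scheme"
  where "restrict_module M S = M\<lparr>carrier := S, grade := (\<lambda>j. S \<inter> grade M j)\<rparr>"

text \<open>The lifting property is tested against epimorphisms of graded modules whose elements lie in
  fixed types. This loses nothing: the free graded module on the homogeneous elements of \<open>P\<close>
  lives in \<open>'p \<Rightarrow> 'r\<close>, and as soon as its canonical epimorphism onto \<open>P\<close> splits, \<open>P\<close> is a direct
  summand of a free module and hence has the lifting property for all graded modules.\<close>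

definition projective ::
    "'r graded_ring \<Rightarrow> ('r, 'p) graded_module \<Rightarrow> bool"
  where "projective R P \<longleftrightarrow> graded_module R P \<and>
    (\<forall>(N :: ('r, 'p \<Rightarrow> 'r) graded_module) (N' :: ('r, 'p) graded_module) g f.
      graded_module R N \<longrightarrow> graded_module R N' \<longrightarrow>
      g \<in> graded_hom R N N' \<longrightarrow> g ` carrier N = carrier N' \<longrightarrow> f \<in> graded_hom R P N' \<longrightarrow>
      (\<exists>h\<in>graded_hom R P N. \<forall>x\<in>carrier P. g (h x) = f x))"

text \<open>\<open>0 \<rightarrow> P n \<rightarrow> \<dots> \<rightarrow> P 1 \<rightarrow> P 0 \<rightarrow> M \<rightarrow> 0\<close> with \<open>d i : P (i + 1) \<rightarrow> P i\<close>; the type argument is the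
  type in which the modules \<open>P i\<close> live.\<close>

definition projective_dimension_le ::
    "'p itself \<Rightarrow> 'r graded_ring \<Rightarrow> ('r, 'm) graded_module \<Rightarrow> nat \<Rightarrow> bool"
  where "projective_dimension_le _ R M n \<longleftrightarrow>
    (\<exists>(P :: nat \<Rightarrow> ('r, 'p) graded_module) d aug.
      (\<forall>i. projective R (P i)) \<and>
      (\<forall>i>n. carrier (P i) = {\<zero>\<^bsub>P i\<^esub>}) \<and>
      aug \<in> graded_hom R (P 0) M \<and>
      (\<forall>i. d i \<in> graded_hom R (P (Suc i)) (P i)) \<and>
      aug ` carrier (P 0) = carrier M \<and>
      d 0 ` carrier (P 1) = {x \<in> carrier (P 0). aug x = \<zero>\<^bsub>M\<^esub>} \<and>
      (\<forall>i. d (Suc i) ` carrier (P (Suc (Suc i))) =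
        {x \<in> carrier (P (Suc i)). d i x = \<zero>\<^bsub>P i\<^esub>}))"

definition finite_projective_dimension ::
    "'p itself \<Rightarrow> 'r graded_ring \<Rightarrow> ('r, 'm) graded_module \<Rightarrow> bool"
  where "finite_projective_dimension T R M \<longleftrightarrow> (\<exists>n. projective_dimension_le T R M n)"


section \<open>Differential modules\<close>

record ('r, 'm) diff_module = "('r, 'm) graded_module" +
  diff :: "'m \<Rightarrow> 'm"

locale diff_module = graded_module R D
  for R :: "'r graded_ring" (structure) and a :: int and D :: "('r, 'm) diff_module" (structure) +
  assumes diff_hom: "diff D \<in> graded_hom R D (twist D a)"
    and diff_diff: "x \<in> carrier D \<Longrightarrow> diff D (diff D x) = \<zero>\<^bsub>D\<^esub>"

definition diff_hom ::
    "'r graded_ring \<Rightarrow> ('r, 'm) diff_module \<Rightarrow> ('r, 'n) diff_module \<Rightarrow> ('m \<Rightarrow> 'n) set"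
  where "diff_hom R D D' =
    {f \<in> graded_hom R D D'. \<forall>x\<in>carrier D. f (diff D x) = diff D' (f x)}"

definition diff_isomorphic ::
    "'r graded_ring \<Rightarrow> ('r, 'm) diff_module \<Rightarrow> ('r, 'n) diff_module \<Rightarrow> bool"
  where "diff_isomorphic R D D' \<longleftrightarrow> (\<exists>f\<in>diff_hom R D D'. bij_betw f (carrier D) (carrier D'))"

definition cycles :: "('r, 'm) diff_module \<Rightarrow> 'm set"
  where "cycles D = {x \<in> carrier D. diff D x = \<zero>\<^bsub>D\<^esub>}"

definition boundaries :: "('r, 'm) diff_module \<Rightarrow> 'm set"
  where "boundaries D = diff D ` carrier D"

text \<open>The elements of \<open>H(D)\<close> are the cosets of the boundaries in the cycles. The ring
  multiplication and unit of the underlying record are irrelevant for a module.\<close>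

definition homology :: "('r, 'm) diff_module \<Rightarrow> ('r, 'm set) graded_module"
  where "homology D =
    \<lparr>carrier = (\<lambda>z. boundaries D +>\<^bsub>D\<^esub> z) ` cycles D,
     mult = undefined,
     one = undefined,
     zero = boundaries D,
     add = (\<lambda>S T. S <+>\<^bsub>D\<^esub> T),
     smult = (\<lambda>r S. boundaries D <+>\<^bsub>D\<^esub> ((\<lambda>x. r \<odot>\<^bsub>D\<^esub> x) ` S)),
     grade = (\<lambda>j. (\<lambda>z. boundaries D +>\<^bsub>D\<^esub> z) ` (cycles D \<inter> grade D j))\<rparr>"

text \<open>\<open>f\<close> sends the class of \<open>z\<close> to the class of \<open>f z\<close>: the image \<open>f ` S\<close> of a coset is only
  part of a coset, and adding the boundaries of the target completes it.\<close>

definition homology_map :: "('r, 'n) diff_module \<Rightarrow> ('m \<Rightarrow> 'n) \<Rightarrow> 'm set \<Rightarrow> 'n set"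
  where "homology_map D' f S = boundaries D' <+>\<^bsub>D'\<^esub> (f ` S)"

definition quasi_iso ::
    "'r graded_ring \<Rightarrow> ('r, 'm) diff_module \<Rightarrow> ('r, 'n) diff_module \<Rightarrow> ('m \<Rightarrow> 'n) \<Rightarrow> bool"
  where "quasi_iso R D D' f \<longleftrightarrow>
    f \<in> diff_hom R D D' \<and> homology_map D' f \<in> graded_iso R (homology D) (homology D')"

definition split_injection ::
    "'r graded_ring \<Rightarrow> ('r, 'm) diff_module \<Rightarrow> ('r, 'n) diff_module \<Rightarrow> ('m \<Rightarrow> 'n) \<Rightarrow> bool"
  where "split_injection R D D' s \<longleftrightarrow>
    s \<in> diff_hom R D D' \<and> (\<exists>p\<in>diff_hom R D' D. \<forall>x\<in>carrier D. p (s x) = x)"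


section \<open>Resolutions of differential modules\<close>

definition free_diff_module :: "'r graded_ring \<Rightarrow> int \<Rightarrow> ('r, 'm) diff_module \<Rightarrow> bool"
  where "free_diff_module R a F \<longleftrightarrow> diff_module R a F \<and> graded_free R F"

text \<open>The summands \<open>F i\<close> of a free flag are given as submodules of \<open>F\<close>.\<close>

definition free_flag :: "'r graded_ring \<Rightarrow> int \<Rightarrow> ('r, 'm) diff_module \<Rightarrow> bool"
  where "free_flag R a F \<longleftrightarrow> diff_module R a F \<and>
    (\<exists>Fl :: nat \<Rightarrow> 'm set.
      is_direct_sum F Fl \<and>
      (\<forall>i. graded_free R (restrict_module F (Fl i))) \<and>
      (\<forall>i. diff F ` Fl i \<subseteq> internal_sum F {..<i} Fl))"

definition free_flag_resolution ::
    "'r graded_ring \<Rightarrow> int \<Rightarrow> ('r, 'd) diff_module \<Rightarrow> ('r, 'm) diff_module \<Rightarrow> ('m \<Rightarrow> 'd) \<Rightarrow> bool"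
  where "free_flag_resolution R a D F \<epsilon> \<longleftrightarrow> free_flag R a F \<and> quasi_iso R F D \<epsilon>"

text \<open>The type argument is the type in which the free flag \<open>F'\<close> that \<open>\<epsilon>\<close> factors through lives.\<close>

definition free_resolution ::
    "'w itself \<Rightarrow> 'r graded_ring \<Rightarrow> int \<Rightarrow> ('r, 'd) diff_module \<Rightarrow> ('r, 'm) diff_module \<Rightarrow>
     ('m \<Rightarrow> 'd) \<Rightarrow> bool"
  where "free_resolution _ R a D F \<epsilon> \<longleftrightarrow>
    free_diff_module R a F \<and> quasi_iso R F D \<epsilon> \<and>
    (\<exists>(F' :: ('r, 'w) diff_module) s \<epsilon>'.
      free_flag_resolution R a D F' \<epsilon>' \<and> split_injection R F F' s \<and>
      (\<forall>x\<in>carrier F. \<epsilon> x = \<epsilon>' (s x)))"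

definition minimal_free_resolution ::
    "'w itself \<Rightarrow> 'r graded_ring \<Rightarrow> int \<Rightarrow> ('r, 'd) diff_module \<Rightarrow> ('r, 'm) diff_module \<Rightarrow>
     ('m \<Rightarrow> 'd) \<Rightarrow> bool"
  where "minimal_free_resolution T R a D F \<epsilon> \<longleftrightarrow>
    free_resolution T R a D F \<epsilon> \<and>
    diff F ` carrier F \<subseteq> lin_combs F (graded_max_ideal R) (carrier F)"

end

theory Submission
  imports Defs
begin

text \<open>A resolution of \<open>D\<close> is built by attaching free generators. Let \<open>F\<close> be a free flag with a chain map
  to \<open>D\<close>. The map is a quasi-isomorphism if and only if its mapping cone is acyclic (\<open>quasi_iso_iff\<close>).
  Since \<open>R\<close> is Noetherian, the homology of the cone is finitely generated (\<open>Cn_finitely_generated\<close>), so it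
  has a finite minimal set of homogeneous generators, represented by cycles \<open>(y, x)\<close>. A new generator of
  \<open>F\<close> with differential \<open>x\<close> and image \<open>y\<close> in \<open>D\<close> turns such a cycle into a boundary. The cycles of the new
  cone correspond to the relations between the attaching cycles modulo boundaries (\<open>new_cycle_relation\<close>,
  \<open>relation_new_cycle\<close>), and minimality puts the coefficients of these relations into the maximal ideal
  \<open>\<mm>\<close>. Starting from \<open>F = 0\<close> and repeating this gives a tower of free flags.

  Let \<open>H(D)\<close> have finite projective dimension, and attach all minimal generators at every stage. Then the
  modules spanned by the generators of the successive stages form a minimal free resolution of \<open>H(D)\<close>,
  and comparison with a finite projective resolution shows that it stops (\<open>minimal_resolution_finite\<close>,
  \<open>tower_terminates\<close>). Some stage is therefore a free flag resolution of finite rank, but it need not be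
  minimal. If the differential of a basis element \<open>b\<close> is not in \<open>\<mm>F\<close>, then \<open>b\<close> and \<open>\<partial>b\<close> span a contractible
  direct summand (\<open>split_off_contractible\<close>), whose complement is again free and has smaller rank. After
  finitely many steps a minimal resolution remains, and it is a direct summand of the flag.

  Let \<open>R\<^sub>0\<close> be a field and the differential of degree zero, and let \<open>j0\<close> bound the degrees of \<open>H(D)\<close> from
  below. Now stage \<open>k\<close> attaches only the minimal generators of degree \<open>j0 + k\<close>. Relations of degree at most
  \<open>j0 + k\<close> between them have coefficients of degree at most zero in \<open>\<mm>\<close>, which vanish. Hence the homology of
  the cone over stage \<open>k\<close> vanishes in degrees less than \<open>j0 + k\<close> (\<open>low_cycle_boundary\<close>), and the union of
  all stages is a resolution. It is minimal already: the differential of a generator involves only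
  generators of smaller degree, with coefficients of positive degree.

  For uniqueness, a map from a free flag to an acyclic differential module is null-homotopic
  (\<open>null_homotopic\<close>), and this passes to direct summands of flags. Two minimal resolutions hence have
  comparison maps in both directions, whose composites are homotopic to the identity. Because the
  differentials have values in \<open>\<mm>M\<close>, the composites are the identity modulo \<open>\<mm>\<close>. Nakayama's lemma then makes
  them bijective (\<open>endomorphism_bij\<close>); it holds for finitely generated modules and, over a field \<open>R\<^sub>0\<close>, for
  modules that are bounded below. The comparison maps themselves show that the second resolution is
  finitely generated or bounded below if the first one is.\<close>

section \<open>Additive maps and direct sums\<close>

definition add_hom :: "('m, 'x) ring_scheme \<Rightarrow> ('n, 'y) ring_scheme \<Rightarrow> ('m \<Rightarrow> 'n) set"
  where "add_hom M N = {f \<in> carrier M \<rightarrow> carrier N.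
    \<forall>x\<in>carrier M. \<forall>y\<in>carrier M. f (x \<oplus>\<^bsub>M\<^esub> y) = f x \<oplus>\<^bsub>N\<^esub> f y}"

lemma add_homI:
  "\<lbrakk>\<And>x. x \<in> carrier M \<Longrightarrow> f x \<in> carrier N;
    \<And>x y. \<lbrakk>x \<in> carrier M; y \<in> carrier M\<rbrakk> \<Longrightarrow> f (x \<oplus>\<^bsub>M\<^esub> y) = f x \<oplus>\<^bsub>N\<^esub> f y\<rbrakk> \<Longrightarrow> f \<in> add_hom M N"
  by (auto simp: add_hom_def)

lemma add_hom_closed: "f \<in> add_hom M N \<Longrightarrow> x \<in> carrier M \<Longrightarrow> f x \<in> carrier N"
  by (auto simp: add_hom_def)

lemma add_hom_add:
  "\<lbrakk>f \<in> add_hom M N; x \<in> carrier M; y \<in> carrier M\<rbrakk> \<Longrightarrow> f (x \<oplus>\<^bsub>M\<^esub> y) = f x \<oplus>\<^bsub>N\<^esub> f y"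
  by (auto simp: add_hom_def)

lemma add_hom_abelian:
  assumes "abelian_group M" "abelian_group N" "f \<in> add_hom M N"
  shows "abelian_group_hom M N f"
  using assms by (intro abelian_group_homI)
    (auto simp: add_hom_def hom_def group_hom_def group_hom_axioms_def abelian_group.a_group)

lemma add_hom_zero:
  "\<lbrakk>abelian_group M; abelian_group N; f \<in> add_hom M N\<rbrakk> \<Longrightarrow> f \<zero>\<^bsub>M\<^esub> = \<zero>\<^bsub>N\<^esub>"
  by (meson abelian_group_hom.hom_zero add_hom_abelian)

lemma add_hom_neg:
  "\<lbrakk>abelian_group M; abelian_group N; f \<in> add_hom M N; x \<in> carrier M\<rbrakk> \<Longrightarrow> f (\<ominus>\<^bsub>M\<^esub> x) = \<ominus>\<^bsub>N\<^esub> f x"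
  by (meson abelian_group_hom.hom_a_inv add_hom_abelian)

lemma add_hom_minus:
  "\<lbrakk>abelian_group M; abelian_group N; f \<in> add_hom M N; x \<in> carrier M; y \<in> carrier M\<rbrakk>
    \<Longrightarrow> f (x \<ominus>\<^bsub>M\<^esub> y) = f x \<ominus>\<^bsub>N\<^esub> f y"
  by (simp add: a_minus_def add_hom_add add_hom_neg abelian_group.a_inv_closed)

lemma add_hom_finsum:
  assumes M: "abelian_group M" and N: "abelian_group N" and f: "f \<in> add_hom M N"
    and g: "g \<in> A \<rightarrow> carrier M"
  shows "f (finsum M g A) = finsum N (\<lambda>i. f (g i)) A"
proof (cases "finite A")
  case False
  interpret M: abelian_group M by fact
  interpret N: abelian_group N by fact
  show ?thesis using False add_hom_zero[OF M N f] by simp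
next
  case True
  interpret M: abelian_group M by fact
  interpret N: abelian_group N by fact
  show ?thesis using True g
  proof (induction A)
    case empty
    then show ?case using add_hom_zero[OF M N f] by simp
  next
    case (insert a A)
    then have "g a \<in> carrier M" "g \<in> A \<rightarrow> carrier M" by auto
    moreover from this have "(\<lambda>i. f (g i)) \<in> A \<rightarrow> carrier N" "f (g a) \<in> carrier N"
      using f by (auto simp: add_hom_def)
    ultimately show ?case using insert f by (simp add: add_hom_add)
  qed
qed

lemma (in abelian_group) a_inv_zero: "\<ominus> \<zero> = \<zero>"
  by (simp add: a_inv_def)

text \<open>Registered with the method \<open>algebra\<close>, which then proves identities between terms of an abelian
  group, in particular of the additive group of a module.\<close>

lemmas (in abelian_group) group_simprules
  [algebra abelian_group "zero G" "add G" "a_inv G" "a_minus G"] =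
  a_closed zero_closed a_inv_closed minus_closed a_assoc l_zero l_neg a_comm minus_eq
  r_zero r_neg r_neg2 r_neg1 minus_add minus_minus a_inv_zero a_lcomm

lemma (in abelian_group) minus_add_cancel:
  "\<lbrakk>x \<in> carrier G; y \<in> carrier G\<rbrakk> \<Longrightarrow> x \<ominus> y \<oplus> y = x"
  by algebra

lemma (in abelian_group) minus_eq_zero_iff:
  assumes "x \<in> carrier G" "y \<in> carrier G"
  shows "x \<ominus> y = \<zero> \<longleftrightarrow> x = y"
proof
  assume "x \<ominus> y = \<zero>"
  then have "(x \<ominus> y) \<oplus> y = \<zero> \<oplus> y" by simp
  moreover have "(x \<ominus> y) \<oplus> y = x" using assms by algebra
  ultimately show "x = y" using assms by simp
qed (use assms in \<open>simp add: minus_eq r_neg\<close>)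

context abelian_monoid begin

lemma finsum_superset:
  assumes "finite B" "A \<subseteq> B" "\<And>i. i \<in> B - A \<Longrightarrow> f i = \<zero>" "f \<in> A \<rightarrow> carrier G"
  shows "finsum G f A = finsum G f B"
  using assms by (intro add.finprod_mono_neutral_cong_left) auto

lemma finsum_eq_single:
  assumes "finite A" "i \<in> A" "f i \<in> carrier G" "\<And>j. \<lbrakk>j \<in> A; j \<noteq> i\<rbrakk> \<Longrightarrow> f j = \<zero>"
  shows "finsum G f A = f i"
proof -
  have "finsum G f {i} = finsum G f A"
    using assms by (intro finsum_superset) auto
  then show ?thesis using assms by simp
qed

lemma finsum_in_subset:
  assumes "f \<in> A \<rightarrow> H" "H \<subseteq> carrier G" "\<zero> \<in> H" "\<And>x y. \<lbrakk>x \<in> H; y \<in> H\<rbrakk> \<Longrightarrow> x \<oplus> y \<in> H"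
  shows "finsum G f A \<in> H"
proof (cases "finite A")
  case True
  then show ?thesis using assms(1)
  proof (induction A)
    case (insert a A)
    then have *: "f a \<in> H" "f \<in> A \<rightarrow> H" by auto
    then have "f \<in> A \<rightarrow> carrier G" "f a \<in> carrier G" using assms(2) by auto
    then show ?case using insert * assms(4) by simp
  qed (use assms in simp)
qed (use assms in simp)

end

lemma add_subgroup_closed:
  assumes "additive_subgroup H M"
  shows "H \<subseteq> carrier M" "\<zero>\<^bsub>M\<^esub> \<in> H" "\<lbrakk>x \<in> H; y \<in> H\<rbrakk> \<Longrightarrow> x \<oplus>\<^bsub>M\<^esub> y \<in> H"
    "\<lbrakk>abelian_group M; x \<in> H\<rbrakk> \<Longrightarrow> \<ominus>\<^bsub>M\<^esub> x \<in> H"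
  by (rule additive_subgroup.a_subset[OF assms], rule additive_subgroup.zero_closed[OF assms],
    rule additive_subgroup.a_closed[OF assms], assumption+,
    rule additive_subgroup.a_inv_closed[OF assms], assumption+)

lemma (in abelian_group) additive_subgroupI':
  assumes "H \<subseteq> carrier G" "\<zero> \<in> H" "\<And>x y. \<lbrakk>x \<in> H; y \<in> H\<rbrakk> \<Longrightarrow> x \<oplus> y \<in> H"
    "\<And>x. x \<in> H \<Longrightarrow> \<ominus> x \<in> H"
  shows "additive_subgroup H G"
proof -
  have "subgroup H (add_monoid G)"
    by (rule group.subgroupI[OF a_group]) (use assms in \<open>auto simp: a_inv_def[symmetric]\<close>)
  then show ?thesis by (rule additive_subgroupI)
qed

text \<open>The component of an element in one summand of a direct sum decomposition.\<close>

definition dpart :: "('m, 'x) ring_scheme \<Rightarrow> ('i \<Rightarrow> 'm set) \<Rightarrow> 'i \<Rightarrow> 'm \<Rightarrow> 'm"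
  where "dpart M G i x = (THE f. (\<forall>i. f i \<in> G i) \<and> finite {i. f i \<noteq> \<zero>\<^bsub>M\<^esub>} \<and>
        x = finsum M f {i. f i \<noteq> \<zero>\<^bsub>M\<^esub>}) i"

locale dsum = abelian_group M for M :: "('m, 'x) ring_scheme" (structure) and G :: "'i \<Rightarrow> 'm set" +
  assumes ds: "is_direct_sum M G"
begin

lemma G_sub: "additive_subgroup (G i) M"
  using ds by (simp add: is_direct_sum_def)

lemmas G_carrier = add_subgroup_closed(1)[OF G_sub]
  and G_zero = add_subgroup_closed(2)[OF G_sub]
  and G_add = add_subgroup_closed(3)[OF G_sub]
  and G_neg = add_subgroup_closed(4)[OF G_sub abelian_group_axioms]

lemma G_in_carrier: "x \<in> G i \<Longrightarrow> x \<in> carrier M"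
  using G_carrier by blast

lemma G_minus: "\<lbrakk>x \<in> G i; y \<in> G i\<rbrakk> \<Longrightarrow> x \<ominus> y \<in> G i"
  by (simp add: a_minus_def G_add G_neg)

lemma G_finsum: "f \<in> A \<rightarrow> G i \<Longrightarrow> finsum M f A \<in> G i"
  by (rule finsum_in_subset) (auto simp: G_zero G_add G_in_carrier)

lemma dpart_all:
  assumes "x \<in> carrier M"
  shows "(\<forall>i. dpart M G i x \<in> G i) \<and> finite {i. dpart M G i x \<noteq> \<zero>} \<and>
    x = finsum M (\<lambda>i. dpart M G i x) {i. dpart M G i x \<noteq> \<zero>}"
proof -
  have "\<exists>!f. (\<forall>i. f i \<in> G i) \<and> finite {i. f i \<noteq> \<zero>} \<and> x = finsum M f {i. f i \<noteq> \<zero>}"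
    using ds assms by (simp add: is_direct_sum_def)
  from theI'[OF this] show ?thesis unfolding dpart_def .
qed

lemma dpart_in: "x \<in> carrier M \<Longrightarrow> dpart M G i x \<in> G i"
  and dpart_finite: "x \<in> carrier M \<Longrightarrow> finite {i. dpart M G i x \<noteq> \<zero>}"
  and dpart_sum: "x \<in> carrier M \<Longrightarrow> finsum M (\<lambda>i. dpart M G i x) {i. dpart M G i x \<noteq> \<zero>} = x"
  using dpart_all by auto

lemma dpart_carrier: "x \<in> carrier M \<Longrightarrow> dpart M G i x \<in> carrier M"
  using dpart_in G_in_carrier by blast

lemma dpart_sum_superset:
  assumes "x \<in> carrier M" "finite A" "\<And>i. i \<notin> A \<Longrightarrow> dpart M G i x = \<zero>"
  shows "finsum M (\<lambda>i. dpart M G i x) A = x"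
proof -
  have "finsum M (\<lambda>i. dpart M G i x) {i. dpart M G i x \<noteq> \<zero>} = finsum M (\<lambda>i. dpart M G i x) A"
    using assms by (intro finsum_superset) (auto simp: dpart_carrier)
  then show ?thesis using dpart_sum assms by simp
qed

lemma dpart_eqI:
  assumes "\<And>i. f i \<in> G i" "finite A" "\<And>i. i \<notin> A \<Longrightarrow> f i = \<zero>" "x = finsum M f A"
  shows "dpart M G i x = f i"
proof -
  have fc: "f i \<in> carrier M" for i using assms(1) G_in_carrier by blast
  have sub: "{i. f i \<noteq> \<zero>} \<subseteq> A" using assms(3) by auto
  have fin: "finite {i. f i \<noteq> \<zero>}" using sub assms(2) finite_subset by blast
  have x: "x = finsum M f {i. f i \<noteq> \<zero>}"
    unfolding assms(4) using assms(2) sub fc by (intro finsum_superset[symmetric]) auto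
  have xc: "x \<in> carrier M" unfolding assms(4) using fc by auto
  have "\<exists>!f. (\<forall>i. f i \<in> G i) \<and> finite {i. f i \<noteq> \<zero>} \<and> x = finsum M f {i. f i \<noteq> \<zero>}"
    using ds xc by (simp add: is_direct_sum_def)
  from the1_equality[OF this, of f] show ?thesis
    unfolding dpart_def using assms(1) fin x by simp
qed

lemma dpart_homog: "x \<in> G i \<Longrightarrow> dpart M G j x = (if j = i then x else \<zero>)"
  by (rule dpart_eqI[where A = "{i}"]) (auto simp: G_zero G_in_carrier)

lemma dpart_zero: "dpart M G j \<zero> = \<zero>"
  using dpart_homog[of \<zero> j j] by (simp add: G_zero)

lemma dpart_add:
  assumes "x \<in> carrier M" "y \<in> carrier M"
  shows "dpart M G i (x \<oplus> y) = dpart M G i x \<oplus> dpart M G i y"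
proof (rule dpart_eqI[where A = "{i. dpart M G i x \<noteq> \<zero>} \<union> {i. dpart M G i y \<noteq> \<zero>}"])
  let ?A = "{i. dpart M G i x \<noteq> \<zero>} \<union> {i. dpart M G i y \<noteq> \<zero>}"
  have "finsum M (\<lambda>i. dpart M G i x) ?A = x" "finsum M (\<lambda>i. dpart M G i y) ?A = y"
    using assms by (auto intro!: dpart_sum_superset dpart_finite)
  then show "x \<oplus> y = (\<Oplus>i\<in>?A. dpart M G i x \<oplus> dpart M G i y)"
    using assms by (subst finsum_addf) (auto simp: dpart_carrier)
qed (use assms dpart_in G_add dpart_finite in auto)

lemma dpart_add_hom: "dpart M G i \<in> add_hom M M"
  by (rule add_homI) (auto simp: dpart_carrier dpart_add)

lemma dpart_minus:
  "\<lbrakk>x \<in> carrier M; y \<in> carrier M\<rbrakk> \<Longrightarrow> dpart M G i (x \<ominus> y) = dpart M G i x \<ominus> dpart M G i y"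
  by (rule add_hom_minus[OF abelian_group_axioms abelian_group_axioms dpart_add_hom])

lemma homogeneous_unique: "\<lbrakk>x \<in> G i; x \<in> G j; x \<noteq> \<zero>\<rbrakk> \<Longrightarrow> i = j"
  using dpart_homog[of x i i] dpart_homog[of x j i] by (auto split: if_splits)

lemma mem_if_dparts:
  assumes "additive_subgroup H M" "x \<in> carrier M" "\<And>i. dpart M G i x \<in> H"
  shows "x \<in> H"
proof -
  have "finsum M (\<lambda>i. dpart M G i x) {i. dpart M G i x \<noteq> \<zero>} \<in> H"
    by (rule finsum_in_subset)
      (use assms add_subgroup_closed[OF assms(1)] in auto)
  then show ?thesis using dpart_sum[OF assms(2)] by simp
qed

end

text \<open>Maps \<open>p i\<close> that are the identity on the summand \<open>H i\<close> and vanish on the others leave no choice in a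
  decomposition: applied to any decomposition of \<open>x\<close>, the map \<open>p i\<close> returns its term in \<open>H i\<close>.\<close>

lemma (in abelian_group) direct_sumI:
  assumes G: "\<And>i. additive_subgroup (H i) G"
    and p: "\<And>i. p i \<in> add_hom G G" "\<And>i x. x \<in> carrier G \<Longrightarrow> p i x \<in> H i"
    and p': "\<And>i j x. x \<in> H i \<Longrightarrow> p j x = (if j = i then x else \<zero>)"
    and f: "\<And>x. x \<in> carrier G \<Longrightarrow> \<exists>A. finite A \<and> (\<forall>i. i \<notin> A \<longrightarrow> p i x = \<zero>) \<and> x = finsum G (\<lambda>i. p i x) A"
  shows "is_direct_sum G H" "dsum G H" "\<And>x i. x \<in> carrier G \<Longrightarrow> dpart G H i x = p i x"
proof -
  have Hc: "x \<in> H i \<Longrightarrow> x \<in> carrier G" for x i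
    using add_subgroup_closed(1)[OF G] by blast
  show ds: "is_direct_sum G H"
    unfolding is_direct_sum_def
  proof (intro conjI allI ballI G)
    fix x assume x: "x \<in> carrier G"
    from f[OF x] obtain A where A: "finite A" "\<forall>i. i \<notin> A \<longrightarrow> p i x = \<zero>" "x = finsum G (\<lambda>i. p i x) A"
      by blast
    have sub: "{i. p i x \<noteq> \<zero>} \<subseteq> A" using A by auto
    have "finsum G (\<lambda>i. p i x) {i. p i x \<noteq> \<zero>} = finsum G (\<lambda>i. p i x) A"
      using A sub x p by (intro finsum_superset) (auto intro: add_hom_closed)
    then have ex: "(\<forall>i. p i x \<in> H i) \<and> finite {i. p i x \<noteq> \<zero>} \<and> x = (\<Oplus>i\<in>{i. p i x \<noteq> \<zero>}. p i x)"
      using A p(2)[OF x] sub finite_subset by auto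
    show "\<exists>!f. (\<forall>i. f i \<in> H i) \<and> finite {i. f i \<noteq> \<zero>} \<and> x = finsum G f {i. f i \<noteq> \<zero>}"
    proof (rule ex1I[of _ "\<lambda>i. p i x"])
      show "(\<forall>i. p i x \<in> H i) \<and> finite {i. p i x \<noteq> \<zero>} \<and> x = (\<Oplus>i\<in>{i. p i x \<noteq> \<zero>}. p i x)" by fact
    next
      fix g assume g: "(\<forall>i. g i \<in> H i) \<and> finite {i. g i \<noteq> \<zero>} \<and> x = finsum G g {i. g i \<noteq> \<zero>}"
      show "g = (\<lambda>i. p i x)"
      proof
        fix i
        have gc: "g j \<in> carrier G" for j using g Hc by blast
        have pg: "p i (g j) = (if i = j then g j else \<zero>)" for j
          using p'[of "g j" j i] g by simp
        have "p i x = (\<Oplus>j\<in>{i. g i \<noteq> \<zero>}. p i (g j))"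
          using g gc add_hom_finsum[OF abelian_group_axioms abelian_group_axioms p(1)[of i], of g "{i. g i \<noteq> \<zero>}"]
          by auto
        also have "\<dots> = (\<Oplus>j\<in>insert i {i. g i \<noteq> \<zero>}. p i (g j))"
          using g gc by (intro finsum_superset)
            (auto simp: pg add_hom_zero[OF abelian_group_axioms abelian_group_axioms p(1)])
        also have "\<dots> = p i (g i)"
          using g gc by (intro finsum_eq_single) (auto simp: pg)
        also have "\<dots> = g i" by (simp add: pg)
        finally show "g i = p i x" by simp
      qed
    qed
  qed
  show d: "dsum G H"
    by (intro dsum.intro abelian_group_axioms dsum_axioms.intro ds)
  fix x i assume x: "x \<in> carrier G"
  from f[OF x] obtain A where A: "finite A" "\<forall>i. i \<notin> A \<longrightarrow> p i x = \<zero>" "x = finsum G (\<lambda>i. p i x) A"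
    by blast
  show "dpart G H i x = p i x"
    by (rule dsum.dpart_eqI[OF d, of _ A]) (use A p(2)[OF x] in auto)
qed

text \<open>An additive map that carries summands into summands carries the decomposition of \<open>x\<close> to a
  decomposition of \<open>f x\<close>.\<close>

lemma dpart_hom:
  fixes G :: "'i \<Rightarrow> 'm set" and G' :: "'j \<Rightarrow> 'n set"
  assumes "dsum M G" "dsum N G'" "f \<in> add_hom M N" "inj s" "\<And>i. f ` G i \<subseteq> G' (s i)" "x \<in> carrier M"
  shows "dpart N G' (s i) (f x) = f (dpart M G i x)"
proof -
  interpret M: dsum M G by fact
  interpret N: dsum N G' by fact
  let ?A = "{i. dpart M G i x \<noteq> \<zero>\<^bsub>M\<^esub>}"
  let ?g = "\<lambda>j. if j \<in> range s then f (dpart M G (inv_into UNIV s j) x) else \<zero>\<^bsub>N\<^esub>"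
  have inv: "inv_into UNIV s (s i) = i" for i using assms(4) by simp
  have fin: "finite ?A" using M.dpart_finite assms(6) by blast
  have f0: "f \<zero>\<^bsub>M\<^esub> = \<zero>\<^bsub>N\<^esub>"
    using add_hom_zero[OF M.abelian_group_axioms N.abelian_group_axioms assms(3)] .
  have fc: "f (dpart M G i x) \<in> carrier N" for i
    using assms(3,6) M.dpart_carrier by (auto intro: add_hom_closed)
  have g_in: "?g j \<in> G' j" for j
  proof (cases "j \<in> range s")
    case True
    then obtain i where "j = s i" by blast
    then show ?thesis using assms(5)[of i] M.dpart_in[OF assms(6), of i] inv by auto
  qed (simp add: N.G_zero)
  have "f x = f (finsum M (\<lambda>i. dpart M G i x) ?A)" using M.dpart_sum[OF assms(6)] by simp
  also have "\<dots> = finsum N (\<lambda>i. f (dpart M G i x)) ?A"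
    using assms(6) M.dpart_carrier
    by (intro add_hom_finsum[OF M.abelian_group_axioms N.abelian_group_axioms assms(3)]) auto
  also have "\<dots> = finsum N (\<lambda>i. ?g (s i)) ?A"
    by (rule N.finsum_cong') (auto simp: inv fc)
  also have "\<dots> = finsum N ?g (s ` ?A)"
    using assms(4) fc by (intro N.finsum_reindex[symmetric]) (auto simp: inv inj_on_def)
  finally have *: "f x = finsum N ?g (s ` ?A)" .
  have "dpart N G' (s i) (f x) = ?g (s i)"
  proof (rule N.dpart_eqI[OF g_in _ _ *])
    fix j assume j: "j \<notin> s ` ?A"
    show "?g j = \<zero>\<^bsub>N\<^esub>"
    proof (cases "j \<in> range s")
      case True
      then obtain i where i: "j = s i" by blast
      then have "dpart M G i x = \<zero>\<^bsub>M\<^esub>" using j by auto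
      then show ?thesis using i inv f0 by simp
    qed simp
  qed (use fin in simp)
  then show ?thesis by (simp add: inv)
qed

section \<open>Local rings\<close>

lemma left_idealD:
  assumes "left_ideal I R"
  shows "I \<subseteq> carrier R" "\<zero>\<^bsub>R\<^esub> \<in> I" "\<lbrakk>x \<in> I; y \<in> I\<rbrakk> \<Longrightarrow> x \<oplus>\<^bsub>R\<^esub> y \<in> I"
    "\<lbrakk>ring R; x \<in> I\<rbrakk> \<Longrightarrow> \<ominus>\<^bsub>R\<^esub> x \<in> I" "\<lbrakk>r \<in> carrier R; x \<in> I\<rbrakk> \<Longrightarrow> r \<otimes>\<^bsub>R\<^esub> x \<in> I"
  using assms add_subgroup_closed[of I R] by (auto simp: left_ideal_def ring_def)

lemma (in ring) left_idealI:
  assumes "I \<subseteq> carrier R" "\<zero> \<in> I" "\<And>x y. \<lbrakk>x \<in> I; y \<in> I\<rbrakk> \<Longrightarrow> x \<oplus> y \<in> I"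
    "\<And>r x. \<lbrakk>r \<in> carrier R; x \<in> I\<rbrakk> \<Longrightarrow> r \<otimes> x \<in> I"
  shows "left_ideal I R"
proof -
  have "\<ominus> x \<in> I" if "x \<in> I" for x
  proof -
    have "\<ominus> \<one> \<otimes> x \<in> I" using assms(4) that by simp
    then show ?thesis using that assms(1) by (simp add: l_minus subset_iff)
  qed
  then show ?thesis
    unfolding left_ideal_def using assms by (intro conjI additive_subgroupI') auto
qed

text \<open>Zorn's lemma applied to the left ideals that contain \<open>J\<close> but not \<open>\<one>\<close>.\<close>

lemma (in ring) proper_left_ideal_in_maximal:
  assumes "left_ideal J R" "\<one> \<notin> J"
  shows "\<exists>I. maximal_left_ideal I R \<and> J \<subseteq> I"
proof -
  let ?S = "{I. left_ideal I R \<and> \<one> \<notin> I \<and> J \<subseteq> I}"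
  have "\<exists>M\<in>?S. \<forall>X\<in>?S. M \<subseteq> X \<longrightarrow> X = M"
  proof (rule subset_Zorn_nonempty)
    show "?S \<noteq> {}" using assms by auto
  next
    fix C assume C: "C \<noteq> {}" "subset.chain ?S C"
    have CS: "C \<subseteq> ?S" and ch: "\<And>X Y. \<lbrakk>X \<in> C; Y \<in> C\<rbrakk> \<Longrightarrow> X \<subseteq> Y \<or> Y \<subseteq> X"
      using C(2) by (auto simp: subset_chain_def)
    have L: "left_ideal X R" if "X \<in> C" for X using CS that by auto
    obtain X0 where X0: "X0 \<in> C" using C(1) by auto
    have "left_ideal (\<Union>C) R"
    proof (rule left_idealI)
      show "\<Union>C \<subseteq> carrier R" using left_idealD(1)[OF L] by blast
      show "\<zero> \<in> \<Union>C" using left_idealD(2)[OF L[OF X0]] X0 by blast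
    next
      fix x y assume "x \<in> \<Union>C" "y \<in> \<Union>C"
      then obtain X Y where XY: "X \<in> C" "Y \<in> C" "x \<in> X" "y \<in> Y" by blast
      then have "\<exists>Z\<in>C. x \<in> Z \<and> y \<in> Z" using ch by blast
      then show "x \<oplus> y \<in> \<Union>C" using left_idealD(3)[OF L] by blast
    next
      fix r x assume "r \<in> carrier R" "x \<in> \<Union>C"
      then show "r \<otimes> x \<in> \<Union>C" using left_idealD(5)[OF L] by blast
    qed
    then show "\<Union>C \<in> ?S" using CS X0 by auto
  qed
  then obtain M where MS: "M \<in> ?S" "\<forall>X\<in>?S. M \<subseteq> X \<longrightarrow> X = M" by blast
  then have M: "left_ideal M R" "\<one> \<notin> M" "J \<subseteq> M" by auto
  have max: "X = M" if "left_ideal X R" "\<one> \<notin> X" "M \<subseteq> X" for X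
    using MS(2) that M(3) by blast
  have "maximal_left_ideal M R"
    unfolding maximal_left_ideal_def
  proof (intro conjI allI impI)
    show "M \<noteq> carrier R" using M by auto
  next
    fix X assume X: "left_ideal X R" "M \<subseteq> X"
    show "X = M \<or> X = carrier R"
    proof (cases "\<one> \<in> X")
      case True
      then have "carrier R \<subseteq> X" using left_idealD(5)[OF X(1), of _ \<one>] by auto
      then show ?thesis using left_idealD(1)[OF X(1)] by auto
    qed (use max X in auto)
  qed (use M in simp)
  then show ?thesis using M by blast
qed

locale noncomm_local_ring = ring R for R (structure) +
  assumes local: "local_ring R"
begin

lemma max_ideal_maximal: "maximal_left_ideal (max_ideal R) R"
  unfolding max_ideal_def by (rule theI') (rule conjunct2[OF local[unfolded local_ring_def]])

lemma max_ideal_left: "left_ideal (max_ideal R) R"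
  using max_ideal_maximal by (simp add: maximal_left_ideal_def)

lemma max_ideal_unique:
  assumes "maximal_left_ideal I R"
  shows "I = max_ideal R"
proof -
  have "\<exists>!I. maximal_left_ideal I R" using local unfolding local_ring_def by (rule conjunct2)
  from the1_equality[OF this assms] show ?thesis by (simp add: max_ideal_def)
qed

lemmas max_ideal_closed = left_idealD(1-3,5)[OF max_ideal_left]

lemma one_notin_max_ideal: "\<one> \<notin> max_ideal R"
proof
  assume "\<one> \<in> max_ideal R"
  then have "carrier R \<subseteq> max_ideal R" using max_ideal_closed(4)[of _ \<one>] by auto
  then show False using max_ideal_maximal max_ideal_closed(1) by (auto simp: maximal_left_ideal_def)
qed

lemma left_inverse:
  assumes "x \<in> carrier R" "x \<notin> max_ideal R"
  shows "\<exists>s\<in>carrier R. s \<otimes> x = \<one>"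
proof (rule ccontr)
  assume n: "\<not> ?thesis"
  let ?J = "{s \<otimes> x | s. s \<in> carrier R}"
  have "left_ideal ?J R"
  proof (rule left_idealI)
    show "\<zero> \<in> ?J" using assms(1) by (auto intro!: exI[of _ \<zero>])
  next
    fix a b assume "a \<in> ?J" "b \<in> ?J"
    then obtain s t where "s \<in> carrier R" "t \<in> carrier R" "a = s \<otimes> x" "b = t \<otimes> x" by blast
    then show "a \<oplus> b \<in> ?J" using assms(1) by (auto intro!: exI[of _ "s \<oplus> t"] simp: l_distr)
  next
    fix r a assume r: "r \<in> carrier R" "a \<in> ?J"
    then obtain s where "s \<in> carrier R" "a = s \<otimes> x" by blast
    then show "r \<otimes> a \<in> ?J" using assms(1) r by (auto intro!: exI[of _ "r \<otimes> s"] simp: m_assoc)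
  qed (use assms in auto)
  moreover have "\<one> \<notin> ?J" using n by auto
  ultimately obtain I where "maximal_left_ideal I R" "?J \<subseteq> I"
    using proper_left_ideal_in_maximal by blast
  then have "?J \<subseteq> max_ideal R" using max_ideal_unique by auto
  moreover have "x \<in> ?J" using assms(1) by (auto intro!: exI[of _ \<one>])
  ultimately show False using assms(2) by blast
qed

text \<open>If \<open>s \<otimes> (x \<otimes> r) = \<one>\<close> with \<open>x\<close> in the maximal ideal, then \<open>r \<otimes> (s \<otimes> x)\<close> is an idempotent of the
  maximal ideal; idempotents there vanish because \<open>\<one>\<close> minus such an element is left invertible.\<close>

lemma max_ideal_right:
  assumes x: "x \<in> max_ideal R" and r: "r \<in> carrier R"
  shows "x \<otimes> r \<in> max_ideal R"
proof (rule ccontr)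
  assume n: "x \<otimes> r \<notin> max_ideal R"
  have xc: "x \<in> carrier R" using x max_ideal_closed by auto
  obtain s where s: "s \<in> carrier R" "s \<otimes> (x \<otimes> r) = \<one>"
    using left_inverse[OF _ n] xc r by auto
  define e where "e = s \<otimes> x"
  have e: "e \<in> max_ideal R" "e \<in> carrier R" "e \<otimes> r = \<one>"
    using max_ideal_closed(4)[OF s(1) x] s xc r by (auto simp: e_def m_assoc)
  define f where "f = r \<otimes> e"
  have f: "f \<in> max_ideal R" "f \<in> carrier R"
    using max_ideal_closed(4)[OF r e(1)] r e by (auto simp: f_def)
  have ff: "f \<otimes> f = f"
  proof -
    have "f \<otimes> f = r \<otimes> (e \<otimes> r) \<otimes> e" using r e(2) by (simp add: f_def m_assoc)
    then show ?thesis using r e by (simp add: f_def)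
  qed
  have "\<one> \<ominus> f \<notin> max_ideal R"
  proof
    assume "\<one> \<ominus> f \<in> max_ideal R"
    then have "\<one> \<ominus> f \<oplus> f \<in> max_ideal R" using f max_ideal_closed by blast
    then show False using f one_notin_max_ideal by (simp add: minus_eq a_assoc l_neg)
  qed
  then obtain u where u: "u \<in> carrier R" "u \<otimes> (\<one> \<ominus> f) = \<one>"
    using left_inverse[of "\<one> \<ominus> f"] f by auto
  have "(\<one> \<ominus> f) \<otimes> f = f \<ominus> f \<otimes> f"
    using f by (simp add: minus_eq l_distr l_minus)
  then have z: "(\<one> \<ominus> f) \<otimes> f = \<zero>" using f by (simp add: ff minus_eq r_neg)
  have "f = u \<otimes> (\<one> \<ominus> f) \<otimes> f" using u f by simp
  also have "\<dots> = u \<otimes> ((\<one> \<ominus> f) \<otimes> f)"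
    by (rule m_assoc) (use u f in auto)
  also have "\<dots> = \<zero>" using u z by simp
  finally have "f = \<zero>" .
  then have "\<one> = e \<otimes> r \<otimes> (e \<otimes> r)" "r \<otimes> e = \<zero>" using e f_def by auto
  moreover have "e \<otimes> r \<otimes> (e \<otimes> r) = e \<otimes> ((r \<otimes> e) \<otimes> r)"
    using e(2) r by (simp only: m_assoc m_closed)
  ultimately have "\<one> = e \<otimes> ((r \<otimes> e) \<otimes> r)" by simp
  then have "\<one> = \<zero>" using \<open>r \<otimes> e = \<zero>\<close> e(2) r by simp
  then show False using one_notin_max_ideal max_ideal_closed(2) by simp
qed

lemma unit_outside_max_ideal:
  assumes "x \<in> carrier R" "x \<notin> max_ideal R"
  shows "\<exists>s\<in>carrier R. s \<otimes> x = \<one> \<and> x \<otimes> s = \<one>"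
proof -
  obtain s where s: "s \<in> carrier R" "s \<otimes> x = \<one>" using left_inverse[OF assms] by blast
  have "s \<notin> max_ideal R"
    using max_ideal_right[of s x] s assms(1) one_notin_max_ideal by auto
  then obtain t where t: "t \<in> carrier R" "t \<otimes> s = \<one>" using left_inverse s(1) by blast
  have "t = t \<otimes> (s \<otimes> x)" using s t by simp
  also have "\<dots> = t \<otimes> s \<otimes> x" by (rule m_assoc[symmetric]) (use s t assms in auto)
  also have "\<dots> = x" using t assms by simp
  finally show ?thesis using s t by blast
qed

end

section \<open>Graded local rings\<close>

text \<open>The grading of the ring, extended by zero to negative degrees. Degrees can then be subtracted: in an
  element of degree \<open>j\<close>, the coefficient of a basis element of degree \<open>d\<close> has degree \<open>j - d\<close>.\<close>

definition rgr :: "('r, 'x) graded_ring_scheme \<Rightarrow> int \<Rightarrow> 'r set"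
  where "rgr R n = (if n < 0 then {\<zero>\<^bsub>R\<^esub>} else rgrade R (nat n))"

abbreviation rpart :: "('r, 'x) graded_ring_scheme \<Rightarrow> int \<Rightarrow> 'r \<Rightarrow> 'r"
  where "rpart R \<equiv> dpart R (rgr R)"

context graded_ring begin

lemma nat_dsum: "dsum R (rgrade R)"
  by (intro dsum.intro dsum_axioms.intro abelian_group_axioms direct_sum)

lemma rgr_direct_sum: "is_direct_sum R (rgr R)"
  and rgr_dsum: "dsum R (rgr R)"
  and rpart_eq: "x \<in> carrier R \<Longrightarrow> rpart R n x = (if n < 0 then \<zero> else dpart R (rgrade R) (nat n) x)"
proof -
  interpret N: dsum R "rgrade R" by (rule nat_dsum)
  let ?p = "\<lambda>n x. if n < 0 then \<zero> else dpart R (rgrade R) (nat n) x"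
  have G: "additive_subgroup (rgr R n) R" for n
    by (cases "n < 0") (auto simp: rgr_def N.G_sub intro: additive_subgroupI')
  have p1: "?p n \<in> add_hom R R" for n
    by (rule add_homI) (auto simp: N.dpart_carrier N.dpart_add)
  have p2: "?p n x \<in> rgr R n" if "x \<in> carrier R" for n x
    using that by (auto simp: rgr_def N.dpart_in)
  have p3: "?p m x = (if m = n then x else \<zero>)" if "x \<in> rgr R n" for x m n
    using that N.dpart_homog[of x "nat n" "nat m"] N.dpart_zero[of "nat m"]
    by (auto simp: rgr_def split: if_splits)
  have p4: "\<exists>A. finite A \<and> (\<forall>n. n \<notin> A \<longrightarrow> ?p n x = \<zero>) \<and> x = finsum R (\<lambda>n. ?p n x) A"
    if "x \<in> carrier R" for x
  proof (intro exI conjI allI impI)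
    let ?A = "{i. dpart R (rgrade R) i x \<noteq> \<zero>}"
    show "finite (int ` ?A)" using N.dpart_finite that by simp
    show "?p n x = \<zero>" if "n \<notin> int ` ?A" for n
      using that by (auto simp: image_iff)
    have "x = (\<Oplus>i\<in>?A. dpart R (rgrade R) i x)" using N.dpart_sum that by simp
    also have "\<dots> = (\<Oplus>i\<in>?A. ?p (int i) x)"
      by (rule finsum_cong') (auto simp: that N.dpart_carrier)
    also have "\<dots> = finsum R (\<lambda>n. ?p n x) (int ` ?A)"
      by (rule finsum_reindex[symmetric]) (auto simp: that N.dpart_carrier inj_on_def)
    finally show "x = finsum R (\<lambda>n. ?p n x) (int ` ?A)" .
  qed
  note D = direct_sumI[OF G p1 p2 p3 p4]
  show "is_direct_sum R (rgr R)" by (rule D(1))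
  show "dsum R (rgr R)" by (rule D(2))
  show "x \<in> carrier R \<Longrightarrow> rpart R n x = ?p n x" by (rule D(3))
qed

sublocale rd: dsum R "rgr R" by (rule rgr_dsum)

lemma one_rgr: "\<one> \<in> rgr R 0"
  using one_degree by (simp add: rgr_def)

lemma rgr_neg_zero: "n < 0 \<Longrightarrow> x \<in> rgr R n \<Longrightarrow> x = \<zero>"
  by (simp add: rgr_def)

lemma rpart_neg: "n < 0 \<Longrightarrow> x \<in> carrier R \<Longrightarrow> rpart R n x = \<zero>"
  by (simp add: rpart_eq)

lemma rgr_mult:
  assumes "x \<in> rgr R i" "y \<in> rgr R j"
  shows "x \<otimes> y \<in> rgr R (i + j)"
proof (cases "i < 0 \<or> j < 0")
  case True
  then have "x \<otimes> y = \<zero>"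
    using assms rgr_neg_zero rd.G_in_carrier by (metis l_null r_null)
  then show ?thesis by (simp add: rd.G_zero)
next
  case False
  then show ?thesis using assms mult_degree[of x "nat i" y "nat j"]
    by (auto simp: rgr_def nat_add_distrib)
qed

lemma rpart_lmult:
  assumes "r \<in> rgr R k" "x \<in> carrier R"
  shows "rpart R (k + n) (r \<otimes> x) = r \<otimes> rpart R n x"
proof (rule dpart_hom[OF rgr_dsum rgr_dsum, of "\<lambda>x. r \<otimes> x" "\<lambda>n. k + n"])
  show "(\<lambda>x. r \<otimes> x) \<in> add_hom R R"
    using rd.G_in_carrier[OF assms(1)] by (intro add_homI) (auto simp: r_distr)
qed (use assms rgr_mult in \<open>auto simp: inj_on_def\<close>)

text \<open>There are no negative degrees, so a product contributes to degree zero only through the parts of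
  degree zero of its factors.\<close>

lemma rpart_0_mult:
  assumes r: "r \<in> carrier R" and s: "s \<in> carrier R"
  shows "rpart R 0 (r \<otimes> s) = rpart R 0 r \<otimes> rpart R 0 s"
proof -
  let ?A = "insert 0 {i. rpart R i r \<noteq> \<zero>}"
  have fin: "finite ?A" using rd.dpart_finite r by auto
  have rc: "rpart R i r \<in> carrier R" for i using r by (rule rd.dpart_carrier)
  have *: "rpart R 0 (rpart R i r \<otimes> s) = (if i = 0 then rpart R 0 r \<otimes> rpart R 0 s else \<zero>)" for i
  proof -
    have "rpart R (i + (- i)) (rpart R i r \<otimes> s) = rpart R i r \<otimes> rpart R (- i) s"
      by (rule rpart_lmult) (use r s rd.dpart_in in auto)
    moreover have "rpart R i r \<otimes> rpart R (- i) s = \<zero>" if "i \<noteq> 0"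
      using that rpart_neg[of i r] rpart_neg[of "- i" s] r s rd.dpart_carrier
      by (cases "i < 0") auto
    ultimately show ?thesis by auto
  qed
  have "r = (\<Oplus>i\<in>?A. rpart R i r)" using fin r by (intro rd.dpart_sum_superset[symmetric]) auto
  then have "r \<otimes> s = (\<Oplus>i\<in>?A. rpart R i r \<otimes> s)"
    using finsum_ldistr[OF fin s, of "\<lambda>i. rpart R i r"] rc by simp
  then have "rpart R 0 (r \<otimes> s) = (\<Oplus>i\<in>?A. rpart R 0 (rpart R i r \<otimes> s))"
    using add_hom_finsum[OF abelian_group_axioms abelian_group_axioms rd.dpart_add_hom[of 0],
        of "\<lambda>i. rpart R i r \<otimes> s" ?A] rc s by auto
  also have "\<dots> = rpart R 0 (rpart R 0 r \<otimes> s)"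
    using fin rc s by (intro finsum_eq_single) (auto simp: * rd.dpart_carrier simp del: finsum_insert)
  finally show ?thesis by (simp add: *)
qed

end

lemma (in graded_local_ring) R0_local: "noncomm_local_ring (degree_zero_ring R)"
  using local_degree_zero
  by (auto simp: local_ring_def noncomm_local_ring_def noncomm_local_ring_axioms_def)

lemma degree_zero_ring_simps [simp]:
  "carrier (degree_zero_ring R) = rgrade R 0" "mult (degree_zero_ring R) = mult R"
  "one (degree_zero_ring R) = one R" "zero (degree_zero_ring R) = zero R"
  "add (degree_zero_ring R) = add R"
  by (simp_all add: degree_zero_ring_def)

lemma rgr_0: "rgr R 0 = rgrade R 0"
  by (simp add: rgr_def)

context graded_local_ring begin

abbreviation "\<mm> \<equiv> graded_max_ideal R"

interpretation Z: noncomm_local_ring "degree_zero_ring R" by (rule R0_local)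

abbreviation "m0 \<equiv> max_ideal (degree_zero_ring R)"

lemma m0_sub: "m0 \<subseteq> rgr R 0"
  using Z.max_ideal_closed(1) by (simp add: rgr_0)

text \<open>The maximal ideal is the preimage of the maximal ideal of \<open>R\<^sub>0\<close> under the ring homomorphism that takes
  parts of degree zero. All its closure properties follow from this description.\<close>

lemma mem_gmax_iff: "r \<in> \<mm> \<longleftrightarrow> r \<in> carrier R \<and> rpart R 0 r \<in> m0"
proof
  assume "r \<in> \<mm>"
  then obtain a b where ab: "r = a \<oplus> b" "a \<in> m0" "b \<in> internal_sum R {0<..} (rgrade R)"
    by (auto simp: graded_max_ideal_def set_add_def')
  from ab(3) obtain f J where b: "b = finsum R f J" "finite J" "J \<subseteq> {0<..}" "f \<in> (\<Pi> i\<in>J. rgrade R i)"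
    by (auto simp: internal_sum_def)
  have f: "f i \<in> rgr R (int i)" if "i \<in> J" for i using that b(4) by (auto simp: rgr_def)
  have fc: "f \<in> J \<rightarrow> carrier R" using f rd.G_in_carrier by blast
  have a: "a \<in> rgr R 0" "a \<in> carrier R" using m0_sub ab(2) rd.G_in_carrier by auto
  have bc: "b \<in> carrier R" using fc b(1) by auto
  have "rpart R 0 b = (\<Oplus>i\<in>J. rpart R 0 (f i))"
    unfolding b(1) using add_hom_finsum[OF abelian_group_axioms abelian_group_axioms rd.dpart_add_hom fc] .
  also have "\<dots> = \<zero>"
  proof (rule add.finprod_one_eqI)
    fix i assume i: "i \<in> J"
    then have "int i \<noteq> 0" using b(3) by auto
    then show "rpart R 0 (f i) = \<zero>" using rd.dpart_homog[OF f[OF i], of 0] by auto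
  qed
  finally have "rpart R 0 b = \<zero>" .
  then have "rpart R 0 r = a" using a bc ab(1) rd.dpart_homog[OF a(1), of 0] by (simp add: rd.dpart_add)
  then show "r \<in> carrier R \<and> rpart R 0 r \<in> m0" using a bc ab by simp
next
  assume r: "r \<in> carrier R \<and> rpart R 0 r \<in> m0"
  interpret N: dsum R "rgrade R" by (rule nat_dsum)
  let ?q = "\<lambda>i. dpart R (rgrade R) i r"
  let ?A = "{i. ?q i \<noteq> \<zero>} - {0}"
  have fin: "finite ?A" "finite (insert 0 ?A)" using N.dpart_finite r by auto
  have q0: "?q 0 = rpart R 0 r" using r by (simp add: rpart_eq)
  have "r = (\<Oplus>i\<in>insert 0 ?A. ?q i)"
    using r fin by (intro N.dpart_sum_superset[symmetric]) auto
  also have "\<dots> = ?q 0 \<oplus> (\<Oplus>i\<in>?A. ?q i)"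
    using fin r N.dpart_carrier by (subst finsum_insert) auto
  finally have "r = rpart R 0 r \<oplus> (\<Oplus>i\<in>?A. ?q i)" using q0 by simp
  moreover have "(\<Oplus>i\<in>?A. ?q i) \<in> internal_sum R {0<..} (rgrade R)"
    unfolding internal_sum_def using fin(1) r N.dpart_in
    by (intro CollectI exI[of _ ?q] exI[of _ ?A] conjI refl) auto
  ultimately show "r \<in> \<mm>" using r unfolding graded_max_ideal_def set_add_def' by blast
qed

lemma gmax_carrier: "r \<in> \<mm> \<Longrightarrow> r \<in> carrier R"
  by (simp add: mem_gmax_iff)

lemma gmax_zero: "\<zero> \<in> \<mm>"
  using Z.max_ideal_closed(2) by (simp add: mem_gmax_iff rd.dpart_zero)

lemma gmax_add: "\<lbrakk>r \<in> \<mm>; s \<in> \<mm>\<rbrakk> \<Longrightarrow> r \<oplus> s \<in> \<mm>"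
  using Z.max_ideal_closed(3) by (simp add: mem_gmax_iff rd.dpart_add)

lemma gmax_lmult: "\<lbrakk>r \<in> carrier R; s \<in> \<mm>\<rbrakk> \<Longrightarrow> r \<otimes> s \<in> \<mm>"
  using Z.max_ideal_closed(4)[of "rpart R 0 r"] rd.dpart_in[of r 0]
  by (simp add: mem_gmax_iff rpart_0_mult rgr_0)

lemma gmax_rmult: "\<lbrakk>r \<in> carrier R; s \<in> \<mm>\<rbrakk> \<Longrightarrow> s \<otimes> r \<in> \<mm>"
  using Z.max_ideal_right[of _ "rpart R 0 r"] rd.dpart_in[of r 0]
  by (simp add: mem_gmax_iff rpart_0_mult rgr_0)

lemma gmax_finsum: "f \<in> A \<rightarrow> \<mm> \<Longrightarrow> finsum R f A \<in> \<mm>"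
  by (rule finsum_in_subset) (auto simp: gmax_carrier gmax_zero gmax_add)

lemma one_notin_gmax: "\<one> \<notin> \<mm>"
  using Z.one_notin_max_ideal rd.dpart_homog[OF one_rgr, of 0] by (simp add: mem_gmax_iff)

lemma one_not_zero: "\<one> \<noteq> \<zero>"
  using one_notin_gmax gmax_zero by auto

lemma positive_degree_gmax: "\<lbrakk>r \<in> rgr R n; n \<noteq> 0\<rbrakk> \<Longrightarrow> r \<in> \<mm>"
  using Z.max_ideal_closed(2) by (simp add: mem_gmax_iff rd.dpart_homog rd.G_in_carrier)

text \<open>An element outside \<open>\<mm>\<close> has a part of degree zero outside the maximal ideal of the local ring \<open>R\<^sub>0\<close>.\<close>

lemma rpart_0_unit:
  assumes "r \<in> carrier R" "r \<notin> \<mm>"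
  shows "\<exists>u\<in>rgr R 0. u \<otimes> rpart R 0 r = \<one> \<and> rpart R 0 r \<otimes> u = \<one>"
  using Z.unit_outside_max_ideal[of "rpart R 0 r"] assms rd.dpart_in[of r 0]
  by (auto simp: mem_gmax_iff rgr_0)

lemma field_gmax:
  assumes "field (degree_zero_ring R)" "r \<in> rgr R 0" "r \<in> \<mm>"
  shows "r = \<zero>"
proof (rule ccontr)
  assume "r \<noteq> \<zero>"
  interpret F: field "degree_zero_ring R" by fact
  have "r \<in> Units (degree_zero_ring R)"
    using F.field_Units assms \<open>r \<noteq> \<zero>\<close> by (simp add: rgr_0)
  then obtain s where "s \<in> rgrade R 0" "s \<otimes> r = \<one>" by (auto simp: Units_def)
  then show False using gmax_lmult[of s r] assms(3) one_notin_gmax rd.G_in_carrier[of s 0] by (auto simp: rgr_0)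
qed

end

section \<open>Submodules and linear combinations\<close>

definition submod :: "('r, 'x) ring_scheme \<Rightarrow> ('r, 'm, 'y) module_scheme \<Rightarrow> 'm set \<Rightarrow> bool"
  where "submod R M N \<longleftrightarrow> N \<subseteq> carrier M \<and> \<zero>\<^bsub>M\<^esub> \<in> N \<and> (\<forall>x\<in>N. \<forall>y\<in>N. x \<oplus>\<^bsub>M\<^esub> y \<in> N) \<and>
    (\<forall>r\<in>carrier R. \<forall>x\<in>N. r \<odot>\<^bsub>M\<^esub> x \<in> N)"

lemma submodI:
  assumes "\<And>x. x \<in> N \<Longrightarrow> x \<in> carrier M" "\<zero>\<^bsub>M\<^esub> \<in> N" "\<And>x y. \<lbrakk>x \<in> N; y \<in> N\<rbrakk> \<Longrightarrow> x \<oplus>\<^bsub>M\<^esub> y \<in> N"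
    "\<And>r x. \<lbrakk>r \<in> carrier R; x \<in> N\<rbrakk> \<Longrightarrow> r \<odot>\<^bsub>M\<^esub> x \<in> N"
  shows "submod R M N"
  using assms by (auto simp: submod_def)

lemma submodD:
  assumes "submod R M N"
  shows "x \<in> N \<Longrightarrow> x \<in> carrier M" "\<zero>\<^bsub>M\<^esub> \<in> N" "\<lbrakk>x \<in> N; y \<in> N\<rbrakk> \<Longrightarrow> x \<oplus>\<^bsub>M\<^esub> y \<in> N"
    "\<lbrakk>r \<in> carrier R; x \<in> N\<rbrakk> \<Longrightarrow> r \<odot>\<^bsub>M\<^esub> x \<in> N"
  using assms by (auto simp: submod_def)

text \<open>Finitely supported coefficient families are functions that vanish outside the index set, so that
  equality of families is equality of functions and families on subsets are families.\<close>

definition coefs :: "('r, 'x) ring_scheme \<Rightarrow> 'i set \<Rightarrow> ('i \<Rightarrow> 'r) set"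
  where "coefs R I = {c. (\<forall>i. c i \<in> carrier R) \<and> (\<forall>i. i \<notin> I \<longrightarrow> c i = \<zero>\<^bsub>R\<^esub>) \<and> finite {i. c i \<noteq> \<zero>\<^bsub>R\<^esub>}}"

definition lincomb ::
  "('r, 'x) ring_scheme \<Rightarrow> ('r, 'm, 'y) module_scheme \<Rightarrow> ('i \<Rightarrow> 'm) \<Rightarrow> ('i \<Rightarrow> 'r) \<Rightarrow> 'm"
  where "lincomb R M \<kappa> c = finsum M (\<lambda>i. c i \<odot>\<^bsub>M\<^esub> \<kappa> i) {i. c i \<noteq> \<zero>\<^bsub>R\<^esub>}"

definition unitvec :: "('r, 'x) ring_scheme \<Rightarrow> 'i \<Rightarrow> 'i \<Rightarrow> 'r"
  where "unitvec R i k = (if k = i then \<one>\<^bsub>R\<^esub> else \<zero>\<^bsub>R\<^esub>)"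

definition spn :: "('r, 'x) ring_scheme \<Rightarrow> ('r, 'm, 'y) module_scheme \<Rightarrow> 'm set \<Rightarrow> 'm set"
  where "spn R M S = lincomb R M (\<lambda>x. x) ` coefs R S"

lemma coefsD:
  assumes "c \<in> coefs R I"
  shows "c i \<in> carrier R" "i \<notin> I \<Longrightarrow> c i = \<zero>\<^bsub>R\<^esub>" "finite {i. c i \<noteq> \<zero>\<^bsub>R\<^esub>}" "{i. c i \<noteq> \<zero>\<^bsub>R\<^esub>} \<subseteq> I"
  using assms by (auto simp: coefs_def)

lemma coefs_mono: "I \<subseteq> J \<Longrightarrow> coefs R I \<subseteq> coefs R J"
  by (auto simp: coefs_def)

context ring begin

lemma coefs_zero: "(\<lambda>i. \<zero>) \<in> coefs R I"
  by (simp add: coefs_def)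

lemma coefs_add: "\<lbrakk>c \<in> coefs R I; d \<in> coefs R I\<rbrakk> \<Longrightarrow> (\<lambda>i. c i \<oplus> d i) \<in> coefs R I"
  by (auto simp: coefs_def intro: finite_subset[of _ "{i. c i \<noteq> \<zero>} \<union> {i. d i \<noteq> \<zero>}"])

lemma coefs_lmult: "\<lbrakk>r \<in> carrier R; c \<in> coefs R I\<rbrakk> \<Longrightarrow> (\<lambda>i. r \<otimes> c i) \<in> coefs R I"
  by (auto simp: coefs_def intro: finite_subset[of _ "{i. c i \<noteq> \<zero>}"])

lemma coefs_unitvec: "i \<in> I \<Longrightarrow> unitvec R i \<in> coefs R I"
  by (auto simp: coefs_def unitvec_def intro: finite_subset[of _ "{i}"])

lemma coefs_restrict: "c \<in> coefs R I \<Longrightarrow> (\<lambda>i. if i \<in> J then c i else \<zero>) \<in> coefs R (I \<inter> J)"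
  by (auto simp: coefs_def intro: finite_subset[of _ "{i. c i \<noteq> \<zero>}"])

end

context left_module begin

lemma smult_l_zero [simp]:
  assumes "x \<in> carrier M" shows "\<zero>\<^bsub>R\<^esub> \<odot>\<^bsub>M\<^esub> x = \<zero>\<^bsub>M\<^esub>"
proof -
  have "\<zero>\<^bsub>R\<^esub> \<odot>\<^bsub>M\<^esub> x \<oplus>\<^bsub>M\<^esub> \<zero>\<^bsub>R\<^esub> \<odot>\<^bsub>M\<^esub> x = \<zero>\<^bsub>R\<^esub> \<odot>\<^bsub>M\<^esub> x"
    using smult_l_distr[of "\<zero>\<^bsub>R\<^esub>" "\<zero>\<^bsub>R\<^esub>" x] assms by simp
  then show ?thesis using assms smult_closed[of "\<zero>\<^bsub>R\<^esub>" x] by (metis M.add.r_cancel_one R.zero_closed)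
qed

lemma smult_r_zero [simp]:
  assumes "r \<in> carrier R" shows "r \<odot>\<^bsub>M\<^esub> \<zero>\<^bsub>M\<^esub> = \<zero>\<^bsub>M\<^esub>"
proof -
  have "r \<odot>\<^bsub>M\<^esub> \<zero>\<^bsub>M\<^esub> \<oplus>\<^bsub>M\<^esub> r \<odot>\<^bsub>M\<^esub> \<zero>\<^bsub>M\<^esub> = r \<odot>\<^bsub>M\<^esub> \<zero>\<^bsub>M\<^esub>"
    using smult_r_distr[of r "\<zero>\<^bsub>M\<^esub>" "\<zero>\<^bsub>M\<^esub>"] assms by simp
  then show ?thesis using assms smult_closed[of r "\<zero>\<^bsub>M\<^esub>"] by (metis M.add.r_cancel_one M.zero_closed)
qed

lemma smult_add_hom: "r \<in> carrier R \<Longrightarrow> (\<lambda>x. r \<odot>\<^bsub>M\<^esub> x) \<in> add_hom M M"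
  by (rule add_homI) (auto simp: smult_closed smult_r_distr)

lemma smult_add_hom': "x \<in> carrier M \<Longrightarrow> (\<lambda>r. r \<odot>\<^bsub>M\<^esub> x) \<in> add_hom R M"
  by (rule add_homI) (auto simp: smult_closed smult_l_distr)

lemma smult_r_neg: "\<lbrakk>r \<in> carrier R; x \<in> carrier M\<rbrakk> \<Longrightarrow> r \<odot>\<^bsub>M\<^esub> (\<ominus>\<^bsub>M\<^esub> x) = \<ominus>\<^bsub>M\<^esub> (r \<odot>\<^bsub>M\<^esub> x)"
  using add_hom_neg[OF M.abelian_group_axioms M.abelian_group_axioms smult_add_hom] .

lemma smult_l_neg: "\<lbrakk>r \<in> carrier R; x \<in> carrier M\<rbrakk> \<Longrightarrow> (\<ominus>\<^bsub>R\<^esub> r) \<odot>\<^bsub>M\<^esub> x = \<ominus>\<^bsub>M\<^esub> (r \<odot>\<^bsub>M\<^esub> x)"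
  using add_hom_neg[OF R.abelian_group_axioms M.abelian_group_axioms smult_add_hom'] .

lemma smult_r_minus:
  "\<lbrakk>r \<in> carrier R; x \<in> carrier M; y \<in> carrier M\<rbrakk> \<Longrightarrow> r \<odot>\<^bsub>M\<^esub> (x \<ominus>\<^bsub>M\<^esub> y) = r \<odot>\<^bsub>M\<^esub> x \<ominus>\<^bsub>M\<^esub> r \<odot>\<^bsub>M\<^esub> y"
  using add_hom_minus[OF M.abelian_group_axioms M.abelian_group_axioms smult_add_hom] .

lemma neg_eq_smult: "x \<in> carrier M \<Longrightarrow> \<ominus>\<^bsub>M\<^esub> x = (\<ominus>\<^bsub>R\<^esub> \<one>\<^bsub>R\<^esub>) \<odot>\<^bsub>M\<^esub> x"
  by (simp add: smult_l_neg smult_one)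

lemma submod_neg: "\<lbrakk>submod R M N; x \<in> N\<rbrakk> \<Longrightarrow> \<ominus>\<^bsub>M\<^esub> x \<in> N"
  using neg_eq_smult[of x] submodD[of R M N] by simp

lemma submod_minus: "\<lbrakk>submod R M N; x \<in> N; y \<in> N\<rbrakk> \<Longrightarrow> x \<ominus>\<^bsub>M\<^esub> y \<in> N"
  by (simp add: a_minus_def submod_neg submodD)

lemma submod_add_subgroup: "submod R M N \<Longrightarrow> additive_subgroup N M"
  by (rule M.additive_subgroupI') (auto simp: submodD submod_neg)

lemma submod_finsum: "\<lbrakk>submod R M N; f \<in> A \<rightarrow> N\<rbrakk> \<Longrightarrow> finsum M f A \<in> N"
  by (rule M.finsum_in_subset) (auto simp: submodD)

lemma submod_add_cancel:
  assumes "submod R M N" "x \<oplus>\<^bsub>M\<^esub> y \<in> N" "x \<in> N" "y \<in> carrier M"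
  shows "y \<in> N"
proof -
  have x: "x \<in> carrier M" by (rule submodD(1)[OF assms(1,3)])
  have "(x \<oplus>\<^bsub>M\<^esub> y) \<ominus>\<^bsub>M\<^esub> x \<in> N" by (rule submod_minus[OF assms(1-3)])
  moreover have "(x \<oplus>\<^bsub>M\<^esub> y) \<ominus>\<^bsub>M\<^esub> x = y"
    using x assms(4) by algebra
  ultimately show ?thesis by simp
qed

lemma lincomb_superset:
  assumes "\<And>i. c i \<in> carrier R" "finite A" "\<And>i. i \<notin> A \<Longrightarrow> c i = \<zero>\<^bsub>R\<^esub>" "\<kappa> \<in> A \<rightarrow> carrier M"
  shows "lincomb R M \<kappa> c = finsum M (\<lambda>i. c i \<odot>\<^bsub>M\<^esub> \<kappa> i) A"
  unfolding lincomb_def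
proof (rule M.finsum_superset)
  show "(\<lambda>i. c i \<odot>\<^bsub>M\<^esub> \<kappa> i) \<in> {i. c i \<noteq> \<zero>\<^bsub>R\<^esub>} \<rightarrow> carrier M"
    using assms by (auto intro!: smult_closed)
qed (use assms in \<open>auto simp: Pi_iff\<close>)

lemma lincomb_submod:
  assumes "submod R M N" "\<And>i. c i \<noteq> \<zero>\<^bsub>R\<^esub> \<Longrightarrow> c i \<odot>\<^bsub>M\<^esub> \<kappa> i \<in> N"
  shows "lincomb R M \<kappa> c \<in> N"
  unfolding lincomb_def using assms by (intro submod_finsum) auto

lemma carrier_submod: "submod R M (carrier M)"
  by (rule submodI) (auto simp: smult_closed)

lemma lincomb_closed:
  assumes "c \<in> coefs R I" "\<kappa> \<in> I \<rightarrow> carrier M"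
  shows "lincomb R M \<kappa> c \<in> carrier M"
proof (rule lincomb_submod[OF carrier_submod])
  fix i assume "c i \<noteq> \<zero>\<^bsub>R\<^esub>"
  then have "i \<in> I" using coefsD(2)[OF assms(1)] by auto
  then show "c i \<odot>\<^bsub>M\<^esub> \<kappa> i \<in> carrier M" using assms(2) coefsD(1)[OF assms(1)] smult_closed by auto
qed

lemma lincomb_add:
  assumes c: "c \<in> coefs R I" and d: "d \<in> coefs R I" and k: "\<kappa> \<in> I \<rightarrow> carrier M"
  shows "lincomb R M \<kappa> (\<lambda>i. c i \<oplus>\<^bsub>R\<^esub> d i) = lincomb R M \<kappa> c \<oplus>\<^bsub>M\<^esub> lincomb R M \<kappa> d"
proof -
  let ?A = "{i. c i \<noteq> \<zero>\<^bsub>R\<^esub>} \<union> {i. d i \<noteq> \<zero>\<^bsub>R\<^esub>}"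
  note C = coefsD[OF c] and D = coefsD[OF d]
  have fin: "finite ?A" and kA: "\<kappa> \<in> ?A \<rightarrow> carrier M" using C D k by auto
  have "lincomb R M \<kappa> c = finsum M (\<lambda>i. c i \<odot>\<^bsub>M\<^esub> \<kappa> i) ?A"
    by (rule lincomb_superset) (use C fin kA in auto)
  moreover have "lincomb R M \<kappa> d = finsum M (\<lambda>i. d i \<odot>\<^bsub>M\<^esub> \<kappa> i) ?A"
    by (rule lincomb_superset) (use D fin kA in auto)
  moreover have "lincomb R M \<kappa> (\<lambda>i. c i \<oplus>\<^bsub>R\<^esub> d i) = finsum M (\<lambda>i. (c i \<oplus>\<^bsub>R\<^esub> d i) \<odot>\<^bsub>M\<^esub> \<kappa> i) ?A"
    by (rule lincomb_superset) (use C D fin kA in auto)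
  moreover have "\<dots> = finsum M (\<lambda>i. c i \<odot>\<^bsub>M\<^esub> \<kappa> i \<oplus>\<^bsub>M\<^esub> d i \<odot>\<^bsub>M\<^esub> \<kappa> i) ?A"
    using C(1) D(1) kA by (intro M.finsum_cong') (auto simp: smult_l_distr smult_closed Pi_iff)
  moreover have "\<dots> = finsum M (\<lambda>i. c i \<odot>\<^bsub>M\<^esub> \<kappa> i) ?A \<oplus>\<^bsub>M\<^esub> finsum M (\<lambda>i. d i \<odot>\<^bsub>M\<^esub> \<kappa> i) ?A"
    using C(1) D(1) kA by (intro M.finsum_addf) (auto simp: smult_closed Pi_iff)
  ultimately show ?thesis by simp
qed

lemma lincomb_smult:
  assumes c: "c \<in> coefs R I" and r: "r \<in> carrier R" and k: "\<kappa> \<in> I \<rightarrow> carrier M"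
  shows "lincomb R M \<kappa> (\<lambda>i. r \<otimes>\<^bsub>R\<^esub> c i) = r \<odot>\<^bsub>M\<^esub> lincomb R M \<kappa> c"
proof -
  let ?A = "{i. c i \<noteq> \<zero>\<^bsub>R\<^esub>}"
  note C = coefsD[OF c]
  have kA: "\<kappa> \<in> ?A \<rightarrow> carrier M" using C k by auto
  have "lincomb R M \<kappa> (\<lambda>i. r \<otimes>\<^bsub>R\<^esub> c i) = finsum M (\<lambda>i. (r \<otimes>\<^bsub>R\<^esub> c i) \<odot>\<^bsub>M\<^esub> \<kappa> i) ?A"
    by (rule lincomb_superset) (use C r kA in auto)
  also have "\<dots> = finsum M (\<lambda>i. r \<odot>\<^bsub>M\<^esub> (c i \<odot>\<^bsub>M\<^esub> \<kappa> i)) ?A"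
    using C(1) r kA by (intro M.finsum_cong') (auto simp: smult_assoc smult_closed Pi_iff)
  also have "\<dots> = r \<odot>\<^bsub>M\<^esub> finsum M (\<lambda>i. c i \<odot>\<^bsub>M\<^esub> \<kappa> i) ?A"
    using C(1) kA by (intro add_hom_finsum[OF M.abelian_group_axioms M.abelian_group_axioms
          smult_add_hom[OF r], symmetric]) (auto simp: smult_closed Pi_iff)
  finally show ?thesis by (simp add: lincomb_def)
qed

lemma lincomb_unitvec:
  assumes "\<kappa> i \<in> carrier M"
  shows "lincomb R M \<kappa> (unitvec R i) = \<kappa> i"
proof -
  have "lincomb R M \<kappa> (unitvec R i) = finsum M (\<lambda>k. unitvec R i k \<odot>\<^bsub>M\<^esub> \<kappa> k) {i}"
    by (rule lincomb_superset) (use assms in \<open>auto simp: unitvec_def\<close>)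
  then show ?thesis using assms by (simp add: unitvec_def smult_one)
qed

lemma lincomb_zero: "lincomb R M \<kappa> (\<lambda>i. \<zero>\<^bsub>R\<^esub>) = \<zero>\<^bsub>M\<^esub>"
  by (simp add: lincomb_def)

lemma lincomb_cong:
  assumes "c \<in> coefs R I" "\<And>i. i \<in> I \<Longrightarrow> \<kappa> i = \<kappa>' i" "\<kappa> \<in> I \<rightarrow> carrier M"
  shows "lincomb R M \<kappa> c = lincomb R M \<kappa>' c"
  unfolding lincomb_def
proof (rule M.finsum_cong')
  show "(\<lambda>i. c i \<odot>\<^bsub>M\<^esub> \<kappa>' i) \<in> {i. c i \<noteq> \<zero>\<^bsub>R\<^esub>} \<rightarrow> carrier M"
  proof
    fix i assume "i \<in> {i. c i \<noteq> \<zero>\<^bsub>R\<^esub>}"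
    then have "i \<in> I" using coefsD(2)[OF assms(1)] by auto
    then show "c i \<odot>\<^bsub>M\<^esub> \<kappa>' i \<in> carrier M"
      using assms(3) assms(2)[of i, symmetric] coefsD(1)[OF assms(1)] by (auto intro!: smult_closed)
  qed
  fix i assume "i \<in> {i. c i \<noteq> \<zero>\<^bsub>R\<^esub>}"
  then have "i \<in> I" using coefsD(2)[OF assms(1)] by auto
  then show "c i \<odot>\<^bsub>M\<^esub> \<kappa> i = c i \<odot>\<^bsub>M\<^esub> \<kappa>' i" using assms(2) by simp
qed simp

lemma spn_submod:
  assumes "S \<subseteq> carrier M" shows "submod R M (spn R M S)"
proof -
  have k: "(\<lambda>x. x) \<in> S \<rightarrow> carrier M" using assms by auto
  show ?thesis
  proof (rule submodI)
    show "\<zero>\<^bsub>M\<^esub> \<in> spn R M S" unfolding spn_def using R.coefs_zero lincomb_zero by (metis imageI)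
  next
    fix x assume "x \<in> spn R M S"
    then show "x \<in> carrier M" using lincomb_closed[OF _ k] by (auto simp: spn_def)
  next
    fix x y assume "x \<in> spn R M S" "y \<in> spn R M S"
    then obtain c d where "c \<in> coefs R S" "d \<in> coefs R S" "x = lincomb R M (\<lambda>x. x) c" "y = lincomb R M (\<lambda>x. x) d"
      by (auto simp: spn_def)
    then show "x \<oplus>\<^bsub>M\<^esub> y \<in> spn R M S"
      unfolding spn_def using lincomb_add[OF _ _ k, of c d] R.coefs_add[of c S d]
      by (intro image_eqI[of _ _ "\<lambda>i. c i \<oplus>\<^bsub>R\<^esub> d i"]) auto
  next
    fix r x assume r: "r \<in> carrier R" "x \<in> spn R M S"
    then obtain c where "c \<in> coefs R S" "x = lincomb R M (\<lambda>x. x) c" by (auto simp: spn_def)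
    then show "r \<odot>\<^bsub>M\<^esub> x \<in> spn R M S"
      unfolding spn_def using lincomb_smult[OF _ r(1) k, of c] R.coefs_lmult[OF r(1), of c S]
      by (intro image_eqI[of _ _ "\<lambda>i. r \<otimes>\<^bsub>R\<^esub> c i"]) auto
  qed
qed

lemma spn_incl: "\<lbrakk>S \<subseteq> carrier M; x \<in> S\<rbrakk> \<Longrightarrow> x \<in> spn R M S"
  unfolding spn_def using lincomb_unitvec[of "\<lambda>x. x" x] R.coefs_unitvec[of x S]
  by (intro image_eqI[of _ _ "unitvec R x"]) auto

lemma spn_least: "\<lbrakk>submod R M N; S \<subseteq> N\<rbrakk> \<Longrightarrow> spn R M S \<subseteq> N"
  unfolding spn_def
proof (rule image_subsetI, rule lincomb_submod, assumption)
  fix c i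
  assume N: "submod R M N" "S \<subseteq> N" and c: "c \<in> coefs R S" and i: "c i \<noteq> \<zero>\<^bsub>R\<^esub>"
  have "i \<in> N" using coefsD(2)[OF c] i N(2) by auto
  then show "c i \<odot>\<^bsub>M\<^esub> i \<in> N" using submodD(4)[OF N(1) coefsD(1)[OF c]] by simp
qed

lemma spn_mono: "S \<subseteq> T \<Longrightarrow> spn R M S \<subseteq> spn R M T"
  unfolding spn_def using coefs_mono by (metis image_mono)

lemma spn_empty: "spn R M {} = {\<zero>\<^bsub>M\<^esub>}"
proof -
  have *: "coefs R {} = {\<lambda>i. \<zero>\<^bsub>R\<^esub>}" by (auto simp: coefs_def)
  show ?thesis by (simp add: spn_def * lincomb_zero)
qed

lemma submod_sum:
  assumes "submod R M A" "submod R M B"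
  shows "submod R M {a \<oplus>\<^bsub>M\<^esub> b | a b. a \<in> A \<and> b \<in> B}" "A \<union> B \<subseteq> {a \<oplus>\<^bsub>M\<^esub> b | a b. a \<in> A \<and> b \<in> B}"
proof -
  let ?N = "{a \<oplus>\<^bsub>M\<^esub> b | a b. a \<in> A \<and> b \<in> B}"
  note A = submodD[OF assms(1)] and B = submodD[OF assms(2)]
  have z: "x = x \<oplus>\<^bsub>M\<^esub> \<zero>\<^bsub>M\<^esub>" "x = \<zero>\<^bsub>M\<^esub> \<oplus>\<^bsub>M\<^esub> x" if "x \<in> carrier M" for x using that by auto
  show sub: "A \<union> B \<subseteq> ?N" using z(1)[OF A(1)] z(2)[OF B(1)] A(2) B(2) by blast
  show "submod R M ?N"
  proof (rule submodI)
    show "\<zero>\<^bsub>M\<^esub> \<in> ?N" using A(2) sub by blast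
  next
    fix y z assume "y \<in> ?N" "z \<in> ?N"
    then obtain a b a' b' where *: "a \<in> A" "a' \<in> A" "b \<in> B" "b' \<in> B" "y = a \<oplus>\<^bsub>M\<^esub> b" "z = a' \<oplus>\<^bsub>M\<^esub> b'" by blast
    then have "y \<oplus>\<^bsub>M\<^esub> z = (a \<oplus>\<^bsub>M\<^esub> a') \<oplus>\<^bsub>M\<^esub> (b \<oplus>\<^bsub>M\<^esub> b')" using A(1) B(1) by (simp add: M.a_ac)
    then show "y \<oplus>\<^bsub>M\<^esub> z \<in> ?N" using * A(3) B(3) by blast
  next
    fix r y assume r: "r \<in> carrier R" "y \<in> ?N"
    then obtain a b where *: "a \<in> A" "b \<in> B" "y = a \<oplus>\<^bsub>M\<^esub> b" by blast
    then have "r \<odot>\<^bsub>M\<^esub> y = r \<odot>\<^bsub>M\<^esub> a \<oplus>\<^bsub>M\<^esub> r \<odot>\<^bsub>M\<^esub> b" using r A(1) B(1) by (simp add: smult_r_distr)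
    then show "r \<odot>\<^bsub>M\<^esub> y \<in> ?N" using * r A(4) B(4) by blast
  qed (use A(1) B(1) in auto)
qed

lemma spn_Un:
  assumes "submod R M B" "S \<subseteq> carrier M" "y \<in> spn R M (B \<union> S)"
  shows "\<exists>b\<in>B. \<exists>c\<in>coefs R S. y = b \<oplus>\<^bsub>M\<^esub> lincomb R M (\<lambda>x. x) c"
proof -
  note S = spn_submod[OF assms(2)]
  have "B \<union> S \<subseteq> {b \<oplus>\<^bsub>M\<^esub> w | b w. b \<in> B \<and> w \<in> spn R M S}"
    using submod_sum(2)[OF assms(1) S] spn_incl[OF assms(2)] by blast
  then have "y \<in> {b \<oplus>\<^bsub>M\<^esub> w | b w. b \<in> B \<and> w \<in> spn R M S}"
    using spn_least[OF submod_sum(1)[OF assms(1) S]] assms(3) by blast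
  then show ?thesis by (auto simp: spn_def)
qed

lemma spn_insert:
  assumes "x \<in> carrier M" "S \<subseteq> carrier M" "y \<in> spn R M (insert x S)"
  shows "\<exists>r\<in>carrier R. \<exists>w\<in>spn R M S. y = r \<odot>\<^bsub>M\<^esub> x \<oplus>\<^bsub>M\<^esub> w"
proof -
  note S = spn_submod[OF assms(2)]
  have "insert x S \<subseteq> spn R M S \<union> {x}" using spn_incl[OF assms(2)] by blast
  then have "y \<in> spn R M (spn R M S \<union> {x})" using spn_mono assms(3) by blast
  then obtain w c where *: "w \<in> spn R M S" "c \<in> coefs R {x}" "y = w \<oplus>\<^bsub>M\<^esub> lincomb R M (\<lambda>x. x) c"
    using spn_Un[OF S, of "{x}"] assms(1) by blast
  have "lincomb R M (\<lambda>x. x) c = finsum M (\<lambda>i. c i \<odot>\<^bsub>M\<^esub> i) {x}"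
    by (rule lincomb_superset) (use coefsD[OF *(2)] assms(1) in auto)
  then have "y = c x \<odot>\<^bsub>M\<^esub> x \<oplus>\<^bsub>M\<^esub> w"
    using * assms(1) smult_closed[OF coefsD(1)[OF *(2)]] submodD(1)[OF S] by (simp add: M.a_comm)
  then show ?thesis using *(1) coefsD(1)[OF *(2)] by blast
qed

lemma lin_combs_eq:
  assumes I: "I \<subseteq> carrier R" "\<zero>\<^bsub>R\<^esub> \<in> I" and S: "S \<subseteq> carrier M"
  shows "lin_combs M I S = lincomb R M (\<lambda>x. x) ` {c \<in> coefs R S. \<forall>x. c x \<in> I}"
proof (intro equalityI subsetI)
  fix y assume "y \<in> lin_combs M I S"
  then obtain c A where A: "finite A" "A \<subseteq> S" "c \<in> A \<rightarrow> I" "y = finsum M (\<lambda>x. c x \<odot>\<^bsub>M\<^esub> x) A"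
    by (auto simp: lin_combs_def)
  let ?c = "\<lambda>x. if x \<in> A then c x else \<zero>\<^bsub>R\<^esub>"
  have AM: "A \<subseteq> carrier M" and cR: "c x \<in> carrier R" if "x \<in> A" for x using A S I that by auto
  have "?c \<in> coefs R S"
    using A I by (auto simp: coefs_def intro: finite_subset[of _ A])
  moreover have "lincomb R M (\<lambda>x. x) ?c = finsum M (\<lambda>x. ?c x \<odot>\<^bsub>M\<^esub> x) A"
    by (rule lincomb_superset) (use A S I in auto)
  moreover have "\<dots> = finsum M (\<lambda>x. c x \<odot>\<^bsub>M\<^esub> x) A"
    using A S I by (intro M.finsum_cong') (auto intro!: smult_closed)
  ultimately show "y \<in> lincomb R M (\<lambda>x. x) ` {c \<in> coefs R S. \<forall>x. c x \<in> I}"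
    using A I(2) by (intro image_eqI[of _ _ ?c]) auto
next
  fix y assume "y \<in> lincomb R M (\<lambda>x. x) ` {c \<in> coefs R S. \<forall>x. c x \<in> I}"
  then obtain c where c: "c \<in> coefs R S" "\<forall>x. c x \<in> I" "y = lincomb R M (\<lambda>x. x) c" by blast
  show "y \<in> lin_combs M I S"
    unfolding lin_combs_def
    by (rule CollectI, intro exI[of _ c] exI[of _ "{x. c x \<noteq> \<zero>\<^bsub>R\<^esub>}"])
      (use c coefsD[OF c(1)] in \<open>auto simp: lincomb_def\<close>)
qed

lemma lin_combs_carrier: "S \<subseteq> carrier M \<Longrightarrow> lin_combs M (carrier R) S = spn R M S"
  by (subst lin_combs_eq) (auto simp: spn_def coefs_def)

end

lemma hom_lincomb:
  assumes M: "left_module R M" and N: "left_module R N" and f: "f \<in> add_hom M N"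
    and l: "\<And>r x. \<lbrakk>r \<in> carrier R; x \<in> carrier M\<rbrakk> \<Longrightarrow> f (r \<odot>\<^bsub>M\<^esub> x) = r \<odot>\<^bsub>N\<^esub> f x"
    and c: "c \<in> coefs R I" and k: "\<kappa> \<in> I \<rightarrow> carrier M"
  shows "f (lincomb R M \<kappa> c) = lincomb R N (\<lambda>i. f (\<kappa> i)) c"
proof -
  interpret M: left_module R M by fact
  interpret N: left_module R N by fact
  have kc: "\<kappa> i \<in> carrier M" if "c i \<noteq> \<zero>\<^bsub>R\<^esub>" for i using that k coefsD(2)[OF c] by auto
  have "f (lincomb R M \<kappa> c) = finsum N (\<lambda>i. f (c i \<odot>\<^bsub>M\<^esub> \<kappa> i)) {i. c i \<noteq> \<zero>\<^bsub>R\<^esub>}"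
    unfolding lincomb_def
    by (rule add_hom_finsum[OF M.M.abelian_group_axioms N.M.abelian_group_axioms f])
      (use kc coefsD[OF c] in \<open>auto intro!: M.smult_closed\<close>)
  also have "\<dots> = lincomb R N (\<lambda>i. f (\<kappa> i)) c"
    unfolding lincomb_def using kc coefsD[OF c] f
    by (intro N.M.finsum_cong') (auto simp: l add_hom_def intro!: N.smult_closed)
  finally show ?thesis .
qed

section \<open>Modules over a Noetherian ring\<close>

context left_module begin

text \<open>Induction on the number of generators. In a chain of submodules of \<open>Rx + span X\<close>, the left ideals of
  the coefficients that occur at \<open>x\<close> become constant, and so do the intersections with \<open>span X\<close>; where both
  are constant, so is the chain.\<close>

lemma submodule_chain_stabilizes:
  assumes acc: "acc (\<lambda>I. left_ideal I R)" and X: "finite X" "X \<subseteq> carrier M"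
    and C: "\<And>n. submod R M (C n)" "\<And>n. C n \<subseteq> C (Suc n)" "\<And>n. C n \<subseteq> spn R M X"
  shows "\<exists>N. \<forall>n\<ge>N. C n = C N"
  using X C
proof (induction X arbitrary: C rule: finite_induct)
  case empty
  then have "C n = {\<zero>\<^bsub>M\<^esub>}" for n
    using submodD(2)[OF empty(2)[of n]] empty(4)[of n] unfolding spn_empty by blast
  then show ?case by auto
next
  case (insert x X)
  then have xc: "x \<in> carrier M" and Xc: "X \<subseteq> carrier M" by auto
  note S = spn_submod[OF Xc]
  let ?I = "\<lambda>n. {r \<in> carrier R. \<exists>w\<in>spn R M X. r \<odot>\<^bsub>M\<^esub> x \<oplus>\<^bsub>M\<^esub> w \<in> C n}"
  have "left_ideal (?I n) R" for n
  proof (rule R.left_idealI)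
    show "\<zero>\<^bsub>R\<^esub> \<in> ?I n"
      using xc submodD(2)[OF S] submodD(2)[OF insert(5)[of n]] by (auto intro!: bexI[of _ "\<zero>\<^bsub>M\<^esub>"])
  next
    fix r s assume "r \<in> ?I n" "s \<in> ?I n"
    then obtain w v where *: "r \<in> carrier R" "s \<in> carrier R" "w \<in> spn R M X" "v \<in> spn R M X"
      "r \<odot>\<^bsub>M\<^esub> x \<oplus>\<^bsub>M\<^esub> w \<in> C n" "s \<odot>\<^bsub>M\<^esub> x \<oplus>\<^bsub>M\<^esub> v \<in> C n" by blast
    have "(r \<oplus>\<^bsub>R\<^esub> s) \<odot>\<^bsub>M\<^esub> x \<oplus>\<^bsub>M\<^esub> (w \<oplus>\<^bsub>M\<^esub> v) = (r \<odot>\<^bsub>M\<^esub> x \<oplus>\<^bsub>M\<^esub> w) \<oplus>\<^bsub>M\<^esub> (s \<odot>\<^bsub>M\<^esub> x \<oplus>\<^bsub>M\<^esub> v)"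
      using * xc submodD(1)[OF S] by (simp add: smult_l_distr smult_closed M.a_ac)
    also have "\<dots> \<in> C n" using * submodD(3)[OF insert(5)] by blast
    finally show "r \<oplus>\<^bsub>R\<^esub> s \<in> ?I n" using * submodD(3)[OF S] by blast
  next
    fix s r assume s: "s \<in> carrier R" "r \<in> ?I n"
    then obtain w where *: "r \<in> carrier R" "w \<in> spn R M X" "r \<odot>\<^bsub>M\<^esub> x \<oplus>\<^bsub>M\<^esub> w \<in> C n" by blast
    have "(s \<otimes>\<^bsub>R\<^esub> r) \<odot>\<^bsub>M\<^esub> x \<oplus>\<^bsub>M\<^esub> s \<odot>\<^bsub>M\<^esub> w = s \<odot>\<^bsub>M\<^esub> (r \<odot>\<^bsub>M\<^esub> x \<oplus>\<^bsub>M\<^esub> w)"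
      using * s xc submodD(1)[OF S] by (simp add: smult_r_distr smult_closed smult_assoc)
    also have "\<dots> \<in> C n" using * s submodD(4)[OF insert(5)] by blast
    finally show "s \<otimes>\<^bsub>R\<^esub> r \<in> ?I n" using * s submodD(4)[OF S] by blast
  qed auto
  moreover have "?I n \<subseteq> ?I (Suc n)" for n using insert(6)[of n] by blast
  ultimately obtain N1 where N1: "\<And>n. n \<ge> N1 \<Longrightarrow> ?I n = ?I N1"
    using acc[unfolded acc_def, rule_format, of ?I] by blast
  have "\<exists>N. \<forall>n\<ge>N. C n \<inter> spn R M X = C N \<inter> spn R M X"
  proof (rule insert.IH[OF Xc])
    show "submod R M (C n \<inter> spn R M X)" for n
      using insert(5)[of n] S by (auto simp: submod_def)
  qed (use insert(6) in auto)
  then obtain N2 where N2: "\<And>n. n \<ge> N2 \<Longrightarrow> C n \<inter> spn R M X = C N2 \<inter> spn R M X" by blast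
  have mono: "C m \<subseteq> C n" if "m \<le> n" for m n
    using lift_Suc_mono_le[of C, OF _ that] insert(6) by auto
  let ?N = "max N1 N2"
  have "C n \<subseteq> C ?N" if n: "n \<ge> ?N" for n
  proof
    fix y assume y: "y \<in> C n"
    then have "y \<in> spn R M (insert x X)" using insert(7) by blast
    from spn_insert[OF xc Xc this] obtain r w
      where r: "r \<in> carrier R" and w: "w \<in> spn R M X" and yeq: "y = r \<odot>\<^bsub>M\<^esub> x \<oplus>\<^bsub>M\<^esub> w" by blast
    then have "r \<in> ?I n" using y by blast
    then have "r \<in> ?I ?N" using N1[of n] N1[of ?N] n by simp
    then obtain v where v: "v \<in> spn R M X" "r \<odot>\<^bsub>M\<^esub> x \<oplus>\<^bsub>M\<^esub> v \<in> C ?N" by blast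
    have rx: "r \<odot>\<^bsub>M\<^esub> x \<in> carrier M" "w \<in> carrier M" "v \<in> carrier M"
      using smult_closed r xc w v submodD(1)[OF S] by auto
    have "w \<ominus>\<^bsub>M\<^esub> v = y \<ominus>\<^bsub>M\<^esub> (r \<odot>\<^bsub>M\<^esub> x \<oplus>\<^bsub>M\<^esub> v)"
      unfolding yeq using rx by algebra
    also have "\<dots> \<in> C n"
      using y v(2) mono[OF n] submod_minus[OF insert(5)] by blast
    finally have "w \<ominus>\<^bsub>M\<^esub> v \<in> C n \<inter> spn R M X" using submod_minus[OF S] w v by blast
    then have "w \<ominus>\<^bsub>M\<^esub> v \<in> C ?N" using N2[of n] N2[of ?N] n by auto
    then have "(w \<ominus>\<^bsub>M\<^esub> v) \<oplus>\<^bsub>M\<^esub> (r \<odot>\<^bsub>M\<^esub> x \<oplus>\<^bsub>M\<^esub> v) \<in> C ?N"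
      using v(2) submodD(3)[OF insert(5)] by blast
    moreover have "(w \<ominus>\<^bsub>M\<^esub> v) \<oplus>\<^bsub>M\<^esub> (r \<odot>\<^bsub>M\<^esub> x \<oplus>\<^bsub>M\<^esub> v) = y"
      unfolding yeq using rx by algebra
    ultimately show "y \<in> C ?N" by simp
  qed
  then have "\<forall>n\<ge>?N. C n = C ?N" using mono by blast
  then show ?case by blast
qed

text \<open>Otherwise elements of \<open>T\<close> can be chosen one after the other outside the span of the earlier ones, and
  these spans would form a chain that never becomes constant.\<close>

lemma finitely_spanned_subset:
  assumes acc: "acc (\<lambda>I. left_ideal I R)" and X: "finite X" "X \<subseteq> carrier M" and T: "T \<subseteq> spn R M X"
  shows "\<exists>T'. finite T' \<and> T' \<subseteq> T \<and> T \<subseteq> spn R M T'"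
proof (rule ccontr)
  assume n: "\<not> ?thesis"
  have TM: "T \<subseteq> carrier M" using T submodD(1)[OF spn_submod[OF X(2)]] by blast
  have "\<forall>F. \<exists>t. finite F \<and> F \<subseteq> T \<longrightarrow> t \<in> T \<and> t \<notin> spn R M F" using n by blast
  then obtain t where t: "\<And>F. \<lbrakk>finite F; F \<subseteq> T\<rbrakk> \<Longrightarrow> t F \<in> T \<and> t F \<notin> spn R M F" by metis
  define F where "F = rec_nat {} (\<lambda>_ F. insert (t F) F)"
  have F_simps: "F 0 = {}" "F (Suc n) = insert (t (F n)) (F n)" for n by (simp_all add: F_def)
  have F: "finite (F n) \<and> F n \<subseteq> T" for n
    by (induction n) (use t in \<open>auto simp: F_simps\<close>)
  have FM: "F n \<subseteq> carrier M" for n using F TM by blast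
  have "\<exists>N. \<forall>n\<ge>N. spn R M (F n) = spn R M (F N)"
  proof (rule submodule_chain_stabilizes[OF acc X])
    show "submod R M (spn R M (F n))" for n by (rule spn_submod[OF FM])
    show "spn R M (F n) \<subseteq> spn R M (F (Suc n))" for n by (rule spn_mono) (auto simp: F_simps)
    show "spn R M (F n) \<subseteq> spn R M X" for n
      by (rule spn_least[OF spn_submod[OF X(2)]]) (use F T in blast)
  qed
  then obtain N where "spn R M (F (Suc N)) = spn R M (F N)" by (metis le_SucI order_refl)
  moreover have "t (F N) \<in> spn R M (F (Suc N))"
    by (rule spn_incl[OF FM]) (simp add: F_simps)
  ultimately show False using t F by metis
qed

end

section \<open>Graded modules and their homomorphisms\<close>

abbreviation mpart :: "('r, 'm, 'y) graded_module_scheme \<Rightarrow> int \<Rightarrow> 'm \<Rightarrow> 'm"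
  where "mpart M \<equiv> dpart M (grade M)"

definition gsub :: "('r, 'x) graded_ring_scheme \<Rightarrow> ('r, 'm, 'y) graded_module_scheme \<Rightarrow> 'm set \<Rightarrow> bool"
  where "gsub R M N \<longleftrightarrow> submod R M N \<and> (\<forall>x\<in>N. \<forall>j. mpart M j x \<in> N)"

lemma gsubD:
  assumes "gsub R M N"
  shows "submod R M N" "x \<in> N \<Longrightarrow> mpart M j x \<in> N"
  using assms by (auto simp: gsub_def)

lemma graded_homD:
  assumes "f \<in> graded_hom R M N"
  shows "f \<in> add_hom M N" "x \<in> carrier M \<Longrightarrow> f x \<in> carrier N"
    "\<lbrakk>x \<in> carrier M; y \<in> carrier M\<rbrakk> \<Longrightarrow> f (x \<oplus>\<^bsub>M\<^esub> y) = f x \<oplus>\<^bsub>N\<^esub> f y"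
    "\<lbrakk>r \<in> carrier R; x \<in> carrier M\<rbrakk> \<Longrightarrow> f (r \<odot>\<^bsub>M\<^esub> x) = r \<odot>\<^bsub>N\<^esub> f x"
    "x \<in> grade M j \<Longrightarrow> f x \<in> grade N j"
  using assms by (auto simp: graded_hom_def add_hom_def image_subset_iff)

lemma graded_homI:
  assumes "\<And>x. x \<in> carrier M \<Longrightarrow> f x \<in> carrier N"
    "\<And>x y. \<lbrakk>x \<in> carrier M; y \<in> carrier M\<rbrakk> \<Longrightarrow> f (x \<oplus>\<^bsub>M\<^esub> y) = f x \<oplus>\<^bsub>N\<^esub> f y"
    "\<And>r x. \<lbrakk>r \<in> carrier R; x \<in> carrier M\<rbrakk> \<Longrightarrow> f (r \<odot>\<^bsub>M\<^esub> x) = r \<odot>\<^bsub>N\<^esub> f x"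
    "\<And>x j. x \<in> grade M j \<Longrightarrow> f x \<in> grade N j"
  shows "f \<in> graded_hom R M N"
  using assms by (auto simp: graded_hom_def)

context graded_module begin

sublocale md: dsum M "grade M"
  by (intro dsum.intro dsum_axioms.intro M.abelian_group_axioms module_direct_sum)

lemma smult_rgr:
  assumes "a \<in> rgr R i" "x \<in> grade M j"
  shows "a \<odot>\<^bsub>M\<^esub> x \<in> grade M (i + j)"
proof (cases "i < 0")
  case True
  then show ?thesis using assms rgr_neg_zero[of i a] md.G_in_carrier md.G_zero by auto
next
  case False
  then show ?thesis using assms smult_degree[of a "nat i" x j] by (auto simp: rgr_def)
qed

lemma mpart_smult:
  assumes "a \<in> rgr R k" "x \<in> carrier M"
  shows "mpart M (k + n) (a \<odot>\<^bsub>M\<^esub> x) = a \<odot>\<^bsub>M\<^esub> mpart M n x"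
proof (rule dpart_hom[of M "grade M" M "grade M" "\<lambda>x. a \<odot>\<^bsub>M\<^esub> x" "\<lambda>n. k + n"])
  show "(\<lambda>x. a \<odot>\<^bsub>M\<^esub> x) \<in> add_hom M M"
    using rd.G_in_carrier[OF assms(1)] by (rule smult_add_hom)
qed (use assms smult_rgr md.dsum_axioms in \<open>auto simp: inj_on_def\<close>)

lemma mpart_smult':
  assumes "a \<in> rgr R k" "x \<in> carrier M"
  shows "mpart M n (a \<odot>\<^bsub>M\<^esub> x) = a \<odot>\<^bsub>M\<^esub> mpart M (n - k) x"
  using mpart_smult[OF assms, of "n - k"] by simp

lemma mpart_smult_grade:
  assumes "a \<in> carrier R" "x \<in> grade M k"
  shows "mpart M n (a \<odot>\<^bsub>M\<^esub> x) = rpart R (n - k) a \<odot>\<^bsub>M\<^esub> x"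
proof -
  have "mpart M (n - k + k) (a \<odot>\<^bsub>M\<^esub> x) = rpart R (n - k) a \<odot>\<^bsub>M\<^esub> x"
    by (rule dpart_hom[where f = "\<lambda>a. a \<odot>\<^bsub>M\<^esub> x" and s = "\<lambda>n. n + k"])
      (use assms smult_rgr md.dsum_axioms rd.dsum_axioms md.G_in_carrier in
        \<open>auto simp: inj_on_def intro!: smult_add_hom'\<close>)
  then show ?thesis by simp
qed

lemma mpart_smult_sum:
  assumes r: "r \<in> carrier R" and x: "x \<in> carrier M"
  shows "mpart M n (r \<odot>\<^bsub>M\<^esub> x) =
    (\<Oplus>\<^bsub>M\<^esub>k\<in>{k. rpart R k r \<noteq> \<zero>\<^bsub>R\<^esub>}. rpart R k r \<odot>\<^bsub>M\<^esub> mpart M (n - k) x)"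
proof -
  let ?A = "{k. rpart R k r \<noteq> \<zero>\<^bsub>R\<^esub>}"
  have rc: "rpart R k r \<in> carrier R" for k using rd.dpart_carrier[OF r] .
  have "r \<odot>\<^bsub>M\<^esub> x = finsum R (\<lambda>k. rpart R k r) ?A \<odot>\<^bsub>M\<^esub> x" using rd.dpart_sum[OF r] by simp
  also have "\<dots> = (\<Oplus>\<^bsub>M\<^esub>k\<in>?A. rpart R k r \<odot>\<^bsub>M\<^esub> x)"
    by (rule add_hom_finsum[OF R.abelian_group_axioms M.abelian_group_axioms smult_add_hom'[OF x]]) (use rc in auto)
  finally have "mpart M n (r \<odot>\<^bsub>M\<^esub> x) = (\<Oplus>\<^bsub>M\<^esub>k\<in>?A. mpart M n (rpart R k r \<odot>\<^bsub>M\<^esub> x))"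
    using add_hom_finsum[OF M.abelian_group_axioms M.abelian_group_axioms md.dpart_add_hom[of n],
        of "\<lambda>k. rpart R k r \<odot>\<^bsub>M\<^esub> x" ?A] rc x by (simp add: smult_closed)
  then show ?thesis using mpart_smult'[OF rd.dpart_in[OF r] x] by simp
qed

lemma gsubI:
  assumes "\<And>x. x \<in> N \<Longrightarrow> x \<in> carrier M" "\<zero>\<^bsub>M\<^esub> \<in> N" "\<And>x y. \<lbrakk>x \<in> N; y \<in> N\<rbrakk> \<Longrightarrow> x \<oplus>\<^bsub>M\<^esub> y \<in> N"
    "\<And>r x. \<lbrakk>r \<in> carrier R; x \<in> N\<rbrakk> \<Longrightarrow> r \<odot>\<^bsub>M\<^esub> x \<in> N" "\<And>x j. x \<in> N \<Longrightarrow> mpart M j x \<in> N"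
  shows "gsub R M N"
  unfolding gsub_def using assms by (intro conjI submodI) auto

lemma gsub_carrier: "gsub R M (carrier M)"
  by (rule gsubI) (auto simp: smult_closed md.dpart_carrier)

lemma gsub_zero: "gsub R M {\<zero>\<^bsub>M\<^esub>}"
  by (rule gsubI) (auto simp: md.dpart_zero)

end

lemmas graded_module_left = graded_module.axioms(2)

lemma graded_module_abelian: "graded_module R M \<Longrightarrow> abelian_group M"
  by (rule left_module.axioms(2)[OF graded_module_left])

lemma graded_module_dsum: "graded_module R M \<Longrightarrow> dsum M (grade M)"
  by (intro dsum.intro dsum_axioms.intro graded_module_abelian graded_module.module_direct_sum)

lemma graded_hom_mpart:
  assumes "graded_module R M" "graded_module R N" "f \<in> graded_hom R M N" "x \<in> carrier M"
  shows "mpart N j (f x) = f (mpart M j x)"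
  by (rule dpart_hom[OF graded_module_dsum[OF assms(1)] graded_module_dsum[OF assms(2)], of f "\<lambda>j. j"])
    (use graded_homD[OF assms(3)] assms(4) in auto)

lemma graded_hom_zero:
  "\<lbrakk>graded_module R M; graded_module R N; f \<in> graded_hom R M N\<rbrakk> \<Longrightarrow> f \<zero>\<^bsub>M\<^esub> = \<zero>\<^bsub>N\<^esub>"
  by (rule add_hom_zero[OF graded_module_abelian graded_module_abelian graded_homD(1)])

lemma graded_hom_neg:
  "\<lbrakk>graded_module R M; graded_module R N; f \<in> graded_hom R M N; x \<in> carrier M\<rbrakk>
    \<Longrightarrow> f (\<ominus>\<^bsub>M\<^esub> x) = \<ominus>\<^bsub>N\<^esub> f x"
  by (rule add_hom_neg[OF graded_module_abelian graded_module_abelian graded_homD(1)])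

lemma graded_hom_minus:
  "\<lbrakk>graded_module R M; graded_module R N; f \<in> graded_hom R M N; x \<in> carrier M; y \<in> carrier M\<rbrakk>
    \<Longrightarrow> f (x \<ominus>\<^bsub>M\<^esub> y) = f x \<ominus>\<^bsub>N\<^esub> f y"
  by (rule add_hom_minus[OF graded_module_abelian graded_module_abelian graded_homD(1)])

lemma graded_hom_lincomb:
  assumes "graded_module R M" "graded_module R N" "f \<in> graded_hom R M N"
    "c \<in> coefs R I" "\<kappa> \<in> I \<rightarrow> carrier M"
  shows "f (lincomb R M \<kappa> c) = lincomb R N (\<lambda>i. f (\<kappa> i)) c"
  by (rule hom_lincomb) (use assms graded_module_left graded_homD[OF assms(3)] in auto)

lemma graded_hom_comp:
  "\<lbrakk>f \<in> graded_hom R M N; g \<in> graded_hom R N K\<rbrakk> \<Longrightarrow> (\<lambda>x. g (f x)) \<in> graded_hom R M K"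
  by (rule graded_homI) (auto simp: graded_homD)

lemma graded_hom_id: "(\<lambda>x. x) \<in> graded_hom R M M"
  by (rule graded_homI) auto

lemma graded_hom_add:
  assumes N: "graded_module R N" and f: "f \<in> graded_hom R M N" and g: "g \<in> graded_hom R M N"
  shows "(\<lambda>x. f x \<oplus>\<^bsub>N\<^esub> g x) \<in> graded_hom R M N"
proof -
  interpret N: graded_module R N by fact
  note F = graded_homD[OF f] and G = graded_homD[OF g]
  show ?thesis
    by (rule graded_homI) (auto simp: F G N.smult_r_distr N.md.G_add N.M.a_ac)
qed

lemma graded_hom_uminus:
  assumes N: "graded_module R N" and f: "f \<in> graded_hom R M N"
  shows "(\<lambda>x. \<ominus>\<^bsub>N\<^esub> f x) \<in> graded_hom R M N"
proof -
  interpret N: graded_module R N by fact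
  note F = graded_homD[OF f]
  show ?thesis
    by (rule graded_homI) (auto simp: F N.smult_r_neg N.md.G_neg N.M.minus_add)
qed

lemma graded_hom_diff:
  assumes N: "graded_module R N" and f: "f \<in> graded_hom R M N" and g: "g \<in> graded_hom R M N"
  shows "(\<lambda>x. f x \<ominus>\<^bsub>N\<^esub> g x) \<in> graded_hom R M N"
  using graded_hom_add[OF N f graded_hom_uminus[OF N g]] by (simp add: a_minus_def)

lemma graded_hom_kernel:
  assumes M: "graded_module R M" and N: "graded_module R N" and f: "f \<in> graded_hom R M N"
  shows "gsub R M {x \<in> carrier M. f x = \<zero>\<^bsub>N\<^esub>}"
proof -
  interpret M: graded_module R M by fact
  interpret N: graded_module R N by fact
  note F = graded_homD[OF f]
  show ?thesis
    by (rule M.gsubI)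
      (auto simp: F graded_hom_zero[OF assms] M.smult_closed M.md.dpart_carrier N.md.dpart_zero
        graded_hom_mpart[OF assms, symmetric])
qed

text \<open>Two maps that agree on a set of generators agree everywhere, because the elements on which they agree
  form a submodule.\<close>

lemma graded_hom_equalizer:
  assumes M: "graded_module R M" and N: "graded_module R N" and f: "f \<in> graded_hom R M N" and g: "g \<in> graded_hom R M N"
  shows "submod R M {x \<in> carrier M. f x = g x}"
proof -
  interpret M: graded_module R M by fact
  show ?thesis
    using graded_homD[OF f] graded_homD[OF g] graded_hom_zero[OF M N f] graded_hom_zero[OF M N g] M.smult_closed
    by (intro submodI) auto
qed

lemma graded_hom_image:
  assumes M: "graded_module R M" and N: "graded_module R N" and f: "f \<in> graded_hom R M N"
    and K: "gsub R M K"
  shows "gsub R N (f ` K)"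
proof -
  interpret M: graded_module R M by fact
  interpret N: graded_module R N by fact
  note F = graded_homD[OF f] and K' = gsubD[OF K]
  note K'' = submodD[OF K'(1)]
  show ?thesis
  proof (rule N.gsubI)
    show "\<zero>\<^bsub>N\<^esub> \<in> f ` K" using graded_hom_zero[OF assms(1-3)] K''(2) by (metis imageI)
  next
    fix x y assume "x \<in> f ` K" "y \<in> f ` K"
    then show "x \<oplus>\<^bsub>N\<^esub> y \<in> f ` K" using F(3)[symmetric] K'' by auto
  next
    fix r x assume "r \<in> carrier R" "x \<in> f ` K"
    then show "r \<odot>\<^bsub>N\<^esub> x \<in> f ` K" using F(4)[symmetric] K'' by auto
  next
    fix x j assume "x \<in> f ` K"
    then show "mpart N j x \<in> f ` K" using graded_hom_mpart[OF assms(1-3)] K'' K' by auto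
  qed (use F K'' in auto)
qed

text \<open>The component of the right degree of any preimage is a preimage.\<close>

lemma homogeneous_preimage:
  assumes M: "graded_module R M" and N: "graded_module R N" and f: "f \<in> graded_hom R M N"
    and z: "z \<in> grade N j" "z \<in> f ` carrier M"
  shows "\<exists>y\<in>grade M j. f y = z"
proof -
  interpret M: graded_module R M by fact
  interpret N: graded_module R N by fact
  obtain y where y: "y \<in> carrier M" "z = f y" using z(2) by blast
  have "f (mpart M j y) = mpart N j z" using graded_hom_mpart[OF M N f y(1)] y(2) by simp
  then show ?thesis using N.md.dpart_homog[OF z(1), of j] M.md.dpart_in[OF y(1), of j] by auto
qed

subsection \<open>Twists and submodules\<close>

lemma twist_simps [simp]:
  "carrier (twist M a) = carrier M" "zero (twist M a) = zero M" "add (twist M a) = add M"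
  "smult (twist M a) = smult M" "grade (twist M a) j = grade M (a + j)" "a_inv (twist M a) = a_inv M"
  "a_minus (twist M a) = a_minus M"
  by (auto simp: twist_def a_inv_def a_minus_def fun_eq_iff)

lemma finsum_twist [simp]: "finsum (twist M a) = finsum M"
  by (simp add: finsum_def fun_eq_iff)

lemma lincomb_twist [simp]: "lincomb R (twist M a) = lincomb R M"
  by (simp add: lincomb_def fun_eq_iff)

lemma twist_twist [simp]: "twist (twist M a) b = twist M (a + b)"
  by (simp add: twist_def add.assoc)

lemma twist_0 [simp]: "twist M 0 = M"
  by (simp add: twist_def)

lemma graded_hom_twist: "f \<in> graded_hom R M N \<Longrightarrow> f \<in> graded_hom R (twist M a) (twist N a)"
  by (auto simp: graded_hom_def)

lemma graded_hom_twist_comp: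
  "\<lbrakk>f \<in> graded_hom R M (twist N a); g \<in> graded_hom R N (twist K b)\<rbrakk>
    \<Longrightarrow> (\<lambda>x. g (f x)) \<in> graded_hom R M (twist K (a + b))"
  using graded_hom_comp[OF _ graded_hom_twist, of f R M N a g "twist K b"] by (simp add: add.commute)

lemma graded_moduleI:
  assumes "graded_ring R" "abelian_group M"
    "\<And>a x. \<lbrakk>a \<in> carrier R; x \<in> carrier M\<rbrakk> \<Longrightarrow> a \<odot>\<^bsub>M\<^esub> x \<in> carrier M"
    "\<And>a b x. \<lbrakk>a \<in> carrier R; b \<in> carrier R; x \<in> carrier M\<rbrakk> \<Longrightarrow> (a \<oplus>\<^bsub>R\<^esub> b) \<odot>\<^bsub>M\<^esub> x = a \<odot>\<^bsub>M\<^esub> x \<oplus>\<^bsub>M\<^esub> b \<odot>\<^bsub>M\<^esub> x"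
    "\<And>a x y. \<lbrakk>a \<in> carrier R; x \<in> carrier M; y \<in> carrier M\<rbrakk> \<Longrightarrow> a \<odot>\<^bsub>M\<^esub> (x \<oplus>\<^bsub>M\<^esub> y) = a \<odot>\<^bsub>M\<^esub> x \<oplus>\<^bsub>M\<^esub> a \<odot>\<^bsub>M\<^esub> y"
    "\<And>a b x. \<lbrakk>a \<in> carrier R; b \<in> carrier R; x \<in> carrier M\<rbrakk> \<Longrightarrow> (a \<otimes>\<^bsub>R\<^esub> b) \<odot>\<^bsub>M\<^esub> x = a \<odot>\<^bsub>M\<^esub> (b \<odot>\<^bsub>M\<^esub> x)"
    "\<And>x. x \<in> carrier M \<Longrightarrow> \<one>\<^bsub>R\<^esub> \<odot>\<^bsub>M\<^esub> x = x"
    "is_direct_sum M (grade M)"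
    "\<And>a x i j. \<lbrakk>a \<in> rgrade R i; x \<in> grade M j\<rbrakk> \<Longrightarrow> a \<odot>\<^bsub>M\<^esub> x \<in> grade M (int i + j)"
  shows "graded_module R M"
  using assms
  by (simp add: graded_module_def left_module_def graded_module_axioms_def left_module_axioms_def graded_ring_def)

lemma left_module_smult_facts:
  assumes "graded_module R M"
  shows "\<lbrakk>a \<in> carrier R; x \<in> carrier M\<rbrakk> \<Longrightarrow> a \<odot>\<^bsub>M\<^esub> x \<in> carrier M"
    "\<lbrakk>a \<in> carrier R; b \<in> carrier R; x \<in> carrier M\<rbrakk> \<Longrightarrow> (a \<oplus>\<^bsub>R\<^esub> b) \<odot>\<^bsub>M\<^esub> x = a \<odot>\<^bsub>M\<^esub> x \<oplus>\<^bsub>M\<^esub> b \<odot>\<^bsub>M\<^esub> x"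
    "\<lbrakk>a \<in> carrier R; x \<in> carrier M; y \<in> carrier M\<rbrakk> \<Longrightarrow> a \<odot>\<^bsub>M\<^esub> (x \<oplus>\<^bsub>M\<^esub> y) = a \<odot>\<^bsub>M\<^esub> x \<oplus>\<^bsub>M\<^esub> a \<odot>\<^bsub>M\<^esub> y"
    "\<lbrakk>a \<in> carrier R; b \<in> carrier R; x \<in> carrier M\<rbrakk> \<Longrightarrow> (a \<otimes>\<^bsub>R\<^esub> b) \<odot>\<^bsub>M\<^esub> x = a \<odot>\<^bsub>M\<^esub> (b \<odot>\<^bsub>M\<^esub> x)"
    "x \<in> carrier M \<Longrightarrow> \<one>\<^bsub>R\<^esub> \<odot>\<^bsub>M\<^esub> x = x"
    "graded_ring R"
  using assms by (simp_all add: graded_module_def left_module_def left_module_axioms_def)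

lemma twist_abelian:
  assumes "abelian_group M" shows "abelian_group (twist M a)"
proof -
  interpret M: abelian_group M by fact
  show ?thesis by (rule abelian_groupI) (auto simp: M.a_ac intro!: bexI[of _ "\<ominus>\<^bsub>M\<^esub> x" for x] M.l_neg)
qed

lemma twist_graded_module:
  assumes "graded_module R M" shows "graded_module R (twist M a)"
proof -
  interpret M: graded_module R M by fact
  interpret T: abelian_group "twist M a" by (rule twist_abelian[OF M.M.abelian_group_axioms])
  have sub: "additive_subgroup (grade (twist M a) i) (twist M a)" for i
    by (rule T.additive_subgroupI') (auto simp: M.md.G_in_carrier M.md.G_zero M.md.G_add M.md.G_neg)
  have "is_direct_sum (twist M a) (grade (twist M a))"
  proof (rule T.direct_sumI(1)[OF sub, of "\<lambda>i. mpart M (a + i)"])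
    fix i show "mpart M (a + i) \<in> add_hom (twist M a) (twist M a)"
      using M.md.dpart_add_hom[of "a + i"] by (simp add: add_hom_def)
  next
    fix i j x assume "x \<in> grade (twist M a) i"
    then show "mpart M (a + j) x = (if j = i then x else \<zero>\<^bsub>twist M a\<^esub>)"
      using M.md.dpart_homog[of x "a + i"] by simp
  next
    fix x assume x: "x \<in> carrier (twist M a)"
    let ?A = "{i. mpart M i x \<noteq> \<zero>\<^bsub>M\<^esub>}"
    let ?B = "(\<lambda>i. i - a) ` ?A"
    have "finsum M (\<lambda>i. mpart M (a + i) x) ?B = finsum M (\<lambda>i. mpart M (a + (i - a)) x) ?A"
      by (rule M.M.finsum_reindex) (use x M.md.dpart_carrier in \<open>auto simp: inj_on_def\<close>)
    also have "\<dots> = x" using M.md.dpart_sum x by simp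
    finally have "x = finsum M (\<lambda>i. mpart M (a + i) x) ?B" by simp
    moreover have "finite ?B" using M.md.dpart_finite x by simp
    moreover have "mpart M (a + i) x = \<zero>\<^bsub>M\<^esub>" if "i \<notin> ?B" for i
      using that by (force simp: image_iff)
    ultimately show "\<exists>A. finite A \<and> (\<forall>i. i \<notin> A \<longrightarrow> mpart M (a + i) x = \<zero>\<^bsub>twist M a\<^esub>) \<and>
        x = (\<Oplus>\<^bsub>twist M a\<^esub>i\<in>A. mpart M (a + i) x)"
      by (intro exI[of _ ?B]) auto
  qed (auto simp: M.md.dpart_in)
  then show ?thesis
    using left_module_smult_facts[OF assms] M.smult_degree
    by (intro graded_moduleI T.abelian_group_axioms)
      (auto simp: add.left_commute[of a] simp del: of_nat_add)
qed

lemma twist_mpart: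
  assumes "graded_module R M" "x \<in> carrier M"
  shows "mpart (twist M a) j x = mpart M (a + j) x"
proof -
  interpret M: graded_module R M by fact
  have "(\<lambda>x. x) \<in> add_hom (twist M a) M" by (simp add: add_hom_def)
  from dpart_hom[OF graded_module_dsum[OF twist_graded_module[OF assms(1)], of a] M.md.dsum_axioms this, of "\<lambda>j. a + j" x j]
  show ?thesis using assms(2) by (simp add: inj_on_def)
qed

lemma restrict_module_simps [simp]:
  "carrier (restrict_module M S) = S" "zero (restrict_module M S) = zero M"
  "add (restrict_module M S) = add M" "smult (restrict_module M S) = smult M"
  "grade (restrict_module M S) j = S \<inter> grade M j"
  by (auto simp: restrict_module_def)

lemma restrict_restrict: "T \<subseteq> S \<Longrightarrow> restrict_module (restrict_module M S) T = restrict_module M T"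
  by (auto simp: restrict_module_def Int_assoc[symmetric] Int_absorb2)

lemma restrict_abelian:
  assumes "left_module R M" "submod R M S"
  shows "abelian_group (restrict_module M S)"
proof (rule abelian_groupI)
  interpret M: left_module R M by fact
  note submod_neg = M.submod_neg and assms = assms(2)
  fix x assume x: "x \<in> carrier (restrict_module M S)"
  then show "\<exists>y\<in>carrier (restrict_module M S). y \<oplus>\<^bsub>restrict_module M S\<^esub> x = \<zero>\<^bsub>restrict_module M S\<^esub>"
    using submod_neg[OF assms, of x] M.M.l_neg[of x] submodD[OF assms] by auto
next
  interpret M: left_module R M by fact
  fix x y z
  assume "x \<in> carrier (restrict_module M S)" "y \<in> carrier (restrict_module M S)"
    "z \<in> carrier (restrict_module M S)"
  then show "x \<oplus>\<^bsub>restrict_module M S\<^esub> y \<oplus>\<^bsub>restrict_module M S\<^esub> z =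
      x \<oplus>\<^bsub>restrict_module M S\<^esub> (y \<oplus>\<^bsub>restrict_module M S\<^esub> z)"
    using submodD(1)[OF assms(2)] by (simp add: M.M.a_assoc)
next
  interpret M: left_module R M by fact
  fix x y
  assume "x \<in> carrier (restrict_module M S)" "y \<in> carrier (restrict_module M S)"
  then show "x \<oplus>\<^bsub>restrict_module M S\<^esub> y = y \<oplus>\<^bsub>restrict_module M S\<^esub> x"
    using submodD(1)[OF assms(2)] by (simp add: M.M.a_comm)
next
  interpret M: left_module R M by fact
  fix x assume "x \<in> carrier (restrict_module M S)"
  then show "\<zero>\<^bsub>restrict_module M S\<^esub> \<oplus>\<^bsub>restrict_module M S\<^esub> x = x"
    using submodD(1)[OF assms(2)] by simp
qed (use submodD[OF assms(2)] in auto)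

lemma restrict_finsum:
  assumes "abelian_group M" "abelian_group (restrict_module M S)" "S \<subseteq> carrier M" "f \<in> A \<rightarrow> S"
  shows "finsum (restrict_module M S) f A = finsum M f A"
proof -
  let ?N = "restrict_module M S"
  have "(\<lambda>x. x) \<in> add_hom ?N M" using assms by (auto simp: add_hom_def)
  from add_hom_finsum[OF assms(2,1) this] assms(4) show ?thesis by simp
qed

lemma restrict_lincomb:
  assumes "left_module R M" "submod R M S" "c \<in> coefs R I" "\<kappa> \<in> I \<rightarrow> S"
  shows "lincomb R (restrict_module M S) \<kappa> c = lincomb R M \<kappa> c"
proof -
  interpret M: left_module R M by fact
  have "c i \<odot>\<^bsub>M\<^esub> \<kappa> i \<in> S" if "c i \<noteq> \<zero>\<^bsub>R\<^esub>" for i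
  proof -
    have "i \<in> I" using coefsD(2)[OF assms(3)] that by auto
    then show ?thesis using submodD(4)[OF assms(2) coefsD(1)[OF assms(3)]] assms(4) by auto
  qed
  then show ?thesis
    unfolding lincomb_def restrict_module_simps
    by (intro restrict_finsum M.M.abelian_group_axioms restrict_abelian[OF assms(1)] assms(2))
      (use submodD(1)[OF assms(2)] in auto)
qed

lemma restrict_graded_module:
  assumes "graded_module R M" "gsub R M S"
  shows "graded_module R (restrict_module M S)"
    "x \<in> S \<Longrightarrow> mpart (restrict_module M S) j x = mpart M j x"
proof -
  let ?N = "restrict_module M S"
  interpret M: graded_module R M by fact
  note S = gsubD[OF assms(2)] and S' = submodD[OF gsubD(1)[OF assms(2)]]
  have ab: "abelian_group ?N" by (rule restrict_abelian[OF M.left_module_axioms S(1)])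
  interpret T: abelian_group "?N" by fact
  have neg: "\<ominus>\<^bsub>?N\<^esub> x = \<ominus>\<^bsub>M\<^esub> x" if "x \<in> S" for x
    using add_hom_neg[OF ab M.M.abelian_group_axioms, of "\<lambda>x. x" x] that S' by (auto simp: add_hom_def)
  have sub: "additive_subgroup (grade ?N i) ?N" for i
    by (rule T.additive_subgroupI')
      (use neg S' M.submod_neg[OF S(1)] in \<open>auto simp: M.md.G_zero M.md.G_add M.md.G_neg\<close>)
  have fin: "\<exists>A. finite A \<and> (\<forall>i. i \<notin> A \<longrightarrow> mpart M i x = \<zero>\<^bsub>?N\<^esub>) \<and>
        x = (\<Oplus>\<^bsub>?N\<^esub>i\<in>A. mpart M i x)" if x: "x \<in> carrier ?N" for x
  proof (intro exI[of _ "{i. mpart M i x \<noteq> \<zero>\<^bsub>M\<^esub>}"] conjI)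
    have xM: "x \<in> carrier M" using x S' by auto
    show "finite {i. mpart M i x \<noteq> \<zero>\<^bsub>M\<^esub>}" by (rule M.md.dpart_finite[OF xM])
    have "(\<Oplus>\<^bsub>?N\<^esub>i\<in>{i. mpart M i x \<noteq> \<zero>\<^bsub>M\<^esub>}. mpart M i x)
      = (\<Oplus>\<^bsub>M\<^esub>i\<in>{i. mpart M i x \<noteq> \<zero>\<^bsub>M\<^esub>}. mpart M i x)"
      by (rule restrict_finsum[OF M.M.abelian_group_axioms ab]) (use x S S' in auto)
    then show "x = (\<Oplus>\<^bsub>?N\<^esub>i\<in>{i. mpart M i x \<noteq> \<zero>\<^bsub>M\<^esub>}. mpart M i x)"
      using M.md.dpart_sum[OF xM] by simp
  qed auto
  have p1: "mpart M i \<in> add_hom ?N ?N" for i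
    using S S' by (auto simp: add_hom_def M.md.dpart_add)
  have p2: "mpart M i x \<in> grade ?N i" if "x \<in> carrier ?N" for i x
    using that S S' M.md.dpart_in by auto
  have p3: "mpart M j x = (if j = i then x else \<zero>\<^bsub>?N\<^esub>)"
    if "x \<in> grade ?N i" for i j x
    using that M.md.dpart_homog[of x i] by simp
  note D = T.direct_sumI[OF sub p1 p2 p3 fin]
  show "graded_module R ?N"
  proof (intro graded_moduleI ab D(1))
    fix a x i j assume "a \<in> rgrade R i" "x \<in> grade ?N j"
    then show "a \<odot>\<^bsub>?N\<^esub> x \<in> grade ?N (int i + j)"
      using M.smult_degree[of a i x j] S'(4)[of a x] M.rd.G_in_carrier[of a "int i"] by (simp add: rgr_def)
  qed (use left_module_smult_facts[OF assms(1)] S' in auto)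
  show "x \<in> S \<Longrightarrow> mpart ?N j x = mpart M j x"
  proof -
    assume "x \<in> S"
    then show ?thesis by (intro D(3)) auto
  qed
qed

section \<open>Bases and free modules\<close>

definition coord ::
    "('r, 'x) graded_ring_scheme \<Rightarrow> ('r, 'm, 'y) graded_module_scheme \<Rightarrow> 'm set \<Rightarrow> 'm \<Rightarrow> 'm \<Rightarrow> 'r"
  where "coord R M B x = (THE c. c \<in> coefs R B \<and> x = lincomb R M (\<lambda>x. x) c)"

text \<open>The degree of a homogeneous element. It is determined by the element unless the element is zero.\<close>

definition hdeg :: "('r, 'm, 'y) graded_module_scheme \<Rightarrow> 'm \<Rightarrow> int"
  where "hdeg M b = (SOME j. b \<in> grade M j)"

lemma (in graded_ring) homogeneous_basis_alt:
  "homogeneous_basis R M B \<longleftrightarrow> B \<subseteq> (\<Union>j. grade M j) \<and>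
    (\<forall>x\<in>carrier M. \<exists>!c. c \<in> coefs R B \<and> x = lincomb R M (\<lambda>x. x) c)"
proof -
  have "c \<in> B \<rightarrow> carrier R \<and> (\<forall>b. b \<notin> B \<longrightarrow> c b = \<zero>) \<and> finite {b. c b \<noteq> \<zero>} \<and>
      x = (\<Oplus>\<^bsub>M\<^esub>b\<in>{b. c b \<noteq> \<zero>}. c b \<odot>\<^bsub>M\<^esub> b) \<longleftrightarrow> c \<in> coefs R B \<and> x = lincomb R M (\<lambda>x. x) c" for c x
    unfolding coefs_def lincomb_def Pi_iff by (auto; metis zero_closed)
  then show ?thesis unfolding homogeneous_basis_def by simp
qed

lemma (in graded_module) mpart_lincomb:
  assumes c: "c \<in> coefs R I" and k: "\<And>i. i \<in> I \<Longrightarrow> \<kappa> i \<in> grade M (d i)"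
  shows "(\<lambda>i. rpart R (j - d i) (c i)) \<in> coefs R I"
    "mpart M j (lincomb R M \<kappa> c) = lincomb R M \<kappa> (\<lambda>i. rpart R (j - d i) (c i))"
proof -
  note C = coefsD[OF c]
  let ?A = "{i. c i \<noteq> \<zero>\<^bsub>R\<^esub>}" and ?c = "\<lambda>i. rpart R (j - d i) (c i)"
  have kc: "\<kappa> i \<in> carrier M" if "i \<in> I" for i using k[OF that] md.G_in_carrier by blast
  show cc: "?c \<in> coefs R I"
    using C by (auto simp: coefs_def rd.dpart_carrier rd.dpart_zero intro: finite_subset[of _ ?A])
  have "mpart M j (lincomb R M \<kappa> c) = finsum M (\<lambda>i. mpart M j (c i \<odot>\<^bsub>M\<^esub> \<kappa> i)) ?A"
    unfolding lincomb_def
    using C kc by (intro add_hom_finsum[OF M.abelian_group_axioms M.abelian_group_axioms md.dpart_add_hom])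
      (auto intro!: smult_closed)
  also have "\<dots> = finsum M (\<lambda>i. ?c i \<odot>\<^bsub>M\<^esub> \<kappa> i) ?A"
  proof (rule M.finsum_cong')
    show "(\<lambda>i. ?c i \<odot>\<^bsub>M\<^esub> \<kappa> i) \<in> ?A \<rightarrow> carrier M"
      using C kc by (auto intro!: smult_closed rd.dpart_carrier)
    fix i assume "i \<in> ?A"
    then have "i \<in> I" using C(2) by auto
    then show "mpart M j (c i \<odot>\<^bsub>M\<^esub> \<kappa> i) = ?c i \<odot>\<^bsub>M\<^esub> \<kappa> i"
      using mpart_smult_grade[OF C(1) k] by simp
  qed simp
  also have "\<dots> = lincomb R M \<kappa> ?c"
    by (rule lincomb_superset[symmetric]) (use C kc cc in \<open>auto simp: rd.dpart_carrier rd.dpart_zero\<close>)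
  finally show "mpart M j (lincomb R M \<kappa> c) = lincomb R M \<kappa> ?c" .
qed

locale gbasis = graded_module R M
  for R :: "('r, 'x) graded_ring_scheme" (structure)
    and M :: "('r, 'm, 'y) graded_module_scheme" (structure) +
  fixes B :: "'m set"
  assumes hbasis: "homogeneous_basis R M B"
begin

lemma basis_homogeneous: "b \<in> B \<Longrightarrow> b \<in> grade M (hdeg M b)"
  using hbasis unfolding homogeneous_basis_alt hdeg_def by (auto intro: someI)

lemma basis_carrier: "B \<subseteq> carrier M"
  using basis_homogeneous md.G_in_carrier by blast

lemma id_basis: "(\<lambda>x. x) \<in> B \<rightarrow> carrier M"
  using basis_carrier by auto

lemma coord_ex1: "x \<in> carrier M \<Longrightarrow> \<exists>!c. c \<in> coefs R B \<and> x = lincomb R M (\<lambda>x. x) c"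
  using hbasis unfolding homogeneous_basis_alt by blast

lemma coord_coefs: "x \<in> carrier M \<Longrightarrow> coord R M B x \<in> coefs R B"
  and coord_lincomb: "x \<in> carrier M \<Longrightarrow> lincomb R M (\<lambda>x. x) (coord R M B x) = x"
  using theI'[OF coord_ex1, of x] unfolding coord_def by auto

lemma coord_eqI:
  assumes "c \<in> coefs R B" "x = lincomb R M (\<lambda>x. x) c"
  shows "coord R M B x = c"
proof -
  have "x \<in> carrier M" using assms lincomb_closed[OF _ id_basis] by simp
  from the1_equality[OF coord_ex1[OF this]] assms show ?thesis unfolding coord_def by blast
qed

lemma coord_closed: "x \<in> carrier M \<Longrightarrow> coord R M B x b \<in> carrier R"
  using coefsD(1)[OF coord_coefs] .

lemma coord_add:
  "\<lbrakk>x \<in> carrier M; y \<in> carrier M\<rbrakk> \<Longrightarrow> coord R M B (x \<oplus>\<^bsub>M\<^esub> y) = (\<lambda>b. coord R M B x b \<oplus>\<^bsub>R\<^esub> coord R M B y b)"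
  by (rule coord_eqI) (auto simp: R.coefs_add coord_coefs coord_lincomb lincomb_add[OF _ _ id_basis])

lemma coord_smult:
  "\<lbrakk>r \<in> carrier R; x \<in> carrier M\<rbrakk> \<Longrightarrow> coord R M B (r \<odot>\<^bsub>M\<^esub> x) = (\<lambda>b. r \<otimes>\<^bsub>R\<^esub> coord R M B x b)"
  by (rule coord_eqI) (auto simp: R.coefs_lmult coord_coefs coord_lincomb lincomb_smult[OF _ _ id_basis])

lemma coord_basis: "b \<in> B \<Longrightarrow> coord R M B b = unitvec R b"
  by (rule coord_eqI) (use basis_carrier in \<open>auto simp: R.coefs_unitvec lincomb_unitvec\<close>)

lemma coord_zero: "coord R M B \<zero>\<^bsub>M\<^esub> = (\<lambda>b. \<zero>\<^bsub>R\<^esub>)"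
  by (rule coord_eqI) (auto simp: R.coefs_zero lincomb_zero)

lemma coord_add_hom: "(\<lambda>x. coord R M B x b) \<in> add_hom M R"
  by (rule add_homI) (auto simp: coord_closed coord_add)

lemma coord_homogeneous:
  assumes "x \<in> grade M j" "b \<in> B"
  shows "coord R M B x b \<in> rgr R (j - hdeg M b)"
proof -
  have x: "x \<in> carrier M" using assms md.G_in_carrier by blast
  note ml = mpart_lincomb[OF coord_coefs[OF x], of "\<lambda>x. x" "hdeg M" j]
  have "x = mpart M j (lincomb R M (\<lambda>x. x) (coord R M B x))"
    using coord_lincomb[OF x] md.dpart_homog[OF assms(1), of j] by simp
  also have "\<dots> = lincomb R M (\<lambda>x. x) (\<lambda>i. rpart R (j - hdeg M i) (coord R M B x i))"
    by (rule ml(2)) (rule basis_homogeneous)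
  finally have "coord R M B x = (\<lambda>i. rpart R (j - hdeg M i) (coord R M B x i))"
    by (intro coord_eqI ml(1)) (rule basis_homogeneous)
  then have "coord R M B x b = rpart R (j - hdeg M b) (coord R M B x b)" by metis
  then show ?thesis using rd.dpart_in[OF coord_closed[OF x]] by metis
qed

lemma spn_basis: "spn R M B = carrier M"
proof
  show "carrier M \<subseteq> spn R M B" unfolding spn_def using coord_coefs coord_lincomb by (metis imageI subsetI)
qed (auto dest: submodD(1)[OF spn_submod[OF basis_carrier]])

lemma hom_eqI:
  assumes N: "graded_module R N" and f: "f \<in> graded_hom R M N" and g: "g \<in> graded_hom R M N"
    and eq: "\<And>b. b \<in> B \<Longrightarrow> f b = g b" and x: "x \<in> carrier M"
  shows "f x = g x"
proof -
  interpret N: graded_module R N by fact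
  have "f x = lincomb R N f (coord R M B x)"
    using graded_hom_lincomb[OF graded_module_axioms N f coord_coefs[OF x] id_basis] coord_lincomb[OF x] by simp
  also have "\<dots> = lincomb R N g (coord R M B x)"
    by (rule N.lincomb_cong[OF coord_coefs[OF x] eq]) (use basis_carrier graded_homD(2)[OF f] in auto)
  also have "\<dots> = g x"
    using graded_hom_lincomb[OF graded_module_axioms N g coord_coefs[OF x] id_basis] coord_lincomb[OF x] by simp
  finally show ?thesis .
qed

lemma hom_extend:
  assumes N: "graded_module R N" and k: "\<And>b. b \<in> B \<Longrightarrow> \<kappa> b \<in> grade N (hdeg M b)"
  shows "(\<lambda>x. lincomb R N \<kappa> (coord R M B x)) \<in> graded_hom R M N"
    "\<And>b. b \<in> B \<Longrightarrow> lincomb R N \<kappa> (coord R M B b) = \<kappa> b"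
proof -
  interpret N: graded_module R N by fact
  have kc: "\<kappa> \<in> B \<rightarrow> carrier N" using k N.md.G_in_carrier by blast
  show "(\<lambda>x. lincomb R N \<kappa> (coord R M B x)) \<in> graded_hom R M N"
  proof (rule graded_homI)
    fix x j assume x: "x \<in> grade M j"
    then have xc: "x \<in> carrier M" by (rule md.G_in_carrier)
    show "lincomb R N \<kappa> (coord R M B x) \<in> grade N j"
      unfolding lincomb_def
    proof (rule N.md.G_finsum, rule)
      fix b assume "b \<in> {i. coord R M B x i \<noteq> \<zero>\<^bsub>R\<^esub>}"
      then have b: "b \<in> B" using coefsD(2)[OF coord_coefs[OF xc]] by auto
      show "coord R M B x b \<odot>\<^bsub>N\<^esub> \<kappa> b \<in> grade N j"
        using N.smult_rgr[OF coord_homogeneous[OF x b] k[OF b]] by simp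
    qed
  qed (auto simp: N.lincomb_closed[OF coord_coefs kc] coord_add coord_smult
      N.lincomb_add[OF coord_coefs coord_coefs kc] N.lincomb_smult[OF coord_coefs _ kc])
  show "lincomb R N \<kappa> (coord R M B b) = \<kappa> b" if "b \<in> B" for b
    using N.lincomb_unitvec[of \<kappa> b] kc that by (auto simp: coord_basis)
qed

text \<open>Free modules are projective: the images of the basis elements have homogeneous preimages, and a map
  from a free module is determined by homogeneous images of the basis elements.\<close>

lemma hom_lift:
  assumes P: "graded_module R P" and L: "graded_module R L" and \<rho>: "\<rho> \<in> graded_hom R P L"
    and f: "f \<in> graded_hom R M L" and sub: "\<And>x. x \<in> carrier M \<Longrightarrow> f x \<in> \<rho> ` carrier P"
  shows "\<exists>g\<in>graded_hom R M P. \<forall>x\<in>carrier M. \<rho> (g x) = f x"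
proof -
  have "\<exists>y. y \<in> grade P (hdeg M b) \<and> \<rho> y = f b" if "b \<in> B" for b
    using homogeneous_preimage[OF P L \<rho> graded_homD(5)[OF f basis_homogeneous[OF that]] sub] that basis_carrier
    by blast
  then obtain \<kappa> where k: "\<And>b. b \<in> B \<Longrightarrow> \<kappa> b \<in> grade P (hdeg M b)" "\<And>b. b \<in> B \<Longrightarrow> \<rho> (\<kappa> b) = f b" by metis
  let ?g = "\<lambda>x. lincomb R P \<kappa> (coord R M B x)"
  have g: "?g \<in> graded_hom R M P" by (rule hom_extend[OF P k(1)])
  have "(\<lambda>x. \<rho> (?g x)) x = f x" if "x \<in> carrier M" for x
  proof (rule hom_eqI[where N = L])
    show "\<rho> (?g b) = f b" if "b \<in> B" for b
      using hom_extend(2)[where \<kappa> = \<kappa>, OF P k(1) that] k(2)[OF that] by simp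
    show "(\<lambda>x. \<rho> (?g x)) \<in> graded_hom R M L" by (rule graded_hom_comp[OF g \<rho>])
    show "graded_module R L" "f \<in> graded_hom R M L" "x \<in> carrier M" by fact+
  qed
  then show ?thesis using g by (intro bexI[of _ ?g]) auto
qed

end

lemma gbasisI: "\<lbrakk>graded_module R M; homogeneous_basis R M B\<rbrakk> \<Longrightarrow> gbasis R M B"
  by (intro gbasis.intro gbasis_axioms.intro)

lemma (in graded_module) homogeneous_basisI:
  assumes hom: "B \<subseteq> (\<Union>j. grade M j)" and spn: "carrier M \<subseteq> spn R M B"
    and indep: "\<And>c b. \<lbrakk>c \<in> coefs R B; lincomb R M (\<lambda>x. x) c = \<zero>\<^bsub>M\<^esub>\<rbrakk> \<Longrightarrow> c b = \<zero>\<^bsub>R\<^esub>"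
  shows "homogeneous_basis R M B"
  unfolding R.homogeneous_basis_alt
proof (intro conjI ballI hom)
  have id: "(\<lambda>x. x) \<in> B \<rightarrow> carrier M" using hom md.G_in_carrier by blast
  fix x assume "x \<in> carrier M"
  then obtain c where c: "c \<in> coefs R B" "x = lincomb R M (\<lambda>x. x) c" using spn by (auto simp: spn_def)
  show "\<exists>!c. c \<in> coefs R B \<and> x = lincomb R M (\<lambda>x. x) c"
  proof (rule ex1I[of _ c])
    fix d assume d: "d \<in> coefs R B \<and> x = lincomb R M (\<lambda>x. x) d"
    let ?e = "\<lambda>i. d i \<oplus>\<^bsub>R\<^esub> (\<ominus>\<^bsub>R\<^esub> \<one>\<^bsub>R\<^esub>) \<otimes>\<^bsub>R\<^esub> c i"
    have nc: "(\<lambda>i. (\<ominus>\<^bsub>R\<^esub> \<one>\<^bsub>R\<^esub>) \<otimes>\<^bsub>R\<^esub> c i) \<in> coefs R B" using c by (intro R.coefs_lmult) auto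
    then have e: "?e \<in> coefs R B" using d R.coefs_add by blast
    have xc: "x \<in> carrier M" by fact
    have "lincomb R M (\<lambda>x. x) ?e = x \<oplus>\<^bsub>M\<^esub> (\<ominus>\<^bsub>R\<^esub> \<one>\<^bsub>R\<^esub>) \<odot>\<^bsub>M\<^esub> x"
      using lincomb_add[OF conjunct1[OF d] nc id] lincomb_smult[OF c(1) _ id, of "\<ominus>\<^bsub>R\<^esub> \<one>\<^bsub>R\<^esub>"] c d by simp
    also have "\<dots> = \<zero>\<^bsub>M\<^esub>" using xc by (simp add: neg_eq_smult[symmetric] M.r_neg)
    finally have eq: "d i \<oplus>\<^bsub>R\<^esub> (\<ominus>\<^bsub>R\<^esub> \<one>\<^bsub>R\<^esub>) \<otimes>\<^bsub>R\<^esub> c i = \<zero>\<^bsub>R\<^esub>" for i using indep[OF e] by blast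
    have "d i = c i" for i
      using coefsD(1)[OF c(1), of i] coefsD(1)[OF conjunct1[OF d], of i] eq[of i]
      by (simp add: R.l_minus R.minus_eq[symmetric] R.minus_eq_zero_iff)
    then show "d = c" by blast
  qed (use c in simp)
qed

subsection \<open>The free module on a graded index set\<close>

text \<open>The free module with one basis element \<open>unitvec R i\<close> of degree \<open>deg i\<close> for each \<open>i \<in> I\<close>. The extension slot \<open>z\<close>
  later holds a differential.\<close>

definition fmod :: "('r, 'x) graded_ring_scheme \<Rightarrow> 'i set \<Rightarrow> ('i \<Rightarrow> int) \<Rightarrow> 'z \<Rightarrow>
    ('r, 'i \<Rightarrow> 'r, 'z) graded_module_scheme"
  where "fmod R I deg z =
    \<lparr>carrier = coefs R I, mult = undefined, one = undefined, zero = (\<lambda>i. \<zero>\<^bsub>R\<^esub>),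
     add = (\<lambda>c d i. c i \<oplus>\<^bsub>R\<^esub> d i), smult = (\<lambda>r c i. r \<otimes>\<^bsub>R\<^esub> c i),
     grade = (\<lambda>j. {c \<in> coefs R I. \<forall>i. c i \<in> rgr R (j - deg i)}), \<dots> = z\<rparr>"

lemma fmod_simps [simp]:
  "carrier (fmod R I deg z) = coefs R I" "zero (fmod R I deg z) = (\<lambda>i. \<zero>\<^bsub>R\<^esub>)"
  "add (fmod R I deg z) c d = (\<lambda>i. c i \<oplus>\<^bsub>R\<^esub> d i)" "smult (fmod R I deg z) r c = (\<lambda>i. r \<otimes>\<^bsub>R\<^esub> c i)"
  "grade (fmod R I deg z) j = {c \<in> coefs R I. \<forall>i. c i \<in> rgr R (j - deg i)}"
  by (simp_all add: fmod_def)

lemma fmod_restrict: "J \<subseteq> I \<Longrightarrow> restrict_module (fmod R I deg z) (coefs R J) = fmod R J deg z"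
  using coefs_mono[of J I R] by (auto simp: restrict_module_def fmod_def fun_eq_iff)

context graded_ring begin

lemma fmod_abelian: "abelian_group (fmod R I deg z)"
proof (rule abelian_groupI)
  fix c assume c: "c \<in> carrier (fmod R I deg z)"
  then have "(\<lambda>i. \<ominus> \<one> \<otimes> c i) \<in> coefs R I" by (intro coefs_lmult) auto
  moreover have "\<ominus> \<one> \<otimes> c i \<oplus> c i = \<zero>" for i
    using coefsD(1)[of c R I i] c by (simp add: l_minus l_neg)
  ultimately show "\<exists>d\<in>carrier (fmod R I deg z). d \<oplus>\<^bsub>fmod R I deg z\<^esub> c = \<zero>\<^bsub>fmod R I deg z\<^esub>"
    by (intro bexI[of _ "\<lambda>i. \<ominus> \<one> \<otimes> c i"]) auto
qed (auto simp: coefs_add coefs_zero coefsD(1) a_ac)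

lemma fmod_finsum:
  assumes "f \<in> A \<rightarrow> coefs R I"
  shows "finsum (fmod R I deg z) f A i = (\<Oplus>k\<in>A. f k i)"
proof -
  have "(\<lambda>c. c i) \<in> add_hom (fmod R I deg z) R" by (auto simp: add_hom_def coefsD(1))
  from add_hom_finsum[OF fmod_abelian abelian_group_axioms this] assms show ?thesis by simp
qed

lemma fmod_graded_module: "graded_module R (fmod R I deg z)"
  and fmod_mpart: "c \<in> coefs R I \<Longrightarrow> mpart (fmod R I deg z) j c = (\<lambda>i. rpart R (j - deg i) (c i))"
proof -
  let ?F = "fmod R I deg z" and ?p = "\<lambda>j c i. rpart R (j - deg i) (c i)"
  interpret F: abelian_group ?F by (rule fmod_abelian)
  have neg: "\<ominus>\<^bsub>?F\<^esub> c = (\<lambda>i. \<ominus> c i)" if c: "c \<in> coefs R I" for c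
  proof
    fix i
    have "(\<lambda>c. c i) \<in> add_hom ?F R" by (auto simp: add_hom_def coefsD(1))
    from add_hom_neg[OF fmod_abelian abelian_group_axioms this] c show "(\<ominus>\<^bsub>?F\<^esub> c) i = \<ominus> c i" by simp
  qed
  have sub: "additive_subgroup (grade ?F j) ?F" for j
  proof (rule F.additive_subgroupI')
    fix c assume c: "c \<in> grade ?F j"
    then have "\<ominus>\<^bsub>?F\<^esub> c \<in> carrier ?F" using F.a_inv_closed by simp
    then show "\<ominus>\<^bsub>?F\<^esub> c \<in> grade ?F j" using c neg by (auto simp: rd.G_neg)
  qed (auto simp: coefs_zero coefs_add rd.G_zero rd.G_add)
  have pc: "?p j c \<in> coefs R I" if "c \<in> coefs R I" for j c
    using coefsD[OF that] by (auto simp: coefs_def rd.dpart_carrier rd.dpart_zero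
        intro: finite_subset[of _ "{i. c i \<noteq> \<zero>}"])
  have p1: "?p j \<in> add_hom ?F ?F" for j
    by (rule add_homI) (auto simp: pc coefsD(1) rd.dpart_add)
  have p2: "?p j c \<in> grade ?F j" if "c \<in> carrier ?F" for j c
    using that pc by (auto simp: rd.dpart_in coefsD(1))
  have p3: "?p k c = (if k = j then c else \<zero>\<^bsub>?F\<^esub>)" if "c \<in> grade ?F j" for j k c
    using that rd.dpart_homog[of "c i" "j - deg i" "k - deg i" for i] by (auto simp: fun_eq_iff)
  have p4: "\<exists>A. finite A \<and> (\<forall>j. j \<notin> A \<longrightarrow> ?p j c = \<zero>\<^bsub>?F\<^esub>) \<and> c = finsum ?F (\<lambda>j. ?p j c) A"
    if "c \<in> carrier ?F" for c
  proof -
    have c: "c \<in> coefs R I" using that by simp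
    note C = coefsD[OF c]
    let ?A = "\<Union>i\<in>{i. c i \<noteq> \<zero>}. (\<lambda>k. k + deg i) ` {k. rpart R k (c i) \<noteq> \<zero>}"
    have fin: "finite ?A" using C rd.dpart_finite by auto
    have out: "rpart R (j - deg i) (c i) = \<zero>" if "j \<notin> ?A" for i j
    proof (rule ccontr)
      assume n: "rpart R (j - deg i) (c i) \<noteq> \<zero>"
      then have "c i \<noteq> \<zero>" using rd.dpart_zero by metis
      moreover have "j = (j - deg i) + deg i" by simp
      ultimately show False using that n by blast
    qed
    have "c i = finsum ?F (\<lambda>j. ?p j c) ?A i" for i
    proof -
      let ?A' = "(\<lambda>j. j - deg i) ` ?A"
      have "c i = (\<Oplus>k\<in>?A'. rpart R k (c i))"
      proof (rule rd.dpart_sum_superset[symmetric])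
        fix k assume "k \<notin> ?A'"
        then have "k + deg i \<notin> ?A" using image_eqI[of k "\<lambda>j. j - deg i" "k + deg i" ?A] by auto
        then show "rpart R k (c i) = \<zero>" using out[of "k + deg i" i] by simp
      qed (use fin C in auto)
      also have "\<dots> = (\<Oplus>j\<in>?A. rpart R (j - deg i) (c i))"
        using C rd.dpart_carrier by (intro finsum_reindex) (auto simp: inj_on_def)
      also have "\<dots> = finsum ?F (\<lambda>j. ?p j c) ?A i"
        using pc c by (intro fmod_finsum[symmetric]) auto
      finally show ?thesis .
    qed
    then have "c = finsum ?F (\<lambda>j. ?p j c) ?A" by (rule ext)
    moreover have "?p j c = \<zero>\<^bsub>?F\<^esub>" if "j \<notin> ?A" for j using out[OF that] by simp
    ultimately show ?thesis using fin by (intro exI[of _ ?A] conjI allI impI)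
  qed
  note D = F.direct_sumI[OF sub p1 p2 p3 p4]
  show "graded_module R ?F"
  proof (rule graded_moduleI[OF graded_ring_axioms F.abelian_group_axioms _ _ _ _ _ D(1)])
    fix a c i j assume a: "a \<in> rgrade R i" and c: "c \<in> grade ?F j"
    have a': "a \<in> rgr R (int i)" using a by (simp add: rgr_def)
    show "a \<odot>\<^bsub>?F\<^esub> c \<in> grade ?F (int i + j)"
      using c rgr_mult[OF a'] coefs_lmult[OF rd.G_in_carrier[OF a']]
      by (auto simp: add_diff_eq[symmetric])
  qed (auto simp: coefs_lmult coefsD(1) l_distr r_distr m_assoc)
  show "c \<in> coefs R I \<Longrightarrow> mpart ?F j c = ?p j c"
  proof -
    assume "c \<in> coefs R I"
    then show ?thesis by (intro D(3)) auto
  qed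
qed

lemma fmod_lincomb:
  assumes "c \<in> coefs R J" "\<kappa> \<in> J \<rightarrow> coefs R I"
  shows "lincomb R (fmod R I deg z) \<kappa> c = (\<lambda>k. \<Oplus>i\<in>{i. c i \<noteq> \<zero>}. c i \<otimes> \<kappa> i k)"
proof
  fix k
  have "(\<lambda>i. c i \<odot>\<^bsub>fmod R I deg z\<^esub> \<kappa> i) \<in> {i. c i \<noteq> \<zero>} \<rightarrow> coefs R I"
    using assms coefsD[OF assms(1)] by (auto intro!: coefs_lmult)
  from fmod_finsum[OF this, of deg z k]
  show "lincomb R (fmod R I deg z) \<kappa> c k = (\<Oplus>i\<in>{i. c i \<noteq> \<zero>}. c i \<otimes> \<kappa> i k)"
    by (simp add: lincomb_def)
qed

lemma fmod_lincomb_unitvec: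
  assumes "c \<in> coefs R I"
  shows "lincomb R (fmod R I deg z) (unitvec R) c = c"
proof
  fix k
  have "lincomb R (fmod R I deg z) (unitvec R) c k = (\<Oplus>i\<in>{i. c i \<noteq> \<zero>}. c i \<otimes> unitvec R i k)"
    using fmod_lincomb[OF assms, of "unitvec R" I deg z] by (simp add: coefs_unitvec)
  also have "\<dots> = (\<Oplus>i\<in>insert k {i. c i \<noteq> \<zero>}. c i \<otimes> unitvec R i k)"
    using coefsD[OF assms] by (intro finsum_superset) (auto simp: unitvec_def)
  also have "\<dots> = c k \<otimes> unitvec R k k"
    by (rule finsum_eq_single) (use coefsD[OF assms] in \<open>auto simp: unitvec_def\<close>)
  finally show "lincomb R (fmod R I deg z) (unitvec R) c k = c k" using coefsD[OF assms] by (simp add: unitvec_def)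
qed

lemma unitvec_grade: "i \<in> I \<Longrightarrow> unitvec R i \<in> grade (fmod R I deg z) (deg i)"
  using coefs_unitvec[of i I] one_rgr rd.G_zero by (auto simp: unitvec_def)

lemma fmod_hom:
  assumes M: "graded_module R M" and k: "\<And>i. i \<in> I \<Longrightarrow> \<kappa> i \<in> grade M (deg i)"
  shows "lincomb R M \<kappa> \<in> graded_hom R (fmod R I deg z) M"
proof -
  interpret M: graded_module R M by fact
  have kc: "\<kappa> \<in> I \<rightarrow> carrier M" using k M.md.G_in_carrier by blast
  show ?thesis
  proof (rule graded_homI)
    fix c j assume c: "c \<in> grade (fmod R I deg z) j"
    show "lincomb R M \<kappa> c \<in> grade M j"
      unfolding lincomb_def
    proof (rule M.md.G_finsum, rule)
      fix i assume "i \<in> {i. c i \<noteq> \<zero>}"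
      then have i: "i \<in> I" using c by (auto simp: coefs_def)
      show "c i \<odot>\<^bsub>M\<^esub> \<kappa> i \<in> grade M j"
        using M.smult_rgr[OF _ k[OF i], of "c i" "j - deg i"] c by simp
    qed
  qed (auto simp: M.lincomb_closed[OF _ kc] M.lincomb_add[OF _ _ kc] M.lincomb_smult[OF _ _ kc])
qed

end

lemma (in graded_local_ring) fmod_basis:
  "homogeneous_basis R (fmod R I deg z) (unitvec R ` I)"
proof -
  let ?F = "fmod R I deg z"
  interpret F: graded_module R "?F" by (rule fmod_graded_module)
  have uc: "unitvec R ` I \<subseteq> carrier ?F" using coefs_unitvec by auto
  then have idc: "(\<lambda>x. x) \<in> unitvec R ` I \<rightarrow> coefs R I" by auto
  have lc: "lincomb R ?F (\<lambda>x. x) d = (\<lambda>i. d (unitvec R i))" if d: "d \<in> coefs R (unitvec R ` I)" for d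
  proof
    fix i
    note D = coefsD[OF d]
    have "lincomb R ?F (\<lambda>x. x) d i = (\<Oplus>b\<in>{b. d b \<noteq> \<zero>}. d b \<otimes> b i)"
      using fmod_lincomb[OF d idc, of deg z] by simp
    also have "\<dots> = (\<Oplus>b\<in>insert (unitvec R i) {b. d b \<noteq> \<zero>}. d b \<otimes> b i)"
      by (rule finsum_superset) (use D in \<open>auto simp: unitvec_def\<close>)
    also have "\<dots> = d (unitvec R i) \<otimes> unitvec R i i"
    proof (rule finsum_eq_single)
      fix b assume b: "b \<in> insert (unitvec R i) {b. d b \<noteq> \<zero>}" "b \<noteq> unitvec R i"
      then have "b \<in> unitvec R ` I" using D(2) by auto
      then obtain k where "b = unitvec R k" by auto
      then show "d b \<otimes> b i = \<zero>" using b(2) D(1) by (auto simp: unitvec_def)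
    qed (use D in \<open>auto simp: unitvec_def\<close>)
    finally show "lincomb R ?F (\<lambda>x. x) d i = d (unitvec R i)" using D by (simp add: unitvec_def)
  qed
  show ?thesis
  proof (rule F.homogeneous_basisI)
    show "unitvec R ` I \<subseteq> (\<Union>j. grade ?F j)"
      using unitvec_grade[of _ I deg z] by (auto simp del: fmod_simps)
  next
    show "carrier ?F \<subseteq> spn R ?F (unitvec R ` I)"
    proof
      fix c assume c: "c \<in> carrier ?F"
      have "lincomb R ?F (unitvec R) c \<in> spn R ?F (unitvec R ` I)"
      proof (rule F.lincomb_submod[OF F.spn_submod[OF uc]])
        fix i assume "c i \<noteq> \<zero>"
        then have "i \<in> I" "c i \<in> carrier R" using c by (auto simp: coefs_def)
        then show "c i \<odot>\<^bsub>?F\<^esub> unitvec R i \<in> spn R ?F (unitvec R ` I)"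
          using F.spn_incl[OF uc] by (intro submodD(4)[OF F.spn_submod[OF uc]]) auto
      qed
      then show "c \<in> spn R ?F (unitvec R ` I)" using c by (simp add: fmod_lincomb_unitvec)
    qed
  next
    fix d b assume d: "d \<in> coefs R (unitvec R ` I)" "lincomb R ?F (\<lambda>x. x) d = \<zero>\<^bsub>?F\<^esub>"
    have "d (unitvec R i) = \<zero>" for i using lc[OF d(1)] d(2) by (auto simp: fun_eq_iff)
    then show "d b = \<zero>" using coefsD(2)[OF d(1), of b] by (cases "b \<in> unitvec R ` I") auto
  qed
qed

section \<open>Nakayama's lemma and minimal generators\<close>

lemma (in left_module) spn_subset: "S \<subseteq> carrier M \<Longrightarrow> spn R M S \<subseteq> carrier M"
  using submodD(1)[OF spn_submod] by blast

lemma (in graded_module) gsub_mpart_generators: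
  assumes Z: "gsub R M Z" and S: "finite S" "S \<subseteq> Z"
  shows "\<exists>T. finite T \<and> T \<subseteq> Z \<and> T \<subseteq> (\<Union>j. grade M j) \<and> S \<subseteq> spn R M T"
proof (intro exI conjI)
  have ZM: "Z \<subseteq> carrier M" using submodD(1)[OF gsubD(1)[OF Z]] by blast
  let ?T = "\<Union>s\<in>S. (\<lambda>j. mpart M j s) ` {j. mpart M j s \<noteq> \<zero>\<^bsub>M\<^esub>}"
  show "finite ?T" using S ZM md.dpart_finite by auto
  show TZ: "?T \<subseteq> Z" using gsubD(2)[OF Z] S by auto
  show "?T \<subseteq> (\<Union>j. grade M j)" using S ZM md.dpart_in by blast
  have TM: "?T \<subseteq> carrier M" using TZ ZM by blast
  show "S \<subseteq> spn R M ?T"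
  proof
    fix s assume s: "s \<in> S"
    then have sM: "s \<in> carrier M" using S ZM by blast
    have "finsum M (\<lambda>j. mpart M j s) {j. mpart M j s \<noteq> \<zero>\<^bsub>M\<^esub>} \<in> spn R M ?T"
      by (rule submod_finsum[OF spn_submod[OF TM]]) (use s spn_incl[OF TM] in blast)
    then show "s \<in> spn R M ?T" using md.dpart_sum[OF sM] by simp
  qed
qed

context graded_local_ring begin

abbreviation mM :: "('r, 'm, 'y) graded_module_scheme \<Rightarrow> 'm set"
  where "mM M \<equiv> lin_combs M \<mm> (carrier M)"

lemma mM_eq:
  assumes "graded_module R M"
  shows "mM M = lincomb R M (\<lambda>x. x) ` {c \<in> coefs R (carrier M). \<forall>x. c x \<in> \<mm>}"
  by (rule left_module.lin_combs_eq[OF graded_module_left[OF assms]])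
    (auto simp: gmax_carrier gmax_zero)

text \<open>The set in question is \<open>\<mm>S\<close>, which for \<open>S = carrier M\<close> is \<open>\<mm>M\<close>.\<close>

lemma mspan_submod:
  assumes "graded_module R M" "S \<subseteq> carrier M"
  shows "submod R M (lincomb R M (\<lambda>x. x) ` {c \<in> coefs R S. \<forall>x. c x \<in> \<mm>})" (is "submod R M (?l ` ?C)")
proof -
  interpret M: graded_module R M by fact
  have id: "(\<lambda>x. x) \<in> S \<rightarrow> carrier M" using assms(2) by blast
  show ?thesis
  proof (rule submodI)
    show "\<zero>\<^bsub>M\<^esub> \<in> ?l ` ?C"
      using coefs_zero gmax_zero by (intro image_eqI[of _ _ "\<lambda>_. \<zero>"]) (auto simp: M.lincomb_zero)
  next
    fix x y assume "x \<in> ?l ` ?C" "y \<in> ?l ` ?C"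
    then obtain c d where "c \<in> ?C" "x = ?l c" "d \<in> ?C" "y = ?l d" by blast
    then show "x \<oplus>\<^bsub>M\<^esub> y \<in> ?l ` ?C"
      by (intro image_eqI[of _ _ "\<lambda>x. c x \<oplus> d x"]) (auto simp: M.lincomb_add[OF _ _ id] coefs_add gmax_add)
  next
    fix r x assume r: "r \<in> carrier R" "x \<in> ?l ` ?C"
    then obtain c where "c \<in> ?C" "x = ?l c" by blast
    then show "r \<odot>\<^bsub>M\<^esub> x \<in> ?l ` ?C"
      using r(1) by (intro image_eqI[of _ _ "\<lambda>x. r \<otimes> c x"]) (auto simp: M.lincomb_smult[OF _ _ id] coefs_lmult gmax_lmult)
  qed (auto intro!: M.lincomb_closed[OF _ id])
qed

lemma mM_submod: "graded_module R M \<Longrightarrow> submod R M (mM M)"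
  using mspan_submod[of M "carrier M"] by (simp add: mM_eq)

lemma mM_smult:
  assumes M: "graded_module R M" and r: "r \<in> \<mm>" and x: "x \<in> carrier M"
  shows "r \<odot>\<^bsub>M\<^esub> x \<in> mM M"
proof -
  interpret M: graded_module R M by fact
  have id: "(\<lambda>x. x) \<in> carrier M \<rightarrow> carrier M" by simp
  have u: "unitvec R x \<in> coefs R (carrier M)" by (rule coefs_unitvec[OF x])
  have "r \<odot>\<^bsub>M\<^esub> x = lincomb R M (\<lambda>x. x) (\<lambda>y. r \<otimes> unitvec R x y)"
    using M.lincomb_smult[OF u gmax_carrier[OF r] id] M.lincomb_unitvec[of "\<lambda>x. x" x] x by simp
  moreover have "(\<lambda>y. r \<otimes> unitvec R x y) \<in> coefs R (carrier M)" by (rule coefs_lmult[OF gmax_carrier[OF r] u])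
  moreover have "\<forall>y. r \<otimes> unitvec R x y \<in> \<mm>" using gmax_rmult[OF coefsD(1)[OF u] r] by blast
  ultimately show ?thesis unfolding mM_eq[OF M] by blast
qed

lemma mM_least:
  assumes M: "graded_module R M" and N: "submod R M N"
    and sm: "\<And>r x. \<lbrakk>r \<in> \<mm>; x \<in> carrier M\<rbrakk> \<Longrightarrow> r \<odot>\<^bsub>M\<^esub> x \<in> N"
  shows "mM M \<subseteq> N"
proof -
  interpret M: graded_module R M by fact
  have "lincomb R M (\<lambda>x. x) c \<in> N" if "c \<in> coefs R (carrier M)" "\<forall>x. c x \<in> \<mm>" for c
    by (rule M.lincomb_submod[OF N]) (use that coefsD(2)[OF that(1)] sm in blast)
  then show ?thesis unfolding mM_eq[OF M] by auto
qed

lemma mM_hom: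
  assumes M: "graded_module R M" and N: "graded_module R N" and f: "f \<in> graded_hom R M (twist N a)"
    and y: "y \<in> mM M"
  shows "f y \<in> mM N"
proof -
  interpret M: graded_module R M by fact
  note F = graded_homD[OF f, simplified] and S = submodD[OF mM_submod[OF N]]
  have "mM M \<subseteq> {y \<in> carrier M. f y \<in> mM N}"
  proof (rule mM_least[OF M])
    show "submod R M {y \<in> carrier M. f y \<in> mM N}"
      using S F graded_hom_zero[OF M twist_graded_module[OF N] f] M.smult_closed by (intro submodI) auto
    show "r \<odot>\<^bsub>M\<^esub> x \<in> {y \<in> carrier M. f y \<in> mM N}" if "r \<in> \<mm>" "x \<in> carrier M" for r x
      using that mM_smult[OF N] F gmax_carrier M.smult_closed by auto
  qed
  then show ?thesis using y by blast
qed

lemma mM_coord: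
  assumes "gbasis R M B" "y \<in> carrier M"
  shows "y \<in> mM M \<longleftrightarrow> (\<forall>b. coord R M B y b \<in> \<mm>)"
proof
  interpret M: gbasis R M B by fact
  have M: "graded_module R M" by (rule M.graded_module_axioms)
  have "mM M \<subseteq> {y \<in> carrier M. \<forall>b. coord R M B y b \<in> \<mm>}"
    by (rule mM_least[OF M])
      (auto intro!: submodI simp: M.coord_zero M.coord_add M.coord_smult M.smult_closed gmax_zero gmax_add
        gmax_lmult gmax_rmult gmax_carrier M.coord_closed)
  then show "y \<in> mM M \<Longrightarrow> \<forall>b. coord R M B y b \<in> \<mm>" by blast
  assume *: "\<forall>b. coord R M B y b \<in> \<mm>"
  have "lincomb R M (\<lambda>x. x) (coord R M B y) \<in> mM M"
  proof (rule M.lincomb_submod[OF mM_submod[OF M]])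
    fix b assume "coord R M B y b \<noteq> \<zero>"
    then have "b \<in> carrier M" using coefsD(2)[OF M.coord_coefs[OF assms(2)]] M.basis_carrier by blast
    then show "coord R M B y b \<odot>\<^bsub>M\<^esub> b \<in> mM M" using mM_smult[OF M] * by blast
  qed
  then show "y \<in> mM M" using M.coord_lincomb[OF assms(2)] by simp
qed

text \<open>A homogeneous generating set of least size works: if a relation had a coefficient outside
  the maximal ideal, its component in the degree of the corresponding generator would have a unit
  there, and that generator could be dropped.\<close>

lemma minimal_generators:
  assumes C: "graded_module R C" and B: "gsub R C B" and Z: "gsub R C Z"
    and S0: "finite S0" "S0 \<subseteq> Z" "S0 \<subseteq> (\<Union>j. grade C j)" "Z \<subseteq> spn R C (B \<union> S0)"
  shows "\<exists>S. finite S \<and> S \<subseteq> Z \<and> S \<subseteq> (\<Union>j. grade C j) \<and> Z \<subseteq> spn R C (B \<union> S) \<and> card S \<le> card S0 \<and>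
    (\<forall>c\<in>coefs R S. lincomb R C (\<lambda>x. x) c \<in> B \<longrightarrow> (\<forall>s. c s \<in> \<mm>))"
proof -
  interpret C: graded_module R C by fact
  note B' = gsubD[OF B] and Z' = gsubD[OF Z]
  define P where "P S \<longleftrightarrow> finite S \<and> S \<subseteq> Z \<and> S \<subseteq> (\<Union>j. grade C j) \<and> Z \<subseteq> spn R C (B \<union> S)" for S
  have "P S0" using S0 by (simp add: P_def)
  define S where "S = arg_min card P"
  have S: "P S" unfolding S_def by (rule arg_min_natI[where P = P and k = S0]) fact
  have least: "card S \<le> card T" if "P T" for T unfolding S_def using that by (rule arg_min_nat_le)
  have SZ: "S \<subseteq> Z" and Sfin: "finite S" and Sh: "S \<subseteq> (\<Union>j. grade C j)" and ZS: "Z \<subseteq> spn R C (B \<union> S)"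
    using S by (auto simp: P_def)
  have ZC: "Z \<subseteq> carrier C" using submodD(1)[OF Z'(1)] by blast
  have BC: "B \<subseteq> carrier C" using submodD(1)[OF B'(1)] by blast
  have SC: "S \<subseteq> carrier C" using SZ ZC by blast
  have id: "(\<lambda>x. x) \<in> S \<rightarrow> carrier C" using SC by auto
  have hd: "s \<in> grade C (hdeg C s)" if "s \<in> S" for s
    using Sh that unfolding hdeg_def by (auto intro: someI)
  have "c s0 \<in> \<mm>" if c: "c \<in> coefs R S" "lincomb R C (\<lambda>x. x) c \<in> B" for c s0
  proof (rule ccontr)
    assume n: "c s0 \<notin> \<mm>"
    have s0: "s0 \<in> S" using n coefsD(2)[OF c(1), of s0] gmax_zero by metis
    let ?d = "hdeg C s0"
    let ?c = "\<lambda>s. rpart R (?d - hdeg C s) (c s)"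
    have c': "?c \<in> coefs R S" "lincomb R C (\<lambda>x. x) ?c \<in> B"
      using C.mpart_lincomb[OF c(1), of "\<lambda>x. x" "hdeg C" ?d] hd B'(2)[OF c(2), of ?d] by auto
    obtain u where u: "u \<in> rgr R 0" "u \<otimes> rpart R 0 (c s0) = \<one>"
      using rpart_0_unit[OF coefsD(1)[OF c(1)] n] by blast
    have uc: "u \<in> carrier R" by (rule rd.G_in_carrier[OF u(1)])
    let ?e = "\<lambda>s. u \<otimes> ?c s"
    have e: "?e \<in> coefs R S" by (rule coefs_lmult[OF uc c'(1)])
    have "lincomb R C (\<lambda>x. x) ?e = u \<odot>\<^bsub>C\<^esub> lincomb R C (\<lambda>x. x) ?c" by (rule C.lincomb_smult[OF c'(1) uc id])
    then have eB: "lincomb R C (\<lambda>x. x) ?e \<in> B" using c'(2) submodD(4)[OF B'(1) uc] by simp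
    let ?T = "S - {s0}"
    let ?W = "spn R C (B \<union> ?T)"
    have BT: "B \<union> ?T \<subseteq> carrier C" using BC SC by blast
    note W = C.spn_submod[OF BT]
    have "lincomb R C (\<lambda>x. x) ?e = finsum C (\<lambda>s. ?e s \<odot>\<^bsub>C\<^esub> s) (insert s0 ?T)"
      by (rule C.lincomb_superset) (use coefsD[OF e] Sfin s0 SC in auto)
    also have "\<dots> = ?e s0 \<odot>\<^bsub>C\<^esub> s0 \<oplus>\<^bsub>C\<^esub> finsum C (\<lambda>s. ?e s \<odot>\<^bsub>C\<^esub> s) ?T"
      using Sfin s0 SC coefsD(1)[OF e] coefsD(1)[OF e, of s0]
      by (intro C.M.finsum_insert) (auto intro!: C.smult_closed)
    also have "?e s0 \<odot>\<^bsub>C\<^esub> s0 = s0" using u(2) s0 SC by (auto simp: C.smult_one)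
    finally have "lincomb R C (\<lambda>x. x) ?e = finsum C (\<lambda>s. ?e s \<odot>\<^bsub>C\<^esub> s) ?T \<oplus>\<^bsub>C\<^esub> s0"
      using s0 SC coefsD(1)[OF e]
      by (subst C.M.a_comm) (auto intro!: C.M.finsum_closed C.smult_closed)
    moreover have "lincomb R C (\<lambda>x. x) ?e \<in> ?W" using eB C.spn_incl[OF BT] by blast
    moreover have "finsum C (\<lambda>s. ?e s \<odot>\<^bsub>C\<^esub> s) ?T \<in> ?W"
    proof (rule C.submod_finsum[OF W], rule)
      fix s assume "s \<in> ?T"
      then show "?e s \<odot>\<^bsub>C\<^esub> s \<in> ?W" using submodD(4)[OF W coefsD(1)[OF e]] C.spn_incl[OF BT] by blast
    qed
    ultimately have "s0 \<in> ?W" using C.submod_add_cancel[OF W] s0 SC by auto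
    then have "B \<union> S \<subseteq> ?W" using C.spn_incl[OF BT] by blast
    then have "spn R C (B \<union> S) \<subseteq> ?W" by (rule C.spn_least[OF W])
    then have "P ?T" using S by (auto simp: P_def)
    then have "card S \<le> card ?T" by (rule least)
    then show False using Sfin s0 by (metis card_Diff1_less linorder_not_less)
  qed
  then show ?thesis using S least[OF \<open>P S0\<close>] unfolding P_def by blast
qed

text \<open>The conclusion of Nakayama's lemma for graded submodules. Finitely generated modules have this
  property, and so do modules that are bounded below if \<open>\<mm>\<close> has no part of degree zero.\<close>

definition nakayama :: "('r, 'm, 'y) graded_module_scheme \<Rightarrow> bool"
  where "nakayama M \<longleftrightarrow> (\<forall>N. gsub R M N \<longrightarrow> (\<forall>x\<in>carrier M. \<exists>n\<in>N. x \<ominus>\<^bsub>M\<^esub> n \<in> mM M) \<longrightarrow> carrier M \<subseteq> N)"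

text \<open>A member \<open>s\<close> of a minimal set of generators modulo \<open>N\<close> would be congruent modulo \<open>N\<close> to a combination of
  that set with coefficients in \<open>\<mm>\<close>. This is a relation in which \<open>s\<close> has a coefficient outside \<open>\<mm>\<close>, so there is
  no such member.\<close>

lemma nakayama_finite:
  assumes M: "graded_module R M" and X: "finite X" "X \<subseteq> carrier M" "carrier M \<subseteq> spn R M X"
  shows "nakayama M"
  unfolding nakayama_def
proof (intro allI impI)
  fix N assume N: "gsub R M N" and NM: "\<forall>x\<in>carrier M. \<exists>n\<in>N. x \<ominus>\<^bsub>M\<^esub> n \<in> mM M"
  interpret M: graded_module R M by fact
  note N' = gsubD[OF N]
  have NC: "N \<subseteq> carrier M" using submodD(1)[OF N'(1)] by blast
  obtain T where T: "finite T" "T \<subseteq> carrier M" "T \<subseteq> (\<Union>j. grade M j)" "X \<subseteq> spn R M T"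
    using M.gsub_mpart_generators[OF M.gsub_carrier X(1,2)] by blast
  have "spn R M X \<subseteq> spn R M T" by (rule M.spn_least[OF M.spn_submod[OF T(2)] T(4)])
  also have "\<dots> \<subseteq> spn R M (N \<union> T)" by (rule M.spn_mono) blast
  finally have gen: "carrier M \<subseteq> spn R M (N \<union> T)" using X(3) by blast
  obtain S where S: "finite S" "S \<subseteq> carrier M" "carrier M \<subseteq> spn R M (N \<union> S)"
    and rel: "\<And>c s. \<lbrakk>c \<in> coefs R S; lincomb R M (\<lambda>x. x) c \<in> N\<rbrakk> \<Longrightarrow> c s \<in> \<mm>"
    using minimal_generators[OF M N M.gsub_carrier T(1-3) gen] by blast
  have id: "(\<lambda>x. x) \<in> S \<rightarrow> carrier M" using S by auto
  let ?L = "lincomb R M (\<lambda>x. x) ` {c \<in> coefs R S. \<forall>s. c s \<in> \<mm>}"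
  have lc: "lincomb R M (\<lambda>x. x) c \<in> carrier M" if "c \<in> coefs R S" for c by (rule M.lincomb_closed[OF that id])
  have mMK: "mM M \<subseteq> {n \<oplus>\<^bsub>M\<^esub> w | n w. n \<in> N \<and> w \<in> ?L}"
  proof (rule mM_least[OF M M.submod_sum(1)[OF N'(1) mspan_submod[OF M S(2)]]])
    fix r x assume r: "r \<in> \<mm>" and "x \<in> carrier M"
    then have "x \<in> spn R M (N \<union> S)" using S(3) by blast
    then obtain n c where *: "n \<in> N" "c \<in> coefs R S" "x = n \<oplus>\<^bsub>M\<^esub> lincomb R M (\<lambda>x. x) c"
      using M.spn_Un[OF N'(1) S(2)] by blast
    have rc: "r \<in> carrier R" using gmax_carrier r .
    have "r \<odot>\<^bsub>M\<^esub> x = r \<odot>\<^bsub>M\<^esub> n \<oplus>\<^bsub>M\<^esub> lincomb R M (\<lambda>x. x) (\<lambda>s. r \<otimes> c s)"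
      unfolding M.lincomb_smult[OF *(2) rc id] using * rc NC lc by (simp add: M.smult_r_distr subset_iff)
    moreover have "lincomb R M (\<lambda>x. x) (\<lambda>s. r \<otimes> c s) \<in> ?L"
      using coefs_lmult[OF rc *(2)] gmax_rmult[OF coefsD(1)[OF *(2)] r] by blast
    ultimately show "r \<odot>\<^bsub>M\<^esub> x \<in> {n \<oplus>\<^bsub>M\<^esub> w | n w. n \<in> N \<and> w \<in> ?L}"
      using submodD(4)[OF N'(1) rc *(1)] by blast
  qed
  have "S = {}"
  proof (rule ccontr)
    assume "S \<noteq> {}"
    then obtain s where s: "s \<in> S" by blast
    then have sM: "s \<in> carrier M" using S by blast
    obtain n where n: "n \<in> N" "s \<ominus>\<^bsub>M\<^esub> n \<in> mM M" using NM sM by blast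
    then obtain n' c where *: "n' \<in> N" "c \<in> coefs R S" "\<forall>s. c s \<in> \<mm>" "s \<ominus>\<^bsub>M\<^esub> n = n' \<oplus>\<^bsub>M\<^esub> lincomb R M (\<lambda>x. x) c"
      using mMK by blast
    let ?m = "\<ominus> \<one>"
    have m: "?m \<in> carrier R" by simp
    let ?d = "\<lambda>i. unitvec R s i \<oplus> ?m \<otimes> c i"
    have mc: "(\<lambda>i. ?m \<otimes> c i) \<in> coefs R S" by (rule coefs_lmult[OF m *(2)])
    have d: "?d \<in> coefs R S" using coefs_add[OF coefs_unitvec[OF s] mc] .
    have nM: "n \<in> carrier M" "n' \<in> carrier M" using n * NC by auto
    have ag: "s \<ominus>\<^bsub>M\<^esub> w = ((s \<ominus>\<^bsub>M\<^esub> n) \<oplus>\<^bsub>M\<^esub> n) \<ominus>\<^bsub>M\<^esub> w"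
      "((n' \<oplus>\<^bsub>M\<^esub> w) \<oplus>\<^bsub>M\<^esub> n) \<ominus>\<^bsub>M\<^esub> w = n' \<oplus>\<^bsub>M\<^esub> n" if "w \<in> carrier M" for w
      using that sM nM by algebra+
    have "lincomb R M (\<lambda>x. x) ?d = s \<ominus>\<^bsub>M\<^esub> lincomb R M (\<lambda>x. x) c"
      unfolding M.lincomb_add[OF coefs_unitvec[OF s] mc id] M.lincomb_smult[OF *(2) m id]
      using M.lincomb_unitvec[of "\<lambda>x. x" s] sM M.neg_eq_smult[OF lc[OF *(2)]] by (simp add: a_minus_def)
    also have "\<dots> = ((s \<ominus>\<^bsub>M\<^esub> n) \<oplus>\<^bsub>M\<^esub> n) \<ominus>\<^bsub>M\<^esub> lincomb R M (\<lambda>x. x) c"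
      using ag(1)[OF lc[OF *(2)]] .
    also have "\<dots> = n' \<oplus>\<^bsub>M\<^esub> n" unfolding *(4) by (rule ag(2)[OF lc[OF *(2)]])
    finally have "lincomb R M (\<lambda>x. x) ?d \<in> N" using submodD(3)[OF N'(1) *(1) n(1)] by simp
    then have "?d s \<in> \<mm>" by (rule rel[OF d])
    then have "?d s \<oplus> c s \<in> \<mm>" using gmax_add *(3) by blast
    moreover have "?d s \<oplus> c s = \<one>"
      using coefsD(1)[OF *(2), of s] by (simp add: unitvec_def l_minus a_assoc l_neg)
    ultimately show False using one_notin_gmax by simp
  qed
  then have "carrier M \<subseteq> spn R M N" using S(3) by simp
  then show "carrier M \<subseteq> N" using M.spn_least[OF N'(1)] by blast
qed

text \<open>If the elements of \<open>\<mm>\<close> have no part of degree zero, then the component of degree \<open>j\<close> of an element of \<open>\<mm>M\<close>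
  is built from components of degree less than \<open>j\<close>, which lie in \<open>N\<close> by induction on \<open>j\<close>.\<close>

lemma nakayama_bounded_below:
  assumes M: "graded_module R M" and low: "\<And>j. j < j0 \<Longrightarrow> grade M j = {\<zero>\<^bsub>M\<^esub>}"
    and m0: "\<And>r. r \<in> \<mm> \<Longrightarrow> rpart R 0 r = \<zero>"
  shows "nakayama M"
  unfolding nakayama_def
proof (intro allI impI)
  fix N assume N: "gsub R M N" and NM: "\<forall>x\<in>carrier M. \<exists>n\<in>N. x \<ominus>\<^bsub>M\<^esub> n \<in> mM M"
  interpret M: graded_module R M by fact
  note N' = gsubD[OF N]
  have gr: "grade M (j0 + int k - 1) \<subseteq> N" for k
  proof (induction k rule: less_induct)
    case (less k)
    let ?j = "j0 + int k - 1"
    have IH: "grade M i \<subseteq> N" if "i < ?j" for i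
    proof (cases "i < j0")
      case True
      then show ?thesis using low submodD(2)[OF N'(1)] by simp
    next
      case False
      then have "i = j0 + int (nat (i - j0 + 1)) - 1" "nat (i - j0 + 1) < k" using that by auto
      then show ?thesis using less.IH[of "nat (i - j0 + 1)"] by metis
    qed
    let ?K = "{y \<in> carrier M. \<forall>i\<le>?j. mpart M i y \<in> N}"
    have sm: "r \<odot>\<^bsub>M\<^esub> x \<in> ?K"
      if r: "r \<in> carrier R" and x: "x \<in> carrier M"
        and *: "\<And>k i. \<lbrakk>rpart R k r \<noteq> \<zero>; 0 \<le> k; i \<le> ?j\<rbrakk> \<Longrightarrow> mpart M (i - k) x \<in> N" for r x
    proof -
      have "mpart M i (r \<odot>\<^bsub>M\<^esub> x) \<in> N" if "i \<le> ?j" for i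
        unfolding M.mpart_smult_sum[OF r x]
      proof (rule M.submod_finsum[OF N'(1)], rule)
        fix k assume k: "k \<in> {k. rpart R k r \<noteq> \<zero>}"
        then have "0 \<le> k" using rpart_neg[of k r] r by (cases "k < 0") auto
        then show "rpart R k r \<odot>\<^bsub>M\<^esub> mpart M (i - k) x \<in> N"
          using k *[of k i] that submodD(4)[OF N'(1) rd.dpart_carrier[OF r]] by blast
      qed
      then show ?thesis using M.smult_closed[OF r x] by blast
    qed
    have K: "mM M \<subseteq> ?K"
    proof (rule mM_least[OF M])
      show "submod R M ?K"
      proof (rule submodI)
        fix r x assume "r \<in> carrier R" "x \<in> ?K"
        then show "r \<odot>\<^bsub>M\<^esub> x \<in> ?K" by (intro sm) auto
      qed (use submodD[OF N'(1)] in \<open>auto simp: M.md.dpart_zero M.md.dpart_add\<close>)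
    next
      fix r x assume r: "r \<in> \<mm>" and x: "x \<in> carrier M"
      show "r \<odot>\<^bsub>M\<^esub> x \<in> ?K"
      proof (rule sm[OF gmax_carrier[OF r] x])
        fix k i assume "rpart R k r \<noteq> \<zero>" "0 \<le> k" "i \<le> ?j"
        then have "i - k < ?j" using m0[OF r] by (cases "k = 0") auto
        then show "mpart M (i - k) x \<in> N" using IH M.md.dpart_in[OF x] by blast
      qed
    qed
    show ?case
    proof
      fix x assume x: "x \<in> grade M ?j"
      then have xM: "x \<in> carrier M" by (rule M.md.G_in_carrier)
      obtain n where n: "n \<in> N" "x \<ominus>\<^bsub>M\<^esub> n \<in> mM M" using NM xM by blast
      have nM: "n \<in> carrier M" using n submodD(1)[OF N'(1)] by blast
      have "mpart M ?j (x \<ominus>\<^bsub>M\<^esub> n) \<in> N" using K n(2) by blast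
      then have "mpart M ?j (x \<ominus>\<^bsub>M\<^esub> n) \<oplus>\<^bsub>M\<^esub> mpart M ?j n \<in> N"
        using submodD(3)[OF N'(1)] N'(2)[OF n(1)] by blast
      moreover have "mpart M ?j (x \<ominus>\<^bsub>M\<^esub> n) \<oplus>\<^bsub>M\<^esub> mpart M ?j n = mpart M ?j ((x \<ominus>\<^bsub>M\<^esub> n) \<oplus>\<^bsub>M\<^esub> n)"
        using xM nM by (simp add: M.md.dpart_add)
      moreover have "(x \<ominus>\<^bsub>M\<^esub> n) \<oplus>\<^bsub>M\<^esub> n = x" using xM nM by algebra
      moreover have "mpart M ?j x = x" using M.md.dpart_homog[OF x, of ?j] by simp
      ultimately show "x \<in> N" by simp
    qed
  qed
  have all: "grade M i \<subseteq> N" for i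
  proof (cases "i < j0")
    case True
    then show ?thesis using low submodD(2)[OF N'(1)] by simp
  next
    case False
    then have "i = j0 + int (nat (i - j0 + 1)) - 1" by simp
    then show ?thesis using gr[of "nat (i - j0 + 1)"] by metis
  qed
  show "carrier M \<subseteq> N"
  proof
    fix x assume x: "x \<in> carrier M"
    show "x \<in> N"
      by (rule M.md.mem_if_dparts[OF M.submod_add_subgroup[OF N'(1)] x]) (use all M.md.dpart_in[OF x] in blast)
  qed
qed

text \<open>Nakayama's lemma makes \<open>f\<close> surjective. A section \<open>w\<close> of \<open>f\<close>, which exists on a free module, is again the
  identity modulo \<open>\<mm>\<close> and hence surjective, so \<open>f\<close> is injective.\<close>

lemma endomorphism_bij:
  assumes M: "gbasis R M B" and nak: "nakayama M" and f: "f \<in> graded_hom R M M"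
    and id: "\<And>x. x \<in> carrier M \<Longrightarrow> x \<ominus>\<^bsub>M\<^esub> f x \<in> mM M"
  shows "bij_betw f (carrier M) (carrier M)"
proof -
  interpret M: gbasis R M B by fact
  note G = M.graded_module_axioms
  have surj: "carrier M \<subseteq> g ` carrier M"
    if g: "g \<in> graded_hom R M M" and "\<And>x. x \<in> carrier M \<Longrightarrow> x \<ominus>\<^bsub>M\<^esub> g x \<in> mM M" for g
    using nak[unfolded nakayama_def, rule_format, of "g ` carrier M"]
      graded_hom_image[OF G G g M.gsub_carrier] that by blast
  note sf = surj[OF f id]
  obtain w where w: "w \<in> graded_hom R M M" "\<And>x. x \<in> carrier M \<Longrightarrow> f (w x) = x"
    using M.hom_lift[OF G G f graded_hom_id] sf by blast
  note W = graded_homD[OF w(1)]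
  have "x \<ominus>\<^bsub>M\<^esub> w x \<in> mM M" if x: "x \<in> carrier M" for x
  proof -
    have "\<ominus>\<^bsub>M\<^esub> (w x \<ominus>\<^bsub>M\<^esub> f (w x)) \<in> mM M" using M.submod_neg[OF mM_submod[OF G] id[OF W(2)[OF x]]] .
    moreover have "\<ominus>\<^bsub>M\<^esub> (w x \<ominus>\<^bsub>M\<^esub> x) = x \<ominus>\<^bsub>M\<^esub> w x" using x W(2)[OF x] by algebra
    ultimately show ?thesis using w(2)[OF x] by simp
  qed
  note sw = surj[OF w(1) this]
  have "inj_on f (carrier M)"
  proof (rule inj_onI)
    fix x y assume xy: "x \<in> carrier M" "y \<in> carrier M" "f x = f y"
    obtain x' y' where *: "x' \<in> carrier M" "x = w x'" "y' \<in> carrier M" "y = w y'" using sw xy by blast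
    then show "x = y" using w(2) xy(3) by metis
  qed
  moreover have "f ` carrier M = carrier M" using sf graded_homD(2)[OF f] by blast
  ultimately show ?thesis by (simp add: bij_betw_def)
qed

end

section \<open>Differential modules and their homology\<close>

lemma diff_moduleD:
  assumes "diff_module R a D"
  shows "graded_module R D" "diff D \<in> graded_hom R D (twist D a)"
    "x \<in> carrier D \<Longrightarrow> diff D x \<in> carrier D"
    "x \<in> carrier D \<Longrightarrow> diff D (diff D x) = \<zero>\<^bsub>D\<^esub>"
    "\<lbrakk>x \<in> carrier D; y \<in> carrier D\<rbrakk> \<Longrightarrow> diff D (x \<oplus>\<^bsub>D\<^esub> y) = diff D x \<oplus>\<^bsub>D\<^esub> diff D y"
    "\<lbrakk>r \<in> carrier R; x \<in> carrier D\<rbrakk> \<Longrightarrow> diff D (r \<odot>\<^bsub>D\<^esub> x) = r \<odot>\<^bsub>D\<^esub> diff D x"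
    "x \<in> grade D j \<Longrightarrow> diff D x \<in> grade D (a + j)"
proof -
  interpret D: diff_module R a D by fact
  show "graded_module R D" by (rule D.graded_module_axioms)
  show "diff D \<in> graded_hom R D (twist D a)" by (rule D.diff_hom)
  note H = graded_homD[OF D.diff_hom, simplified]
  show "x \<in> carrier D \<Longrightarrow> diff D x \<in> carrier D"
    "\<lbrakk>x \<in> carrier D; y \<in> carrier D\<rbrakk> \<Longrightarrow> diff D (x \<oplus>\<^bsub>D\<^esub> y) = diff D x \<oplus>\<^bsub>D\<^esub> diff D y"
    "\<lbrakk>r \<in> carrier R; x \<in> carrier D\<rbrakk> \<Longrightarrow> diff D (r \<odot>\<^bsub>D\<^esub> x) = r \<odot>\<^bsub>D\<^esub> diff D x"
    "x \<in> grade D j \<Longrightarrow> diff D x \<in> grade D (a + j)" using H by auto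
  show "x \<in> carrier D \<Longrightarrow> diff D (diff D x) = \<zero>\<^bsub>D\<^esub>" by (rule D.diff_diff)
qed

lemma diff_moduleI:
  assumes "graded_module R D" "diff D \<in> graded_hom R D (twist D a)"
    "\<And>x. x \<in> carrier D \<Longrightarrow> diff D (diff D x) = \<zero>\<^bsub>D\<^esub>"
  shows "diff_module R a D"
  using assms by (intro diff_module.intro diff_module_axioms.intro)

context diff_module begin

lemmas d_simps = diff_moduleD(3-6)[OF diff_module_axioms]

lemma d_graded: "graded_module R D"
  by (rule graded_module_axioms)

lemma d_zero [simp]: "diff D \<zero>\<^bsub>D\<^esub> = \<zero>\<^bsub>D\<^esub>"
  using graded_hom_zero[OF d_graded twist_graded_module[OF d_graded] diff_hom] by simp

lemma d_neg: "x \<in> carrier D \<Longrightarrow> diff D (\<ominus>\<^bsub>D\<^esub> x) = \<ominus>\<^bsub>D\<^esub> diff D x"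
  using graded_hom_neg[OF d_graded twist_graded_module[OF d_graded] diff_hom] by simp

lemma d_minus: "\<lbrakk>x \<in> carrier D; y \<in> carrier D\<rbrakk> \<Longrightarrow> diff D (x \<ominus>\<^bsub>D\<^esub> y) = diff D x \<ominus>\<^bsub>D\<^esub> diff D y"
  using graded_hom_minus[OF d_graded twist_graded_module[OF d_graded] diff_hom] by simp

lemma cycles_gsub: "gsub R D (cycles D)"
  using graded_hom_kernel[OF d_graded twist_graded_module[OF d_graded] diff_hom] by (simp add: cycles_def)

lemma boundaries_gsub: "gsub R D (boundaries D)"
proof -
  have "gsub R (twist D a) (boundaries D)"
    unfolding boundaries_def
    by (rule graded_hom_image[OF d_graded twist_graded_module[OF d_graded] diff_hom gsub_carrier])
  then have g: "submod R D (boundaries D)" "\<And>x j. x \<in> boundaries D \<Longrightarrow> mpart (twist D a) j x \<in> boundaries D"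
    by (auto simp: gsub_def submod_def)
  moreover have "mpart D j x \<in> boundaries D" if x: "x \<in> boundaries D" for x j
    using g(2)[OF x, of "j - a"] twist_mpart[OF d_graded submodD(1)[OF g(1) x], of a "j - a"] by simp
  ultimately show ?thesis by (simp add: gsub_def)
qed

lemma boundaries_cycles: "boundaries D \<subseteq> cycles D"
  by (auto simp: boundaries_def cycles_def d_simps)

lemmas cycles_closed = submodD[OF gsubD(1)[OF cycles_gsub]]
  and boundaries_closed = submodD[OF gsubD(1)[OF boundaries_gsub]]

abbreviation cls :: "'m \<Rightarrow> 'm set" where "cls x \<equiv> boundaries D +>\<^bsub>D\<^esub> x"

lemma mem_cls: "y \<in> cls x \<longleftrightarrow> (\<exists>b\<in>boundaries D. y = b \<oplus>\<^bsub>D\<^esub> x)"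
  by (auto simp: a_r_coset_def')

lemma cls_eq_iff:
  assumes x: "x \<in> carrier D" and y: "y \<in> carrier D"
  shows "cls x = cls y \<longleftrightarrow> x \<ominus>\<^bsub>D\<^esub> y \<in> boundaries D"
proof
  assume "cls x = cls y"
  moreover have "x \<in> cls x" using x boundaries_closed(2) by (auto simp: mem_cls intro!: bexI[of _ "\<zero>\<^bsub>D\<^esub>"])
  ultimately obtain b where b: "b \<in> boundaries D" "x = b \<oplus>\<^bsub>D\<^esub> y" by (auto simp: mem_cls)
  have bc: "b \<in> carrier D" using b boundaries_closed by auto
  have "b \<oplus>\<^bsub>D\<^esub> y \<ominus>\<^bsub>D\<^esub> y = b" using bc y by algebra
  then show "x \<ominus>\<^bsub>D\<^esub> y \<in> boundaries D" using b by simp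
next
  assume d: "x \<ominus>\<^bsub>D\<^esub> y \<in> boundaries D"
  have sub: "cls u \<subseteq> cls v" if uv: "u \<in> carrier D" "v \<in> carrier D" "u \<ominus>\<^bsub>D\<^esub> v \<in> boundaries D" for u v
  proof
    fix z assume "z \<in> cls u"
    then obtain b where b: "b \<in> boundaries D" "z = b \<oplus>\<^bsub>D\<^esub> u" by (auto simp: mem_cls)
    have bc: "b \<in> carrier D" using b boundaries_closed by auto
    have "b \<oplus>\<^bsub>D\<^esub> u = (b \<oplus>\<^bsub>D\<^esub> (u \<ominus>\<^bsub>D\<^esub> v)) \<oplus>\<^bsub>D\<^esub> v" using bc uv(1,2) by algebra
    moreover have "b \<oplus>\<^bsub>D\<^esub> (u \<ominus>\<^bsub>D\<^esub> v) \<in> boundaries D" using b(1) uv(3) boundaries_closed(3) by blast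
    ultimately show "z \<in> cls v" using b(2) mem_cls by blast
  qed
  have "\<ominus>\<^bsub>D\<^esub> (x \<ominus>\<^bsub>D\<^esub> y) = y \<ominus>\<^bsub>D\<^esub> x" using x y by algebra
  then have "y \<ominus>\<^bsub>D\<^esub> x \<in> boundaries D"
    using submod_neg[OF gsubD(1)[OF boundaries_gsub] d] by simp
  then show "cls x = cls y" using sub[OF x y d] sub[OF y x] by blast
qed

lemma cls_zero: "cls \<zero>\<^bsub>D\<^esub> = boundaries D"
  using boundaries_closed(1) by (force simp: set_eq_iff mem_cls)

lemma cls_boundary: "z \<in> carrier D \<Longrightarrow> cls z = boundaries D \<longleftrightarrow> z \<in> boundaries D"
  using cls_eq_iff[of z "\<zero>\<^bsub>D\<^esub>"] by (simp add: cls_zero a_minus_def M.a_inv_zero)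

lemma cls_add:
  assumes x: "x \<in> carrier D" and y: "y \<in> carrier D"
  shows "cls x <+>\<^bsub>D\<^esub> cls y = cls (x \<oplus>\<^bsub>D\<^esub> y)"
proof (intro equalityI subsetI)
  fix z assume "z \<in> cls x <+>\<^bsub>D\<^esub> cls y"
  then obtain b c where bc: "b \<in> boundaries D" "c \<in> boundaries D" "z = (b \<oplus>\<^bsub>D\<^esub> x) \<oplus>\<^bsub>D\<^esub> (c \<oplus>\<^bsub>D\<^esub> y)"
    by (auto simp: set_add_def' mem_cls)
  then have "b \<in> carrier D" "c \<in> carrier D" using boundaries_closed by auto
  then have "z = (b \<oplus>\<^bsub>D\<^esub> c) \<oplus>\<^bsub>D\<^esub> (x \<oplus>\<^bsub>D\<^esub> y)" unfolding bc(3) using x y by algebra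
  then show "z \<in> cls (x \<oplus>\<^bsub>D\<^esub> y)" using bc boundaries_closed(3) mem_cls by blast
next
  fix z assume "z \<in> cls (x \<oplus>\<^bsub>D\<^esub> y)"
  then obtain b where b: "b \<in> boundaries D" "z = b \<oplus>\<^bsub>D\<^esub> (x \<oplus>\<^bsub>D\<^esub> y)" by (auto simp: mem_cls)
  have "b \<in> carrier D" using b boundaries_closed by auto
  then have "z = (b \<oplus>\<^bsub>D\<^esub> x) \<oplus>\<^bsub>D\<^esub> (\<zero>\<^bsub>D\<^esub> \<oplus>\<^bsub>D\<^esub> y)" unfolding b(2) using x y by algebra
  moreover have "b \<oplus>\<^bsub>D\<^esub> x \<in> cls x" "\<zero>\<^bsub>D\<^esub> \<oplus>\<^bsub>D\<^esub> y \<in> cls y" using b(1) boundaries_closed(2) mem_cls by blast+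
  ultimately show "z \<in> cls x <+>\<^bsub>D\<^esub> cls y" unfolding set_add_def' by blast
qed

lemma cls_smult:
  assumes r: "r \<in> carrier R" and x: "x \<in> carrier D"
  shows "boundaries D <+>\<^bsub>D\<^esub> ((\<lambda>x. r \<odot>\<^bsub>D\<^esub> x) ` cls x) = cls (r \<odot>\<^bsub>D\<^esub> x)"
proof (intro equalityI subsetI)
  fix z assume "z \<in> boundaries D <+>\<^bsub>D\<^esub> ((\<lambda>x. r \<odot>\<^bsub>D\<^esub> x) ` cls x)"
  then obtain b c where bc: "b \<in> boundaries D" "c \<in> boundaries D" "z = b \<oplus>\<^bsub>D\<^esub> r \<odot>\<^bsub>D\<^esub> (c \<oplus>\<^bsub>D\<^esub> x)"
    by (auto simp: set_add_def' mem_cls)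
  then have bc': "b \<in> carrier D" "c \<in> carrier D" using boundaries_closed by auto
  have "z = (b \<oplus>\<^bsub>D\<^esub> r \<odot>\<^bsub>D\<^esub> c) \<oplus>\<^bsub>D\<^esub> r \<odot>\<^bsub>D\<^esub> x"
    unfolding bc(3) using bc' x r by (simp add: smult_r_distr smult_closed M.a_assoc)
  then show "z \<in> cls (r \<odot>\<^bsub>D\<^esub> x)" using bc boundaries_closed(3,4) r mem_cls by blast
next
  fix z assume "z \<in> cls (r \<odot>\<^bsub>D\<^esub> x)"
  then obtain b where b: "b \<in> boundaries D" "z = b \<oplus>\<^bsub>D\<^esub> r \<odot>\<^bsub>D\<^esub> x" by (auto simp: mem_cls)
  have "x = \<zero>\<^bsub>D\<^esub> \<oplus>\<^bsub>D\<^esub> x" using x by simp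
  then have "x \<in> cls x" using boundaries_closed(2) mem_cls by blast
  then show "z \<in> boundaries D <+>\<^bsub>D\<^esub> ((\<lambda>x. r \<odot>\<^bsub>D\<^esub> x) ` cls x)" using b unfolding set_add_def' by blast
qed

end

lemma homology_simps [simp]:
  "carrier (homology D) = (\<lambda>z. boundaries D +>\<^bsub>D\<^esub> z) ` cycles D"
  "zero (homology D) = boundaries D" "add (homology D) = (\<lambda>S T. S <+>\<^bsub>D\<^esub> T)"
  "smult (homology D) = (\<lambda>r S. boundaries D <+>\<^bsub>D\<^esub> ((\<lambda>x. r \<odot>\<^bsub>D\<^esub> x) ` S))"
  "grade (homology D) j = (\<lambda>z. boundaries D +>\<^bsub>D\<^esub> z) ` (cycles D \<inter> grade D j)"
  by (simp_all add: homology_def)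

context diff_module begin

text \<open>The component of degree \<open>j\<close> of a homology class is the class of the component of degree \<open>j\<close> of any cycle
  in it, because components of boundaries are boundaries.\<close>

lemma homology_graded_module: "graded_module R (homology D)"
  and cls_hom: "cls \<in> graded_hom R (restrict_module D (cycles D)) (homology D)"
proof -
  let ?H = "homology D"
  have cc: "x \<in> cycles D \<Longrightarrow> x \<in> carrier D" for x by (rule cycles_closed(1))
  have ab: "abelian_group ?H"
  proof (rule abelian_groupI)
    fix S assume "S \<in> carrier ?H"
    then obtain x where x: "x \<in> cycles D" "S = cls x" by auto
    have "cls (\<ominus>\<^bsub>D\<^esub> x) \<oplus>\<^bsub>?H\<^esub> S = \<zero>\<^bsub>?H\<^esub>"
      using x cc[OF x(1)] by (simp add: cls_add M.l_neg cls_zero)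
    then show "\<exists>T\<in>carrier ?H. T \<oplus>\<^bsub>?H\<^esub> S = \<zero>\<^bsub>?H\<^esub>"
      using submod_neg[OF gsubD(1)[OF cycles_gsub] x(1)] by (auto simp del: homology_simps(2,3))
  next
    show "\<zero>\<^bsub>?H\<^esub> \<in> carrier ?H" using cycles_closed(2) cls_zero by (auto simp: image_iff intro!: bexI[of _ "\<zero>\<^bsub>D\<^esub>"])
  next
    fix S assume "S \<in> carrier ?H"
    then obtain x where x: "x \<in> cycles D" "S = cls x" by auto
    have "cls \<zero>\<^bsub>D\<^esub> <+>\<^bsub>D\<^esub> cls x = cls x" using cls_add[of "\<zero>\<^bsub>D\<^esub>" x] cc[OF x(1)] by simp
    then show "\<zero>\<^bsub>?H\<^esub> \<oplus>\<^bsub>?H\<^esub> S = S" using x cls_zero by simp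
  qed (auto simp: cls_add cc cycles_closed M.a_ac)
  interpret H: abelian_group ?H by fact
  let ?Z = "restrict_module D (cycles D)"
  have Z: "graded_module R ?Z" by (rule restrict_graded_module(1)[OF d_graded cycles_gsub])
  interpret Z: graded_module R ?Z by fact
  have ch: "cls \<in> add_hom ?Z ?H" by (rule add_homI) (auto simp: cls_add cc)
  define p where "p j S = cls (mpart D j (SOME x. x \<in> cycles D \<and> S = cls x))" for j S
  have p: "p j (cls x) = cls (mpart D j x)" if x: "x \<in> cycles D" for j x
  proof -
    let ?y = "SOME y. y \<in> cycles D \<and> cls x = cls y"
    have y: "?y \<in> cycles D \<and> cls x = cls ?y" by (rule someI[of _ x]) (use x in simp)
    then have "?y \<ominus>\<^bsub>D\<^esub> x \<in> boundaries D" using cls_eq_iff[of ?y x] cc x by auto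
    then have "mpart D j (?y \<ominus>\<^bsub>D\<^esub> x) \<in> boundaries D" by (rule gsubD(2)[OF boundaries_gsub])
    then have "mpart D j ?y \<ominus>\<^bsub>D\<^esub> mpart D j x \<in> boundaries D"
      using md.dpart_minus[of ?y x j] cc y x by simp
    then show ?thesis unfolding p_def using cls_eq_iff md.dpart_carrier cc y x by simp
  qed
  have neg: "\<ominus>\<^bsub>?H\<^esub> cls x = cls (\<ominus>\<^bsub>D\<^esub> x)" if x: "x \<in> cycles D" for x
  proof -
    have "cls (\<ominus>\<^bsub>D\<^esub> x) \<oplus>\<^bsub>?H\<^esub> cls x = \<zero>\<^bsub>?H\<^esub>" using x cc[OF x] by (simp add: cls_add M.l_neg cls_zero)
    then show ?thesis
      using H.minus_equality[of "cls (\<ominus>\<^bsub>D\<^esub> x)" "cls x"] x submod_neg[OF gsubD(1)[OF cycles_gsub] x] by auto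
  qed
  have sub: "additive_subgroup (grade ?H j) ?H" for j
  proof (rule H.additive_subgroupI')
    show "\<zero>\<^bsub>?H\<^esub> \<in> grade ?H j"
      using cycles_closed(2) md.G_zero[of j] cls_zero by (auto simp: image_iff intro!: bexI[of _ "\<zero>\<^bsub>D\<^esub>"])
  next
    fix S T assume "S \<in> grade ?H j" "T \<in> grade ?H j"
    then obtain x y where xy: "x \<in> cycles D" "x \<in> grade D j" "S = cls x" "y \<in> cycles D" "y \<in> grade D j" "T = cls y"
      by auto
    then show "S \<oplus>\<^bsub>?H\<^esub> T \<in> grade ?H j"
      using cycles_closed(3)[of x y] md.G_add[of x j y] by (auto simp: cls_add cc)
  next
    fix S assume "S \<in> grade ?H j"
    then obtain x where x: "x \<in> cycles D" "x \<in> grade D j" "S = cls x" by auto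
    then show "\<ominus>\<^bsub>?H\<^esub> S \<in> grade ?H j"
      using neg[OF x(1)] submod_neg[OF gsubD(1)[OF cycles_gsub] x(1)] md.G_neg[of x j] by auto
  qed auto
  have pc: "p j S \<in> grade ?H j" if "S \<in> carrier ?H" for j S
    using that p gsubD(2)[OF cycles_gsub] md.dpart_in cc by auto
  have p1: "p j \<in> add_hom ?H ?H" for j
  proof (rule add_homI)
    show "S \<in> carrier ?H \<Longrightarrow> p j S \<in> carrier ?H" for S using pc[of S j] by auto
    fix S T assume "S \<in> carrier ?H" "T \<in> carrier ?H"
    then obtain x y where xy: "x \<in> cycles D" "S = cls x" "y \<in> cycles D" "T = cls y" by auto
    then show "p j (S \<oplus>\<^bsub>?H\<^esub> T) = p j S \<oplus>\<^bsub>?H\<^esub> p j T"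
      using cycles_closed(3)[of x y] by (simp add: cls_add cc p md.dpart_carrier md.dpart_add)
  qed
  have p3: "p k S = (if k = j then S else \<zero>\<^bsub>?H\<^esub>)" if "S \<in> grade ?H j" for j k S
    using that by (auto simp: p md.dpart_homog cls_zero)
  have p4: "\<exists>A. finite A \<and> (\<forall>j. j \<notin> A \<longrightarrow> p j S = \<zero>\<^bsub>?H\<^esub>) \<and> S = finsum ?H (\<lambda>j. p j S) A"
    if S: "S \<in> carrier ?H" for S
  proof -
    obtain x where x: "x \<in> cycles D" "S = cls x" using S by auto
    let ?A = "{j. mpart D j x \<noteq> \<zero>\<^bsub>D\<^esub>}"
    have mz: "mpart D j x \<in> cycles D" for j using gsubD(2)[OF cycles_gsub x(1)] .
    have "finsum ?Z (\<lambda>j. mpart D j x) ?A = finsum D (\<lambda>j. mpart D j x) ?A"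
      by (rule restrict_finsum[OF M.abelian_group_axioms Z.M.abelian_group_axioms]) (use cc mz in auto)
    then have "x = finsum ?Z (\<lambda>j. mpart D j x) ?A" using md.dpart_sum[OF cc[OF x(1)]] by simp
    then have "S = cls (finsum ?Z (\<lambda>j. mpart D j x) ?A)" using x(2) by simp
    also have "\<dots> = finsum ?H (\<lambda>j. cls (mpart D j x)) ?A"
      by (rule add_hom_finsum[OF Z.M.abelian_group_axioms ab ch]) (use mz in auto)
    also have "\<dots> = finsum ?H (\<lambda>j. p j S) ?A" using p[OF x(1)] x(2) by simp
    finally have "S = finsum ?H (\<lambda>j. p j S) ?A" .
    moreover have "p j S = \<zero>\<^bsub>?H\<^esub>" if "j \<notin> ?A" for j using that p[OF x(1)] x(2) cls_zero by simp
    ultimately show ?thesis using md.dpart_finite[OF cc[OF x(1)]] by blast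
  qed
  note D = H.direct_sumI[OF sub p1 pc p3 p4]
  show G: "graded_module R ?H"
  proof (rule graded_moduleI[OF graded_ring_axioms ab])
    show "is_direct_sum ?H (grade ?H)" by (rule D(1))
  next
    fix r S i j assume r: "r \<in> rgrade R i" and "S \<in> grade ?H j"
    then obtain x where x: "x \<in> cycles D" "x \<in> grade D j" "S = cls x" by auto
    have rc: "r \<in> carrier R" using r rd.G_in_carrier[of r "int i"] by (simp add: rgr_def)
    then show "r \<odot>\<^bsub>?H\<^esub> S \<in> grade ?H (int i + j)"
      using x smult_degree[OF r x(2)] cycles_closed(4)[OF rc x(1)] by (simp add: cls_smult cc)
  next
    fix r s S assume "r \<in> carrier R" "s \<in> carrier R" "S \<in> carrier ?H"
    then show "(r \<oplus>\<^bsub>R\<^esub> s) \<odot>\<^bsub>?H\<^esub> S = r \<odot>\<^bsub>?H\<^esub> S \<oplus>\<^bsub>?H\<^esub> s \<odot>\<^bsub>?H\<^esub> S"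
      "(r \<otimes>\<^bsub>R\<^esub> s) \<odot>\<^bsub>?H\<^esub> S = r \<odot>\<^bsub>?H\<^esub> (s \<odot>\<^bsub>?H\<^esub> S)"
      by (auto simp: cls_smult cls_add cc smult_closed smult_l_distr smult_assoc)
  qed (auto simp: cls_smult cls_add cc smult_closed smult_r_distr smult_one cycles_closed)
  show "cls \<in> graded_hom R ?Z ?H"
    by (rule graded_homI) (auto simp: cls_smult cls_add cc)
qed

end

section \<open>The mapping cone and quasi-isomorphisms\<close>

lemma diff_homD:
  assumes "f \<in> diff_hom R D E"
  shows "f \<in> graded_hom R D E" "x \<in> carrier D \<Longrightarrow> f (diff D x) = diff E (f x)"
  using assms by (auto simp: diff_hom_def)

text \<open>The mapping cone of \<open>q : N \<rightarrow> D\<close>. Its second summand is twisted by \<open>a\<close>, which makes the differential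
  homogeneous of degree \<open>a\<close>.\<close>

definition cone :: "int \<Rightarrow> ('r, 'd) diff_module \<Rightarrow> ('r, 'n) diff_module \<Rightarrow> ('n \<Rightarrow> 'd) \<Rightarrow> ('r, 'd \<times> 'n) diff_module"
  where "cone a D N q =
    \<lparr>carrier = carrier D \<times> carrier N, mult = undefined, one = undefined, zero = (\<zero>\<^bsub>D\<^esub>, \<zero>\<^bsub>N\<^esub>),
     add = (\<lambda>u v. (fst u \<oplus>\<^bsub>D\<^esub> fst v, snd u \<oplus>\<^bsub>N\<^esub> snd v)),
     smult = (\<lambda>r u. (r \<odot>\<^bsub>D\<^esub> fst u, r \<odot>\<^bsub>N\<^esub> snd u)),
     grade = (\<lambda>j. grade D j \<times> grade N (j + a)),
     diff = (\<lambda>u. (q (snd u) \<ominus>\<^bsub>D\<^esub> diff D (fst u), diff N (snd u)))\<rparr>"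

lemma cone_simps [simp]:
  "carrier (cone a D N q) = carrier D \<times> carrier N" "zero (cone a D N q) = (\<zero>\<^bsub>D\<^esub>, \<zero>\<^bsub>N\<^esub>)"
  "add (cone a D N q) u v = (fst u \<oplus>\<^bsub>D\<^esub> fst v, snd u \<oplus>\<^bsub>N\<^esub> snd v)"
  "smult (cone a D N q) r u = (r \<odot>\<^bsub>D\<^esub> fst u, r \<odot>\<^bsub>N\<^esub> snd u)"
  "grade (cone a D N q) j = grade D j \<times> grade N (j + a)"
  "diff (cone a D N q) u = (q (snd u) \<ominus>\<^bsub>D\<^esub> diff D (fst u), diff N (snd u))"
  by (simp_all add: cone_def)

lemma cone_abelian:
  assumes D: "abelian_group D" and N: "abelian_group N"
  shows "abelian_group (cone a D N q)"
proof -
  interpret D: abelian_group D by fact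
  interpret N: abelian_group N by fact
  show ?thesis
  proof (rule abelian_groupI)
    fix u assume "u \<in> carrier (cone a D N q)"
    then show "\<exists>v\<in>carrier (cone a D N q). v \<oplus>\<^bsub>cone a D N q\<^esub> u = \<zero>\<^bsub>cone a D N q\<^esub>"
      by (intro bexI[of _ "(\<ominus>\<^bsub>D\<^esub> fst u, \<ominus>\<^bsub>N\<^esub> snd u)"]) (auto simp: D.l_neg N.l_neg)
  qed (auto simp: D.a_ac N.a_ac)
qed

lemma cone_graded_module:
  assumes D: "graded_module R D" and N: "graded_module R N"
  shows "graded_module R (cone a D N q)"
    "u \<in> carrier (cone a D N q) \<Longrightarrow> mpart (cone a D N q) j u = (mpart D j (fst u), mpart N (j + a) (snd u))"
    "u \<in> carrier (cone a D N q) \<Longrightarrow> \<ominus>\<^bsub>cone a D N q\<^esub> u = (\<ominus>\<^bsub>D\<^esub> fst u, \<ominus>\<^bsub>N\<^esub> snd u)"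
proof -
  let ?C = "cone a D N q"
  interpret D: graded_module R D by fact
  interpret N: graded_module R N by fact
  have ab: "abelian_group ?C" by (rule cone_abelian[OF D.M.abelian_group_axioms N.M.abelian_group_axioms])
  interpret C: abelian_group ?C by fact
  have h1: "fst \<in> add_hom ?C D" and h2: "snd \<in> add_hom ?C N" by (auto simp: add_hom_def)
  show neg: "\<ominus>\<^bsub>?C\<^esub> u = (\<ominus>\<^bsub>D\<^esub> fst u, \<ominus>\<^bsub>N\<^esub> snd u)" if "u \<in> carrier ?C" for u
    using add_hom_neg[OF ab D.M.abelian_group_axioms h1 that] add_hom_neg[OF ab N.M.abelian_group_axioms h2 that]
    by (simp add: prod_eq_iff)
  have neg': "\<ominus>\<^bsub>?C\<^esub> u = (\<ominus>\<^bsub>D\<^esub> fst u, \<ominus>\<^bsub>N\<^esub> snd u)" if "u \<in> grade ?C j" for u j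
    using that by (intro neg) (auto simp: D.md.G_in_carrier N.md.G_in_carrier)
  have sub: "additive_subgroup (grade ?C j) ?C" for j
  proof (rule C.additive_subgroupI')
    fix u assume "u \<in> grade ?C j"
    then show "\<ominus>\<^bsub>?C\<^esub> u \<in> grade ?C j" using neg'[of u j] by (auto simp: D.md.G_neg N.md.G_neg)
  qed (auto simp: D.md.G_in_carrier N.md.G_in_carrier D.md.G_zero N.md.G_zero D.md.G_add N.md.G_add)
  let ?p = "\<lambda>j u. (mpart D j (fst u), mpart N (j + a) (snd u))"
  have p1: "?p j \<in> add_hom ?C ?C" for j
    by (rule add_homI) (auto simp: D.md.dpart_carrier N.md.dpart_carrier D.md.dpart_add N.md.dpart_add)
  have p2: "?p j u \<in> grade ?C j" if "u \<in> carrier ?C" for j u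
    using that by (auto simp: D.md.dpart_in N.md.dpart_in)
  have p3: "?p k u = (if k = j then u else \<zero>\<^bsub>?C\<^esub>)" if "u \<in> grade ?C j" for j k u
    using that by (auto simp: D.md.dpart_homog N.md.dpart_homog)
  have p4: "\<exists>A. finite A \<and> (\<forall>j. j \<notin> A \<longrightarrow> ?p j u = \<zero>\<^bsub>?C\<^esub>) \<and> u = finsum ?C (\<lambda>j. ?p j u) A"
    if u: "u \<in> carrier ?C" for u
  proof -
    have u': "fst u \<in> carrier D" "snd u \<in> carrier N" using u by auto
    let ?A = "{j. mpart D j (fst u) \<noteq> \<zero>\<^bsub>D\<^esub>} \<union> (\<lambda>j. j - a) ` {j. mpart N j (snd u) \<noteq> \<zero>\<^bsub>N\<^esub>}"
    have fin: "finite ?A" using D.md.dpart_finite[OF u'(1)] N.md.dpart_finite[OF u'(2)] by simp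
    have outN: "mpart N (j + a) (snd u) = \<zero>\<^bsub>N\<^esub>" if "j \<notin> ?A" for j
    proof (rule ccontr)
      assume "mpart N (j + a) (snd u) \<noteq> \<zero>\<^bsub>N\<^esub>"
      then have "j + a - a \<in> (\<lambda>j. j - a) ` {j. mpart N j (snd u) \<noteq> \<zero>\<^bsub>N\<^esub>}" by blast
      then show False using that by simp
    qed
    have pc: "(\<lambda>j. ?p j u) \<in> ?A \<rightarrow> carrier ?C" using u' by (auto simp: D.md.dpart_carrier N.md.dpart_carrier)
    have "fst (finsum ?C (\<lambda>j. ?p j u) ?A) = finsum D (\<lambda>j. mpart D j (fst u)) ?A"
      using add_hom_finsum[OF ab D.M.abelian_group_axioms h1 pc] by simp
    also have "\<dots> = fst u" by (rule D.md.dpart_sum_superset[OF u'(1) fin]) auto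
    finally have 1: "fst (finsum ?C (\<lambda>j. ?p j u) ?A) = fst u" .
    have "snd (finsum ?C (\<lambda>j. ?p j u) ?A) = finsum N (\<lambda>j. mpart N (j + a) (snd u)) ?A"
      using add_hom_finsum[OF ab N.M.abelian_group_axioms h2 pc] by simp
    also have "\<dots> = finsum N (\<lambda>j. mpart N j (snd u)) ((\<lambda>j. j + a) ` ?A)"
      by (rule N.M.finsum_reindex[symmetric]) (use u' in \<open>auto simp: inj_on_def N.md.dpart_carrier\<close>)
    also have "\<dots> = snd u"
    proof (rule N.md.dpart_sum_superset[OF u'(2)])
      fix j assume "j \<notin> (\<lambda>j. j + a) ` ?A"
      then have "j - a \<notin> ?A" using image_eqI[of j "\<lambda>j. j + a" "j - a" ?A] by auto
      then show "mpart N j (snd u) = \<zero>\<^bsub>N\<^esub>" using outN[of "j - a"] by simp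
    qed (use fin in simp)
    finally have 2: "snd (finsum ?C (\<lambda>j. ?p j u) ?A) = snd u" .
    have "u = finsum ?C (\<lambda>j. ?p j u) ?A" using 1 2 by (simp add: prod_eq_iff)
    moreover have "?p j u = \<zero>\<^bsub>?C\<^esub>" if "j \<notin> ?A" for j using outN[OF that] that by simp
    ultimately show ?thesis using fin by blast
  qed
  note P = C.direct_sumI[OF sub p1 p2 p3 p4]
  show "u \<in> carrier ?C \<Longrightarrow> mpart ?C j u = ?p j u" by (rule P(3))
  show "graded_module R ?C"
  proof (rule graded_moduleI[OF D.graded_ring_axioms ab])
    show "is_direct_sum ?C (grade ?C)" by (rule P(1))
  next
    fix r u i j assume "r \<in> rgrade R i" "u \<in> grade ?C j"
    then show "r \<odot>\<^bsub>?C\<^esub> u \<in> grade ?C (int i + j)"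
      using D.smult_degree[of r i "fst u" j] N.smult_degree[of r i "snd u" "j + a"] by (auto simp: add.assoc)
  qed (use left_module_smult_facts[OF D] left_module_smult_facts[OF N] in auto)
qed

lemma cone_diff_module:
  assumes D: "diff_module R a D" and N: "diff_module R a N" and q: "q \<in> diff_hom R N D"
  shows "diff_module R a (cone a D N q)"
proof -
  let ?C = "cone a D N q"
  interpret D: diff_module R a D by fact
  interpret N: diff_module R a N by fact
  note Q = graded_homD[OF diff_homD(1)[OF q]]
  have C: "graded_module R ?C" by (rule cone_graded_module(1)[OF D.d_graded N.d_graded])
  show ?thesis
  proof (rule diff_moduleI[OF C])
    fix u assume "u \<in> carrier ?C"
    then have u: "fst u \<in> carrier D" "snd u \<in> carrier N" by auto
    have e: "q (diff N (snd u)) = diff D (q (snd u))" using diff_homD(2)[OF q u(2)] .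
    have "diff D (q (snd u) \<ominus>\<^bsub>D\<^esub> diff D (fst u)) = diff D (q (snd u)) \<ominus>\<^bsub>D\<^esub> \<zero>\<^bsub>D\<^esub>"
      using u Q(2) by (simp add: D.d_minus D.d_simps)
    then show "diff ?C (diff ?C u) = \<zero>\<^bsub>?C\<^esub>"
      using u Q(2) e by (simp add: N.d_simps D.d_simps a_minus_def D.M.a_inv_zero D.M.r_neg)
  next
    show "diff ?C \<in> graded_hom R ?C (twist ?C a)"
    proof (rule graded_homI)
      fix u v assume "u \<in> carrier ?C" "v \<in> carrier ?C"
      then have uv: "fst u \<in> carrier D" "snd u \<in> carrier N" "fst v \<in> carrier D" "snd v \<in> carrier N" by auto
      then have c: "q (snd u) \<in> carrier D" "q (snd v) \<in> carrier D" "diff D (fst u) \<in> carrier D" "diff D (fst v) \<in> carrier D"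
        using Q(2) D.d_simps by auto
      have "(q (snd u) \<oplus>\<^bsub>D\<^esub> q (snd v)) \<ominus>\<^bsub>D\<^esub> (diff D (fst u) \<oplus>\<^bsub>D\<^esub> diff D (fst v)) =
        (q (snd u) \<ominus>\<^bsub>D\<^esub> diff D (fst u)) \<oplus>\<^bsub>D\<^esub> (q (snd v) \<ominus>\<^bsub>D\<^esub> diff D (fst v))"
        using c by algebra
      then show "diff ?C (u \<oplus>\<^bsub>?C\<^esub> v) = diff ?C u \<oplus>\<^bsub>twist ?C a\<^esub> diff ?C v"
        using uv by (simp add: Q D.d_simps N.d_simps)
    next
      fix r u assume r: "r \<in> carrier R" and "u \<in> carrier ?C"
      then have u: "fst u \<in> carrier D" "snd u \<in> carrier N" by auto
      then show "diff ?C (r \<odot>\<^bsub>?C\<^esub> u) = r \<odot>\<^bsub>twist ?C a\<^esub> diff ?C u"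
        using r by (simp add: Q D.d_simps N.d_simps D.smult_r_minus)
    next
      fix u j assume "u \<in> grade ?C j"
      then have u: "fst u \<in> grade D j" "snd u \<in> grade N (j + a)" by auto
      have "q (snd u) \<in> grade D (a + j)" using Q(5)[OF u(2)] by (simp add: add.commute)
      then show "diff ?C u \<in> grade (twist ?C a) j"
        using u diff_moduleD(7)[OF D u(1)] diff_moduleD(7)[OF N u(2)]
        by (auto simp: add_ac intro!: D.md.G_minus)
    qed (auto simp: Q D.d_simps N.d_simps)
  qed
qed

lemma cone_cycles:
  assumes D: "diff_module R a D" and q: "q \<in> diff_hom R N D"
  shows "(d, x) \<in> cycles (cone a D N q) \<longleftrightarrow>
    d \<in> carrier D \<and> x \<in> carrier N \<and> diff N x = \<zero>\<^bsub>N\<^esub> \<and> q x = diff D d"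
proof -
  interpret D: diff_module R a D by fact
  show ?thesis
    using graded_homD(2)[OF diff_homD(1)[OF q], of x] D.d_simps(1)[of d] D.M.minus_eq_zero_iff[of "q x" "diff D d"]
    by (auto simp: cycles_def)
qed

lemma cone_boundaries:
  "(d, x) \<in> boundaries (cone a D N q) \<longleftrightarrow>
    (\<exists>d'\<in>carrier D. \<exists>x'\<in>carrier N. d = q x' \<ominus>\<^bsub>D\<^esub> diff D d' \<and> x = diff N x')"
  by (force simp: boundaries_def)

lemma homology_map_cls:
  assumes N: "diff_module R a N" and D: "diff_module R a D" and q: "q \<in> diff_hom R N D" and z: "z \<in> carrier N"
  shows "homology_map D q (boundaries N +>\<^bsub>N\<^esub> z) = boundaries D +>\<^bsub>D\<^esub> q z"
proof -
  interpret D: diff_module R a D by fact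
  interpret N: diff_module R a N by fact
  note Q = graded_homD[OF diff_homD(1)[OF q]]
  have qb: "q b \<in> boundaries D" if "b \<in> boundaries N" for b
    using that diff_homD(2)[OF q] Q(2) by (auto simp: boundaries_def)
  show ?thesis
  proof (intro equalityI subsetI)
    fix y assume "y \<in> homology_map D q (boundaries N +>\<^bsub>N\<^esub> z)"
    then obtain b c where bc: "b \<in> boundaries D" "c \<in> boundaries N" "y = b \<oplus>\<^bsub>D\<^esub> q (c \<oplus>\<^bsub>N\<^esub> z)"
      by (auto simp: homology_map_def set_add_def' N.mem_cls)
    have cc: "c \<in> carrier N" "b \<in> carrier D" "q c \<in> carrier D" using bc N.boundaries_closed(1) D.boundaries_closed(1) Q(2) by auto
    have "y = (b \<oplus>\<^bsub>D\<^esub> q c) \<oplus>\<^bsub>D\<^esub> q z" using bc(3) cc z Q(2,3) by (simp add: D.M.a_assoc)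
    then show "y \<in> boundaries D +>\<^bsub>D\<^esub> q z"
      using D.boundaries_closed(3)[OF bc(1) qb[OF bc(2)]] D.mem_cls by blast
  next
    fix y assume "y \<in> boundaries D +>\<^bsub>D\<^esub> q z"
    then obtain b where b: "b \<in> boundaries D" "y = b \<oplus>\<^bsub>D\<^esub> q z" by (auto simp: D.mem_cls)
    have "z = \<zero>\<^bsub>N\<^esub> \<oplus>\<^bsub>N\<^esub> z" using z by simp
    then have "z \<in> boundaries N +>\<^bsub>N\<^esub> z" using N.boundaries_closed(2) N.mem_cls by blast
    then show "y \<in> homology_map D q (boundaries N +>\<^bsub>N\<^esub> z)"
      using b unfolding homology_map_def set_add_def' by blast
  qed
qed

text \<open>The part of the long exact homology sequence of the cone which says that \<open>q\<close> is an isomorphism on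
  homology if and only if the cone is acyclic.\<close>

lemma quasi_iso_iff:
  assumes N: "diff_module R a N" and D: "diff_module R a D"
  shows "quasi_iso R N D q \<longleftrightarrow>
    q \<in> diff_hom R N D \<and> cycles (cone a D N q) \<subseteq> boundaries (cone a D N q)"
proof (cases "q \<in> diff_hom R N D")
  case True
  note q = this
  interpret D: diff_module R a D by fact
  interpret N: diff_module R a N by fact
  note Q = graded_homD[OF diff_homD(1)[OF q]] and qd = diff_homD(2)[OF q]
  note hm = homology_map_cls[OF N D q]
  note Nc = N.cycles_closed(1) and Dc = D.cycles_closed(1)
  note Dz = D.graded_module_axioms and Nz = N.graded_module_axioms
  have q0: "q \<zero>\<^bsub>N\<^esub> = \<zero>\<^bsub>D\<^esub>" by (rule graded_hom_zero[OF Nz Dz diff_homD(1)[OF q]])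
  have qcyc: "q z \<in> cycles D" if z: "z \<in> cycles N" for z
    using z qd[of z] q0 Q(2) by (auto simp: cycles_def)
  have hom: "homology_map D q \<in> graded_hom R (homology N) (homology D)"
  proof (rule graded_homI)
    fix S T assume "S \<in> carrier (homology N)" "T \<in> carrier (homology N)"
    then show "homology_map D q (S \<oplus>\<^bsub>homology N\<^esub> T) = homology_map D q S \<oplus>\<^bsub>homology D\<^esub> homology_map D q T"
      by (auto simp: N.cls_add hm Nc D.cls_add Q)
  next
    fix r S assume "r \<in> carrier R" "S \<in> carrier (homology N)"
    then show "homology_map D q (r \<odot>\<^bsub>homology N\<^esub> S) = r \<odot>\<^bsub>homology D\<^esub> homology_map D q S"
      by (auto simp: N.cls_smult hm Nc D.cls_smult Q N.smult_closed)
  next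
    fix S assume "S \<in> carrier (homology N)"
    then show "homology_map D q S \<in> carrier (homology D)" using qcyc Nc by (auto simp: hm)
  next
    fix S j assume "S \<in> grade (homology N) j"
    then show "homology_map D q S \<in> grade (homology D) j" using qcyc Nc Q(5) by (auto simp: hm)
  qed
  have bij: "bij_betw (homology_map D q) (carrier (homology N)) (carrier (homology D)) \<longleftrightarrow>
      cycles (cone a D N q) \<subseteq> boundaries (cone a D N q)"
  proof
    assume b: "bij_betw (homology_map D q) (carrier (homology N)) (carrier (homology D))"
    show "cycles (cone a D N q) \<subseteq> boundaries (cone a D N q)"
    proof (rule subrelI)
      fix d x assume "(d, x) \<in> cycles (cone a D N q)"
      then have dx: "d \<in> carrier D" "x \<in> carrier N" "diff N x = \<zero>\<^bsub>N\<^esub>" "q x = diff D d"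
        using cone_cycles[OF D q] by auto
      have xc: "x \<in> cycles N" using dx by (simp add: cycles_def)
      have "q x \<in> boundaries D" using dx by (auto simp: boundaries_def)
      then have "homology_map D q (N.cls x) = homology_map D q (N.cls \<zero>\<^bsub>N\<^esub>)"
        using dx q0 Q(2) D.cls_boundary[of "q x"] D.d_simps(1)[OF dx(1)] by (simp add: hm D.cls_zero)
      moreover have "inj_on (homology_map D q) (carrier (homology N))" using b by (simp add: bij_betw_def)
      ultimately have "N.cls x = N.cls \<zero>\<^bsub>N\<^esub>"
        using inj_onD[of "homology_map D q" "carrier (homology N)" "N.cls x" "N.cls \<zero>\<^bsub>N\<^esub>"] xc N.cycles_closed(2) by auto
      then have "x \<in> boundaries N" using N.cls_boundary[OF dx(2)] N.cls_zero by simp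
      then obtain x' where x': "x' \<in> carrier N" "x = diff N x'" by (auto simp: boundaries_def)
      have "diff D (d \<ominus>\<^bsub>D\<^esub> q x') = q x \<ominus>\<^bsub>D\<^esub> q x"
        using dx(1) x' Q(2) qd[OF x'(1)] dx(4)[symmetric] by (simp add: D.d_minus)
      then have "d \<ominus>\<^bsub>D\<^esub> q x' \<in> cycles D"
        using dx x' Q(2) D.d_simps(1)[OF dx(1)] by (simp add: cycles_def a_minus_def D.M.r_neg)
      then have "D.cls (d \<ominus>\<^bsub>D\<^esub> q x') \<in> homology_map D q ` carrier (homology N)"
        using b by (auto simp: bij_betw_def)
      then obtain z where z: "z \<in> cycles N" "D.cls (d \<ominus>\<^bsub>D\<^esub> q x') = D.cls (q z)" using hm Nc by auto
      have zc: "z \<in> carrier N" "diff N z = \<zero>\<^bsub>N\<^esub>" using z(1) by (auto simp: cycles_def)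
      have c: "q x' \<in> carrier D" "q z \<in> carrier D" using Q(2) x' zc by auto
      have "(d \<ominus>\<^bsub>D\<^esub> q x') \<ominus>\<^bsub>D\<^esub> q z \<in> boundaries D" using D.cls_eq_iff[of "d \<ominus>\<^bsub>D\<^esub> q x'" "q z"] z(2) dx(1) c by auto
      then obtain d' where d': "d' \<in> carrier D" "(d \<ominus>\<^bsub>D\<^esub> q x') \<ominus>\<^bsub>D\<^esub> q z = diff D d'" by (auto simp: boundaries_def)
      have "d = (q x' \<oplus>\<^bsub>D\<^esub> q z) \<oplus>\<^bsub>D\<^esub> ((d \<ominus>\<^bsub>D\<^esub> q x') \<ominus>\<^bsub>D\<^esub> q z)" using dx(1) c by algebra
      also have "\<dots> = q (x' \<oplus>\<^bsub>N\<^esub> z) \<ominus>\<^bsub>D\<^esub> diff D (\<ominus>\<^bsub>D\<^esub> d')"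
        using d' x' zc c by (simp add: Q D.d_neg a_minus_def D.d_simps)
      finally have "d = q (x' \<oplus>\<^bsub>N\<^esub> z) \<ominus>\<^bsub>D\<^esub> diff D (\<ominus>\<^bsub>D\<^esub> d')" .
      moreover have "x = diff N (x' \<oplus>\<^bsub>N\<^esub> z)" using x' zc N.d_simps(3)[of x' z] N.d_simps(1)[of x'] by simp
      ultimately show "(d, x) \<in> boundaries (cone a D N q)"
        unfolding cone_boundaries using d'(1) x'(1) zc(1)
        by (intro bexI[of _ "\<ominus>\<^bsub>D\<^esub> d'"] bexI[of _ "x' \<oplus>\<^bsub>N\<^esub> z"] conjI) auto
    qed
  next
    assume ac: "cycles (cone a D N q) \<subseteq> boundaries (cone a D N q)"
    have "inj_on (homology_map D q) (carrier (homology N))"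
    proof (rule inj_onI)
      fix S T assume "S \<in> carrier (homology N)" "T \<in> carrier (homology N)" and eq: "homology_map D q S = homology_map D q T"
      then obtain x y where xy: "x \<in> cycles N" "S = N.cls x" "y \<in> cycles N" "T = N.cls y" by auto
      then have xyc: "x \<in> carrier N" "y \<in> carrier N" "diff N x = \<zero>\<^bsub>N\<^esub>" "diff N y = \<zero>\<^bsub>N\<^esub>" by (auto simp: cycles_def)
      have "q x \<ominus>\<^bsub>D\<^esub> q y \<in> boundaries D" using eq xy(2,4) D.cls_eq_iff Q(2) xyc by (simp add: hm)
      then obtain d where d: "d \<in> carrier D" "q x \<ominus>\<^bsub>D\<^esub> q y = diff D d" by (auto simp: boundaries_def)
      have dz: "diff N (x \<ominus>\<^bsub>N\<^esub> y) = \<zero>\<^bsub>N\<^esub>"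
        using xyc by (simp add: N.d_minus N.M.minus_eq_zero_iff)
      have "(d, x \<ominus>\<^bsub>N\<^esub> y) \<in> cycles (cone a D N q)"
        unfolding cone_cycles[OF D q]
        using d xyc dz graded_hom_minus[OF Nz Dz diff_homD(1)[OF q] xyc(1,2)] by simp
      then have "x \<ominus>\<^bsub>N\<^esub> y \<in> boundaries N" using ac cone_boundaries[of d "x \<ominus>\<^bsub>N\<^esub> y"] by (auto simp: boundaries_def)
      then show "S = T" using N.cls_eq_iff xyc xy by simp
    qed
    moreover have "homology_map D q ` carrier (homology N) = carrier (homology D)"
    proof (intro equalityI subsetI)
      fix S assume "S \<in> carrier (homology D)"
      then obtain d where d: "d \<in> cycles D" "S = D.cls d" by auto
      then have dc: "d \<in> carrier D" "diff D d = \<zero>\<^bsub>D\<^esub>" by (auto simp: cycles_def)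
      have "(d, \<zero>\<^bsub>N\<^esub>) \<in> cycles (cone a D N q)" unfolding cone_cycles[OF D q] using dc q0 by simp
      then have "(d, \<zero>\<^bsub>N\<^esub>) \<in> boundaries (cone a D N q)" using ac by blast
      then obtain d' x' where *: "d' \<in> carrier D" "x' \<in> carrier N" "d = q x' \<ominus>\<^bsub>D\<^esub> diff D d'" "diff N x' = \<zero>\<^bsub>N\<^esub>"
        unfolding cone_boundaries by metis
      have c: "q x' \<in> carrier D" "diff D d' \<in> carrier D" using * Q(2) D.d_simps by auto
      have "q x' \<ominus>\<^bsub>D\<^esub> d = diff D d'" unfolding *(3) using c by algebra
      then have "q x' \<ominus>\<^bsub>D\<^esub> d \<in> boundaries D" using * by (auto simp: boundaries_def)
      then have "D.cls (q x') = D.cls d" using D.cls_eq_iff[OF c(1) dc(1)] by blast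
      then have "S = D.cls (q x')" using d(2) by simp
      also have "\<dots> = homology_map D q (N.cls x')" using hm *(2) by simp
      finally show "S \<in> homology_map D q ` carrier (homology N)" using * by (auto simp: cycles_def)
    qed (use hom in \<open>auto simp: graded_hom_def\<close>)
    ultimately show "bij_betw (homology_map D q) (carrier (homology N)) (carrier (homology D))"
      by (simp add: bij_betw_def)
  qed
  show ?thesis using q hom bij by (simp add: quasi_iso_def graded_iso_def)
qed (simp add: quasi_iso_def)

section \<open>Free flags and homotopies\<close>

text \<open>A free flag seen through its basis: the differential of a basis element involves only basis elements of
  smaller rank. This is the form in which maps out of a flag are constructed.\<close>

definition ranked_basis :: "'r graded_ring \<Rightarrow> ('r, 'm) diff_module \<Rightarrow> 'm set \<Rightarrow> ('m \<Rightarrow> nat) \<Rightarrow> bool"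
  where "ranked_basis R F B rk \<longleftrightarrow> homogeneous_basis R F B \<and>
    (\<forall>b\<in>B. diff F b \<in> spn R F {b'\<in>B. rk b' < rk b})"

lemma internal_sum_least:
  assumes "left_module R M" "submod R M N" "\<And>i. i \<in> I \<Longrightarrow> G i \<subseteq> N"
  shows "internal_sum M I G \<subseteq> N"
proof
  interpret left_module R M by fact
  fix x assume "x \<in> internal_sum M I G"
  then obtain f J where *: "x = finsum M f J" "finite J" "J \<subseteq> I" "f \<in> (\<Pi> i\<in>J. G i)"
    by (auto simp: internal_sum_def)
  have "f \<in> J \<rightarrow> N" using *(3,4) assms(3) by blast
  then show "x \<in> N" unfolding *(1) by (rule submod_finsum[OF assms(2)])
qed

lemma (in graded_local_ring) basis_zero_notin:
  assumes "gbasis R M B" shows "\<zero>\<^bsub>M\<^esub> \<notin> B"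
proof
  interpret M: gbasis R M B by fact
  assume "\<zero>\<^bsub>M\<^esub> \<in> B"
  then have "unitvec R \<zero>\<^bsub>M\<^esub> = (\<lambda>_. \<zero>)" using M.coord_basis M.coord_zero by simp
  then have "unitvec R \<zero>\<^bsub>M\<^esub> \<zero>\<^bsub>M\<^esub> = \<zero>" by metis
  then show False using one_not_zero by (simp add: unitvec_def)
qed

text \<open>Bases of the layers together form a basis of the flag, and the rank of a basis element is the number
  of its layer.\<close>

lemma free_flag_ranked_basis:
  fixes F :: "('r, 'm) diff_module"
  assumes R: "graded_local_ring R" and flag: "free_flag R a F"
  shows "\<exists>B rk. ranked_basis R F B rk"
proof -
  interpret R: graded_local_ring R by fact
  interpret F: diff_module R a F using flag by (simp add: free_flag_def)
  obtain Fl :: "nat \<Rightarrow> 'm set" where flag': "is_direct_sum F Fl \<and>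
      (\<forall>i. graded_free R (restrict_module F (Fl i))) \<and> (\<forall>i. diff F ` Fl i \<subseteq> internal_sum F {..<i} Fl)"
    using flag unfolding free_flag_def by blast
  then have Fl: "is_direct_sum F Fl" "\<And>i. graded_free R (restrict_module F (Fl i))"
    "\<And>i. diff F ` Fl i \<subseteq> internal_sum F {..<i} Fl" by auto
  interpret Fl: dsum F Fl by (intro dsum.intro dsum_axioms.intro F.M.abelian_group_axioms Fl(1))
  let ?G = "\<lambda>i. restrict_module F (Fl i)"
  have "\<exists>B. homogeneous_basis R (?G i) B" for i using Fl(2) by (simp add: graded_free_def)
  then obtain Bs where Bs: "\<And>i. homogeneous_basis R (?G i) (Bs i)" by metis
  have gb: "gbasis R (?G i) (Bs i)" for i
    using Fl(2) Bs by (intro gbasisI) (auto simp: graded_free_def)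
  have sub: "submod R F (Fl i)" for i
  proof -
    interpret G: gbasis R "?G i" "Bs i" by (rule gb)
    show ?thesis using G.carrier_submod Fl.G_in_carrier by (auto simp: submod_def)
  qed
  have BFl: "Bs i \<subseteq> Fl i" for i using gbasis.basis_carrier[OF gb[of i]] by simp
  have Bhom: "Bs i \<subseteq> (\<Union>j. grade F j)" for i
    using gbasis.basis_homogeneous[OF gb[of i]] by auto
  have B0: "b \<noteq> \<zero>\<^bsub>F\<^esub>" if "b \<in> Bs i" for b i using R.basis_zero_notin[OF gb[of i]] that by auto
  define B where "B = (\<Union>i. Bs i)"
  define rk where "rk b = (THE i. b \<in> Bs i)" for b
  have rk: "rk b = i" if "b \<in> Bs i" for b i
  proof -
    have "k = i" if "b \<in> Bs k" for k
    proof (rule Fl.homogeneous_unique)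
      show "b \<in> Fl k" using BFl that by auto
      show "b \<in> Fl i" using BFl \<open>b \<in> Bs i\<close> by auto
    qed (rule B0[OF that])
    then show ?thesis
      unfolding rk_def using that by (intro the_equality[where P = "\<lambda>i. b \<in> Bs i" and a = i])
  qed
  have BF: "B \<subseteq> carrier F" using BFl Fl.G_in_carrier by (auto simp: B_def)
  have FlB: "Fl i \<subseteq> spn R F (Bs i)" for i
  proof
    fix x assume x: "x \<in> Fl i"
    interpret G: gbasis R "?G i" "Bs i" by (rule gb)
    have xc: "x \<in> carrier (?G i)" using x by simp
    have "lincomb R (?G i) (\<lambda>x. x) (coord R (?G i) (Bs i) x)
      = lincomb R F (\<lambda>x. x) (coord R (?G i) (Bs i) x)"
      by (rule restrict_lincomb[OF F.left_module_axioms sub G.coord_coefs[OF xc]]) (use BFl in auto)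
    then show "x \<in> spn R F (Bs i)"
      unfolding spn_def using G.coord_coefs[OF xc] G.coord_lincomb[OF xc] by (metis image_eqI)
  qed
  have parts: "dpart F Fl i \<in> add_hom F F" for i by (rule Fl.dpart_add_hom)
  have part_smult: "dpart F Fl i (r \<odot>\<^bsub>F\<^esub> x) = r \<odot>\<^bsub>F\<^esub> dpart F Fl i x"
    if "r \<in> carrier R" "x \<in> carrier F" for i r x
    by (rule dpart_hom[OF Fl.dsum_axioms Fl.dsum_axioms F.smult_add_hom[OF that(1)], of "\<lambda>i. i"])
      (use that submodD(4)[OF sub] in auto)
  have "homogeneous_basis R F B"
  proof (rule F.homogeneous_basisI)
    show "B \<subseteq> (\<Union>j. grade F j)" using Bhom by (auto simp: B_def)
  next
    show "carrier F \<subseteq> spn R F B"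
    proof
      fix x assume x: "x \<in> carrier F"
      have "Fl i \<subseteq> spn R F B" for i using FlB F.spn_mono[of "Bs i" B] by (auto simp: B_def)
      then show "x \<in> spn R F B"
        using Fl.mem_if_dparts[OF F.submod_add_subgroup[OF F.spn_submod[OF BF]] x] Fl.dpart_in[OF x] by blast
    qed
  next
    fix c b assume c: "c \<in> coefs R B" and z: "lincomb R F (\<lambda>x. x) c = \<zero>\<^bsub>F\<^esub>"
    show "c b = \<zero>\<^bsub>R\<^esub>"
    proof (cases "b \<in> B")
      case True
      then obtain i where i: "b \<in> Bs i" by (auto simp: B_def)
      interpret G: gbasis R "?G i" "Bs i" by (rule gb)
      let ?c = "\<lambda>x. if x \<in> Bs i then c x else \<zero>\<^bsub>R\<^esub>"
      have c': "?c \<in> coefs R (Bs i)" using R.coefs_restrict[OF c, of "Bs i"] coefs_mono[of "B \<inter> Bs i" "Bs i" R] by blast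
      have id: "(\<lambda>x. x) \<in> Bs i \<rightarrow> Fl i" using BFl by auto
      have cR: "c x \<in> carrier R" for x by (rule coefsD(1)[OF c])
      have "\<zero>\<^bsub>F\<^esub> = dpart F Fl i (lincomb R F (\<lambda>x. x) c)" using z Fl.dpart_zero by simp
      also have "\<dots> = lincomb R F (\<lambda>x. dpart F Fl i x) c"
        by (rule hom_lincomb[OF F.left_module_axioms F.left_module_axioms parts part_smult c]) (use BF in auto)
      also have "\<dots> = finsum F (\<lambda>x. c x \<odot>\<^bsub>F\<^esub> dpart F Fl i x) {x. c x \<noteq> \<zero>\<^bsub>R\<^esub>}" by (simp add: lincomb_def)
      also have "\<dots> = finsum F (\<lambda>x. ?c x \<odot>\<^bsub>F\<^esub> x) {x. c x \<noteq> \<zero>\<^bsub>R\<^esub>}"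
      proof (rule F.M.finsum_cong')
        show "(\<lambda>x. ?c x \<odot>\<^bsub>F\<^esub> x) \<in> {x. c x \<noteq> \<zero>\<^bsub>R\<^esub>} \<rightarrow> carrier F"
          using cR coefsD(2)[OF c] BF by (auto intro!: F.smult_closed)
        fix x assume "x \<in> {x. c x \<noteq> \<zero>\<^bsub>R\<^esub>}"
        then have "x \<in> B" using coefsD(2)[OF c] by auto
        then obtain k where k: "x \<in> Bs k" by (auto simp: B_def)
        have xF: "x \<in> carrier F" using BF \<open>x \<in> B\<close> by auto
        show "c x \<odot>\<^bsub>F\<^esub> dpart F Fl i x = ?c x \<odot>\<^bsub>F\<^esub> x"
        proof (cases "k = i")
          case True
          then have "x \<in> Fl i" using k BFl by blast
          then show ?thesis using Fl.dpart_homog[of x i i] k True by simp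
        next
          case False
          then have "x \<notin> Bs i" using k rk by blast
          moreover have "dpart F Fl i x = \<zero>\<^bsub>F\<^esub>" using Fl.dpart_homog[of x k i] k BFl False by auto
          ultimately show ?thesis using cR xF by simp
        qed
      qed simp
      also have "\<dots> = lincomb R F (\<lambda>x. x) ?c"
        by (rule F.lincomb_superset[symmetric]) (use cR coefsD[OF c] BF in auto)
      also have "\<dots> = lincomb R (?G i) (\<lambda>x. x) ?c"
        by (rule restrict_lincomb[OF F.left_module_axioms sub c' id, symmetric])
      finally have "coord R (?G i) (Bs i) \<zero>\<^bsub>?G i\<^esub> = ?c"
        by (intro G.coord_eqI[OF c']) simp
      then have "?c = (\<lambda>_. \<zero>\<^bsub>R\<^esub>)" using G.coord_zero by simp
      then show ?thesis using i by metis
    qed (use coefsD(2)[OF c] in blast)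
  qed
  moreover have "diff F b \<in> spn R F {b'\<in>B. rk b' < rk b}" if b: "b \<in> B" for b
  proof -
    obtain i where i: "b \<in> Bs i" using b by (auto simp: B_def)
    let ?S = "{b'\<in>B. rk b' < rk b}"
    have S: "?S \<subseteq> carrier F" using BF by auto
    have "internal_sum F {..<i} Fl \<subseteq> spn R F ?S"
    proof (rule internal_sum_least[OF F.left_module_axioms F.spn_submod[OF S]])
      fix k assume "k \<in> {..<i}"
      then have "Bs k \<subseteq> ?S" using rk i by (auto simp: B_def)
      then show "Fl k \<subseteq> spn R F ?S" using FlB F.spn_mono by blast
    qed
    then show ?thesis using Fl(3)[of i] i BFl by blast
  qed
  ultimately show ?thesis by (intro exI[of _ B] exI[of _ rk]) (auto simp: ranked_basis_def)
qed

text \<open>The homotopy is chosen on basis elements by recursion on their rank. Where it has been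
  constructed, \<open>f b - k(\<partial>b)\<close> is a cycle, hence a boundary, and a preimage of it is the value at \<open>b\<close>.\<close>

lemma null_homotopic:
  fixes R :: "'r graded_ring" and F :: "('r, 'm) diff_module" and C :: "('r, 'c) diff_module"
  assumes F: "diff_module R a F" and rb: "ranked_basis R F B rk"
    and C: "diff_module R a C" and ac: "cycles C \<subseteq> boundaries C"
    and f: "f \<in> graded_hom R F (twist C c)"
    and fd: "\<And>x. x \<in> carrier F \<Longrightarrow> diff C (f x) = f (diff F x)"
  shows "\<exists>k\<in>graded_hom R F (twist C (c - a)). \<forall>x\<in>carrier F. diff C (k x) \<oplus>\<^bsub>C\<^esub> k (diff F x) = f x"
proof -
  interpret F: diff_module R a F by fact
  interpret C: diff_module R a C by fact
  interpret B: gbasis R F B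
    using rb by (intro gbasisI F.d_graded) (simp add: ranked_basis_def)
  let ?T = "twist C (c - a)"
  note TG = twist_graded_module[OF C.d_graded]
  have rb': "diff F b \<in> spn R F {b'\<in>B. rk b' < rk b}" if "b \<in> B" for b using rb that by (simp add: ranked_basis_def)
  define lin where "lin \<kappa> x = lincomb R C \<kappa> (coord R F B x)" for \<kappa> :: "'m \<Rightarrow> 'c" and x
  define hom where "hom \<kappa> \<longleftrightarrow> (\<forall>b\<in>B. \<kappa> b \<in> grade ?T (hdeg F b))" for \<kappa>
  have linT: "lin \<kappa> \<in> graded_hom R F ?T" "\<And>b. b \<in> B \<Longrightarrow> lin \<kappa> b = \<kappa> b" if "hom \<kappa>" for \<kappa>
    using B.hom_extend[OF TG, of \<kappa>] that by (auto simp: lin_def[abs_def] hom_def)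
  have agree: "lin \<kappa> x = lin \<kappa>' x"
    if k: "hom \<kappa>" "hom \<kappa>'" and eq: "\<And>b. b \<in> S \<Longrightarrow> \<kappa> b = \<kappa>' b" and S: "S \<subseteq> B" and x: "x \<in> spn R F S" for \<kappa> \<kappa>' S x
  proof -
    have "S \<subseteq> {x \<in> carrier F. lin \<kappa> x = lin \<kappa>' x}" using linT(2)[OF k(1)] linT(2)[OF k(2)] eq S B.basis_carrier by auto
    from F.spn_least[OF graded_hom_equalizer[OF F.d_graded TG linT(1)[OF k(1)] linT(1)[OF k(2)]] this]
    show ?thesis using x by blast
  qed
  have lower: "diff C (lin \<kappa> x) \<oplus>\<^bsub>C\<^esub> lin \<kappa> (diff F x) = f x"
    if k: "hom \<kappa>" and eq: "\<And>b. b \<in> S \<Longrightarrow> diff C (\<kappa> b) \<oplus>\<^bsub>C\<^esub> lin \<kappa> (diff F b) = f b"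
      and S: "S \<subseteq> B" and x: "x \<in> spn R F S" for \<kappa> S x
  proof -
    have 1: "(\<lambda>x. diff C (lin \<kappa> x)) \<in> graded_hom R F (twist C c)"
      using graded_hom_twist_comp[OF linT(1)[OF k] diff_moduleD(2)[OF C]] by simp
    have 2: "(\<lambda>x. lin \<kappa> (diff F x)) \<in> graded_hom R F (twist C c)"
      using graded_hom_twist_comp[OF diff_moduleD(2)[OF F] linT(1)[OF k]] by simp
    have "S \<subseteq> {x \<in> carrier F. diff C (lin \<kappa> x) \<oplus>\<^bsub>C\<^esub> lin \<kappa> (diff F x) = f x}"
      using linT(2)[OF k] eq S B.basis_carrier by auto
    from F.spn_least[OF graded_hom_equalizer[OF F.d_graded TG graded_hom_add[OF TG 1 2] f, simplified] this]
    show ?thesis using x by blast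
  qed
  \<comment> \<open>The values at basis elements of rank at least \<open>n\<close> are erased, so that the recursion equation at \<open>b\<close>
    refers only to smaller ranks.\<close>
  define cut where "cut \<kappa> n b = (if b \<in> B \<and> rk b < n then \<kappa> b else \<zero>\<^bsub>C\<^esub>)" for \<kappa> :: "'m \<Rightarrow> 'c" and n b
  define P where "P \<kappa> b v \<longleftrightarrow> (b \<in> B \<longrightarrow>
    v \<in> grade ?T (hdeg F b) \<and> diff C v \<oplus>\<^bsub>C\<^esub> lin (cut \<kappa> (rk b)) (diff F b) = f b)" for \<kappa> b v
  have "\<exists>v. P \<kappa> b v" if IH: "\<And>b'. (b', b) \<in> measure rk \<Longrightarrow> P \<kappa> b' (\<kappa> b')" for \<kappa> b
  proof (cases "b \<in> B")
    case b: True
    have cut: "hom (cut \<kappa> n)" if "n \<le> rk b" for n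
      using that IH unfolding hom_def cut_def P_def by (auto simp: C.md.G_zero)
    let ?\<kappa> = "cut \<kappa> (rk b)"
    note k = cut[OF order_refl]
    note L = graded_homD[OF linT(1)[OF k], simplified]
    have bF: "b \<in> carrier F" "diff F b \<in> carrier F" using b B.basis_carrier F.d_simps by auto
    have fC: "f b \<in> carrier C" "f (diff F b) \<in> carrier C" using graded_homD(2)[OF f] bF by auto
    have c: "f b \<in> carrier C" "lin ?\<kappa> (diff F b) \<in> carrier C" using fC(1) L(2)[OF bF(2)] by auto
    let ?w = "f b \<ominus>\<^bsub>C\<^esub> lin ?\<kappa> (diff F b)"
    have "diff C (lin ?\<kappa> (diff F b)) \<oplus>\<^bsub>C\<^esub> lin ?\<kappa> (diff F (diff F b)) = f (diff F b)"
    proof (rule lower[OF k _ _ rb'[OF b]])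
      fix b' assume "b' \<in> {b'\<in>B. rk b' < rk b}"
      then have b': "b' \<in> B" "rk b' < rk b" by auto
      have "lin ?\<kappa> (diff F b') = lin (cut \<kappa> (rk b')) (diff F b')"
        by (rule agree[OF k cut _ _ rb'[OF b'(1)]]) (use b'(2) in \<open>auto simp: cut_def\<close>)
      then show "diff C (?\<kappa> b') \<oplus>\<^bsub>C\<^esub> lin ?\<kappa> (diff F b') = f b'"
        using IH[of b'] b' by (simp add: P_def cut_def)
    qed blast
    then have "diff C (lin ?\<kappa> (diff F b)) = f (diff F b)"
      using F.d_simps(2)[OF bF(1)] graded_hom_zero[OF F.d_graded TG linT(1)[OF k]] C.d_simps(1)[OF c(2)] by simp
    then have "?w \<in> cycles C"
      using c fd[OF bF(1)] fC(2) by (simp add: cycles_def C.d_minus C.M.minus_eq_zero_iff)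
    then have w1: "?w \<in> diff C ` carrier C" using ac by (auto simp: boundaries_def)
    have bg: "b \<in> grade F (hdeg F b)" by (rule B.basis_homogeneous[OF b])
    have "f b \<in> grade C (c + hdeg F b)" using graded_homD(5)[OF f bg] by simp
    moreover have "lin ?\<kappa> (diff F b) \<in> grade C (c - a + (a + hdeg F b))"
      using L(5)[OF diff_moduleD(7)[OF F bg]] by simp
    ultimately have "?w \<in> grade C (c + hdeg F b)" by (auto intro: C.md.G_minus)
    then have w2: "?w \<in> grade (twist C a) (c - a + hdeg F b)" by simp
    obtain v where v: "v \<in> grade C (c - a + hdeg F b)" "diff C v = ?w"
      using homogeneous_preimage[OF C.d_graded TG diff_moduleD(2)[OF C] w2 w1] by blast
    have "?w \<oplus>\<^bsub>C\<^esub> lin ?\<kappa> (diff F b) = f b" using c by algebra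
    then show ?thesis using v unfolding P_def by (intro exI[of _ v]) simp
  qed (simp add: P_def)
  moreover have "P \<kappa> b v = P \<kappa>' b v" if "\<And>b'. (b', b) \<in> measure rk \<Longrightarrow> \<kappa> b' = \<kappa>' b'" for \<kappa> \<kappa>' b v
  proof -
    have "cut \<kappa> (rk b) = cut \<kappa>' (rk b)" using that by (auto simp: cut_def)
    then show ?thesis by (simp only: P_def)
  qed
  ultimately obtain \<kappa> where "\<forall>b. P \<kappa> b (\<kappa> b)" using dependent_wf_choice[OF wf_measure, of rk P] by blast
  then have \<kappa>: "\<kappa> b \<in> grade ?T (hdeg F b)" "diff C (\<kappa> b) \<oplus>\<^bsub>C\<^esub> lin (cut \<kappa> (rk b)) (diff F b) = f b"
    if "b \<in> B" for b using that unfolding P_def by blast+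
  have k: "hom \<kappa>" "hom (cut \<kappa> n)" for n using \<kappa>(1) by (auto simp: hom_def cut_def C.md.G_zero)
  have eq: "diff C (\<kappa> b) \<oplus>\<^bsub>C\<^esub> lin \<kappa> (diff F b) = f b" if b: "b \<in> B" for b
  proof -
    have "lin \<kappa> (diff F b) = lin (cut \<kappa> (rk b)) (diff F b)"
      by (rule agree[OF k _ _ rb'[OF b]]) (auto simp: cut_def)
    then show ?thesis using \<kappa>(2)[OF b] by simp
  qed
  show ?thesis
    by (rule bexI[OF _ linT(1)[OF k(1)]], rule ballI, rule lower[OF k(1) eq order_refl]) (simp_all add: B.spn_basis)
qed

text \<open>Homotopies pass to a direct summand by composition with its inclusion and retraction.\<close>

lemma null_homotopic_retract:
  assumes R: "graded_local_ring R" and flag: "free_flag R a F" and split: "split_injection R M F s"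
    and M: "diff_module R a M" and C: "diff_module R a C" and ac: "cycles C \<subseteq> boundaries C"
    and f: "f \<in> graded_hom R M (twist C c)"
    and fd: "\<And>x. x \<in> carrier M \<Longrightarrow> diff C (f x) = f (diff M x)"
  shows "\<exists>k\<in>graded_hom R M (twist C (c - a)). \<forall>x\<in>carrier M. diff C (k x) \<oplus>\<^bsub>C\<^esub> k (diff M x) = f x"
proof -
  obtain B rk where rb: "ranked_basis R F B rk" using free_flag_ranked_basis[OF R flag] by blast
  have F: "diff_module R a F" using flag by (simp add: free_flag_def)
  interpret M: diff_module R a M by fact
  interpret F: diff_module R a F by fact
  obtain p where s: "s \<in> diff_hom R M F" and p: "p \<in> diff_hom R F M" "\<And>x. x \<in> carrier M \<Longrightarrow> p (s x) = x"
    using split by (auto simp: split_injection_def)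
  note S = graded_homD[OF diff_homD(1)[OF s]] and P = graded_homD[OF diff_homD(1)[OF p(1)]]
  have fp: "(\<lambda>x. f (p x)) \<in> graded_hom R F (twist C c)" by (rule graded_hom_comp[OF diff_homD(1)[OF p(1)] f])
  have fp': "diff C (f (p x)) = f (p (diff F x))" if "x \<in> carrier F" for x
    using fd[OF P(2)[OF that]] diff_homD(2)[OF p(1) that] by simp
  obtain k where k: "k \<in> graded_hom R F (twist C (c - a))"
    "\<And>x. x \<in> carrier F \<Longrightarrow> diff C (k x) \<oplus>\<^bsub>C\<^esub> k (diff F x) = f (p x)"
    using null_homotopic[OF F rb C ac fp fp'] by blast
  have "diff C (k (s x)) \<oplus>\<^bsub>C\<^esub> k (s (diff M x)) = f x" if "x \<in> carrier M" for x
    using k(2)[OF S(2)[OF that]] p(2)[OF that] diff_homD(2)[OF s that] by simp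
  then show ?thesis using graded_hom_comp[OF diff_homD(1)[OF s] k(1)] by (intro bexI[of _ "\<lambda>x. k (s x)"]) auto
qed

lemma diff_update_graded_module:
  assumes "graded_module R C" shows "graded_module R (C\<lparr>diff := d\<rparr>)"
proof -
  interpret C: graded_module R C by fact
  have fs: "finsum (C\<lparr>diff := d\<rparr>) = finsum C" by (simp add: finsum_def fun_eq_iff)
  have "abelian_group (C\<lparr>diff := d\<rparr>)"
    by (rule abelian_groupI) (auto simp: C.M.a_ac intro: C.M.l_neg)
  moreover have "is_direct_sum (C\<lparr>diff := d\<rparr>) (grade (C\<lparr>diff := d\<rparr>))"
    using C.module_direct_sum by (simp add: is_direct_sum_def additive_subgroup_def fs)
  ultimately show ?thesis
    using left_module_smult_facts[OF assms] C.smult_degree by (intro graded_moduleI) auto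
qed

text \<open>After the sign of the differential is changed, a map that anticommutes with the differentials commutes
  with them, while cycles and boundaries stay the same.\<close>

lemma negated_diff_module:
  assumes "diff_module R a C"
  shows "diff_module R a (C\<lparr>diff := \<lambda>x. \<ominus>\<^bsub>C\<^esub> diff C x\<rparr>)"
    "cycles (C\<lparr>diff := \<lambda>x. \<ominus>\<^bsub>C\<^esub> diff C x\<rparr>) = cycles C"
    "boundaries (C\<lparr>diff := \<lambda>x. \<ominus>\<^bsub>C\<^esub> diff C x\<rparr>) = boundaries C"
proof -
  interpret C: diff_module R a C by fact
  let ?C = "C\<lparr>diff := \<lambda>x. \<ominus>\<^bsub>C\<^esub> diff C x\<rparr>"
  show "diff_module R a ?C"
  proof (rule diff_moduleI)
    have "(\<lambda>x. \<ominus>\<^bsub>C\<^esub> diff C x) \<in> graded_hom R C (twist C a)"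
      using graded_hom_uminus[OF twist_graded_module[OF C.d_graded] C.diff_hom] by simp
    then show "diff ?C \<in> graded_hom R ?C (twist ?C a)" by (simp add: graded_hom_def)
  qed (auto simp: diff_update_graded_module C.d_graded C.d_simps C.d_neg C.M.a_inv_zero)
  have neg0: "\<ominus>\<^bsub>C\<^esub> x = \<zero>\<^bsub>C\<^esub> \<longleftrightarrow> x = \<zero>\<^bsub>C\<^esub>" if "x \<in> carrier C" for x
    using C.M.minus_minus[OF that] C.M.a_inv_zero by metis
  show "cycles ?C = cycles C" by (auto simp: cycles_def neg0 C.d_simps)
  show "boundaries ?C = boundaries C"
  proof (intro equalityI subsetI)
    fix y assume "y \<in> boundaries ?C"
    then obtain x where x: "x \<in> carrier C" "y = \<ominus>\<^bsub>C\<^esub> diff C x" by (auto simp: boundaries_def)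
    then show "y \<in> boundaries C" using C.d_neg[OF x(1)] unfolding boundaries_def by (intro image_eqI[of _ _ "\<ominus>\<^bsub>C\<^esub> x"]) auto
  next
    fix y assume "y \<in> boundaries C"
    then obtain x where x: "x \<in> carrier C" "y = diff C x" by (auto simp: boundaries_def)
    then show "y \<in> boundaries ?C"
      using C.d_neg[OF x(1)] C.d_simps(1)[OF x(1)] unfolding boundaries_def by (intro image_eqI[of _ _ "\<ominus>\<^bsub>C\<^esub> x"]) auto
  qed
qed

text \<open>The map \<open>x \<mapsto> (g x, 0)\<close> into the acyclic cone of \<open>q\<close> anticommutes with the differentials. The two components of
  a null-homotopy of it are the homotopy \<open>h\<close> and, up to sign, the lift \<open>u\<close>.\<close>

lemma homotopy_lift:
  assumes R: "graded_local_ring R" and flag: "free_flag R a F" and split: "split_injection R M F s"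
    and M: "diff_module R a M" and N: "diff_module R a N" and D: "diff_module R a D"
    and q: "quasi_iso R N D q" and g: "g \<in> diff_hom R M D"
  shows "\<exists>u\<in>diff_hom R M N. \<exists>h\<in>graded_hom R M (twist D (- a)).
    \<forall>x\<in>carrier M. g x = q (u x) \<oplus>\<^bsub>D\<^esub> (diff D (h x) \<oplus>\<^bsub>D\<^esub> h (diff M x))"
proof -
  interpret M: diff_module R a M by fact
  interpret N: diff_module R a N by fact
  interpret D: diff_module R a D by fact
  have q': "q \<in> diff_hom R N D" and ac: "cycles (cone a D N q) \<subseteq> boundaries (cone a D N q)"
    using q quasi_iso_iff[OF N D] by auto
  note Q = graded_homD[OF diff_homD(1)[OF q']] and G = graded_homD[OF diff_homD(1)[OF g]]
  let ?C = "cone a D N q"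
  let ?C' = "?C\<lparr>diff := \<lambda>x. \<ominus>\<^bsub>?C\<^esub> diff ?C x\<rparr>"
  have C: "diff_module R a ?C" by (rule cone_diff_module[OF D N q'])
  note C' = negated_diff_module[OF C]
  have neg: "\<ominus>\<^bsub>?C\<^esub> u = (\<ominus>\<^bsub>D\<^esub> fst u, \<ominus>\<^bsub>N\<^esub> snd u)" if "u \<in> carrier ?C" for u
    by (rule cone_graded_module(3)[OF D.d_graded N.d_graded that])
  have q0: "q \<zero>\<^bsub>N\<^esub> = \<zero>\<^bsub>D\<^esub>" by (rule graded_hom_zero[OF N.d_graded D.d_graded diff_homD(1)[OF q']])
  have d': "diff ?C' u = (diff D (fst u) \<ominus>\<^bsub>D\<^esub> q (snd u), \<ominus>\<^bsub>N\<^esub> diff N (snd u))" if "u \<in> carrier ?C" for u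
  proof -
    have c: "q (snd u) \<in> carrier D" "diff D (fst u) \<in> carrier D" "diff N (snd u) \<in> carrier N"
      using that Q(2) D.d_simps N.d_simps by auto
    have "\<ominus>\<^bsub>D\<^esub> (q (snd u) \<ominus>\<^bsub>D\<^esub> diff D (fst u)) = diff D (fst u) \<ominus>\<^bsub>D\<^esub> q (snd u)"
      using c(1,2) by algebra
    then show ?thesis using neg[of "diff ?C u"] c by simp
  qed
  have f: "(\<lambda>x. (g x, \<zero>\<^bsub>N\<^esub>)) \<in> graded_hom R M (twist ?C' 0)"
    by (rule graded_homI) (auto simp: G N.md.G_zero)
  have "\<exists>k\<in>graded_hom R M (twist ?C' (0 - a)). \<forall>x\<in>carrier M.
      diff ?C' (k x) \<oplus>\<^bsub>?C'\<^esub> k (diff M x) = (g x, \<zero>\<^bsub>N\<^esub>)"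
  proof (rule null_homotopic_retract[OF R flag split M C'(1) _ f])
    show "cycles ?C' \<subseteq> boundaries ?C'" using ac C' by simp
    fix x assume x: "x \<in> carrier M"
    then show "diff ?C' (g x, \<zero>\<^bsub>N\<^esub>) = (g (diff M x), \<zero>\<^bsub>N\<^esub>)"
      using d'[of "(g x, \<zero>\<^bsub>N\<^esub>)"] G(2)[OF x] q0 diff_homD(2)[OF g x] D.d_simps(1)[of "g x"]
      by (simp del: cone_simps(6) add: a_minus_def D.M.a_inv_zero N.M.a_inv_zero)
  qed
  then obtain k where k: "k \<in> graded_hom R M (twist ?C' (- a))"
    "\<And>x. x \<in> carrier M \<Longrightarrow> diff ?C' (k x) \<oplus>\<^bsub>?C'\<^esub> k (diff M x) = (g x, \<zero>\<^bsub>N\<^esub>)" by auto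
  note K = graded_homD[OF k(1), simplified]
  have K2: "fst (k x) \<in> carrier D" "snd (k x) \<in> carrier N" if "x \<in> carrier M" for x
    using K(2)[OF that] by auto
  have eq1: "(diff D (fst (k x)) \<ominus>\<^bsub>D\<^esub> q (snd (k x))) \<oplus>\<^bsub>D\<^esub> fst (k (diff M x)) = g x"
    and eq2: "\<ominus>\<^bsub>N\<^esub> diff N (snd (k x)) \<oplus>\<^bsub>N\<^esub> snd (k (diff M x)) = \<zero>\<^bsub>N\<^esub>" if x: "x \<in> carrier M" for x
  proof -
    have "k x \<in> carrier ?C" using K(2)[OF x] by simp
    from k(2)[OF x] d'[OF this]
    show "(diff D (fst (k x)) \<ominus>\<^bsub>D\<^esub> q (snd (k x))) \<oplus>\<^bsub>D\<^esub> fst (k (diff M x)) = g x"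
      "\<ominus>\<^bsub>N\<^esub> diff N (snd (k x)) \<oplus>\<^bsub>N\<^esub> snd (k (diff M x)) = \<zero>\<^bsub>N\<^esub>" by auto
  qed
  have k1: "(\<lambda>x. fst (k x)) \<in> graded_hom R M (twist D (- a))"
    by (rule graded_homI) (use K K2 in \<open>auto simp: mem_Times_iff\<close>)
  have k2: "(\<lambda>x. snd (k x)) \<in> graded_hom R M N"
    by (rule graded_homI) (use K K2 in \<open>auto simp: mem_Times_iff\<close>)
  define u where "u x = \<ominus>\<^bsub>N\<^esub> snd (k x)" for x
  have u: "u \<in> graded_hom R M N" unfolding u_def[abs_def] by (rule graded_hom_uminus[OF N.d_graded k2])
  have "u (diff M x) = diff N (u x)" if x: "x \<in> carrier M" for x
  proof -
    have c: "diff N (snd (k x)) \<in> carrier N" "snd (k (diff M x)) \<in> carrier N"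
      using K2 x M.d_simps N.d_simps by auto
    have "diff N (snd (k x)) = diff N (snd (k x)) \<oplus>\<^bsub>N\<^esub> (\<ominus>\<^bsub>N\<^esub> diff N (snd (k x)) \<oplus>\<^bsub>N\<^esub> snd (k (diff M x)))"
      using eq2[OF x] c by simp
    also have "\<dots> = snd (k (diff M x))" using c by algebra
    finally show ?thesis using K2(2)[OF x] by (simp add: u_def N.d_neg)
  qed
  then have "u \<in> diff_hom R M N" using u by (simp add: diff_hom_def)
  moreover have "g x = q (u x) \<oplus>\<^bsub>D\<^esub> (diff D (fst (k x)) \<oplus>\<^bsub>D\<^esub> fst (k (diff M x)))" if x: "x \<in> carrier M" for x
  proof -
    have c: "diff D (fst (k x)) \<in> carrier D" "fst (k (diff M x)) \<in> carrier D" "q (snd (k x)) \<in> carrier D"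
      using K2 x M.d_simps D.d_simps Q(2) by auto
    have "q (u x) = \<ominus>\<^bsub>D\<^esub> q (snd (k x))"
      unfolding u_def by (rule graded_hom_neg[OF N.d_graded D.d_graded diff_homD(1)[OF q'] K2(2)[OF x]])
    moreover have "(diff D (fst (k x)) \<ominus>\<^bsub>D\<^esub> q (snd (k x))) \<oplus>\<^bsub>D\<^esub> fst (k (diff M x)) =
      \<ominus>\<^bsub>D\<^esub> q (snd (k x)) \<oplus>\<^bsub>D\<^esub> (diff D (fst (k x)) \<oplus>\<^bsub>D\<^esub> fst (k (diff M x)))" using c by algebra
    ultimately show ?thesis using eq1[OF x] by simp
  qed
  ultimately show ?thesis using k1 by (intro bexI[of _ u] bexI[of _ "\<lambda>x. fst (k x)"] ballI)
qed

text \<open>Here \<open>x \<mapsto> (h x, g x)\<close> is a chain map into the acyclic cone of \<open>q\<close>, and the second component of a null-homotopy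
  of it is the required homotopy.\<close>

lemma null_homotopic_cancel:
  assumes R: "graded_local_ring R" and flag: "free_flag R a F" and split: "split_injection R M F s"
    and M: "diff_module R a M" and N: "diff_module R a N" and D: "diff_module R a D"
    and q: "quasi_iso R N D q" and g: "g \<in> diff_hom R M N" and h: "h \<in> graded_hom R M (twist D (- a))"
    and eq: "\<And>x. x \<in> carrier M \<Longrightarrow> q (g x) = diff D (h x) \<oplus>\<^bsub>D\<^esub> h (diff M x)"
  shows "\<exists>k\<in>graded_hom R M (twist N (- a)). \<forall>x\<in>carrier M. g x = diff N (k x) \<oplus>\<^bsub>N\<^esub> k (diff M x)"
proof -
  interpret M: diff_module R a M by fact
  interpret N: diff_module R a N by fact
  interpret D: diff_module R a D by fact
  have q': "q \<in> diff_hom R N D" and ac: "cycles (cone a D N q) \<subseteq> boundaries (cone a D N q)"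
    using q quasi_iso_iff[OF N D] by auto
  note G = graded_homD[OF diff_homD(1)[OF g]] and H = graded_homD[OF h, simplified]
  let ?C = "cone a D N q"
  have C: "diff_module R a ?C" by (rule cone_diff_module[OF D N q'])
  have f: "(\<lambda>x. (h x, g x)) \<in> graded_hom R M (twist ?C (- a))"
    by (rule graded_homI) (auto simp: G H)
  have "\<exists>k\<in>graded_hom R M (twist ?C (- a - a)). \<forall>x\<in>carrier M. diff ?C (k x) \<oplus>\<^bsub>?C\<^esub> k (diff M x) = (h x, g x)"
  proof (rule null_homotopic_retract[OF R flag split M C ac f])
    fix x assume x: "x \<in> carrier M"
    have c: "diff D (h x) \<in> carrier D" "h (diff M x) \<in> carrier D" using x H M.d_simps D.d_simps by auto
    have "diff D (h x) \<oplus>\<^bsub>D\<^esub> h (diff M x) \<ominus>\<^bsub>D\<^esub> diff D (h x) = h (diff M x)" using c by algebra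
    then show "diff ?C (h x, g x) = (h (diff M x), g (diff M x))"
      using eq[OF x] diff_homD(2)[OF g x] by simp
  qed
  then obtain k where k: "k \<in> graded_hom R M (twist ?C (- a - a))"
    "\<And>x. x \<in> carrier M \<Longrightarrow> diff ?C (k x) \<oplus>\<^bsub>?C\<^esub> k (diff M x) = (h x, g x)" by blast
  note K = graded_homD[OF k(1), simplified]
  have "(\<lambda>x. snd (k x)) \<in> graded_hom R M (twist N (- a))"
    by (rule graded_homI) (use K in \<open>auto simp: mem_Times_iff\<close>)
  moreover have "g x = diff N (snd (k x)) \<oplus>\<^bsub>N\<^esub> snd (k (diff M x))" if "x \<in> carrier M" for x
    using k(2)[OF that] by simp
  ultimately show ?thesis by (intro bexI[of _ "\<lambda>x. snd (k x)"] ballI)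
qed

section \<open>Uniqueness of minimal resolutions\<close>

text \<open>Comparison maps between two resolutions are inverse to each other up to homotopy, and over
  minimal complexes null-homotopic maps vanish modulo the maximal ideal.\<close>

lemma minimal_homotopy_inverse:
  assumes R: "graded_local_ring R" and flag: "free_flag R a F" and split: "split_injection R M F s"
    and M: "diff_module R a M" and N: "diff_module R a N" and D: "diff_module R a D"
    and e: "quasi_iso R M D \<epsilon>" and e': "\<epsilon>' \<in> diff_hom R N D"
    and min: "diff M ` carrier M \<subseteq> lin_combs M (graded_max_ideal R) (carrier M)"
    and u: "u \<in> diff_hom R M N" and h: "h \<in> graded_hom R M (twist D (- a))"
    and uh: "\<And>x. x \<in> carrier M \<Longrightarrow> \<epsilon> x = \<epsilon>' (u x) \<oplus>\<^bsub>D\<^esub> (diff D (h x) \<oplus>\<^bsub>D\<^esub> h (diff M x))"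
    and v: "v \<in> diff_hom R N M" and h': "h' \<in> graded_hom R N (twist D (- a))"
    and vh: "\<And>x. x \<in> carrier N \<Longrightarrow> \<epsilon>' x = \<epsilon> (v x) \<oplus>\<^bsub>D\<^esub> (diff D (h' x) \<oplus>\<^bsub>D\<^esub> h' (diff N x))"
    and x: "x \<in> carrier M"
  shows "x \<ominus>\<^bsub>M\<^esub> v (u x) \<in> lin_combs M (graded_max_ideal R) (carrier M)"
proof -
  interpret R: graded_local_ring R by fact
  interpret M: diff_module R a M by fact
  interpret N: diff_module R a N by fact
  interpret D: diff_module R a D by fact
  have e1: "\<epsilon> \<in> diff_hom R M D" using e by (simp add: quasi_iso_def)
  note E = graded_homD[OF diff_homD(1)[OF e1]] and E' = graded_homD[OF diff_homD(1)[OF e']]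
    and U = graded_homD[OF diff_homD(1)[OF u]] and V = graded_homD[OF diff_homD(1)[OF v]]
    and H = graded_homD[OF h, simplified] and H' = graded_homD[OF h', simplified]
  define g where "g x = x \<ominus>\<^bsub>M\<^esub> v (u x)" for x
  have vu: "(\<lambda>x. v (u x)) \<in> graded_hom R M M" by (rule graded_hom_comp[OF diff_homD(1)[OF u] diff_homD(1)[OF v]])
  have g1: "g \<in> graded_hom R M M" unfolding g_def[abs_def] by (rule graded_hom_diff[OF M.d_graded graded_hom_id vu])
  have g2: "g (diff M x) = diff M (g x)" if "x \<in> carrier M" for x
    using that U(2) V(2) by (simp add: g_def M.d_minus diff_homD(2)[OF u] diff_homD(2)[OF v])
  have g: "g \<in> diff_hom R M M" using g1 g2 by (simp add: diff_hom_def)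
  define H2 where "H2 x = h x \<oplus>\<^bsub>D\<^esub> h' (u x)" for x
  have h2: "H2 \<in> graded_hom R M (twist D (- a))"
    using graded_hom_add[OF twist_graded_module[OF D.d_graded] h graded_hom_comp[OF diff_homD(1)[OF u] h']]
    by (simp add: H2_def[abs_def])
  have eq: "\<epsilon> (g x) = diff D (H2 x) \<oplus>\<^bsub>D\<^esub> H2 (diff M x)" if x: "x \<in> carrier M" for x
  proof -
    have ux: "u x \<in> carrier N" "v (u x) \<in> carrier M" "diff M x \<in> carrier M" using x U(2) V(2) M.d_simps by auto
    have c: "diff D (h x) \<in> carrier D" "h (diff M x) \<in> carrier D" "diff D (h' (u x)) \<in> carrier D"
      "h' (u (diff M x)) \<in> carrier D" "\<epsilon> (v (u x)) \<in> carrier D" "\<epsilon>' (u x) \<in> carrier D"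
      "h x \<in> carrier D" "h' (u x) \<in> carrier D"
      using x ux H(2) H'(2) U(2) E(2) E'(2) D.d_simps by auto
    have "\<epsilon> (g x) = \<epsilon> x \<ominus>\<^bsub>D\<^esub> \<epsilon> (v (u x))"
      unfolding g_def by (rule graded_hom_minus[OF M.d_graded D.d_graded diff_homD(1)[OF e1] x ux(2)])
    also have "\<dots> = ((\<epsilon> (v (u x)) \<oplus>\<^bsub>D\<^esub> (diff D (h' (u x)) \<oplus>\<^bsub>D\<^esub> h' (u (diff M x)))) \<oplus>\<^bsub>D\<^esub>
        (diff D (h x) \<oplus>\<^bsub>D\<^esub> h (diff M x))) \<ominus>\<^bsub>D\<^esub> \<epsilon> (v (u x))"
      using uh[OF x] vh[OF ux(1)] diff_homD(2)[OF u x] by simp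
    also have "\<dots> = (diff D (h x) \<oplus>\<^bsub>D\<^esub> diff D (h' (u x))) \<oplus>\<^bsub>D\<^esub> (h (diff M x) \<oplus>\<^bsub>D\<^esub> h' (u (diff M x)))"
      using c by algebra
    finally show ?thesis using c by (simp add: H2_def D.d_simps)
  qed
  obtain k where k: "k \<in> graded_hom R M (twist M (- a))"
    "\<And>x. x \<in> carrier M \<Longrightarrow> g x = diff M (k x) \<oplus>\<^bsub>M\<^esub> k (diff M x)"
    using null_homotopic_cancel[OF R flag split M M D e g h2 eq] by blast
  have "diff M (k x) \<in> R.mM M" using graded_homD(2)[OF k(1) x] min by auto
  moreover have "k (diff M x) \<in> R.mM M" using R.mM_hom[OF M.d_graded M.d_graded k(1)] min x by auto
  ultimately have "g x \<in> R.mM M" using k(2)[OF x] submodD(3)[OF R.mM_submod[OF M.d_graded]] by simp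
  then show ?thesis by (simp add: g_def)
qed

lemma minimal_resolutions_comparison:
  fixes R :: "'r graded_ring" and D :: "('r, 'd) diff_module"
    and M :: "('r, 'm) diff_module" and M' :: "('r, 'n) diff_module"
  assumes R: "graded_local_ring R" and D: "diff_module R a D"
    and m: "minimal_free_resolution TYPE('w) R a D M \<epsilon>"
    and m': "minimal_free_resolution TYPE('v) R a D M' \<epsilon>'"
  shows "\<exists>u\<in>diff_hom R M M'. \<exists>v\<in>diff_hom R M' M.
    (\<forall>x\<in>carrier M. x \<ominus>\<^bsub>M\<^esub> v (u x) \<in> lin_combs M (graded_max_ideal R) (carrier M)) \<and>
    (\<forall>x\<in>carrier M'. x \<ominus>\<^bsub>M'\<^esub> u (v x) \<in> lin_combs M' (graded_max_ideal R) (carrier M'))"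
proof -
  obtain F :: "('r, 'w) diff_module" and s where F: "free_flag R a F" "split_injection R M F s"
    and M: "diff_module R a M" "quasi_iso R M D \<epsilon>"
      "diff M ` carrier M \<subseteq> lin_combs M (graded_max_ideal R) (carrier M)"
    using m unfolding minimal_free_resolution_def free_resolution_def free_flag_resolution_def free_diff_module_def
    by blast
  obtain F' :: "('r, 'v) diff_module" and s' where F': "free_flag R a F'" "split_injection R M' F' s'"
    and M': "diff_module R a M'" "quasi_iso R M' D \<epsilon>'"
      "diff M' ` carrier M' \<subseteq> lin_combs M' (graded_max_ideal R) (carrier M')"
    using m' unfolding minimal_free_resolution_def free_resolution_def free_flag_resolution_def free_diff_module_def
    by blast
  have e: "\<epsilon> \<in> diff_hom R M D" "\<epsilon>' \<in> diff_hom R M' D" using M(2) M'(2) by (auto simp: quasi_iso_def)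
  obtain u h where u: "u \<in> diff_hom R M M'" "h \<in> graded_hom R M (twist D (- a))"
    "\<And>x. x \<in> carrier M \<Longrightarrow> \<epsilon> x = \<epsilon>' (u x) \<oplus>\<^bsub>D\<^esub> (diff D (h x) \<oplus>\<^bsub>D\<^esub> h (diff M x))"
    using homotopy_lift[OF R F M(1) M'(1) D M'(2) e(1)] by blast
  obtain v h' where v: "v \<in> diff_hom R M' M" "h' \<in> graded_hom R M' (twist D (- a))"
    "\<And>x. x \<in> carrier M' \<Longrightarrow> \<epsilon>' x = \<epsilon> (v x) \<oplus>\<^bsub>D\<^esub> (diff D (h' x) \<oplus>\<^bsub>D\<^esub> h' (diff M' x))"
    using homotopy_lift[OF R F' M'(1) M(1) D M(2) e(2)] by blast
  show ?thesis
  proof (intro bexI[OF _ u(1)] bexI[OF _ v(1)] conjI ballI)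
    show "x \<ominus>\<^bsub>M\<^esub> v (u x) \<in> lin_combs M (graded_max_ideal R) (carrier M)" if "x \<in> carrier M" for x
      by (rule minimal_homotopy_inverse[OF R F M(1) M'(1) D M(2) e(2) M(3) u v that])
    show "x \<ominus>\<^bsub>M'\<^esub> u (v x) \<in> lin_combs M' (graded_max_ideal R) (carrier M')" if "x \<in> carrier M'" for x
      by (rule minimal_homotopy_inverse[OF R F' M'(1) M(1) D M'(2) e(1) M'(3) v u that])
  qed
qed

text \<open>Both composites are the identity modulo \<open>\<mm>\<close> and hence bijective.\<close>

lemma nakayama_isomorphic:
  assumes R: "graded_local_ring R" and M: "graded_free R M" and M': "graded_free R M'"
    and nak: "graded_local_ring.nakayama R M" "graded_local_ring.nakayama R M'"
    and u: "u \<in> diff_hom R M M'" and v: "v \<in> diff_hom R M' M"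
    and vu: "\<And>x. x \<in> carrier M \<Longrightarrow> x \<ominus>\<^bsub>M\<^esub> v (u x) \<in> lin_combs M (graded_max_ideal R) (carrier M)"
    and uv: "\<And>x. x \<in> carrier M' \<Longrightarrow> x \<ominus>\<^bsub>M'\<^esub> u (v x) \<in> lin_combs M' (graded_max_ideal R) (carrier M')"
  shows "diff_isomorphic R M M'"
proof -
  interpret R: graded_local_ring R by fact
  obtain B where B: "gbasis R M B" using M by (auto simp: graded_free_def intro: gbasisI)
  obtain B' where B': "gbasis R M' B'" using M' by (auto simp: graded_free_def intro: gbasisI)
  note U = graded_homD(2)[OF diff_homD(1)[OF u]] and V = graded_homD(2)[OF diff_homD(1)[OF v]]
  have b1: "bij_betw (\<lambda>x. v (u x)) (carrier M) (carrier M)"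
    by (rule R.endomorphism_bij[OF B nak(1) graded_hom_comp[OF diff_homD(1)[OF u] diff_homD(1)[OF v]] vu])
  have b2: "bij_betw (\<lambda>x. u (v x)) (carrier M') (carrier M')"
    by (rule R.endomorphism_bij[OF B' nak(2) graded_hom_comp[OF diff_homD(1)[OF v] diff_homD(1)[OF u]] uv])
  have "inj_on u (carrier M)"
    using b1 by (auto simp: bij_betw_def inj_on_def)
  moreover have "u ` carrier M = carrier M'"
    using b2 U V unfolding bij_betw_def by (auto simp: image_iff) (metis imageE)
  ultimately show ?thesis using u by (auto simp: diff_isomorphic_def bij_betw_def)
qed

section \<open>Flags built by attaching generators\<close>

text \<open>Data for a free module with generators \<open>e\<^sub>0, e\<^sub>1, \<dots>\<close>, a differential on it and a map to \<open>D\<close>: the generator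
  \<open>e\<^sub>n\<close> has degree \<open>gd g n\<close>, its differential is \<open>gx g n\<close>, and its image in \<open>D\<close> is \<open>gy g n\<close>. In other words, \<open>e\<^sub>n\<close> is
  attached along the element \<open>(gy g n, gx g n)\<close> of the cone over the earlier generators. The linear extensions
  of \<open>gx g\<close> and \<open>gy g\<close> are \<open>gdif\<close> and \<open>geps\<close>.\<close>

type_synonym ('r, 'd) attaching = "nat \<Rightarrow> int \<times> 'd \<times> (nat \<Rightarrow> 'r)"

definition gd :: "('r, 'd) attaching \<Rightarrow> nat \<Rightarrow> int" where "gd g i = fst (g i)"
definition gy :: "('r, 'd) attaching \<Rightarrow> nat \<Rightarrow> 'd" where "gy g i = fst (snd (g i))"
definition gx :: "('r, 'd) attaching \<Rightarrow> nat \<Rightarrow> nat \<Rightarrow> 'r" where "gx g i = snd (snd (g i))"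

definition gdif :: "'r graded_ring \<Rightarrow> ('r, 'd) attaching \<Rightarrow> (nat \<Rightarrow> 'r) \<Rightarrow> nat \<Rightarrow> 'r"
  where "gdif R g c = (\<lambda>k. \<Oplus>\<^bsub>R\<^esub>i\<in>{i. c i \<noteq> \<zero>\<^bsub>R\<^esub>}. c i \<otimes>\<^bsub>R\<^esub> gx g i k)"

definition geps :: "'r graded_ring \<Rightarrow> ('r, 'd) diff_module \<Rightarrow> ('r, 'd) attaching \<Rightarrow> (nat \<Rightarrow> 'r) \<Rightarrow> 'd"
  where "geps R D g = lincomb R D (gy g)"

text \<open>Erasing the data outside \<open>I\<close> makes differential modules equal when they are built on \<open>I\<close> from data that
  agree on \<open>I\<close>.\<close>

definition rg :: "nat set \<Rightarrow> ('r, 'd) attaching \<Rightarrow> ('r, 'd) attaching"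
  where "rg I g i = (if i \<in> I then g i else undefined)"

text \<open>The free differential module on the generators in \<open>I\<close>.\<close>

definition FM :: "'r graded_ring \<Rightarrow> nat set \<Rightarrow> ('r, 'd) attaching \<Rightarrow> ('r, nat \<Rightarrow> 'r) diff_module"
  where "FM R I g = fmod R I (gd (rg I g)) (diff_module.fields (gdif R (rg I g)))"

text \<open>The conditions under which \<open>gdif\<close> is a differential and \<open>geps\<close> a chain map to \<open>D\<close>: the attaching elements are
  homogeneous cycles of the cone, and each involves only earlier generators.\<close>

definition flag_data :: "'r graded_ring \<Rightarrow> int \<Rightarrow> ('r, 'd) diff_module \<Rightarrow> nat set \<Rightarrow> ('r, 'd) attaching \<Rightarrow> bool"
  where "flag_data R a D I g \<longleftrightarrow> (\<forall>n\<in>I. {..<n} \<subseteq> I \<and> gx g n \<in> coefs R {..<n} \<and>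
    (\<forall>i<n. gx g n i \<in> rgr R (gd g n + a - gd g i)) \<and> gy g n \<in> grade D (gd g n) \<and>
    gdif R g (gx g n) = (\<lambda>_. \<zero>\<^bsub>R\<^esub>) \<and> geps R D g (gx g n) = diff D (gy g n))"

lemma rg_simps: "i \<in> I \<Longrightarrow> gd (rg I g) i = gd g i" "i \<in> I \<Longrightarrow> gy (rg I g) i = gy g i"
  "i \<in> I \<Longrightarrow> gx (rg I g) i = gx g i"
  by (simp_all add: gd_def gy_def gx_def rg_def)

lemma rg_cong: "(\<And>i. i \<in> I \<Longrightarrow> g i = g' i) \<Longrightarrow> rg I g = rg I g'"
  by (auto simp: rg_def fun_eq_iff)

lemma FM_cong: "(\<And>i. i \<in> I \<Longrightarrow> g i = g' i) \<Longrightarrow> FM R I g = FM R I g'"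
  using rg_cong[of I g g'] by (simp add: FM_def)

lemma FM_simps [simp]:
  "carrier (FM R I g) = coefs R I" "zero (FM R I g) = (\<lambda>_. \<zero>\<^bsub>R\<^esub>)"
  "add (FM R I g) c d = (\<lambda>i. c i \<oplus>\<^bsub>R\<^esub> d i)" "smult (FM R I g) r c = (\<lambda>i. r \<otimes>\<^bsub>R\<^esub> c i)"
  "diff (FM R I g) = gdif R (rg I g)"
  by (simp_all add: FM_def) (simp add: fmod_def diff_module.defs)

locale resolving = L?: graded_local_ring R + diff_module R a D
  for R :: "'r graded_ring" (structure) and a :: int and D :: "('r, 'd) diff_module" (structure)
begin

lemma flag_dataD:
  assumes "flag_data R a D I g" "n \<in> I"
  shows "{..<n} \<subseteq> I" "gx g n \<in> coefs R {..<n}" "i < n \<Longrightarrow> gx g n i \<in> rgr R (gd g n + a - gd g i)"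
    "gy g n \<in> grade D (gd g n)" "gdif R g (gx g n) = (\<lambda>_. \<zero>\<^bsub>R\<^esub>)" "geps R D g (gx g n) = diff D (gy g n)"
    "gx g n \<in> coefs R I" "gy g n \<in> carrier D"
  using assms coefs_mono[of "{..<n}" I R] md.G_in_carrier[of "gy g n"] unfolding flag_data_def by blast+

lemma gdif_cong:
  assumes c: "c \<in> coefs R I" and x: "\<And>i. i \<in> I \<Longrightarrow> gx g i = gx g' i"
    and gx: "\<And>i. i \<in> I \<Longrightarrow> gx g i \<in> coefs R J"
  shows "gdif R g c = gdif R g' c"
  unfolding gdif_def
proof
  fix k
  show "(\<Oplus>\<^bsub>R\<^esub>i\<in>{i. c i \<noteq> \<zero>\<^bsub>R\<^esub>}. c i \<otimes>\<^bsub>R\<^esub> gx g i k) = (\<Oplus>\<^bsub>R\<^esub>i\<in>{i. c i \<noteq> \<zero>\<^bsub>R\<^esub>}. c i \<otimes>\<^bsub>R\<^esub> gx g' i k)"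
  proof (rule L.finsum_cong')
    show "(\<lambda>i. c i \<otimes>\<^bsub>R\<^esub> gx g' i k) \<in> {i. c i \<noteq> \<zero>\<^bsub>R\<^esub>} \<rightarrow> carrier R"
    proof
      fix i assume "i \<in> {i. c i \<noteq> \<zero>\<^bsub>R\<^esub>}"
      then have i: "i \<in> I" using coefsD(2)[OF c] by auto
      show "c i \<otimes>\<^bsub>R\<^esub> gx g' i k \<in> carrier R"
        using coefsD(1)[OF c] coefsD(1)[OF gx[OF i]] x[OF i] by simp
    qed
    fix i assume "i \<in> {i. c i \<noteq> \<zero>\<^bsub>R\<^esub>}"
    then have "i \<in> I" using coefsD(2)[OF c] by auto
    then show "c i \<otimes>\<^bsub>R\<^esub> gx g i k = c i \<otimes>\<^bsub>R\<^esub> gx g' i k" using x by simp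
  qed simp
qed

lemma geps_cong:
  assumes c: "c \<in> coefs R I" and x: "\<And>i. i \<in> I \<Longrightarrow> gy g i = gy g' i"
    and gy: "\<And>i. i \<in> I \<Longrightarrow> gy g i \<in> carrier D"
  shows "geps R D g c = geps R D g' c"
  unfolding geps_def by (rule lincomb_cong[OF c x]) (use gy in auto)

lemma gdif_rg: "\<lbrakk>flag_data R a D I g; c \<in> coefs R I\<rbrakk> \<Longrightarrow> gdif R (rg I g) c = gdif R g c"
  by (rule gdif_cong[symmetric, of _ I _ _ I]) (auto simp: rg_simps flag_dataD(7))

lemma geps_rg: "\<lbrakk>flag_data R a D I g; c \<in> coefs R I\<rbrakk> \<Longrightarrow> geps R D (rg I g) c = geps R D g c"
  by (rule geps_cong[symmetric, of _ I]) (auto simp: rg_simps flag_dataD(8))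

lemma flag_data_cong:
  assumes fd: "flag_data R a D I g" and eq: "\<And>i. i \<in> I \<Longrightarrow> g i = g' i"
  shows "flag_data R a D I g'"
proof -
  have eqs: "gd g i = gd g' i" "gx g i = gx g' i" "gy g i = gy g' i" if "i \<in> I" for i
    using eq[OF that] by (simp_all add: gd_def gx_def gy_def)
  show ?thesis
    unfolding flag_data_def
  proof (intro ballI)
    fix n assume n: "n \<in> I"
    note F = flag_dataD[OF fd n]
    have lt: "i \<in> I" if "i < n" for i using F(1) that by auto
    have 1: "gdif R g (gx g n) = gdif R g' (gx g n)"
      by (rule gdif_cong[OF F(7) eqs(2)]) (use flag_dataD(7)[OF fd] in auto)
    have 2: "geps R D g (gx g n) = geps R D g' (gx g n)"
      by (rule geps_cong[OF F(7) eqs(3)]) (use flag_dataD(8)[OF fd] in auto)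
    show "{..<n} \<subseteq> I \<and> gx g' n \<in> coefs R {..<n} \<and> (\<forall>i<n. gx g' n i \<in> rgr R (gd g' n + a - gd g' i)) \<and>
      gy g' n \<in> grade D (gd g' n) \<and> gdif R g' (gx g' n) = (\<lambda>_. \<zero>\<^bsub>R\<^esub>) \<and> geps R D g' (gx g' n) = diff D (gy g' n)"
      using F(1-6) eqs[OF n] eqs(1)[OF lt] 1 2 by simp
  qed
qed

lemma FM_graded: "graded_module R (FM R I g)"
  unfolding FM_def by (rule fmod_graded_module)

lemma FM_grade:
  "c \<in> grade (FM R I g) j \<longleftrightarrow> c \<in> coefs R I \<and> (\<forall>i\<in>I. c i \<in> rgr R (j - gd g i))"
proof -
  have "c i \<in> rgr R k" if "c \<in> coefs R I" "i \<notin> I" for i k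
    using coefsD(2)[OF that] rd.G_zero by simp
  then have "(\<forall>i. c i \<in> rgr R (j - gd (rg I g) i)) \<longleftrightarrow> (\<forall>i\<in>I. c i \<in> rgr R (j - gd g i))" if "c \<in> coefs R I"
    using that rg_simps(1)[of _ I g] by metis
  then show ?thesis unfolding FM_def by auto
qed

lemma FM_basis: "homogeneous_basis R (FM R I g) (unitvec R ` I)"
  unfolding FM_def by (rule fmod_basis)

lemma FM_lincomb:
  assumes "c \<in> coefs R J" "\<And>i. i \<in> J \<Longrightarrow> gx g i \<in> coefs R I"
  shows "lincomb R (FM R I g') (gx g) c = gdif R g c"
  unfolding FM_def gdif_def by (rule fmod_lincomb[OF assms(1)]) (use assms(2) in auto)

lemma gx_grade:
  assumes fd: "flag_data R a D I g" and n: "n \<in> I"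
  shows "gx g n \<in> grade (FM R I g) (gd g n + a)"
  unfolding FM_grade
proof (intro conjI ballI)
  fix i assume "i \<in> I"
  show "gx g n i \<in> rgr R (gd g n + a - gd g i)"
  proof (cases "i < n")
    case False
    then have "gx g n i = \<zero>\<^bsub>R\<^esub>" using coefsD(2)[OF flag_dataD(2)[OF fd n]] by simp
    then show ?thesis using rd.G_zero by simp
  qed (use flag_dataD(3)[OF fd n] in simp)
qed (rule flag_dataD(7)[OF fd n])

lemma graded_hom_cong:
  assumes M: "graded_module R M" and f: "f \<in> graded_hom R M N" and eq: "\<And>x. x \<in> carrier M \<Longrightarrow> f x = g x"
  shows "g \<in> graded_hom R M N"
proof -
  interpret M: graded_module R M by fact
  show ?thesis
  proof (rule graded_homI)
    fix x j assume "x \<in> grade M j"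
    then show "g x \<in> grade N j" using graded_homD(5)[OF f] eq[OF M.md.G_in_carrier] by simp
  qed (simp_all add: eq[symmetric] graded_homD[OF f] M.smult_closed)
qed

lemma FM_facts:
  assumes fd: "flag_data R a D I g"
  shows FM_diff_module: "diff_module R a (FM R I g)"
    and geps_hom: "geps R D (rg I g) \<in> diff_hom R (FM R I g) D"
proof -
  let ?F = "FM R I g"
  note FG = FM_graded[of I g]
  interpret F: graded_module R ?F by (rule FG)
  have gxI: "gx (rg I g) \<in> I \<rightarrow> carrier ?F" using flag_dataD(7)[OF fd] by (simp add: rg_simps)
  have gxk: "gx (rg I g) i \<in> grade (twist ?F a) (gd (rg I g) i)" if "i \<in> I" for i
    using gx_grade[OF fd that] that by (simp add: rg_simps add.commute)
  have "lincomb R (twist ?F a) (gx (rg I g)) \<in> graded_hom R ?F (twist ?F a)"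
    unfolding FM_def by (rule fmod_hom[OF twist_graded_module[OF FG, unfolded FM_def]])
      (use gxk in \<open>simp add: FM_def\<close>)
  then have lc: "lincomb R ?F (gx (rg I g)) \<in> graded_hom R ?F (twist ?F a)" by simp
  have lcd: "lincomb R ?F (gx (rg I g)) c = gdif R (rg I g) c" if "c \<in> coefs R I" for c
    by (rule FM_lincomb[OF that]) (use gxI in auto)
  have dh: "diff ?F \<in> graded_hom R ?F (twist ?F a)"
    unfolding FM_simps by (rule graded_hom_cong[OF FG lc]) (simp add: lcd)
  note dh' = graded_hom_lincomb[OF FG twist_graded_module[OF FG] dh, simplified]
  show dm: "diff_module R a ?F"
  proof (rule diff_moduleI[OF FG dh])
    fix c assume "c \<in> carrier ?F"
    then have c: "c \<in> coefs R I" by simp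
    have "gdif R (rg I g) (gdif R (rg I g) c) = lincomb R ?F (\<lambda>i. gdif R (rg I g) (gx (rg I g) i)) c"
      unfolding lcd[OF c, symmetric] by (rule dh'[OF c]) (use gxI in auto)
    also have "\<dots> = lincomb R ?F (\<lambda>i. \<zero>\<^bsub>?F\<^esub>) c"
    proof (rule F.lincomb_cong[OF c])
      fix i assume "i \<in> I"
      then show "gdif R (rg I g) (gx (rg I g) i) = \<zero>\<^bsub>?F\<^esub>"
        using gdif_rg[OF fd] flag_dataD(5,7)[OF fd] by (simp add: rg_simps)
    next
      show "(\<lambda>i. gdif R (rg I g) (gx (rg I g) i)) \<in> I \<rightarrow> carrier ?F"
        using gxI graded_homD(2)[OF dh] by auto
    qed
    also have "\<dots> = \<zero>\<^bsub>?F\<^esub>"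
      unfolding lincomb_def by (rule F.M.add.finprod_one_eqI) (use coefsD(1)[OF c] F.smult_r_zero in blast)
    finally show "diff ?F (diff ?F c) = \<zero>\<^bsub>?F\<^esub>" by simp
  qed
  have gyI: "gy (rg I g) \<in> I \<rightarrow> carrier D" using flag_dataD(8)[OF fd] by (simp add: rg_simps)
  have eh: "geps R D (rg I g) \<in> graded_hom R ?F D"
    unfolding geps_def FM_def by (rule fmod_hom[OF d_graded]) (use flag_dataD(4)[OF fd] in \<open>simp add: rg_simps\<close>)
  have "geps R D (rg I g) (gdif R (rg I g) c) = diff D (geps R D (rg I g) c)" if c: "c \<in> coefs R I" for c
  proof -
    have "geps R D (rg I g) (gdif R (rg I g) c) = lincomb R D (\<lambda>i. geps R D (rg I g) (gx (rg I g) i)) c"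
      unfolding lcd[OF c, symmetric] by (rule graded_hom_lincomb[OF FG d_graded eh c gxI])
    also have "\<dots> = lincomb R D (\<lambda>i. diff D (gy (rg I g) i)) c"
    proof (rule lincomb_cong[OF c])
      fix i assume i: "i \<in> I"
      show "geps R D (rg I g) (gx (rg I g) i) = diff D (gy (rg I g) i)"
        using flag_dataD(6,7)[OF fd i] geps_rg[OF fd] i by (simp add: rg_simps)
    next
      show "(\<lambda>i. geps R D (rg I g) (gx (rg I g) i)) \<in> I \<rightarrow> carrier D"
        using gxI graded_homD(2)[OF eh] by auto
    qed
    also have "\<dots> = diff D (geps R D (rg I g) c)"
      unfolding geps_def
      using graded_hom_lincomb[OF d_graded twist_graded_module[OF d_graded] diff_hom c gyI] by simp
    finally show ?thesis .
  qed
  then show "geps R D (rg I g) \<in> diff_hom R ?F D" using eh by (simp add: diff_hom_def)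
qed

text \<open>The cone of the map to \<open>D\<close> from the free differential module on the generators in \<open>I\<close>.\<close>

abbreviation Cn :: "nat set \<Rightarrow> ('r, 'd) attaching \<Rightarrow> ('r, 'd \<times> (nat \<Rightarrow> 'r)) diff_module"
  where "Cn I g \<equiv> cone a D (FM R I g) (geps R D (rg I g))"

lemma Cn_cong: "(\<And>i. i \<in> I \<Longrightarrow> g i = g' i) \<Longrightarrow> Cn I g = Cn I g'"
  using rg_cong[of I g g'] FM_cong[of I g g' R] by simp

lemma Cn_diff_module: "flag_data R a D I g \<Longrightarrow> diff_module R a (Cn I g)"
  by (intro cone_diff_module FM_diff_module geps_hom diff_module_axioms)

lemma Cn_cycles:
  assumes fd: "flag_data R a D I g"
  shows "(d, x) \<in> cycles (Cn I g) \<longleftrightarrow>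
    d \<in> carrier D \<and> x \<in> coefs R I \<and> gdif R g x = (\<lambda>_. \<zero>\<^bsub>R\<^esub>) \<and> geps R D g x = diff D d"
  unfolding cone_cycles[OF diff_module_axioms geps_hom[OF fd]]
  using gdif_rg[OF fd] geps_rg[OF fd] by auto

lemma Cn_boundaries:
  assumes fd: "flag_data R a D I g"
  shows "(d, x) \<in> boundaries (Cn I g) \<longleftrightarrow>
    (\<exists>d'\<in>carrier D. \<exists>x'\<in>coefs R I. d = geps R D g x' \<ominus>\<^bsub>D\<^esub> diff D d' \<and> x = gdif R g x')"
  unfolding cone_boundaries using gdif_rg[OF fd] geps_rg[OF fd] by auto

lemma Cn_boundaries_mono:
  assumes "flag_data R a D I g" "flag_data R a D J g" "I \<subseteq> J"
  shows "boundaries (Cn I g) \<subseteq> boundaries (Cn J g)"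
proof (rule subrelI)
  fix d x assume "(d, x) \<in> boundaries (Cn I g)"
  then show "(d, x) \<in> boundaries (Cn J g)"
    unfolding Cn_boundaries[OF assms(1)] Cn_boundaries[OF assms(2)] using coefs_mono[OF assms(3), of R] by blast
qed

lemma gdif_unitvec:
  assumes fd: "flag_data R a D I g" and n: "n \<in> I"
  shows "gdif R g (unitvec R n) = gx g n" "geps R D g (unitvec R n) = gy g n"
proof -
  interpret F: graded_module R "FM R I g" by (rule FM_graded)
  have "lincomb R (FM R I g) (gx g) (unitvec R n) = gx g n"
    by (rule F.lincomb_unitvec) (simp add: flag_dataD(7)[OF fd n])
  then show "gdif R g (unitvec R n) = gx g n"
    using FM_lincomb[OF L.coefs_unitvec[OF n], of g I g] flag_dataD(7)[OF fd] by simp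
  show "geps R D g (unitvec R n) = gy g n"
    unfolding geps_def by (rule lincomb_unitvec) (rule flag_dataD(8)[OF fd n])
qed

text \<open>In the cone, the differential of the generator \<open>e\<^sub>n\<close> is the cycle along which it is attached.\<close>

lemma attaching_cycle_boundary:
  assumes fd: "flag_data R a D I g" and n: "n \<in> I"
  shows "(gy g n, gx g n) \<in> boundaries (Cn I g)"
  unfolding Cn_boundaries[OF fd]
  using gdif_unitvec[OF fd n] L.coefs_unitvec[OF n] flag_dataD(8)[OF fd n]
  by (intro bexI[of _ "\<zero>\<^bsub>D\<^esub>"] bexI[of _ "unitvec R n"]) (auto simp: a_minus_def M.a_inv_zero)

lemma Cn_lincomb:
  assumes c: "c \<in> coefs R J" and y: "\<And>n. n \<in> J \<Longrightarrow> gy g n \<in> carrier D" and x: "\<And>n. n \<in> J \<Longrightarrow> gx g n \<in> coefs R I"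
  shows "lincomb R (Cn I g') (\<lambda>n. (gy g n, gx g n)) c = (geps R D g c, gdif R g c)"
proof -
  let ?C = "Cn I g'"
  have C: "left_module R ?C"
    by (rule graded_module_left[OF cone_graded_module(1)[OF d_graded FM_graded]])
  have k: "(\<lambda>n. (gy g n, gx g n)) \<in> J \<rightarrow> carrier ?C" using x y by auto
  have "fst (lincomb R ?C (\<lambda>n. (gy g n, gx g n)) c) = lincomb R D (\<lambda>n. fst (gy g n, gx g n)) c"
    by (rule hom_lincomb[OF C left_module_axioms _ _ c k]) (auto simp: add_hom_def)
  moreover have "snd (lincomb R ?C (\<lambda>n. (gy g n, gx g n)) c) = lincomb R (FM R I g') (\<lambda>n. snd (gy g n, gx g n)) c"
    by (rule hom_lincomb[OF C graded_module_left[OF FM_graded] _ _ c k]) (auto simp: add_hom_def)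
  ultimately show ?thesis using FM_lincomb[OF c x] by (simp add: geps_def prod_eq_iff)
qed

lemma gdif_add:
  assumes fd: "flag_data R a D I g" and c: "c \<in> coefs R I" "d \<in> coefs R I"
  shows "gdif R g (\<lambda>i. c i \<oplus>\<^bsub>R\<^esub> d i) = (\<lambda>k. gdif R g c k \<oplus>\<^bsub>R\<^esub> gdif R g d k)"
    "geps R D g (\<lambda>i. c i \<oplus>\<^bsub>R\<^esub> d i) = geps R D g c \<oplus>\<^bsub>D\<^esub> geps R D g d"
    "gdif R g c \<in> coefs R I" "geps R D g c \<in> carrier D"
proof -
  interpret F: diff_module R a "FM R I g" by (rule FM_diff_module[OF fd])
  note E = graded_homD[OF diff_homD(1)[OF geps_hom[OF fd]]]
  show "gdif R g (\<lambda>i. c i \<oplus>\<^bsub>R\<^esub> d i) = (\<lambda>k. gdif R g c k \<oplus>\<^bsub>R\<^esub> gdif R g d k)"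
    "gdif R g c \<in> coefs R I"
    using F.d_simps(3)[of c d] F.d_simps(1)[of c] c gdif_rg[OF fd] L.coefs_add[OF c] by auto
  show "geps R D g (\<lambda>i. c i \<oplus>\<^bsub>R\<^esub> d i) = geps R D g c \<oplus>\<^bsub>D\<^esub> geps R D g d" "geps R D g c \<in> carrier D"
    using E(3)[of c d] E(2)[of c] c geps_rg[OF fd] L.coefs_add[OF c] by auto
qed

lemma coefs_split:
  assumes c: "c \<in> coefs R J"
  shows "(\<lambda>i. if i \<in> I then c i else \<zero>\<^bsub>R\<^esub>) \<in> coefs R I"
    "(\<lambda>i. if i \<in> J - I then c i else \<zero>\<^bsub>R\<^esub>) \<in> coefs R (J - I)"
    "(\<lambda>i. (if i \<in> I then c i else \<zero>\<^bsub>R\<^esub>) \<oplus>\<^bsub>R\<^esub> (if i \<in> J - I then c i else \<zero>\<^bsub>R\<^esub>)) = c"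
proof -
  show "(\<lambda>i. if i \<in> I then c i else \<zero>\<^bsub>R\<^esub>) \<in> coefs R I"
    using L.coefs_restrict[OF c, of I] coefs_mono[of "J \<inter> I" I R] by blast
  show "(\<lambda>i. if i \<in> J - I then c i else \<zero>\<^bsub>R\<^esub>) \<in> coefs R (J - I)"
    using L.coefs_restrict[OF c, of "J - I"] coefs_mono[of "J \<inter> (J - I)" "J - I" R] by blast
  show "(\<lambda>i. (if i \<in> I then c i else \<zero>\<^bsub>R\<^esub>) \<oplus>\<^bsub>R\<^esub> (if i \<in> J - I then c i else \<zero>\<^bsub>R\<^esub>)) = c"
    using coefsD(1,2)[OF c] by (auto simp: fun_eq_iff)
qed

text \<open>Let the generators in \<open>J - I\<close> be attached along cycles of the cone over \<open>I\<close>. The cycles of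
  the new cone correspond to the relations that these attaching cycles satisfy modulo boundaries.\<close>

lemma new_cycle_relation:
  assumes I: "flag_data R a D I g" and J: "flag_data R a D J g" "I \<subseteq> J"
    and x: "\<And>n. n \<in> J - I \<Longrightarrow> gx g n \<in> coefs R I" and z: "(d, z) \<in> cycles (Cn J g)"
  shows "lincomb R (Cn I g) (\<lambda>n. (gy g n, gx g n)) (\<lambda>i. if i \<in> J - I then z i else \<zero>\<^bsub>R\<^esub>) \<in> boundaries (Cn I g)"
proof -
  interpret F: graded_module R "FM R I g" by (rule FM_graded)
  have z': "d \<in> carrier D" "z \<in> coefs R J" "gdif R g z = (\<lambda>_. \<zero>\<^bsub>R\<^esub>)" "geps R D g z = diff D d"
    using z Cn_cycles[OF J(1)] by auto
  let ?x = "\<lambda>i. if i \<in> I then z i else \<zero>\<^bsub>R\<^esub>" and ?t = "\<lambda>i. if i \<in> J - I then z i else \<zero>\<^bsub>R\<^esub>"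
  note s = coefs_split[OF z'(2), of I]
  have xJ: "?x \<in> coefs R J" and tJ: "?t \<in> coefs R J"
    using s coefs_mono[OF J(2), of R] coefs_mono[of "J - I" J R] by auto
  note ga = gdif_add[OF J(1) xJ tJ, unfolded s(3) z'(3,4)]
  note gI = gdif_add(3,4)[OF I s(1) s(1)]
  have tI: "gdif R g ?t \<in> coefs R I" "geps R D g ?t \<in> carrier D"
  proof -
    have "lincomb R (FM R I g) (gx g) ?t \<in> carrier (FM R I g)"
      by (rule F.lincomb_closed[OF s(2)]) (use x in auto)
    then show "gdif R g ?t \<in> coefs R I" using FM_lincomb[OF s(2), of g I g] x by simp
    show "geps R D g ?t \<in> carrier D" by (rule gdif_add(4)[OF J(1) tJ tJ])
  qed
  let ?m = "\<ominus>\<^bsub>R\<^esub> \<one>\<^bsub>R\<^esub>"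
  let ?nx = "\<lambda>i. ?m \<otimes>\<^bsub>R\<^esub> ?x i"
  have nx: "?nx \<in> coefs R I" using L.coefs_lmult[OF _ s(1), of ?m] by simp
  interpret FF: diff_module R a "FM R I g" by (rule FM_diff_module[OF I])
  have d1: "gdif R g ?nx = (\<lambda>k. ?m \<otimes>\<^bsub>R\<^esub> gdif R g ?x k)"
    using FF.d_simps(4)[of ?m ?x] s(1) nx gdif_rg[OF I] by simp
  have e1: "geps R D g ?nx = ?m \<odot>\<^bsub>D\<^esub> geps R D g ?x"
    using graded_homD(4)[OF diff_homD(1)[OF geps_hom[OF I]], of ?m ?x] s(1) nx geps_rg[OF I] by simp
  have "gdif R g ?t = gdif R g ?nx"
  proof
    fix k
    have "gdif R g ?x k \<oplus>\<^bsub>R\<^esub> gdif R g ?t k = \<zero>\<^bsub>R\<^esub>" using ga(1) by metis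
    then have "gdif R g ?t k = \<ominus>\<^bsub>R\<^esub> gdif R g ?x k"
      using coefsD(1)[OF gI(1), of k] coefsD(1)[OF tI(1), of k]
        L.minus_equality[of "gdif R g ?t k" "gdif R g ?x k"] L.a_comm[of "gdif R g ?t k" "gdif R g ?x k"] by simp
    then show "gdif R g ?t k = gdif R g ?nx k"
      unfolding d1 using coefsD(1)[OF gI(1), of k] by (simp add: L.l_minus)
  qed
  moreover have "geps R D g ?t = geps R D g ?nx \<ominus>\<^bsub>D\<^esub> diff D (\<ominus>\<^bsub>D\<^esub> d)"
  proof -
    have c: "diff D d \<in> carrier D" using z'(1) d_simps by simp
    have "geps R D g ?nx \<ominus>\<^bsub>D\<^esub> diff D (\<ominus>\<^bsub>D\<^esub> d) = \<ominus>\<^bsub>D\<^esub> geps R D g ?x \<oplus>\<^bsub>D\<^esub> (geps R D g ?x \<oplus>\<^bsub>D\<^esub> geps R D g ?t)"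
      using e1 z'(1) c gI(2) ga(2) neg_eq_smult[OF gI(2)] by (simp add: d_neg a_minus_def)
    also have "\<dots> = geps R D g ?t" using gI(2) tI(2) by (rule M.r_neg1)
    finally show ?thesis by simp
  qed
  ultimately have "(geps R D g ?t, gdif R g ?t) \<in> boundaries (Cn I g)"
    unfolding Cn_boundaries[OF I] using nx z'(1) by (intro bexI[of _ "\<ominus>\<^bsub>D\<^esub> d"] bexI[of _ ?nx]) auto
  then show ?thesis using Cn_lincomb[OF s(2), of g I g] x flag_dataD(8)[OF J(1)] by simp
qed

lemma relation_new_cycle:
  assumes I: "flag_data R a D I g" and J: "flag_data R a D J g" "I \<subseteq> J"
    and x: "\<And>n. n \<in> J - I \<Longrightarrow> gx g n \<in> coefs R I" and t: "t \<in> coefs R (J - I)"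
    and b: "lincomb R (Cn I g) (\<lambda>n. (gy g n, gx g n)) t \<in> boundaries (Cn I g)"
  shows "\<exists>d x. x \<in> coefs R I \<and> (d, \<lambda>i. t i \<oplus>\<^bsub>R\<^esub> x i) \<in> cycles (Cn J g)"
proof -
  have tJ: "t \<in> coefs R J" using t coefs_mono[of "J - I" J R] by blast
  have "(geps R D g t, gdif R g t) \<in> boundaries (Cn I g)"
    using b Cn_lincomb[OF t, of g I g] x flag_dataD(8)[OF J(1)] by simp
  then obtain d' x' where *: "d' \<in> carrier D" "x' \<in> coefs R I" "geps R D g t = geps R D g x' \<ominus>\<^bsub>D\<^esub> diff D d'"
    "gdif R g t = gdif R g x'" unfolding Cn_boundaries[OF I] by blast
  let ?m = "\<ominus>\<^bsub>R\<^esub> \<one>\<^bsub>R\<^esub>"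
  let ?nx = "\<lambda>i. ?m \<otimes>\<^bsub>R\<^esub> x' i"
  have nx: "?nx \<in> coefs R I" using L.coefs_lmult[OF _ *(2), of ?m] by simp
  then have nxJ: "?nx \<in> coefs R J" using coefs_mono[OF J(2), of R] by blast
  interpret FF: diff_module R a "FM R I g" by (rule FM_diff_module[OF I])
  note gI = gdif_add(3,4)[OF I *(2) *(2)]
  have d1: "gdif R g ?nx = (\<lambda>k. ?m \<otimes>\<^bsub>R\<^esub> gdif R g x' k)"
    using FF.d_simps(4)[of ?m x'] *(2) nx gdif_rg[OF I] by simp
  have e1: "geps R D g ?nx = ?m \<odot>\<^bsub>D\<^esub> geps R D g x'"
    using graded_homD(4)[OF diff_homD(1)[OF geps_hom[OF I]], of ?m x'] *(2) nx geps_rg[OF I] by simp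
  have c: "diff D d' \<in> carrier D" using *(1) d_simps by simp
  have "gdif R g (\<lambda>i. t i \<oplus>\<^bsub>R\<^esub> ?nx i) = (\<lambda>_. \<zero>\<^bsub>R\<^esub>)"
    unfolding gdif_add(1)[OF J(1) tJ nxJ] d1 *(4) using coefsD(1)[OF gI(1)] by (simp add: L.l_minus L.r_neg)
  moreover have "geps R D g (\<lambda>i. t i \<oplus>\<^bsub>R\<^esub> ?nx i) = diff D (\<ominus>\<^bsub>D\<^esub> d')"
  proof -
    have "geps R D g (\<lambda>i. t i \<oplus>\<^bsub>R\<^esub> ?nx i) = (geps R D g x' \<ominus>\<^bsub>D\<^esub> diff D d') \<oplus>\<^bsub>D\<^esub> \<ominus>\<^bsub>D\<^esub> geps R D g x'"
      unfolding gdif_add(2)[OF J(1) tJ nxJ] e1 *(3) using gI(2) by (simp add: neg_eq_smult)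
    also have "\<dots> = \<ominus>\<^bsub>D\<^esub> diff D d'" using gI(2) c by algebra
    finally show ?thesis using *(1) by (simp add: d_neg)
  qed
  ultimately have "(\<ominus>\<^bsub>D\<^esub> d', \<lambda>i. t i \<oplus>\<^bsub>R\<^esub> ?nx i) \<in> cycles (Cn J g)"
    unfolding Cn_cycles[OF J(1)] using *(1) L.coefs_add[OF tJ nxJ] by auto
  then show ?thesis using nx by blast
qed

end

lemma (in graded_ring) fmod_spn: 
  "carrier (fmod R I deg z) = spn R (fmod R I deg z) (unitvec R ` I)"
proof -
  interpret F: graded_module R "fmod R I deg z" by (rule fmod_graded_module)
  have uc: "unitvec R ` I \<subseteq> carrier (fmod R I deg z)" using coefs_unitvec by auto
  show ?thesis
  proof (intro equalityI subsetI)
    fix c assume c: "c \<in> carrier (fmod R I deg z)"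
    have "lincomb R (fmod R I deg z) (unitvec R) c \<in> spn R (fmod R I deg z) (unitvec R ` I)"
    proof (rule F.lincomb_submod[OF F.spn_submod[OF uc]])
      fix i assume "c i \<noteq> \<zero>"
      then have "i \<in> I" "c i \<in> carrier R" using c by (auto simp: coefs_def)
      then show "c i \<odot>\<^bsub>fmod R I deg z\<^esub> unitvec R i \<in> spn R (fmod R I deg z) (unitvec R ` I)"
        using F.spn_incl[OF uc] by (intro submodD(4)[OF F.spn_submod[OF uc]]) auto
    qed
    then show "c \<in> spn R (fmod R I deg z) (unitvec R ` I)" using c by (simp add: fmod_lincomb_unitvec)
  qed (use F.spn_subset[OF uc] in blast)
qed

lemma grade_hdeg: "x \<in> (\<Union>j. grade M j) \<Longrightarrow> x \<in> grade M (hdeg M x)"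
  unfolding hdeg_def by (auto intro: someI)

context resolving begin

text \<open>The second components of the cycles form a submodule of a Noetherian module, and the cycles with
  second component zero come from the finitely generated module \<open>H(D)\<close>.\<close>

lemma Cn_finitely_generated:
  assumes fd: "flag_data R a D {..<N} g"
    and A: "finite A" "A \<subseteq> cycles D" "cycles D \<subseteq> spn R D (boundaries D \<union> A)"
  shows "\<exists>S. finite S \<and> S \<subseteq> cycles (Cn {..<N} g) \<and> cycles (Cn {..<N} g) \<subseteq> spn R (Cn {..<N} g) (boundaries (Cn {..<N} g) \<union> S)"
proof -
  let ?F = "FM R {..<N} g" and ?C = "Cn {..<N} g"
  let ?o = "\<lambda>_ :: nat. \<zero>\<^bsub>R\<^esub>"
  interpret F: graded_module R ?F by (rule FM_graded)
  interpret C: diff_module R a ?C by (rule Cn_diff_module[OF fd])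
  have acc: "acc (\<lambda>I. left_ideal I R)" using noetherian by (simp add: noncomm_noetherian_def)
  let ?U = "unitvec R ` {..<N}"
  have U: "finite ?U" "?U \<subseteq> carrier ?F" by (auto simp: L.coefs_unitvec)
  have T: "snd ` cycles ?C \<subseteq> spn R ?F ?U"
  proof -
    have "carrier ?F = spn R ?F ?U" unfolding FM_def by (rule fmod_spn)
    then show ?thesis using C.cycles_closed(1) by auto
  qed
  obtain T' where T': "finite T'" "T' \<subseteq> snd ` cycles ?C" "snd ` cycles ?C \<subseteq> spn R ?F T'"
    using F.finitely_spanned_subset[OF acc U T] by blast
  have "\<forall>t\<in>T'. \<exists>d. (d, t) \<in> cycles ?C" using T'(2) by force
  then obtain \<delta> where \<delta>: "\<And>t. t \<in> T' \<Longrightarrow> (\<delta> t, t) \<in> cycles ?C" by metis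
  let ?S = "(\<lambda>t. (\<delta> t, t)) ` T' \<union> (\<lambda>d. (d, ?o)) ` A"
  have z0: "(d, ?o) \<in> cycles ?C \<longleftrightarrow> d \<in> cycles D" for d
    unfolding Cn_cycles[OF fd] by (auto simp: cycles_def L.coefs_zero gdif_def geps_def lincomb_def)
  have SZ: "?S \<subseteq> cycles ?C" using \<delta> z0 A(2) by auto
  have SC: "?S \<subseteq> carrier ?C" using SZ C.cycles_closed(1) by blast
  let ?W = "spn R ?C (boundaries ?C \<union> ?S)"
  let ?V = "{d \<in> carrier D. (d, ?o) \<in> ?W}"
  have BS: "boundaries ?C \<union> ?S \<subseteq> carrier ?C" using SC C.boundaries_closed(1) by blast
  note W = submodD[OF C.spn_submod[OF BS]]
  have D0: "spn R D (boundaries D \<union> A) \<subseteq> ?V"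
  proof (rule spn_least)
    show "submod R D ?V"
    proof (rule submodI)
      fix d e assume "d \<in> ?V" "e \<in> ?V"
      then show "d \<oplus>\<^bsub>D\<^esub> e \<in> ?V"
        using W(3)[of "(d, ?o)" "(e, ?o)"] by simp
    next
      fix r d assume "r \<in> carrier R" "d \<in> ?V"
      then show "r \<odot>\<^bsub>D\<^esub> d \<in> ?V"
        using W(4)[of r "(d, ?o)"] smult_closed by simp
    qed (use W(2) in auto)
    have "(b, ?o) \<in> boundaries ?C" if b: "b \<in> boundaries D" for b
    proof -
      obtain e where e: "e \<in> carrier D" "b = diff D e" using b by (auto simp: boundaries_def)
      show ?thesis
        unfolding Cn_boundaries[OF fd]
        by (rule bexI[of _ "\<ominus>\<^bsub>D\<^esub> e"], rule bexI[of _ "\<lambda>_. \<zero>\<^bsub>R\<^esub>"])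
          (use e in \<open>auto simp: L.coefs_zero gdif_def geps_def lincomb_def d_neg a_minus_def d_simps\<close>)
    qed
    moreover have "(d, ?o) \<in> ?S" if "d \<in> A" for d using that by blast
    ultimately show "boundaries D \<union> A \<subseteq> ?V"
      using C.spn_incl[OF BS] boundaries_closed(1) cycles_closed(1) A(2) by blast
  qed
  have "cycles ?C \<subseteq> ?W"
  proof
    fix z assume z: "z \<in> cycles ?C"
    then have "snd z \<in> spn R ?F T'" using T'(3) by blast
    then obtain c where c: "c \<in> coefs R T'" "snd z = lincomb R ?F (\<lambda>x. x) c" by (auto simp: spn_def)
    let ?w = "lincomb R ?C (\<lambda>t. (\<delta> t, t)) c"
    have TC: "(\<lambda>t. (\<delta> t, t)) \<in> T' \<rightarrow> carrier ?C" using \<delta> C.cycles_closed(1) by blast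
    have TS: "(\<delta> t, t) \<in> boundaries ?C \<union> ?S" if "t \<in> T'" for t using that by blast
    have tin: "t \<in> T'" if "c t \<noteq> \<zero>\<^bsub>R\<^esub>" for t using coefsD(2)[OF c(1), of t] that by blast
    have wW: "?w \<in> ?W"
    proof (rule C.lincomb_submod[OF C.spn_submod[OF BS]])
      fix t assume "c t \<noteq> \<zero>\<^bsub>R\<^esub>"
      then have "(\<delta> t, t) \<in> ?W" using C.spn_incl[OF BS TS[OF tin]] by blast
      then show "c t \<odot>\<^bsub>?C\<^esub> (\<delta> t, t) \<in> ?W" by (rule W(4)[OF coefsD(1)[OF c(1)]])
    qed
    have wZ: "?w \<in> cycles ?C"
    proof (rule C.lincomb_submod[OF gsubD(1)[OF C.cycles_gsub]])
      fix t assume "c t \<noteq> \<zero>\<^bsub>R\<^esub>"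
      then show "c t \<odot>\<^bsub>?C\<^esub> (\<delta> t, t) \<in> cycles ?C" by (intro C.cycles_closed(4)[OF coefsD(1)[OF c(1)]] \<delta> tin)
    qed
    have "snd ?w = lincomb R ?F (\<lambda>t. snd (\<delta> t, t)) c"
      by (rule hom_lincomb[OF C.left_module_axioms F.left_module_axioms _ _ c(1) TC]) (auto simp: add_hom_def)
    then have sw: "snd ?w = snd z" using c(2) by simp
    let ?v = "z \<ominus>\<^bsub>?C\<^esub> ?w"
    have v: "?v \<in> cycles ?C" by (rule C.submod_minus[OF gsubD(1)[OF C.cycles_gsub] z wZ])
    have zc: "z \<in> carrier ?C" "?w \<in> carrier ?C" using z wZ C.cycles_closed(1) by blast+
    have "snd ?v = snd z \<ominus>\<^bsub>?F\<^esub> snd ?w"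
      by (rule add_hom_minus[OF C.M.abelian_group_axioms F.M.abelian_group_axioms _ zc]) (auto simp: add_hom_def)
    also have "\<dots> = \<zero>\<^bsub>?F\<^esub>" using zc sw F.M.minus_eq_zero_iff[of "snd z" "snd ?w"] by auto
    finally have "?v = (fst ?v, ?o)" by (simp add: prod_eq_iff)
    then have "fst ?v \<in> cycles D" using v z0[of "fst ?v"] by simp
    then have "(fst ?v, ?o) \<in> ?W" using A(3) D0 by blast
    then have vW: "?v \<in> ?W" using \<open>?v = (fst ?v, ?o)\<close> by simp
    have "?v \<oplus>\<^bsub>?C\<^esub> ?w = z"
      by (rule C.M.minus_add_cancel[OF zc])
    then show "z \<in> ?W" using W(3)[OF vW wW] by simp
  qed
  then show ?thesis using T'(1) A(1) SZ by (intro exI[of _ ?S]) auto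
qed

text \<open>Homogeneous cycles whose classes form a minimal set of generators of the homology of the cone: the
  coefficients of every relation between the classes lie in \<open>\<mm>\<close>.\<close>

definition minimal_cycles :: "nat \<Rightarrow> ('r, 'd) attaching \<Rightarrow> ('d \<times> (nat \<Rightarrow> 'r)) set \<Rightarrow> bool"
  where "minimal_cycles N g S \<longleftrightarrow> finite S \<and> S \<subseteq> cycles (Cn {..<N} g) \<and> S \<subseteq> (\<Union>j. grade (Cn {..<N} g) j) \<and>
    cycles (Cn {..<N} g) \<subseteq> spn R (Cn {..<N} g) (boundaries (Cn {..<N} g) \<union> S) \<and>
    (\<forall>c\<in>coefs R S. lincomb R (Cn {..<N} g) (\<lambda>x. x) c \<in> boundaries (Cn {..<N} g) \<longrightarrow> (\<forall>s. c s \<in> \<mm>))"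

lemma minimal_cycles_exist:
  assumes fd: "flag_data R a D {..<N} g"
    and A: "finite A" "A \<subseteq> cycles D" "cycles D \<subseteq> spn R D (boundaries D \<union> A)"
  shows "\<exists>S. minimal_cycles N g S"
proof -
  let ?C = "Cn {..<N} g"
  interpret C: diff_module R a ?C by (rule Cn_diff_module[OF fd])
  obtain S0 where S0: "finite S0" "S0 \<subseteq> cycles ?C" "cycles ?C \<subseteq> spn R ?C (boundaries ?C \<union> S0)"
    using Cn_finitely_generated[OF assms] by blast
  obtain T where T: "finite T" "T \<subseteq> cycles ?C" "T \<subseteq> (\<Union>j. grade ?C j)" "S0 \<subseteq> spn R ?C T"
    using C.gsub_mpart_generators[OF C.cycles_gsub S0(1,2)] by blast
  have TC: "boundaries ?C \<union> T \<subseteq> carrier ?C" using T(2) C.cycles_closed(1) C.boundaries_closed(1) by blast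
  have "boundaries ?C \<union> S0 \<subseteq> spn R ?C (boundaries ?C \<union> T)"
    using T(4) C.spn_mono[of T "boundaries ?C \<union> T"] C.spn_incl[OF TC] by blast
  then have "spn R ?C (boundaries ?C \<union> S0) \<subseteq> spn R ?C (boundaries ?C \<union> T)"
    by (rule C.spn_least[OF C.spn_submod[OF TC]])
  then have "cycles ?C \<subseteq> spn R ?C (boundaries ?C \<union> T)" using S0(3) by blast
  from minimal_generators[OF C.d_graded C.boundaries_gsub C.cycles_gsub T(1-3) this]
  show ?thesis unfolding minimal_cycles_def by blast
qed

lemma flag_data_extend:
  assumes fd: "flag_data R a D {..<N} g"
    and S: "finite S" "S \<subseteq> cycles (Cn {..<N} g)" "S \<subseteq> (\<Union>j. grade (Cn {..<N} g) j)"
  shows "\<exists>N' g'. N \<le> N' \<and> (\<forall>i<N. g' i = g i) \<and> flag_data R a D {..<N'} g' \<and>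
    bij_betw (\<lambda>n. (gy g' n, gx g' n)) {N..<N'} S \<and>
    (\<forall>n\<in>{N..<N'}. gd g' n = hdeg (Cn {..<N} g) (gy g' n, gx g' n))"
proof -
  let ?C = "Cn {..<N} g"
  obtain xs where xs: "set xs = S" "distinct xs" using finite_distinct_list[OF S(1)] by blast
  let ?N = "N + length xs"
  define g' where "g' i = (if i < N then g i else (hdeg ?C (xs ! (i - N)), fst (xs ! (i - N)), snd (xs ! (i - N))))" for i
  have old: "g' i = g i" if "i < N" for i using that by (simp add: g'_def)
  have new: "(gy g' n, gx g' n) = xs ! (n - N)" "gd g' n = hdeg ?C (xs ! (n - N))" if "n \<in> {N..<?N}" for n
    using that by (auto simp: g'_def gy_def gx_def gd_def)
  have fd': "flag_data R a D {..<N} g'" by (rule flag_data_cong[OF fd]) (simp add: old)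
  have C': "Cn {..<N} g' = ?C" by (rule Cn_cong) (simp add: old)
  have "flag_data R a D {..<?N} g'"
    unfolding flag_data_def
  proof (intro ballI)
    fix n assume n: "n \<in> {..<?N}"
    show "{..<n} \<subseteq> {..<?N} \<and> gx g' n \<in> coefs R {..<n} \<and> (\<forall>i<n. gx g' n i \<in> rgr R (gd g' n + a - gd g' i)) \<and>
      gy g' n \<in> grade D (gd g' n) \<and> gdif R g' (gx g' n) = (\<lambda>_. \<zero>\<^bsub>R\<^esub>) \<and> geps R D g' (gx g' n) = diff D (gy g' n)"
    proof (cases "n < N")
      case True
      then show ?thesis using flag_dataD(1-6)[OF fd', of n] by auto
    next
      case False
      let ?s = "xs ! (n - N)"
      have nn: "n \<in> {N..<?N}" and s: "?s \<in> S" using n False xs(1) by auto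
      have e: "gy g' n = fst ?s" "gx g' n = snd ?s" "gd g' n = hdeg ?C ?s"
        using new[OF nn] by (auto simp: prod_eq_iff)
      have sc: "(gy g' n, gx g' n) \<in> cycles (Cn {..<N} g')" using S(2) s new(1)[OF nn] C' by auto
      have "?s \<in> grade ?C (hdeg ?C ?s)" using S(3) s by (intro grade_hdeg) blast
      then have "(gy g' n, gx g' n) \<in> grade (Cn {..<N} g') (gd g' n)" using e(3) new(1)[OF nn] C' by simp
      then have g1: "gy g' n \<in> grade D (gd g' n)" "gx g' n \<in> grade (FM R {..<N} g') (gd g' n + a)" by auto
      have cN: "gx g' n \<in> coefs R {..<N}" using g1(2) FM_grade by blast
      have "gx g' n i \<in> rgr R (gd g' n + a - gd g' i)" for i
      proof (cases "i < N")
        case True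
        then show ?thesis using g1(2) FM_grade by blast
      next
        case False
        then have "gx g' n i = \<zero>\<^bsub>R\<^esub>" using coefsD(2)[OF cN] by simp
        then show ?thesis using rd.G_zero by simp
      qed
      moreover have "gx g' n \<in> coefs R {..<n}" using cN coefs_mono[of "{..<N}" "{..<n}" R] False by auto
      ultimately show ?thesis using n g1(1) sc Cn_cycles[OF fd'] by auto
    qed
  qed
  moreover have "bij_betw (\<lambda>n. (gy g' n, gx g' n)) {N..<?N} S"
  proof -
    have "bij_betw ((!) xs) {..<length xs} S" using bij_betw_nth[OF xs(2)] xs(1) by simp
    moreover have "bij_betw (\<lambda>n. n - N) {N..<?N} {..<length xs}"
      by (rule bij_betw_byWitness[where f' = "\<lambda>i. i + N"]) auto
    ultimately have "bij_betw ((!) xs \<circ> (\<lambda>n. n - N)) {N..<?N} S" using bij_betw_trans by blast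
    then show ?thesis using new(1) by (subst bij_betw_cong[where g = "(!) xs \<circ> (\<lambda>n. n - N)"]) auto
  qed
  ultimately show ?thesis using old new by (intro exI[of _ ?N] exI[of _ g']) auto
qed

text \<open>The generators of stage \<open>k\<close> are attached along those elements of a minimal generating set of
  the homology of the cone whose degree is selected by \<open>Sel k\<close>.\<close>

definition tower :: "(nat \<Rightarrow> int \<Rightarrow> bool) \<Rightarrow> (nat \<Rightarrow> nat) \<Rightarrow> ('r, 'd) attaching \<Rightarrow> bool"
  where "tower Sel N g \<longleftrightarrow> N 0 = 0 \<and> (\<forall>k. N k \<le> N (Suc k) \<and> flag_data R a D {..<N k} g \<and>
    (\<exists>S. minimal_cycles (N k) g S \<and>
      bij_betw (\<lambda>n. (gy g n, gx g n)) {N k..<N (Suc k)} {s \<in> S. Sel k (hdeg (Cn {..<N k} g) s)} \<and>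
      (\<forall>n\<in>{N k..<N (Suc k)}. gd g n = hdeg (Cn {..<N k} g) (gy g n, gx g n))))"

text \<open>The stages are chosen one after the other; data for earlier generators are kept, so the choices
  have a limit.\<close>

lemma tower_exists:
  assumes A: "finite A" "A \<subseteq> cycles D" "cycles D \<subseteq> spn R D (boundaries D \<union> A)"
  shows "\<exists>N g. tower Sel N g"
proof -
  define P :: "nat \<Rightarrow> nat \<times> ('r, 'd) attaching \<Rightarrow> bool"
    where "P k u \<longleftrightarrow> (k = 0 \<longrightarrow> fst u = 0) \<and> flag_data R a D {..<fst u} (snd u)" for k u
  define Q :: "nat \<Rightarrow> nat \<times> ('r, 'd) attaching \<Rightarrow> nat \<times> ('r, 'd) attaching \<Rightarrow> bool"
    where "Q k u v \<longleftrightarrow> fst u \<le> fst v \<and> (\<forall>i<fst u. snd v i = snd u i) \<and> (\<exists>S. minimal_cycles (fst u) (snd u) S \<and>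
      bij_betw (\<lambda>n. (gy (snd v) n, gx (snd v) n)) {fst u..<fst v} {s \<in> S. Sel k (hdeg (Cn {..<fst u} (snd u)) s)} \<and>
      (\<forall>n\<in>{fst u..<fst v}. gd (snd v) n = hdeg (Cn {..<fst u} (snd u)) (gy (snd v) n, gx (snd v) n)))" for k u v
  have "\<exists>f. \<forall>k. P k (f k) \<and> Q k (f k) (f (Suc k))"
  proof (rule dependent_nat_choice)
    show "\<exists>u. P 0 u" by (rule exI[of _ "(0, undefined)"]) (simp add: P_def flag_data_def)
  next
    fix u k assume P: "P k u"
    then have fd: "flag_data R a D {..<fst u} (snd u)" by (simp add: P_def)
    obtain S where S: "minimal_cycles (fst u) (snd u) S" using minimal_cycles_exist[OF fd A] by blast
    let ?S = "{s \<in> S. Sel k (hdeg (Cn {..<fst u} (snd u)) s)}"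
    have "finite ?S" "?S \<subseteq> cycles (Cn {..<fst u} (snd u))" "?S \<subseteq> (\<Union>j. grade (Cn {..<fst u} (snd u)) j)"
      using S unfolding minimal_cycles_def by auto
    from flag_data_extend[OF fd this] obtain N' g' where
      "fst u \<le> N'" "\<forall>i<fst u. g' i = snd u i" "flag_data R a D {..<N'} g'"
      "bij_betw (\<lambda>n. (gy g' n, gx g' n)) {fst u..<N'} ?S"
      "\<forall>n\<in>{fst u..<N'}. gd g' n = hdeg (Cn {..<fst u} (snd u)) (gy g' n, gx g' n)" by blast
    then show "\<exists>v. P (Suc k) v \<and> Q k u v"
      using S by (intro exI[of _ "(N', g')"]) (auto simp: P_def Q_def)
  qed
  then obtain f where f: "\<And>k. P k (f k)" "\<And>k. Q k (f k) (f (Suc k))" by blast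
  define N where "N k = fst (f k)" for k
  define g where "g i = snd (f (LEAST k. i < N k)) i" for i
  have step: "snd (f (Suc k)) i = snd (f k) i" if "i < N k" for i k
    using f(2)[of k] that by (simp add: Q_def N_def)
  have mono: "N k \<le> N (Suc k)" for k using f(2)[of k] by (simp add: Q_def N_def)
  have mono': "N k \<le> N l" if "k \<le> l" for k l using lift_Suc_mono_le[of N, OF mono that] .
  have steps: "snd (f (k + m)) i = snd (f k) i" if "i < N k" for i k m
  proof (induction m)
    case (Suc m)
    have "i < N (k + m)" using that mono'[of k "k + m"] by simp
    then show ?case using step[of i "k + m"] Suc by simp
  qed simp
  have g: "g i = snd (f k) i" if "i < N k" for i k
  proof -
    let ?l = "LEAST k. i < N k"
    have l: "i < N ?l" "?l \<le> k" using LeastI[of "\<lambda>k. i < N k" k] Least_le[of "\<lambda>k. i < N k" k] that by auto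
    then show ?thesis using steps[OF l(1), of "k - ?l"] by (simp add: g_def)
  qed
  have "tower Sel N g"
    unfolding tower_def
  proof (intro conjI allI)
    show "N 0 = 0" using f(1)[of 0] by (simp add: P_def N_def)
    fix k
    show "N k \<le> N (Suc k)" by (rule mono)
    have fd: "flag_data R a D {..<N k} (snd (f k))" using f(1)[of k] by (simp add: P_def N_def)
    then show "flag_data R a D {..<N k} g" by (rule flag_data_cong) (simp add: g)
    have C: "Cn {..<N k} (snd (f k)) = Cn {..<N k} g" by (rule Cn_cong) (simp add: g)
    have gn: "gy g n = gy (snd (f (Suc k))) n" "gx g n = gx (snd (f (Suc k))) n" "gd g n = gd (snd (f (Suc k))) n"
      if "n \<in> {N k..<N (Suc k)}" for n
      using g[of n "Suc k"] that by (simp_all add: gy_def gx_def gd_def)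
    obtain S where S: "minimal_cycles (N k) (snd (f k)) S"
      "bij_betw (\<lambda>n. (gy (snd (f (Suc k))) n, gx (snd (f (Suc k))) n)) {N k..<N (Suc k)} {s \<in> S. Sel k (hdeg (Cn {..<N k} (snd (f k))) s)}"
      "\<forall>n\<in>{N k..<N (Suc k)}. gd (snd (f (Suc k))) n = hdeg (Cn {..<N k} (snd (f k))) (gy (snd (f (Suc k))) n, gx (snd (f (Suc k))) n)"
      using f(2)[of k] unfolding Q_def N_def by blast
    show "\<exists>S. minimal_cycles (N k) g S \<and>
      bij_betw (\<lambda>n. (gy g n, gx g n)) {N k..<N (Suc k)} {s \<in> S. Sel k (hdeg (Cn {..<N k} g) s)} \<and>
      (\<forall>n\<in>{N k..<N (Suc k)}. gd g n = hdeg (Cn {..<N k} g) (gy g n, gx g n))"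
    proof (intro exI[of _ S] conjI)
      show "minimal_cycles (N k) g S" using S(1) unfolding minimal_cycles_def C .
      show "bij_betw (\<lambda>n. (gy g n, gx g n)) {N k..<N (Suc k)} {s \<in> S. Sel k (hdeg (Cn {..<N k} g) s)}"
        using S(2) unfolding C by (subst bij_betw_cong[where g = "\<lambda>n. (gy (snd (f (Suc k))) n, gx (snd (f (Suc k))) n)"]) (use gn in auto)
      show "\<forall>n\<in>{N k..<N (Suc k)}. gd g n = hdeg (Cn {..<N k} g) (gy g n, gx g n)"
        using S(3) gn unfolding C by simp
    qed
  qed
  then show ?thesis by blast
qed

text \<open>Every generator forms a layer of its own, since its differential involves only earlier generators.\<close>

lemma FM_free_flag:
  assumes fd: "flag_data R a D I g"
  shows "free_flag R a (FM R I g)"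
proof -
  let ?F = "FM R I g"
  interpret F: diff_module R a ?F by (rule FM_diff_module[OF fd])
  let ?Fl = "\<lambda>i. coefs R ({i} \<inter> I)"
  let ?p = "\<lambda>i c k. if k = i then c k else \<zero>\<^bsub>R\<^esub>"
  have sub: "gsub R ?F (coefs R J)" if "J \<subseteq> I" for J
  proof (rule F.gsubI)
    fix c j assume c: "c \<in> coefs R J"
    then have cI: "c \<in> coefs R I" using coefs_mono[OF that] by blast
    have m: "mpart ?F j c = (\<lambda>i. rpart R (j - gd (rg I g) i) (c i))"
      unfolding FM_def by (rule fmod_mpart[OF cI])
    have "(\<lambda>i. rpart R (j - gd (rg I g) i) (c i)) \<in> coefs R J"
      using coefsD[OF c] by (auto simp: coefs_def rd.dpart_carrier rd.dpart_zero
          intro: finite_subset[of _ "{i. c i \<noteq> \<zero>\<^bsub>R\<^esub>}"])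
    then show "mpart ?F j c \<in> coefs R J" using m by simp
  qed (use that coefs_mono[OF that, of R] in \<open>auto simp: L.coefs_zero L.coefs_add L.coefs_lmult\<close>)
  have add: "additive_subgroup (?Fl i) ?F" for i
    by (rule F.submod_add_subgroup[OF gsubD(1)[OF sub]]) auto
  have pin: "?p i c \<in> coefs R ({i} \<inter> I)" if "c \<in> coefs R I" for i c
    using coefsD[OF that] by (auto simp: coefs_def intro: finite_subset[of _ "{i}"])
  have p1: "?p i \<in> add_hom ?F ?F" for i
  proof (rule add_homI)
    show "?p i c \<in> carrier ?F" if "c \<in> carrier ?F" for c
      using pin[of c i] coefs_mono[of "{i} \<inter> I" I R] that by auto
  qed (auto simp: fun_eq_iff)
  have p2: "?p i c \<in> ?Fl i" if "c \<in> carrier ?F" for i c using pin that by simp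
  have p3: "?p j c = (if j = i then c else \<zero>\<^bsub>?F\<^esub>)" if "c \<in> ?Fl i" for i j c
    using coefsD(2)[OF that] by (auto simp: fun_eq_iff)
  have fin: "c = finsum ?F (\<lambda>i. ?p i c) A" if c: "c \<in> coefs R I" and A: "finite A" "{i. c i \<noteq> \<zero>\<^bsub>R\<^esub>} \<subseteq> A" for c A
  proof
    fix k
    have "finsum ?F (\<lambda>i. ?p i c) A k = (\<Oplus>\<^bsub>R\<^esub>i\<in>A. ?p i c k)"
      unfolding FM_def by (rule fmod_finsum) (use pin[OF c] coefs_mono[of "{i} \<inter> I" I R for i] in blast)
    also have "\<dots> = (\<Oplus>\<^bsub>R\<^esub>i\<in>insert k A. ?p i c k)"
      using A coefsD(1)[OF c] by (intro L.finsum_superset) auto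
    also have "\<dots> = ?p k c k" by (rule L.finsum_eq_single) (use A coefsD(1)[OF c] in auto)
    finally show "c k = finsum ?F (\<lambda>i. ?p i c) A k" by simp
  qed
  have p4: "\<exists>A. finite A \<and> (\<forall>i. i \<notin> A \<longrightarrow> ?p i c = \<zero>\<^bsub>?F\<^esub>) \<and> c = finsum ?F (\<lambda>i. ?p i c) A"
    if "c \<in> carrier ?F" for c
  proof (intro exI[of _ "{i. c i \<noteq> \<zero>\<^bsub>R\<^esub>}"] conjI allI impI)
    have c: "c \<in> coefs R I" using that by simp
    show "finite {i. c i \<noteq> \<zero>\<^bsub>R\<^esub>}" by (rule coefsD(3)[OF c])
    then show "c = finsum ?F (\<lambda>i. ?p i c) {i. c i \<noteq> \<zero>\<^bsub>R\<^esub>}" by (rule fin[OF c]) simp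
  qed (auto simp: fun_eq_iff)
  have "is_direct_sum ?F ?Fl" by (rule F.M.direct_sumI(1)[OF add p1 p2 p3 p4])
  moreover have "graded_free R (restrict_module ?F (?Fl i))" for i
  proof -
    have "restrict_module ?F (?Fl i) = fmod R ({i} \<inter> I) (gd (rg I g)) (diff_module.fields (gdif R (rg I g)))"
      unfolding FM_def by (rule fmod_restrict) simp
    then show ?thesis unfolding graded_free_def
      using fmod_graded_module fmod_basis by (metis (no_types))
  qed
  moreover have "diff ?F ` ?Fl n \<subseteq> internal_sum ?F {..<n} ?Fl" for n
  proof
    fix y assume "y \<in> diff ?F ` ?Fl n"
    then obtain c where c: "c \<in> coefs R ({n} \<inter> I)" "y = gdif R (rg I g) c" by auto
    then have cI: "c \<in> coefs R I" using coefs_mono[of "{n} \<inter> I" I R] by auto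
    have y: "y = gdif R g c" using c gdif_rg[OF fd cI] by simp
    have yI: "y \<in> coefs R I" using y gdif_add(3)[OF fd cI cI] by simp
    have "y k = \<zero>\<^bsub>R\<^esub>" if "k \<ge> n" for k
      unfolding y gdif_def
    proof (rule L.add.finprod_one_eqI)
      fix i assume "i \<in> {i. c i \<noteq> \<zero>\<^bsub>R\<^esub>}"
      then have "i = n" "n \<in> I" using coefsD(2)[OF c(1), of i] by auto
      then have "gx g i k = \<zero>\<^bsub>R\<^esub>" using coefsD(2)[OF flag_dataD(2)[OF fd \<open>n \<in> I\<close>]] that by simp
      then show "c i \<otimes>\<^bsub>R\<^esub> gx g i k = \<zero>\<^bsub>R\<^esub>" using coefsD(1)[OF c(1)] by simp
    qed
    then have "{i. y i \<noteq> \<zero>\<^bsub>R\<^esub>} \<subseteq> {..<n}" by (auto simp: not_less[symmetric])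
    then have "y = finsum ?F (\<lambda>i. ?p i y) {..<n}" by (intro fin[OF yI]) auto
    then show "y \<in> internal_sum ?F {..<n} ?Fl"
      unfolding internal_sum_def using pin[OF yI]
      by (intro CollectI exI[of _ "\<lambda>i. ?p i y"] exI[of _ "{..<n}"]) auto
  qed
  ultimately show ?thesis unfolding free_flag_def using F.diff_module_axioms by blast
qed

lemma FM_quasi_iso:
  assumes "flag_data R a D I g" "cycles (Cn I g) \<subseteq> boundaries (Cn I g)"
  shows "quasi_iso R (FM R I g) D (geps R D (rg I g))"
  unfolding quasi_iso_iff[OF FM_diff_module[OF assms(1)] diff_module_axioms]
  using assms geps_hom by blast

end

section \<open>Comparison with a projective resolution\<close>

text \<open>A projective module has a dual basis: the canonical map from the free module on its
  homogeneous elements splits. This gives the lifting property for modules in all types.\<close>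

lemma projective_lift:
  fixes R :: "'r graded_ring" and P :: "('r, 'p) graded_module"
  assumes R: "graded_local_ring R" and P: "projective R P" and G: "graded_module R G" and Q: "graded_module R Q"
    and \<rho>: "\<rho> \<in> graded_hom R G Q" and f: "f \<in> graded_hom R P Q"
    and sub: "\<And>x. x \<in> carrier P \<Longrightarrow> f x \<in> \<rho> ` carrier G"
  shows "\<exists>h\<in>graded_hom R P G. \<forall>x\<in>carrier P. \<rho> (h x) = f x"
proof -
  interpret R: graded_local_ring R by fact
  have GP: "graded_module R P" using P by (simp add: projective_def)
  interpret P: graded_module R P by (rule GP)
  interpret G: graded_module R G by fact
  interpret Q: graded_module R Q by fact
  let ?I = "\<Union>j. grade P j"
  define N :: "('r, 'p \<Rightarrow> 'r) graded_module" where "N = fmod R ?I (hdeg P) ()"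
  have N: "graded_module R N" unfolding N_def by (rule R.fmod_graded_module)
  interpret N: graded_module R N by fact
  let ?can = "lincomb R P (\<lambda>p. p)"
  have hd: "p \<in> grade P (hdeg P p)" if "p \<in> ?I" for p using that by (rule grade_hdeg)
  have can: "?can \<in> graded_hom R N P" unfolding N_def by (rule R.fmod_hom[OF GP hd])
  have uN: "unitvec R p \<in> carrier N" if "p \<in> ?I" for p using R.coefs_unitvec[OF that] by (simp add: N_def)
  have canu: "?can (unitvec R p) = p" if "p \<in> ?I" for p
    using P.lincomb_unitvec[of "\<lambda>p. p" p] that P.md.G_in_carrier by auto
  have "carrier P \<subseteq> ?can ` carrier N"
  proof
    fix x assume x: "x \<in> carrier P"
    have img: "gsub R P (?can ` carrier N)" by (rule graded_hom_image[OF N GP can N.gsub_carrier])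
    show "x \<in> ?can ` carrier N"
    proof (rule P.md.mem_if_dparts[OF P.submod_add_subgroup[OF gsubD(1)[OF img]] x])
      fix j
      have "mpart P j x \<in> ?I" using P.md.dpart_in[OF x] by blast
      then show "mpart P j x \<in> ?can ` carrier N" using canu uN by (metis image_eqI)
    qed
  qed
  then have surj: "?can ` carrier N = carrier P" using graded_homD(2)[OF can] by blast
  obtain h where h: "h \<in> graded_hom R P N" "\<And>x. x \<in> carrier P \<Longrightarrow> ?can (h x) = x"
    using P N GP can surj graded_hom_id[of R P] unfolding projective_def by metis
  have "\<exists>y. y \<in> grade G (hdeg P p) \<and> \<rho> y = f p" if "p \<in> ?I" for p
    using homogeneous_preimage[OF G Q \<rho> graded_homD(5)[OF f hd[OF that]] sub] hd[OF that] P.md.G_in_carrier by blast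
  then obtain \<kappa> where k: "\<And>p. p \<in> ?I \<Longrightarrow> \<kappa> p \<in> grade G (hdeg P p)" "\<And>p. p \<in> ?I \<Longrightarrow> \<rho> (\<kappa> p) = f p" by metis
  have lk: "lincomb R G \<kappa> \<in> graded_hom R N G" unfolding N_def by (rule R.fmod_hom[OF G k(1)])
  have "\<rho> (lincomb R G \<kappa> (h x)) = f x" if x: "x \<in> carrier P" for x
  proof -
    have hx: "h x \<in> coefs R ?I" using graded_homD(2)[OF h(1) x] by (simp add: N_def)
    have "\<rho> (lincomb R G \<kappa> (h x)) = lincomb R Q (\<lambda>p. \<rho> (\<kappa> p)) (h x)"
      by (rule graded_hom_lincomb[OF G Q \<rho> hx]) (use k(1) G.md.G_in_carrier in blast)
    also have "\<dots> = lincomb R Q (\<lambda>p. f p) (h x)"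
      by (rule Q.lincomb_cong[OF hx k(2)]) (use k(1) G.md.G_in_carrier graded_homD(2)[OF \<rho>] in blast)+
    also have "\<dots> = f (?can (h x))"
      by (rule graded_hom_lincomb[OF GP Q f hx, symmetric]) (use P.md.G_in_carrier in blast)
    finally show ?thesis using h(2)[OF x] by simp
  qed
  then show ?thesis using graded_hom_comp[OF h(1) lk] by (intro bexI[of _ "\<lambda>x. lincomb R G \<kappa> (h x)"]) auto
qed

text \<open>Comparison of a finite projective resolution \<open>P\<close> with a minimal free resolution \<open>G\<close>: maps
  \<open>f\<close> and \<open>h\<close> in both directions are lifted step by step together with a homotopy, of which
  only the composite \<open>t\<close> with the differential of \<open>G\<close> is recorded. Beyond the length of \<open>P\<close> the
  map \<open>f\<close> is zero, so \<open>t\<close> is the identity modulo the maximal ideal and hence injective, while it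
  vanishes on the kernel of the differential.\<close>

lemma minimal_resolution_finite:
  fixes R :: "'r graded_ring" and H :: "('r, 'h) graded_module" and G :: "nat \<Rightarrow> ('r, 'g, 'z) graded_module_scheme"
  assumes R: "graded_local_ring R" and H: "graded_module R H"
    and pd: "projective_dimension_le TYPE('p) R H n"
    and G: "\<And>k. gbasis R (G k) (B k)" "\<And>k. finite (B k)"
    and p0: "p0 \<in> graded_hom R (G 0) H" "p0 ` carrier (G 0) = carrier H"
    and p: "\<And>k. p k \<in> graded_hom R (G (Suc k)) (G k)"
    and ex0: "p 0 ` carrier (G 1) = {x \<in> carrier (G 0). p0 x = \<zero>\<^bsub>H\<^esub>}"
    and ex: "\<And>k. p (Suc k) ` carrier (G (Suc (Suc k))) = {x \<in> carrier (G (Suc k)). p k x = \<zero>\<^bsub>G k\<^esub>}"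
    and min: "\<And>k. {x \<in> carrier (G (Suc k)). p k x = \<zero>\<^bsub>G k\<^esub>} \<subseteq> lin_combs (G (Suc k)) (graded_max_ideal R) (carrier (G (Suc k)))"
  shows "{x \<in> carrier (G (Suc n)). p n x = \<zero>\<^bsub>G n\<^esub>} = {\<zero>\<^bsub>G (Suc n)\<^esub>}"
proof -
  interpret R: graded_local_ring R by fact
  obtain P :: "nat \<Rightarrow> ('r, 'p) graded_module" and d aug where res:
    "(\<forall>i. projective R (P i)) \<and> (\<forall>i>n. carrier (P i) = {\<zero>\<^bsub>P i\<^esub>}) \<and> aug \<in> graded_hom R (P 0) H \<and>
      (\<forall>i. d i \<in> graded_hom R (P (Suc i)) (P i)) \<and> aug ` carrier (P 0) = carrier H \<and>
      d 0 ` carrier (P 1) = {x \<in> carrier (P 0). aug x = \<zero>\<^bsub>H\<^esub>} \<and>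
      (\<forall>i. d (Suc i) ` carrier (P (Suc (Suc i))) = {x \<in> carrier (P (Suc i)). d i x = \<zero>\<^bsub>P i\<^esub>})"
    using pd unfolding projective_dimension_le_def by (elim exE) (rule that)
  then have P: "\<And>i. projective R (P i)" and Pz: "\<And>i. i > n \<Longrightarrow> carrier (P i) = {\<zero>\<^bsub>P i\<^esub>}"
    and aug: "aug \<in> graded_hom R (P 0) H" "aug ` carrier (P 0) = carrier H"
    and d: "\<And>i. d i \<in> graded_hom R (P (Suc i)) (P i)"
    and exd0: "d 0 ` carrier (P 1) = {x \<in> carrier (P 0). aug x = \<zero>\<^bsub>H\<^esub>}"
    and exd: "\<And>i. d (Suc i) ` carrier (P (Suc (Suc i))) = {x \<in> carrier (P (Suc i)). d i x = \<zero>\<^bsub>P i\<^esub>}"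
    by auto
  have GP: "graded_module R (P i)" for i using P[of i] by (simp add: projective_def)
  have GG: "graded_module R (G k)" for k using G(1)[of k] by (simp add: gbasis_def)
  \<comment> \<open>The kernels of the maps that leave \<open>G k\<close> and \<open>P k\<close> in the two augmented resolutions.\<close>
  define KG where "KG k = (case k of 0 \<Rightarrow> {x \<in> carrier (G 0). p0 x = \<zero>\<^bsub>H\<^esub>} | Suc k \<Rightarrow> {x \<in> carrier (G (Suc k)). p k x = \<zero>\<^bsub>G k\<^esub>})" for k
  define KP where "KP k = (case k of 0 \<Rightarrow> {x \<in> carrier (P 0). aug x = \<zero>\<^bsub>H\<^esub>} | Suc k \<Rightarrow> {x \<in> carrier (P (Suc k)). d k x = \<zero>\<^bsub>P k\<^esub>})" for k
  have KG: "p k ` carrier (G (Suc k)) = KG k" for k using ex0 ex by (cases k) (auto simp: KG_def)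
  have KP: "d k ` carrier (P (Suc k)) = KP k" for k using exd0 exd by (cases k) (auto simp: KP_def)
  have KGs: "x \<in> KG (Suc k) \<longleftrightarrow> x \<in> carrier (G (Suc k)) \<and> p k x = \<zero>\<^bsub>G k\<^esub>" for x k by (simp add: KG_def)
  have KPs: "x \<in> KP (Suc k) \<longleftrightarrow> x \<in> carrier (P (Suc k)) \<and> d k x = \<zero>\<^bsub>P k\<^esub>" for x k by (simp add: KP_def)
  have GM: "x \<ominus>\<^bsub>G k\<^esub> y = \<zero>\<^bsub>G k\<^esub> \<longleftrightarrow> x = y" if "x \<in> carrier (G k)" "y \<in> carrier (G k)" for x y k
    using abelian_group.minus_eq_zero_iff[OF graded_module_abelian[OF GG] that] .
  have HM: "x \<ominus>\<^bsub>H\<^esub> y = \<zero>\<^bsub>H\<^esub> \<longleftrightarrow> x = y" if "x \<in> carrier H" "y \<in> carrier H" for x y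
    using abelian_group.minus_eq_zero_iff[OF graded_module_abelian[OF H] that] .
  have "\<exists>f\<in>graded_hom R (G k) (P k). \<exists>h\<in>graded_hom R (P k) (G k). \<exists>t\<in>graded_hom R (G k) (G k).
      f ` KG k \<subseteq> KP k \<and> h ` KP k \<subseteq> KG k \<and> (\<forall>x\<in>KG k. t x = \<zero>\<^bsub>G k\<^esub>) \<and>
      (\<forall>x\<in>carrier (G k). x \<ominus>\<^bsub>G k\<^esub> h (f x) \<ominus>\<^bsub>G k\<^esub> t x \<in> KG k)" for k
  proof (induction k)
    case 0
    interpret G0: gbasis R "G 0" "B 0" by (rule G)
    interpret P0: graded_module R "P 0" by (rule GP)
    obtain f where f: "f \<in> graded_hom R (G 0) (P 0)" "\<And>x. x \<in> carrier (G 0) \<Longrightarrow> aug (f x) = p0 x"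
      using G0.hom_lift[OF GP H aug(1) p0(1)] graded_homD(2)[OF p0(1)] aug(2) by blast
    obtain h where h: "h \<in> graded_hom R (P 0) (G 0)" "\<And>x. x \<in> carrier (P 0) \<Longrightarrow> p0 (h x) = aug x"
      using projective_lift[OF R P GG H p0(1) aug(1)] graded_homD(2)[OF aug(1)] p0(2) by blast
    have t: "(\<lambda>x. \<zero>\<^bsub>G 0\<^esub>) \<in> graded_hom R (G 0) (G 0)"
      by (rule graded_homI) (auto simp: G0.md.G_zero)
    have f1: "f ` KG 0 \<subseteq> KP 0" using f graded_homD(2)[OF f(1)] by (auto simp: KG_def KP_def)
    have h1: "h ` KP 0 \<subseteq> KG 0" using h graded_homD(2)[OF h(1)] by (auto simp: KG_def KP_def)
    have e: "x \<ominus>\<^bsub>G 0\<^esub> h (f x) \<ominus>\<^bsub>G 0\<^esub> \<zero>\<^bsub>G 0\<^esub> \<in> KG 0" if x: "x \<in> carrier (G 0)" for x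
    proof -
      have c: "f x \<in> carrier (P 0)" "h (f x) \<in> carrier (G 0)" "p0 x \<in> carrier H"
        using x graded_homD(2)[OF f(1)] graded_homD(2)[OF h(1)] graded_homD(2)[OF p0(1)] by auto
      have "p0 (x \<ominus>\<^bsub>G 0\<^esub> h (f x)) = p0 x \<ominus>\<^bsub>H\<^esub> p0 (h (f x))" by (rule graded_hom_minus[OF GG H p0(1) x c(2)])
      also have "\<dots> = \<zero>\<^bsub>H\<^esub>" using HM f(2)[OF x] h(2)[OF c(1)] c(3) by simp
      finally show ?thesis using x c by (simp add: KG_def a_minus_def G0.M.a_inv_zero)
    qed
    show ?case by (intro bexI[OF _ f(1)] bexI[OF _ h(1)] bexI[OF _ t] conjI f1 h1 ballI e refl)
  next
    case (Suc k)
    then obtain f h t where f: "f \<in> graded_hom R (G k) (P k)" and h: "h \<in> graded_hom R (P k) (G k)"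
      and t: "t \<in> graded_hom R (G k) (G k)" and fht: "f ` KG k \<subseteq> KP k \<and> h ` KP k \<subseteq> KG k \<and>
        (\<forall>x\<in>KG k. t x = \<zero>\<^bsub>G k\<^esub>) \<and> (\<forall>x\<in>carrier (G k). x \<ominus>\<^bsub>G k\<^esub> h (f x) \<ominus>\<^bsub>G k\<^esub> t x \<in> KG k)"
      by (elim bexE) (rule that)
    from fht have fK: "f ` KG k \<subseteq> KP k" and hK: "h ` KP k \<subseteq> KG k" and tK: "\<And>x. x \<in> KG k \<Longrightarrow> t x = \<zero>\<^bsub>G k\<^esub>"
      and e: "\<And>x. x \<in> carrier (G k) \<Longrightarrow> x \<ominus>\<^bsub>G k\<^esub> h (f x) \<ominus>\<^bsub>G k\<^esub> t x \<in> KG k" by simp_all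
    interpret G0: gbasis R "G k" "B k" by (rule G)
    interpret G1: gbasis R "G (Suc k)" "B (Suc k)" by (rule G)
    have pk: "p k x \<in> KG k" if "x \<in> carrier (G (Suc k))" for x using KG that by blast
    have dk: "d k x \<in> KP k" if "x \<in> carrier (P (Suc k))" for x using KP that by blast
    obtain f' where f': "f' \<in> graded_hom R (G (Suc k)) (P (Suc k))"
      "\<And>x. x \<in> carrier (G (Suc k)) \<Longrightarrow> d k (f' x) = f (p k x)"
      using G1.hom_lift[OF GP GP d graded_hom_comp[OF p f]] KP pk fK by blast
    obtain h' where h': "h' \<in> graded_hom R (P (Suc k)) (G (Suc k))"
      "\<And>x. x \<in> carrier (P (Suc k)) \<Longrightarrow> p k (h' x) = h (d k x)"
      using projective_lift[OF R P GG GG p graded_hom_comp[OF d h]] KG dk hK by blast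
    have eh: "(\<lambda>x. x \<ominus>\<^bsub>G k\<^esub> h (f x) \<ominus>\<^bsub>G k\<^esub> t x) \<in> graded_hom R (G k) (G k)"
      by (intro graded_hom_diff GG graded_hom_id graded_hom_comp[OF f h] t)
    obtain s where s: "s \<in> graded_hom R (G k) (G (Suc k))"
      "\<And>x. x \<in> carrier (G k) \<Longrightarrow> p k (s x) = x \<ominus>\<^bsub>G k\<^esub> h (f x) \<ominus>\<^bsub>G k\<^esub> t x"
      using G0.hom_lift[OF GG GG p eh] KG e by blast
    have t': "(\<lambda>x. s (p k x)) \<in> graded_hom R (G (Suc k)) (G (Suc k))" by (rule graded_hom_comp[OF p s(1)])
    have f1: "f' ` KG (Suc k) \<subseteq> KP (Suc k)"
      using f'(2) graded_homD(2)[OF f'(1)] graded_hom_zero[OF GG GP f] by (auto simp: KGs KPs)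
    have h1: "h' ` KP (Suc k) \<subseteq> KG (Suc k)"
      using h'(2) graded_homD(2)[OF h'(1)] graded_hom_zero[OF GP GG h] by (auto simp: KGs KPs)
    have t1: "s (p k x) = \<zero>\<^bsub>G (Suc k)\<^esub>" if "x \<in> KG (Suc k)" for x
      using that graded_hom_zero[OF GG GG s(1)] by (simp add: KGs)
    have "x \<ominus>\<^bsub>G (Suc k)\<^esub> h' (f' x) \<ominus>\<^bsub>G (Suc k)\<^esub> s (p k x) \<in> KG (Suc k)" if x: "x \<in> carrier (G (Suc k))" for x
    proof -
      have c: "f' x \<in> carrier (P (Suc k))" "h' (f' x) \<in> carrier (G (Suc k))" "p k x \<in> carrier (G k)"
        "s (p k x) \<in> carrier (G (Suc k))"
        using x graded_homD(2)[OF f'(1)] graded_homD(2)[OF h'(1)] graded_homD(2)[OF p] graded_homD(2)[OF s(1)] by auto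
      have c2: "h (f (p k x)) \<in> carrier (G k)" using c(3) graded_homD(2)[OF f] graded_homD(2)[OF h] by auto
      have "p k (x \<ominus>\<^bsub>G (Suc k)\<^esub> h' (f' x) \<ominus>\<^bsub>G (Suc k)\<^esub> s (p k x)) =
        p k x \<ominus>\<^bsub>G k\<^esub> p k (h' (f' x)) \<ominus>\<^bsub>G k\<^esub> p k (s (p k x))"
        using graded_hom_minus[OF GG GG p] x c G1.M.minus_closed by simp
      also have "\<dots> = p k x \<ominus>\<^bsub>G k\<^esub> h (f (p k x)) \<ominus>\<^bsub>G k\<^esub> (p k x \<ominus>\<^bsub>G k\<^esub> h (f (p k x)) \<ominus>\<^bsub>G k\<^esub> \<zero>\<^bsub>G k\<^esub>)"
        using h'(2)[OF c(1)] f'(2)[OF x] s(2)[OF c(3)] tK[OF pk[OF x]] by simp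
      also have "\<dots> = \<zero>\<^bsub>G k\<^esub>" using c(3) c2 by (simp add: a_minus_def G0.M.a_inv_zero G0.M.r_neg)
      finally show ?thesis using x c by (simp add: KGs)
    qed
    then show ?case by (intro bexI[OF _ f'(1)] bexI[OF _ h'(1)] bexI[OF _ t'] conjI f1 h1 ballI t1)
  qed
  then obtain f h t where f: "f \<in> graded_hom R (G (Suc n)) (P (Suc n))" and h: "h \<in> graded_hom R (P (Suc n)) (G (Suc n))"
    and t: "t \<in> graded_hom R (G (Suc n)) (G (Suc n))" and tK: "\<And>x. x \<in> KG (Suc n) \<Longrightarrow> t x = \<zero>\<^bsub>G (Suc n)\<^esub>"
    and e: "\<And>x. x \<in> carrier (G (Suc n)) \<Longrightarrow> x \<ominus>\<^bsub>G (Suc n)\<^esub> h (f x) \<ominus>\<^bsub>G (Suc n)\<^esub> t x \<in> KG (Suc n)" by metis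
  interpret G1: gbasis R "G (Suc n)" "B (Suc n)" by (rule G)
  have id: "x \<ominus>\<^bsub>G (Suc n)\<^esub> t x \<in> R.mM (G (Suc n))" if x: "x \<in> carrier (G (Suc n))" for x
  proof -
    have "f x = \<zero>\<^bsub>P (Suc n)\<^esub>" using graded_homD(2)[OF f x] Pz[of "Suc n"] by simp
    then have "h (f x) = \<zero>\<^bsub>G (Suc n)\<^esub>" using graded_hom_zero[OF GP GG h] by simp
    then show ?thesis using e[OF x] x min[of n] by (auto simp: KG_def a_minus_def G1.M.a_inv_zero)
  qed
  have nak: "R.nakayama (G (Suc n))"
    by (rule R.nakayama_finite[OF GG G(2) G1.basis_carrier]) (simp add: G1.spn_basis)
  have "bij_betw t (carrier (G (Suc n))) (carrier (G (Suc n)))"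
    by (rule R.endomorphism_bij[OF G(1) nak t id])
  then have inj: "inj_on t (carrier (G (Suc n)))" by (simp add: bij_betw_def)
  have "x = \<zero>\<^bsub>G (Suc n)\<^esub>" if x: "x \<in> KG (Suc n)" for x
  proof (rule inj_onD[OF inj])
    show "t x = t \<zero>\<^bsub>G (Suc n)\<^esub>" using tK[OF x] graded_hom_zero[OF GG GG t] by simp
  qed (use x in \<open>auto simp: KGs\<close>)
  moreover have "\<zero>\<^bsub>G (Suc n)\<^esub> \<in> KG (Suc n)" using graded_hom_zero[OF GG GG p] by (simp add: KGs)
  ultimately show ?thesis unfolding KG_def by auto
qed

section \<open>Termination of the attaching process\<close>

lemma twist_gbasis:
  assumes "gbasis R M B" shows "gbasis R (twist M c) B"
proof -
  interpret M: gbasis R M B by fact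
  have B: "B \<subseteq> (\<Union>j. grade M j)" and u: "\<And>x. x \<in> carrier M \<Longrightarrow> \<exists>!c. c \<in> coefs R B \<and> x = lincomb R M (\<lambda>x. x) c"
    using M.hbasis unfolding M.homogeneous_basis_alt by auto
  have "B \<subseteq> (\<Union>j. grade (twist M c) j)"
  proof
    fix b assume "b \<in> B"
    then obtain j where "b \<in> grade M j" using B by blast
    then have "b \<in> grade (twist M c) (j - c)" by simp
    then show "b \<in> (\<Union>j. grade (twist M c) j)" by blast
  qed
  then have "homogeneous_basis R (twist M c) B" unfolding M.homogeneous_basis_alt using u by simp
  then show ?thesis by (intro gbasisI twist_graded_module M.graded_module_axioms)
qed

lemma (in left_module) lincomb_reindex:
  assumes s: "bij_betw s J S" and c: "c \<in> coefs R S" and SM: "S \<subseteq> carrier M"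
  shows "(\<lambda>n. if n \<in> J then c (s n) else \<zero>\<^bsub>R\<^esub>) \<in> coefs R J"
    "lincomb R M s (\<lambda>n. if n \<in> J then c (s n) else \<zero>\<^bsub>R\<^esub>) = lincomb R M (\<lambda>x. x) c"
proof -
  let ?t = "\<lambda>n. if n \<in> J then c (s n) else \<zero>\<^bsub>R\<^esub>"
  have inj: "inj_on s J" and im: "s ` J = S" using s by (auto simp: bij_betw_def)
  have A: "{n. ?t n \<noteq> \<zero>\<^bsub>R\<^esub>} = {n \<in> J. c (s n) \<noteq> \<zero>\<^bsub>R\<^esub>}" by auto
  have im2: "s ` {n. ?t n \<noteq> \<zero>\<^bsub>R\<^esub>} = {x. c x \<noteq> \<zero>\<^bsub>R\<^esub>}"
    using coefsD(2)[OF c] im unfolding A by auto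
  have inj2: "inj_on s {n. ?t n \<noteq> \<zero>\<^bsub>R\<^esub>}" by (rule inj_on_subset[OF inj]) auto
  have "finite {n. ?t n \<noteq> \<zero>\<^bsub>R\<^esub>}" using finite_imageD[OF _ inj2] im2 coefsD(3)[OF c] by simp
  then show "?t \<in> coefs R J" using coefsD(1)[OF c] by (auto simp: coefs_def)
  have "lincomb R M (\<lambda>x. x) c = finsum M (\<lambda>x. c x \<odot>\<^bsub>M\<^esub> x) (s ` {n. ?t n \<noteq> \<zero>\<^bsub>R\<^esub>})"
    unfolding im2 lincomb_def ..
  also have "\<dots> = finsum M (\<lambda>n. c (s n) \<odot>\<^bsub>M\<^esub> s n) {n. ?t n \<noteq> \<zero>\<^bsub>R\<^esub>}"
    using coefsD(1)[OF c] im SM by (intro M.finsum_reindex[OF _ inj2]) (auto simp: A intro!: smult_closed)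
  also have "\<dots> = lincomb R M s ?t"
    unfolding lincomb_def using coefsD(1)[OF c] im SM
    by (intro M.finsum_cong') (auto simp: A intro!: smult_closed)
  finally show "lincomb R M s ?t = lincomb R M (\<lambda>x. x) c" by simp
qed

lemma (in left_module) lincomb_reindex':
  assumes s: "inj_on s J" and t: "t \<in> coefs R J" and S: "s ` J \<subseteq> S" "S \<subseteq> carrier M"
  shows "\<exists>c\<in>coefs R S. lincomb R M (\<lambda>x. x) c = lincomb R M s t \<and> (\<forall>n\<in>J. c (s n) = t n)"
proof -
  let ?c = "\<lambda>x. if x \<in> s ` J then t (inv_into J s x) else \<zero>\<^bsub>R\<^esub>"
  have cs: "?c (s n) = t n" if "n \<in> J" for n using s that by simp
  have "{x. ?c x \<noteq> \<zero>\<^bsub>R\<^esub>} \<subseteq> s ` {n. t n \<noteq> \<zero>\<^bsub>R\<^esub>}" using s by (auto split: if_splits)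
  then have "finite {x. ?c x \<noteq> \<zero>\<^bsub>R\<^esub>}" using finite_subset coefsD(3)[OF t] by blast
  then have c: "?c \<in> coefs R (s ` J)" using coefsD(1)[OF t] by (auto simp: coefs_def)
  have b: "bij_betw s J (s ` J)" using s by (simp add: bij_betw_def)
  have "(\<lambda>n. if n \<in> J then ?c (s n) else \<zero>\<^bsub>R\<^esub>) = t" using cs coefsD(2)[OF t] by (auto simp: fun_eq_iff)
  then have "lincomb R M s t = lincomb R M (\<lambda>x. x) ?c"
    using lincomb_reindex(2)[OF b c] S by simp
  then show ?thesis using c cs coefs_mono[OF S(1), of R] by (intro bexI[of _ ?c]) auto
qed

lemma (in graded_local_ring) fmod_mM:
  assumes t: "t \<in> coefs R I" and m: "\<And>n. t n \<in> \<mm>"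
  shows "t \<in> mM (fmod R I deg z)"
proof -
  interpret F: graded_module R "fmod R I deg z" by (rule fmod_graded_module)
  have "lincomb R (fmod R I deg z) (unitvec R) t \<in> mM (fmod R I deg z)"
  proof (rule F.lincomb_submod[OF mM_submod[OF fmod_graded_module]])
    fix i assume "t i \<noteq> \<zero>"
    then have "i \<in> I" using coefsD(2)[OF t] by blast
    then show "t i \<odot>\<^bsub>fmod R I deg z\<^esub> unitvec R i \<in> mM (fmod R I deg z)"
      by (intro mM_smult[OF fmod_graded_module] m) (simp add: coefs_unitvec)
  qed
  then show ?thesis by (simp add: fmod_lincomb_unitvec[OF t])
qed

context resolving begin

lemma gdif_smult:
  assumes fd: "flag_data R a D I g" and r: "r \<in> carrier R" and c: "c \<in> coefs R I"
  shows "gdif R g (\<lambda>i. r \<otimes>\<^bsub>R\<^esub> c i) = (\<lambda>k. r \<otimes>\<^bsub>R\<^esub> gdif R g c k)"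
    "geps R D g (\<lambda>i. r \<otimes>\<^bsub>R\<^esub> c i) = r \<odot>\<^bsub>D\<^esub> geps R D g c"
proof -
  interpret F: diff_module R a "FM R I g" by (rule FM_diff_module[OF fd])
  note rc = L.coefs_lmult[OF r c]
  show "gdif R g (\<lambda>i. r \<otimes>\<^bsub>R\<^esub> c i) = (\<lambda>k. r \<otimes>\<^bsub>R\<^esub> gdif R g c k)"
    using F.d_simps(4)[OF r, of c] c gdif_rg[OF fd c] gdif_rg[OF fd rc] by simp
  show "geps R D g (\<lambda>i. r \<otimes>\<^bsub>R\<^esub> c i) = r \<odot>\<^bsub>D\<^esub> geps R D g c"
    using graded_homD(4)[OF diff_homD(1)[OF geps_hom[OF fd]] r, of c] c geps_rg[OF fd c] geps_rg[OF fd rc] by simp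
qed

lemma FM_mM: "\<lbrakk>t \<in> coefs R I; \<And>n. t n \<in> \<mm>\<rbrakk> \<Longrightarrow> t \<in> mM (FM R I g)"
  unfolding FM_def by (rule fmod_mM)

context
  fixes Sel :: "nat \<Rightarrow> int \<Rightarrow> bool" and N :: "nat \<Rightarrow> nat" and g :: "('r, 'd) attaching"
  assumes tw: "tower Sel N g"
begin

abbreviation "s n \<equiv> (gy g n, gx g n)"
abbreviation "Ib k \<equiv> {..<N k}"
abbreviation "Jb k \<equiv> {N k..<N (Suc k)}"
abbreviation "Ck k \<equiv> Cn {..<N k} g"

lemma tower_basic:
  shows tower_0: "N 0 = 0" and tower_mono: "N k \<le> N (Suc k)" and tower_fd: "flag_data R a D (Ib k) g"
    and tower_J: "Ib (Suc k) - Ib k = Jb k" and tower_I: "Ib k \<subseteq> Ib (Suc k)"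
  using tw unfolding tower_def by force+

lemma tower_S:
  "\<exists>S. minimal_cycles (N k) g S \<and> bij_betw s (Jb k) {u \<in> S. Sel k (hdeg (Ck k) u)} \<and>
    (\<forall>n\<in>Jb k. gd g n = hdeg (Ck k) (s n))"
  using tw unfolding tower_def by blast

lemma Ck_diff: "diff_module R a (Ck k)"
  by (rule Cn_diff_module[OF tower_fd])

lemma attaching_facts:
  assumes n: "n \<in> Jb k"
  shows attaching_cycle: "s n \<in> cycles (Ck k)" and attaching_grade: "s n \<in> grade (Ck k) (gd g n)"
    and attaching_x: "gx g n \<in> coefs R (Ib k)" and attaching_y: "gy g n \<in> carrier D"
proof -
  obtain S where S: "minimal_cycles (N k) g S" "bij_betw s (Jb k) {u \<in> S. Sel k (hdeg (Ck k) u)}"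
    "\<forall>n\<in>Jb k. gd g n = hdeg (Ck k) (s n)" using tower_S by blast
  have sS: "s n \<in> S" using bij_betwE[OF S(2)] n by blast
  then show c: "s n \<in> cycles (Ck k)" using S(1) unfolding minimal_cycles_def by blast
  have "s n \<in> (\<Union>j. grade (Ck k) j)" using S(1) sS unfolding minimal_cycles_def by blast
  then show "s n \<in> grade (Ck k) (gd g n)" using grade_hdeg S(3) n by metis
  show "gx g n \<in> coefs R (Ib k)" "gy g n \<in> carrier D" using c Cn_cycles[OF tower_fd] by auto
qed

lemma attaching_relation:
  assumes t: "t \<in> coefs R (Jb k)" and b: "lincomb R (Ck k) s t \<in> boundaries (Ck k)"
  shows "t n \<in> \<mm>"
proof (cases "n \<in> Jb k")
  case True
  interpret C: diff_module R a "Ck k" by (rule Ck_diff)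
  obtain S where S: "minimal_cycles (N k) g S" "bij_betw s (Jb k) {u \<in> S. Sel k (hdeg (Ck k) u)}"
    using tower_S by blast
  have SC: "S \<subseteq> carrier (Ck k)" using S(1) C.cycles_closed(1) unfolding minimal_cycles_def by blast
  have "inj_on s (Jb k)" "s ` Jb k \<subseteq> S" using S(2) by (auto simp: bij_betw_def)
  then obtain c where c: "c \<in> coefs R S" "lincomb R (Ck k) (\<lambda>x. x) c = lincomb R (Ck k) s t" "\<forall>n\<in>Jb k. c (s n) = t n"
    using C.lincomb_reindex'[OF _ t _ SC] by blast
  then have "c (s n) \<in> \<mm>" using S(1) b unfolding minimal_cycles_def by simp
  then show ?thesis using c(3) True by simp
qed (use coefsD(2)[OF t] gmax_zero in simp)

lemma stage_gx:
  assumes "n \<in> Ib (Suc k)" shows "gx g n \<in> coefs R (Ib k)"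
proof (cases "n < N k")
  case True
  then show ?thesis using flag_dataD(7)[OF tower_fd, of n k] by simp
next
  case False
  then show ?thesis using attaching_x[of n k] assms by simp
qed

lemma stage_gdif:
  assumes "c \<in> coefs R (Ib (Suc k))" shows "gdif R g c \<in> coefs R (Ib k)"
proof -
  interpret F: graded_module R "FM R (Ib k) g" by (rule FM_graded)
  have "lincomb R (FM R (Ib k) g) (gx g) c \<in> carrier (FM R (Ib k) g)"
    by (rule F.lincomb_closed[OF assms]) (use stage_gx in auto)
  then show ?thesis using FM_lincomb[OF assms stage_gx, where g' = g] by simp
qed

lemma J_coefs: "t \<in> coefs R (Jb k) \<Longrightarrow> t \<in> coefs R (Ib (Suc k))"
  by (rule subsetD[OF coefs_mono]) auto

lemma attaching_lincomb:
  assumes t: "t \<in> coefs R (Jb k)"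
  shows "lincomb R (Ck k) s t = (geps R D g t, gdif R g t)"
  by (rule Cn_lincomb[OF t attaching_y attaching_x])

lemma attaching_lincomb_cycle:
  assumes t: "t \<in> coefs R (Jb k)"
  shows "(geps R D g t, gdif R g t) \<in> cycles (Ck k)"
proof -
  interpret C: diff_module R a "Ck k" by (rule Ck_diff)
  have "lincomb R (Ck k) s t \<in> cycles (Ck k)"
  proof (rule C.lincomb_submod[OF gsubD(1)[OF C.cycles_gsub]])
    fix n assume "t n \<noteq> \<zero>\<^bsub>R\<^esub>"
    then have "n \<in> Jb k" using coefsD(2)[OF t] by blast
    then show "t n \<odot>\<^bsub>Ck k\<^esub> s n \<in> cycles (Ck k)"
      by (intro C.cycles_closed(4)[OF coefsD(1)[OF t]] attaching_cycle)
  qed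
  then show ?thesis using attaching_lincomb[OF t] by simp
qed

end

text \<open>If all minimal generators are attached at every stage, then the modules spanned by the
  generators of one stage form a minimal free resolution of \<open>H(D)\<close>, up to twists. If the projective
  dimension is finite, then this resolution is finite and some stage is a resolution of \<open>D\<close>.\<close>

lemma tower_terminates:
  assumes tw: "tower (\<lambda>_ _. True) N g" and pd: "projective_dimension_le TYPE('p) R (homology D) n"
  shows "cycles (Cn {..<N (Suc (Suc n))} g) \<subseteq> boundaries (Cn {..<N (Suc (Suc n))} g)"
proof -
  let ?J = "\<lambda>k. {N k..<N (Suc k)}" and ?I = "\<lambda>k. {..<N k}" and ?s = "\<lambda>n. (gy g n, gx g n)"
  let ?o = "\<lambda>_ :: nat. \<zero>\<^bsub>R\<^esub>"
  let ?C = "\<lambda>k. Cn {..<N k} g"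
  note fd = tower_fd[OF tw] and JI = tower_J[OF tw] and I = tower_I[OF tw]
  note Jx = attaching_x[OF tw]
  note lcs = attaching_lincomb[OF tw]
  note J_coefs = J_coefs[OF tw]
  note gdifI = stage_gdif[OF tw]
  have gen: "\<exists>b\<in>boundaries (?C k). \<exists>t\<in>coefs R (?J k). z = b \<oplus>\<^bsub>?C k\<^esub> lincomb R (?C k) ?s t"
    if z: "z \<in> cycles (?C k)" for z k
  proof -
    interpret C: diff_module R a "?C k" by (rule Ck_diff[OF tw])
    obtain S where S: "minimal_cycles (N k) g S" "bij_betw ?s (?J k) S"
      using tower_S[OF tw, of k] by auto
    have SC: "S \<subseteq> carrier (?C k)" using S(1) C.cycles_closed(1) unfolding minimal_cycles_def by blast
    have "z \<in> spn R (?C k) (boundaries (?C k) \<union> S)" using S(1) z unfolding minimal_cycles_def by blast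
    from C.spn_Un[OF gsubD(1)[OF C.boundaries_gsub] SC this] obtain b c where
      bc: "b \<in> boundaries (?C k)" "c \<in> coefs R S" "z = b \<oplus>\<^bsub>?C k\<^esub> lincomb R (?C k) (\<lambda>x. x) c"
      by (elim bexE) (rule that)
    note r = C.lincomb_reindex[OF S(2) bc(2) SC]
    show ?thesis by (rule bexI[OF _ bc(1)], rule bexI[OF _ r(1)]) (simp only: r(2) bc(3))
  qed
  have Z_next: "cycles (?C k) \<subseteq> boundaries (?C (Suc k))" for k
  proof
    fix z assume "z \<in> cycles (?C k)"
    then obtain b t where b: "b \<in> boundaries (?C k)" and t: "t \<in> coefs R (?J k)"
      and z: "z = b \<oplus>\<^bsub>?C k\<^esub> lincomb R (?C k) ?s t" using gen by blast
    interpret C1: diff_module R a "?C (Suc k)" by (rule Ck_diff[OF tw])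
    have b1: "b \<in> boundaries (?C (Suc k))" using Cn_boundaries_mono[OF fd fd I] b by blast
    have "lincomb R (?C (Suc k)) ?s t \<in> boundaries (?C (Suc k))"
    proof (rule C1.lincomb_submod[OF gsubD(1)[OF C1.boundaries_gsub]])
      fix n assume "t n \<noteq> \<zero>\<^bsub>R\<^esub>"
      then have "n \<in> ?I (Suc k)" using coefsD(2)[OF J_coefs[OF t], of n] by blast
      then show "t n \<odot>\<^bsub>?C (Suc k)\<^esub> ?s n \<in> boundaries (?C (Suc k))"
        by (intro C1.boundaries_closed(4)[OF coefsD(1)[OF t]] attaching_cycle_boundary[OF fd])
    qed
    moreover have "lincomb R (?C (Suc k)) ?s t = (geps R D g t, gdif R g t)"
      by (rule Cn_lincomb[OF J_coefs[OF t] flag_dataD(8)[OF fd] flag_dataD(7)[OF fd]])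
    ultimately have "(geps R D g t, gdif R g t) \<in> boundaries (?C (Suc k))" by simp
    from C1.boundaries_closed(3)[OF b1 this] show "z \<in> boundaries (?C (Suc k))"
      using z lcs[OF t] by simp
  qed
  \<comment> \<open>\<open>Kr k\<close> is the module of relations between the attaching cycles of stage \<open>k\<close> modulo boundaries.
    The twists of \<open>G k\<close> make the maps \<open>p k\<close> and \<open>p0\<close> preserve degrees.\<close>
  define Kr where "Kr k = {t \<in> coefs R (?J k). lincomb R (?C k) ?s t \<in> boundaries (?C k)}" for k
  define G where "G k = twist (FM R (?J k) g) (- (int k * a))" for k
  define res where "res k c = (\<lambda>i. if i \<in> ?J k then c i else \<zero>\<^bsub>R\<^esub>)" for k and c :: "nat \<Rightarrow> 'r"
  define p where "p k t = res k (gdif R g t)" for k t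
  define p0 where "p0 t = cls (geps R D g t)" for t
  have GG: "graded_module R (G k)" for k unfolding G_def by (rule twist_graded_module[OF FM_graded])
  have Gc [simp]: "carrier (G k) = coefs R (?J k)" "zero (G k) = ?o" for k by (simp_all add: G_def)
  have res_coefs: "res k c \<in> coefs R (?J k)" if "c \<in> coefs R J" for k c J
    using L.coefs_restrict[OF that, of "?J k"] coefs_mono[of "J \<inter> ?J k" "?J k" R] by (auto simp: res_def)
  have res_I: "res k c = ?o" if "c \<in> coefs R (?I k)" for k c
    using coefsD(2)[OF that] by (auto simp: res_def fun_eq_iff)
  have res_J: "res k c = c" if "c \<in> coefs R (?J k)" for k c
    using coefsD(2)[OF that] by (auto simp: res_def fun_eq_iff)
  have res_add: "res k (\<lambda>i. c i \<oplus>\<^bsub>R\<^esub> d i) = (\<lambda>i. res k c i \<oplus>\<^bsub>R\<^esub> res k d i)" for k c d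
    by (auto simp: res_def fun_eq_iff)
  have res_new: "(\<lambda>i. if i \<in> ?I (Suc k) - ?I k then c i else \<zero>\<^bsub>R\<^esub>) = res k c" for k c
    unfolding JI res_def by simp
  have xk: "gx g n \<in> coefs R (?I k)" if "n \<in> ?I (Suc k) - ?I k" for n k
    using Jx[of n k] that unfolding JI by blast
  have Kr_of_cycle: "res k z \<in> Kr k" if z: "(d, z) \<in> cycles (?C (Suc k))" for d z k
  proof -
    have "lincomb R (?C k) ?s (res k z) \<in> boundaries (?C k)"
      using new_cycle_relation[OF fd fd I xk z] unfolding res_new .
    moreover have "z \<in> coefs R (?I (Suc k))" using z Cn_cycles[OF fd] by blast
    ultimately show ?thesis using res_coefs unfolding Kr_def by blast
  qed
  have kerp: "{t \<in> carrier (G (Suc k)). p k t = \<zero>\<^bsub>G k\<^esub>} = Kr (Suc k)" for k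
  proof (intro equalityI subsetI)
    fix t assume "t \<in> {t \<in> carrier (G (Suc k)). p k t = \<zero>\<^bsub>G k\<^esub>}"
    then have t: "t \<in> coefs R (?J (Suc k))" and pt: "res k (gdif R g t) = ?o" by (auto simp: p_def)
    note c = attaching_lincomb_cycle[OF tw t]
    have dI: "gdif R g t \<in> coefs R (?I (Suc k))" by (rule gdifI[OF J_coefs[OF t]])
    have "gdif R g t i = \<zero>\<^bsub>R\<^esub>" if "i \<notin> ?I k" for i
    proof (cases "i \<in> ?J k")
      case True
      then show ?thesis using fun_cong[OF pt, of i] by (simp add: res_def)
    qed (use coefsD(2)[OF dI] that in auto)
    then have "gdif R g t \<in> coefs R (?I k)" using dI by (auto simp: coefs_def)
    then have "(geps R D g t, gdif R g t) \<in> cycles (?C k)" using c Cn_cycles[OF fd] by blast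
    then have "(geps R D g t, gdif R g t) \<in> boundaries (?C (Suc k))" using Z_next by blast
    then show "t \<in> Kr (Suc k)" using t lcs[OF t] by (simp add: Kr_def)
  next
    fix t assume "t \<in> Kr (Suc k)"
    then have t: "t \<in> coefs R (?J (Suc k))" and "(geps R D g t, gdif R g t) \<in> boundaries (?C (Suc k))"
      using lcs by (auto simp: Kr_def)
    then obtain x' where "x' \<in> coefs R (?I (Suc k))" "gdif R g t = gdif R g x'"
      unfolding Cn_boundaries[OF fd] by blast
    then have "gdif R g t \<in> coefs R (?I k)" using gdifI by simp
    then show "t \<in> {t \<in> carrier (G (Suc k)). p k t = \<zero>\<^bsub>G k\<^esub>}" using t res_I by (simp add: p_def)
  qed
  have imp: "p k ` carrier (G (Suc k)) = Kr k" for k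
  proof (intro equalityI subsetI)
    fix y assume "y \<in> p k ` carrier (G (Suc k))"
    then obtain t where t: "t \<in> coefs R (?J (Suc k))" "y = res k (gdif R g t)" by (auto simp: p_def)
    show "y \<in> Kr k" using Kr_of_cycle[OF attaching_lincomb_cycle[OF tw t(1)]] t(2) by simp
  next
    fix t assume "t \<in> Kr k"
    then have t: "t \<in> coefs R (?J k)" "lincomb R (?C k) ?s t \<in> boundaries (?C k)" by (auto simp: Kr_def)
    obtain d x where x: "x \<in> coefs R (?I k)" "(d, \<lambda>i. t i \<oplus>\<^bsub>R\<^esub> x i) \<in> cycles (?C (Suc k))"
      using relation_new_cycle[OF fd fd I xk _ t(2)] t(1) unfolding JI by blast
    obtain b t' where b: "b \<in> boundaries (?C (Suc k))" and t': "t' \<in> coefs R (?J (Suc k))"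
      and z: "(d, \<lambda>i. t i \<oplus>\<^bsub>R\<^esub> x i) = b \<oplus>\<^bsub>?C (Suc k)\<^esub> lincomb R (?C (Suc k)) ?s t'" using gen[OF x(2)] by blast
    have "(fst b, snd b) \<in> boundaries (?C (Suc k))" using b by simp
    then obtain x' where x': "x' \<in> coefs R (?I (Suc k))" "snd b = gdif R g x'"
      unfolding Cn_boundaries[OF fd] by blast
    have eq: "(\<lambda>i. t i \<oplus>\<^bsub>R\<^esub> x i) = (\<lambda>i. gdif R g x' i \<oplus>\<^bsub>R\<^esub> gdif R g t' i)"
      using z lcs[OF t'] x'(2) by simp
    have "res k (\<lambda>i. t i \<oplus>\<^bsub>R\<^esub> x i) = t"
      unfolding res_add res_J[OF t(1)] res_I[OF x(1)] using coefsD(1)[OF t(1)] by simp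
    moreover have "res k (\<lambda>i. gdif R g x' i \<oplus>\<^bsub>R\<^esub> gdif R g t' i) = res k (gdif R g t')"
      unfolding res_add res_I[OF gdifI[OF x'(1)]]
      using coefsD(1)[OF res_coefs[OF gdifI[OF J_coefs[OF t']]]] by simp
    ultimately have "t = p k t'" using eq by (simp add: p_def)
    then show "t \<in> p k ` carrier (G (Suc k))" using t' by simp
  qed
  have I0: "?I 0 = {}" using tower_0[OF tw] by simp
  have c0: "coefs R {} = {\<lambda>i :: nat. \<zero>\<^bsub>R\<^esub>}" by (auto simp: coefs_def)
  have g0: "geps R D g ?o = \<zero>\<^bsub>D\<^esub>" "gdif R g ?o = ?o"
    by (simp_all add: geps_def lincomb_def gdif_def)
  have B0: "(d, x) \<in> boundaries (?C 0) \<longleftrightarrow> d \<in> boundaries D \<and> x = ?o" for d x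
  proof
    assume "(d, x) \<in> boundaries (?C 0)"
    then obtain d' where d': "d' \<in> carrier D" "d = \<zero>\<^bsub>D\<^esub> \<ominus>\<^bsub>D\<^esub> diff D d'" "x = ?o"
      unfolding Cn_boundaries[OF fd] unfolding I0 c0 using g0 by auto
    then have "d = diff D (\<ominus>\<^bsub>D\<^esub> d')" by (simp add: d_neg a_minus_def d_simps)
    then show "d \<in> boundaries D \<and> x = ?o" using d' by (auto simp: boundaries_def)
  next
    assume "d \<in> boundaries D \<and> x = ?o"
    then obtain e where e: "e \<in> carrier D" "d = diff D e" "x = ?o" by (auto simp: boundaries_def)
    then show "(d, x) \<in> boundaries (?C 0)"
      unfolding Cn_boundaries[OF fd] unfolding I0 c0 using g0
      by (intro bexI[of _ "\<ominus>\<^bsub>D\<^esub> e"]) (auto simp: d_neg a_minus_def d_simps)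
  qed
  have dif0: "gdif R g t = ?o" if "t \<in> coefs R (?J 0)" for t
    using gdifI[OF J_coefs[OF that]] unfolding I0 c0 by simp
  have epsc: "geps R D g t \<in> cycles D" if t: "t \<in> coefs R (?J 0)" for t
    using attaching_lincomb_cycle[OF tw t] Cn_cycles[OF fd] dif0[OF t] g0 by (auto simp: cycles_def)
  have ker0: "{t \<in> carrier (G 0). p0 t = \<zero>\<^bsub>homology D\<^esub>} = Kr 0"
  proof (intro equalityI subsetI)
    fix t assume "t \<in> {t \<in> carrier (G 0). p0 t = \<zero>\<^bsub>homology D\<^esub>}"
    then have t: "t \<in> coefs R (?J 0)" "cls (geps R D g t) = boundaries D" by (auto simp: p0_def)
    then show "t \<in> Kr 0" using cls_boundary[OF cycles_closed(1)[OF epsc[OF t(1)]]] lcs[OF t(1)] B0 dif0 by (simp add: Kr_def)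
  next
    fix t assume "t \<in> Kr 0"
    then have t: "t \<in> coefs R (?J 0)" "geps R D g t \<in> boundaries D" using lcs B0 by (auto simp: Kr_def)
    then show "t \<in> {t \<in> carrier (G 0). p0 t = \<zero>\<^bsub>homology D\<^esub>}"
      using cls_boundary[OF cycles_closed(1)[OF epsc[OF t(1)]]] by (simp add: p0_def)
  qed
  have p0_surj: "p0 ` carrier (G 0) = carrier (homology D)"
  proof (intro equalityI subsetI)
    fix S assume "S \<in> p0 ` carrier (G 0)"
    then show "S \<in> carrier (homology D)" using epsc by (auto simp: p0_def)
  next
    fix S assume "S \<in> carrier (homology D)"
    then obtain d where d: "d \<in> cycles D" "S = cls d" by auto
    have "(d, ?o) \<in> cycles (?C 0)"
      unfolding Cn_cycles[OF fd] using d(1) g0 L.coefs_zero by (auto simp: cycles_def)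
    then obtain b t where b: "b \<in> boundaries (?C 0)" and t: "t \<in> coefs R (?J 0)"
      and z: "(d, ?o) = b \<oplus>\<^bsub>?C 0\<^esub> lincomb R (?C 0) ?s t" using gen by blast
    have bb: "fst b \<in> boundaries D" using b B0[of "fst b" "snd b"] by simp
    have bc: "fst b \<in> carrier D" using bb boundaries_closed(1) by blast
    have dc: "d \<in> carrier D" "geps R D g t \<in> carrier D" using d(1) epsc[OF t] cycles_closed(1) by auto
    have "d = fst b \<oplus>\<^bsub>D\<^esub> geps R D g t" using z lcs[OF t] by simp
    moreover have "fst b \<oplus>\<^bsub>D\<^esub> geps R D g t \<ominus>\<^bsub>D\<^esub> geps R D g t = fst b" using bc dc by algebra
    ultimately have "d \<ominus>\<^bsub>D\<^esub> geps R D g t \<in> boundaries D" using bb by simp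
    then have "S = p0 t" using cls_eq_iff[OF dc] d(2) by (simp add: p0_def)
    then show "S \<in> p0 ` carrier (G 0)" using t by simp
  qed
  have \<iota>: "(\<lambda>c. c) \<in> graded_hom R (FM R (?J k) g) (FM R (?I (Suc k)) g)" for k
  proof (rule graded_homI)
    fix c j assume "c \<in> grade (FM R (?J k) g) j"
    then have c: "c \<in> coefs R (?J k)" "\<forall>i\<in>?J k. c i \<in> rgr R (j - gd g i)" unfolding FM_grade by auto
    have "c i \<in> rgr R (j - gd g i)" for i using c coefsD(2)[OF c(1), of i] rd.G_zero by (cases "i \<in> ?J k") auto
    then show "c \<in> grade (FM R (?I (Suc k)) g) j" unfolding FM_grade using J_coefs[OF c(1)] by simp
  qed (use J_coefs in auto)
  have \<rho>: "res k \<in> graded_hom R (FM R (?I (Suc (Suc k))) g) (FM R (?J k) g)" for k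
  proof (rule graded_homI)
    fix c j assume "c \<in> grade (FM R (?I (Suc (Suc k))) g) j"
    then have c: "c \<in> coefs R (?I (Suc (Suc k)))" "\<forall>i\<in>?I (Suc (Suc k)). c i \<in> rgr R (j - gd g i)" unfolding FM_grade by auto
    have "i \<in> ?I (Suc (Suc k))" if "i \<in> ?J k" for i using that tower_mono[OF tw, of "Suc k"] by auto
    then show "res k c \<in> grade (FM R (?J k) g) j" unfolding FM_grade using c res_coefs[OF c(1)] by (auto simp: res_def)
  qed (use res_coefs in \<open>auto simp: res_def fun_eq_iff\<close>)
  interpret F0: graded_module R "FM R (?J 0) g" by (rule FM_graded)
  have "(\<lambda>c. geps R D (rg (?I 1) g) c) \<in> graded_hom R (FM R (?J 0) g) D"
    using graded_hom_comp[OF \<iota>[of 0] diff_homD(1)[OF geps_hom[OF fd]]] by simp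
  then have "geps R D g \<in> graded_hom R (FM R (?J 0) g) D"
    by (rule graded_hom_cong[OF FM_graded]) (use geps_rg[OF fd J_coefs[of _ 0]] in simp)
  then have "geps R D g \<in> graded_hom R (G 0) (restrict_module D (cycles D))"
    using epsc F0.md.G_in_carrier
    by (simp add: G_def graded_hom_def image_subset_iff Pi_iff)
  from graded_hom_comp[OF this cls_hom] have p0h: "p0 \<in> graded_hom R (G 0) (homology D)"
    by (simp add: p0_def[abs_def])
  have ph: "p k \<in> graded_hom R (G (Suc k)) (G k)" for k
  proof -
    have "(\<lambda>t. res k (gdif R (rg (?I (Suc (Suc k))) g) t)) \<in> graded_hom R (FM R (?J (Suc k)) g) (twist (FM R (?J k) g) a)"
      using graded_hom_comp[OF graded_hom_comp[OF \<iota>[of "Suc k"] diff_moduleD(2)[OF FM_diff_module[OF fd]]] graded_hom_twist[OF \<rho>]]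
      by simp
    then have "p k \<in> graded_hom R (FM R (?J (Suc k)) g) (twist (FM R (?J k) g) a)"
      by (rule graded_hom_cong[OF FM_graded]) (use gdif_rg[OF fd J_coefs] in \<open>simp add: p_def\<close>)
    from graded_hom_twist[OF this, of "- (int (Suc k) * a)"]
    show ?thesis by (simp add: G_def algebra_simps)
  qed
  have gb: "gbasis R (G k) (unitvec R ` ?J k)" for k
    unfolding G_def by (intro twist_gbasis gbasisI FM_graded FM_basis)
  have min: "{t \<in> carrier (G (Suc k)). p k t = \<zero>\<^bsub>G k\<^esub>} \<subseteq> mM (G (Suc k))" for k
    unfolding kerp
  proof
    fix t assume "t \<in> Kr (Suc k)"
    then have t: "t \<in> coefs R (?J (Suc k))" "lincomb R (?C (Suc k)) ?s t \<in> boundaries (?C (Suc k))" by (auto simp: Kr_def)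
    have "t \<in> mM (FM R (?J (Suc k)) g)" by (rule FM_mM[OF t(1) attaching_relation[OF tw t]])
    then show "t \<in> mM (G (Suc k))" by (simp add: G_def lin_combs_def)
  qed
  have "{x \<in> carrier (G (Suc n)). p n x = \<zero>\<^bsub>G n\<^esub>} = {\<zero>\<^bsub>G (Suc n)\<^esub>}"
  proof (rule minimal_resolution_finite[OF graded_local_ring_axioms homology_graded_module pd gb _ p0h p0_surj ph _ _ min])
    show "p 0 ` carrier (G 1) = {x \<in> carrier (G 0). p0 x = \<zero>\<^bsub>homology D\<^esub>}" using imp[of 0] ker0 by simp
    show "p (Suc k) ` carrier (G (Suc (Suc k))) = {x \<in> carrier (G (Suc k)). p k x = \<zero>\<^bsub>G k\<^esub>}" for k
      using imp kerp by simp
  qed simp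
  then have K0: "Kr (Suc n) = {\<lambda>_. \<zero>\<^bsub>R\<^esub>}" unfolding kerp by simp
  show ?thesis
  proof (rule subrelI)
    fix d z assume z: "(d, z) \<in> cycles (?C (Suc (Suc n)))"
    have "res (Suc n) z = ?o" using Kr_of_cycle[OF z] K0 by simp
    then have r0: "z i = \<zero>\<^bsub>R\<^esub>" if "i \<in> ?J (Suc n)" for i using that unfolding res_def by metis
    have zI: "z \<in> coefs R (?I (Suc (Suc n)))" using z Cn_cycles[OF fd] by blast
    have "z i = \<zero>\<^bsub>R\<^esub>" if "i \<notin> ?I (Suc n)" for i
      using r0[of i] coefsD(2)[OF zI, of i] that by (cases "i \<in> ?J (Suc n)") auto
    then have "z \<in> coefs R (?I (Suc n))" using zI by (auto simp: coefs_def)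
    then have "(d, z) \<in> cycles (?C (Suc n))" using z Cn_cycles[OF fd] by blast
    then show "(d, z) \<in> boundaries (?C (Suc (Suc n)))" using Z_next by blast
  qed
qed

end

section \<open>Minimisation\<close>

text \<open>A finitely generated projective module over a graded local ring is free on any minimal set of
  homogeneous generators: the composite of a splitting with the projection from the free module is
  the identity modulo the maximal ideal.\<close>

lemma (in graded_local_ring) retract_free:
  assumes F: "gbasis R F B" and e: "e \<in> graded_hom R F F" and ee: "\<And>x. x \<in> carrier F \<Longrightarrow> e (e x) = e x"
    and M: "M = restrict_module F (e ` carrier F)"
    and S0: "finite S0" "S0 \<subseteq> carrier M" "S0 \<subseteq> (\<Union>j. grade M j)" "carrier M \<subseteq> spn R M S0"
  shows "\<exists>X. homogeneous_basis R M X \<and> finite X \<and> card X \<le> card S0"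
proof -
  interpret F: gbasis R F B by fact
  have FG: "graded_module R F" by (rule F.graded_module_axioms)
  have img: "gsub R F (e ` carrier F)" by (rule graded_hom_image[OF FG FG e F.gsub_carrier])
  have MG: "graded_module R M" unfolding M by (rule restrict_graded_module(1)[OF FG img])
  interpret M: graded_module R M by (rule MG)
  have MF: "carrier M \<subseteq> carrier F" using graded_homD(2)[OF e] by (auto simp: M)
  have "carrier M \<subseteq> spn R M ({\<zero>\<^bsub>M\<^esub>} \<union> S0)" using S0(4) M.spn_mono[of S0 "{\<zero>\<^bsub>M\<^esub>} \<union> S0"] by blast
  from minimal_generators[OF MG M.gsub_zero M.gsub_carrier S0(1-3) this]
  obtain X where X: "finite X" "X \<subseteq> carrier M" "X \<subseteq> (\<Union>j. grade M j)" "carrier M \<subseteq> spn R M ({\<zero>\<^bsub>M\<^esub>} \<union> X)"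
    "card X \<le> card S0"
    and rel': "\<forall>c\<in>coefs R X. lincomb R M (\<lambda>x. x) c \<in> {\<zero>\<^bsub>M\<^esub>} \<longrightarrow> (\<forall>s. c s \<in> \<mm>)"
    by (elim exE conjE) (rule that)
  have rel: "c s \<in> \<mm>" if "c \<in> coefs R X" "lincomb R M (\<lambda>x. x) c = \<zero>\<^bsub>M\<^esub>" for c s
    using bspec[OF rel' that(1)] that(2) by simp
  have XM: "carrier M \<subseteq> spn R M X"
  proof -
    have "{\<zero>\<^bsub>M\<^esub>} \<union> X \<subseteq> spn R M X" using submodD(2)[OF M.spn_submod[OF X(2)]] M.spn_incl[OF X(2)] by blast
    then show ?thesis using M.spn_least[OF M.spn_submod[OF X(2)]] X(4) by blast
  qed
  let ?G = "fmod R X (hdeg M) ()" and ?\<rho> = "lincomb R M (\<lambda>x. x)"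
  have G: "gbasis R ?G (unitvec R ` X)" by (intro gbasisI fmod_graded_module fmod_basis)
  interpret G: gbasis R ?G "unitvec R ` X" by (rule G)
  have \<rho>: "?\<rho> \<in> graded_hom R ?G M" by (rule fmod_hom[OF MG]) (use X(3) in \<open>intro grade_hdeg, blast\<close>)
  have eM: "e \<in> graded_hom R F M"
    by (rule graded_homI) (use graded_homD[OF e] F.md.G_in_carrier in \<open>auto simp: M\<close>)
  have iM: "(\<lambda>x. x) \<in> graded_hom R M F" by (rule graded_homI) (use MF in \<open>auto simp: M\<close>)
  have sub: "e x \<in> ?\<rho> ` carrier ?G" if "x \<in> carrier F" for x
    using subsetD[OF XM graded_homD(2)[OF eM that]] by (simp add: spn_def)
  have "\<exists>s\<in>graded_hom R F ?G. \<forall>x\<in>carrier F. ?\<rho> (s x) = e x"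
    by (rule F.hom_lift[OF G.graded_module_axioms MG \<rho> eM sub])
  then obtain s where s: "s \<in> graded_hom R F ?G" "\<And>x. x \<in> carrier F \<Longrightarrow> ?\<rho> (s x) = e x"
    by (elim bexE) (rule that, assumption, erule bspec)
  have q: "(\<lambda>t. s (?\<rho> t)) \<in> graded_hom R ?G ?G"
    using graded_hom_comp[OF graded_hom_comp[OF \<rho> iM] s(1)] .
  have id: "t \<ominus>\<^bsub>?G\<^esub> s (?\<rho> t) \<in> mM ?G" if t: "t \<in> carrier ?G" for t
  proof -
    have c: "?\<rho> t \<in> carrier M" "s (?\<rho> t) \<in> carrier ?G" using graded_homD(2)[OF \<rho> t] graded_homD(2)[OF q t] by auto
    have "e (?\<rho> t) = ?\<rho> t" using c(1) ee by (auto simp: M)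
    then have "?\<rho> (t \<ominus>\<^bsub>?G\<^esub> s (?\<rho> t)) = \<zero>\<^bsub>M\<^esub>"
      using graded_hom_minus[OF G.graded_module_axioms MG \<rho> t c(2)] s(2)[of "?\<rho> t"] c(1) MF
      by (simp add: a_minus_def M.M.r_neg subset_iff)
    moreover have "t \<ominus>\<^bsub>?G\<^esub> s (?\<rho> t) \<in> coefs R X" using G.M.minus_closed[OF t c(2)] by simp
    ultimately show ?thesis using rel by (intro fmod_mM) blast+
  qed
  have nak: "nakayama ?G"
    by (rule nakayama_finite[OF G.graded_module_axioms _ G.basis_carrier]) (use X(1) G.spn_basis in auto)
  have bij: "bij_betw (\<lambda>t. s (?\<rho> t)) (carrier ?G) (carrier ?G)" by (rule endomorphism_bij[OF G nak q id])
  have "homogeneous_basis R M X"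
  proof (rule M.homogeneous_basisI[OF X(3) XM])
    fix c b assume c: "c \<in> coefs R X" "?\<rho> c = \<zero>\<^bsub>M\<^esub>"
    have "s (?\<rho> c) = s (?\<rho> \<zero>\<^bsub>?G\<^esub>)" using c(2) graded_hom_zero[OF G.graded_module_axioms MG \<rho>] by simp
    then have "c = \<zero>\<^bsub>?G\<^esub>" using bij c(1) G.M.zero_closed unfolding bij_betw_def inj_on_def by simp
    then show "c b = \<zero>" by simp
  qed
  then show ?thesis using X by blast
qed

lemma restrict_diff [simp]: "diff (restrict_module F S) = diff F"
  by (simp add: restrict_module_def)

lemma restrict_diff_module:
  assumes F: "diff_module R a F" and S: "gsub R F S" and d: "\<And>x. x \<in> S \<Longrightarrow> diff F x \<in> S"
  shows "diff_module R a (restrict_module F S)"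
proof -
  interpret F: diff_module R a F by fact
  have SF: "x \<in> S \<Longrightarrow> x \<in> carrier F" for x by (rule submodD(1)[OF gsubD(1)[OF S]])
  show ?thesis
  proof (rule diff_moduleI[OF restrict_graded_module(1)[OF F.d_graded S]])
    show "diff (restrict_module F S) \<in> graded_hom R (restrict_module F S) (twist (restrict_module F S) a)"
      by (rule graded_homI) (use d SF diff_moduleD(7)[OF F] in \<open>auto simp: F.d_simps\<close>)
  qed (simp add: SF F.d_simps)
qed

lemma restrict_carrier:
  assumes "graded_module R F" shows "restrict_module F (carrier F) = F"
proof -
  interpret F: graded_module R F by fact
  have "(\<lambda>j. carrier F \<inter> grade F j) = grade F" using F.md.G_in_carrier by blast
  then show ?thesis by (simp add: restrict_module_def)
qed

text \<open>If some \<open>\<partial>b\<close> does not lie in \<open>\<mm>F\<close>, then some functional \<open>\<phi>\<close> satisfies \<open>\<phi>(\<partial>b) = \<one>\<close>. After \<open>b\<close>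
  is changed so that \<open>\<phi>(b) = \<zero>\<close>, the map \<open>x \<mapsto> x - \<phi>(\<partial>x)b - \<phi>(x)\<partial>b\<close> projects onto the subcomplex
  \<open>ker \<phi> \<inter> ker \<phi>\<partial>\<close> along the contractible complex spanned by \<open>b\<close> and \<open>\<partial>b\<close>.\<close>

lemma split_off_contractible:
  assumes R: "graded_local_ring R" and F: "diff_module R a F" and B: "homogeneous_basis R F B" "finite B"
    and nmin: "\<not> diff F ` carrier F \<subseteq> lin_combs F (graded_max_ideal R) (carrier F)"
  shows "\<exists>\<pi> X. \<pi> \<in> diff_hom R F F \<and> (\<forall>x\<in>carrier F. \<pi> (\<pi> x) = \<pi> x) \<and>
    (\<forall>z\<in>cycles F. \<pi> z = \<zero>\<^bsub>F\<^esub> \<longrightarrow> z \<in> boundaries F) \<and>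
    homogeneous_basis R (restrict_module F (\<pi> ` carrier F)) X \<and> finite X \<and> card X < card B"
proof -
  interpret R: graded_local_ring R by fact
  interpret F: diff_module R a F by fact
  have FG: "graded_module R F" by (rule F.d_graded)
  have gb: "gbasis R F B" by (rule gbasisI[OF FG B(1)])
  interpret B: gbasis R F B by (rule gb)
  note mMF = submodD[OF R.mM_submod[OF FG]]
  have "\<exists>b\<in>B. diff F b \<notin> R.mM F"
  proof (rule ccontr)
    assume "\<not> ?thesis"
    then have "B \<subseteq> {x \<in> carrier F. diff F x \<in> R.mM F}" using B.basis_carrier by blast
    moreover have "submod R F {x \<in> carrier F. diff F x \<in> R.mM F}"
      by (rule submodI) (use mMF F.d_simps F.smult_closed in auto)
    ultimately have "spn R F B \<subseteq> {x \<in> carrier F. diff F x \<in> R.mM F}" by (intro F.spn_least)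
    then show False using nmin B.spn_basis by blast
  qed
  then obtain b where b: "b \<in> B" "diff F b \<notin> R.mM F" by blast
  have bF: "b \<in> carrier F" "diff F b \<in> carrier F" using b(1) B.basis_carrier F.d_simps by auto
  obtain b' where u: "coord R F B (diff F b) b' \<notin> R.\<mm>" using R.mM_coord[OF gb bF(2)] b(2) by blast
  have b': "b' \<in> B" using u coefsD(2)[OF B.coord_coefs[OF bF(2)], of b'] R.gmax_zero by metis
  let ?u = "coord R F B (diff F b) b'"
  have bg: "b \<in> grade F (hdeg F b)" by (rule B.basis_homogeneous[OF b(1)])
  have ug: "?u \<in> rgr R (a + hdeg F b - hdeg F b')"
    by (rule B.coord_homogeneous[OF diff_moduleD(7)[OF F bg] b'])
  have deg: "hdeg F b' = a + hdeg F b" 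
  proof (rule ccontr)
    assume "hdeg F b' \<noteq> a + hdeg F b"
    then show False using R.positive_degree_gmax[OF ug] u by simp
  qed
  have u0: "?u \<in> rgr R 0" using ug deg by simp
  have uR: "?u \<in> carrier R" using R.rd.G_in_carrier[OF u0] .
  obtain v where v: "v \<in> rgr R 0" "v \<otimes>\<^bsub>R\<^esub> ?u = \<one>\<^bsub>R\<^esub>" "?u \<otimes>\<^bsub>R\<^esub> v = \<one>\<^bsub>R\<^esub>"
    using R.rpart_0_unit[OF uR u] R.rd.dpart_homog[OF u0, of 0] by auto
  have vR: "v \<in> carrier R" using R.rd.G_in_carrier[OF v(1)] .
  define \<phi> where "\<phi> x = coord R F B x b' \<otimes>\<^bsub>R\<^esub> v" for x
  have \<phi>c: "\<phi> x \<in> carrier R" if "x \<in> carrier F" for x using B.coord_closed[OF that] vR by (simp add: \<phi>_def)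
  have \<phi>a: "\<phi> (x \<oplus>\<^bsub>F\<^esub> y) = \<phi> x \<oplus>\<^bsub>R\<^esub> \<phi> y" if "x \<in> carrier F" "y \<in> carrier F" for x y
    using that B.coord_closed vR by (simp add: \<phi>_def B.coord_add R.l_distr)
  have \<phi>s: "\<phi> (r \<odot>\<^bsub>F\<^esub> x) = r \<otimes>\<^bsub>R\<^esub> \<phi> x" if "r \<in> carrier R" "x \<in> carrier F" for r x
    using that B.coord_closed vR by (simp add: \<phi>_def B.coord_smult R.m_assoc)
  have \<phi>h: "\<phi> \<in> add_hom F R" by (rule add_homI) (auto simp: \<phi>c \<phi>a)
  have \<phi>m: "\<phi> (x \<ominus>\<^bsub>F\<^esub> y) = \<phi> x \<ominus>\<^bsub>R\<^esub> \<phi> y" if "x \<in> carrier F" "y \<in> carrier F" for x y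
    by (rule add_hom_minus[OF F.M.abelian_group_axioms R.abelian_group_axioms \<phi>h that])
  have \<phi>0: "\<phi> \<zero>\<^bsub>F\<^esub> = \<zero>\<^bsub>R\<^esub>" by (rule add_hom_zero[OF F.M.abelian_group_axioms R.abelian_group_axioms \<phi>h])
  have \<phi>g: "\<phi> x \<in> rgr R (j - hdeg F b')" if "x \<in> grade F j" for x j
    using R.rgr_mult[OF B.coord_homogeneous[OF that b'] v(1)] by (simp add: \<phi>_def)
  have \<phi>db: "\<phi> (diff F b) = \<one>\<^bsub>R\<^esub>" using v(3) by (simp add: \<phi>_def)
  \<comment> \<open>Subtracting a multiple of \<open>\<partial>b\<close> from \<open>b\<close> keeps its differential.\<close>
  define c where "c = b \<ominus>\<^bsub>F\<^esub> \<phi> b \<odot>\<^bsub>F\<^esub> diff F b"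
  have sb: "\<phi> b \<odot>\<^bsub>F\<^esub> diff F b \<in> carrier F" using F.smult_closed[OF \<phi>c[OF bF(1)] bF(2)] .
  have cF: "c \<in> carrier F" unfolding c_def using bF(1) sb by simp
  have dc: "diff F c = diff F b"
  proof -
    have "diff F c = diff F b \<ominus>\<^bsub>F\<^esub> \<phi> b \<odot>\<^bsub>F\<^esub> diff F (diff F b)"
      unfolding c_def using bF sb \<phi>c[OF bF(1)] by (simp add: F.d_minus F.d_simps)
    then show ?thesis using bF \<phi>c[OF bF(1)] by (simp add: F.d_simps a_minus_def F.M.a_inv_zero)
  qed
  have \<phi>c0: "\<phi> c = \<zero>\<^bsub>R\<^esub>"
    unfolding c_def using bF sb \<phi>c[OF bF(1)] by (simp add: \<phi>m \<phi>s \<phi>db R.minus_eq_zero_iff)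
  have cg: "c \<in> grade F (hdeg F b)"
    unfolding c_def using F.smult_rgr[OF \<phi>g[OF bg] diff_moduleD(7)[OF F bg]] bg deg by (auto intro: F.md.G_minus)
  define \<pi> where "\<pi> x = x \<ominus>\<^bsub>F\<^esub> (\<phi> (diff F x) \<odot>\<^bsub>F\<^esub> c \<oplus>\<^bsub>F\<^esub> \<phi> x \<odot>\<^bsub>F\<^esub> diff F b)" for x
  have parts: "\<phi> (diff F x) \<odot>\<^bsub>F\<^esub> c \<in> carrier F" "\<phi> x \<odot>\<^bsub>F\<^esub> diff F b \<in> carrier F" "\<phi> (diff F x) \<in> carrier R" "\<phi> x \<in> carrier R"
    if "x \<in> carrier F" for x
    using that \<phi>c F.d_simps F.smult_closed cF bF by auto
  have q1: "(\<lambda>x. \<phi> (diff F x) \<odot>\<^bsub>F\<^esub> c) \<in> graded_hom R F F"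
  proof (rule graded_homI)
    fix x j assume x: "x \<in> grade F j"
    have "\<phi> (diff F x) \<in> rgr R (a + j - hdeg F b')" by (rule \<phi>g[OF diff_moduleD(7)[OF F x]])
    from F.smult_rgr[OF this cg] show "\<phi> (diff F x) \<odot>\<^bsub>F\<^esub> c \<in> grade F j" using deg by simp
  qed (use parts cF in \<open>auto simp: F.d_simps \<phi>a \<phi>s F.smult_l_distr F.smult_assoc \<phi>c\<close>)
  have q2: "(\<lambda>x. \<phi> x \<odot>\<^bsub>F\<^esub> diff F b) \<in> graded_hom R F F"
  proof (rule graded_homI)
    fix x j assume x: "x \<in> grade F j"
    from F.smult_rgr[OF \<phi>g[OF x] diff_moduleD(7)[OF F bg]] show "\<phi> x \<odot>\<^bsub>F\<^esub> diff F b \<in> grade F j" using deg by simp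
  qed (use parts bF in \<open>auto simp: \<phi>a \<phi>s F.smult_l_distr F.smult_assoc \<phi>c\<close>)
  have \<pi>h: "\<pi> \<in> graded_hom R F F"
    unfolding \<pi>_def[abs_def] by (intro graded_hom_diff FG graded_hom_id graded_hom_add q1 q2)
  note \<pi>D = graded_homD[OF \<pi>h]
  have \<pi>d: "\<pi> (diff F x) = diff F (\<pi> x)" if x: "x \<in> carrier F" for x
  proof -
    have dx: "diff F x \<in> carrier F" using x F.d_simps by simp
    have "\<pi> (diff F x) = diff F x \<ominus>\<^bsub>F\<^esub> \<phi> (diff F x) \<odot>\<^bsub>F\<^esub> diff F b"
      using x cF parts[OF dx] by (simp add: \<pi>_def F.d_simps \<phi>0)
    moreover have "diff F (\<pi> x) = diff F x \<ominus>\<^bsub>F\<^esub> \<phi> (diff F x) \<odot>\<^bsub>F\<^esub> diff F b"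
      unfolding \<pi>_def using x parts[OF x] cF bF parts[OF dx] dc by (simp add: F.d_minus F.d_simps)
    ultimately show ?thesis by simp
  qed
  have \<pi>dh: "\<pi> \<in> diff_hom R F F" using \<pi>h \<pi>d by (simp add: diff_hom_def)
  have \<phi>\<pi>: "\<phi> (\<pi> x) = \<zero>\<^bsub>R\<^esub>" if x: "x \<in> carrier F" for x
    unfolding \<pi>_def using x parts[OF x] cF bF
    by (simp add: \<phi>m \<phi>a \<phi>s \<phi>c0 \<phi>db R.minus_eq_zero_iff)
  have \<pi>\<pi>: "\<pi> (\<pi> x) = \<pi> x" if x: "x \<in> carrier F" for x
  proof -
    have px: "\<pi> x \<in> carrier F" by (rule \<pi>D(2)[OF x])
    have "\<phi> (diff F (\<pi> x)) = \<zero>\<^bsub>R\<^esub>" using \<phi>\<pi>[of "diff F x"] \<pi>d[OF x] x F.d_simps by simp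
    then show ?thesis
      unfolding \<pi>_def[of "\<pi> x"] using \<phi>\<pi>[OF x] px cF bF by (simp add: a_minus_def F.M.a_inv_zero)
  qed
  have cyc: "z \<in> boundaries F" if z: "z \<in> cycles F" "\<pi> z = \<zero>\<^bsub>F\<^esub>" for z
  proof -
    have zF: "z \<in> carrier F" "diff F z = \<zero>\<^bsub>F\<^esub>" using z(1) by (auto simp: cycles_def)
    have "z \<ominus>\<^bsub>F\<^esub> \<phi> z \<odot>\<^bsub>F\<^esub> diff F b = \<zero>\<^bsub>F\<^esub>" using z(2) zF cF parts[OF zF(1)] by (simp add: \<pi>_def \<phi>0)
    then have "z = \<phi> z \<odot>\<^bsub>F\<^esub> diff F b" using F.M.minus_eq_zero_iff[OF zF(1) parts(2)[OF zF(1)]] by simp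
    also have "\<dots> = diff F (\<phi> z \<odot>\<^bsub>F\<^esub> b)" using F.d_simps(4)[OF parts(4)[OF zF(1)] bF(1)] by simp
    finally show ?thesis using F.smult_closed[OF parts(4)[OF zF(1)] bF(1)] by (auto simp: boundaries_def)
  qed
  define M where "M = restrict_module F (\<pi> ` carrier F)"
  have img: "gsub R F (\<pi> ` carrier F)" by (rule graded_hom_image[OF FG FG \<pi>h F.gsub_carrier])
  have MG: "graded_module R M" unfolding M_def by (rule restrict_graded_module(1)[OF FG img])
  interpret M: graded_module R M by (rule MG)
  have Mc: "carrier M = \<pi> ` carrier F" by (simp add: M_def)
  let ?T = "\<pi> ` (B - {b'})"
  have TM: "?T \<subseteq> carrier M" using B.basis_carrier by (auto simp: Mc)
  have Tg: "?T \<subseteq> (\<Union>j. grade M j)"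
  proof
    fix y assume "y \<in> ?T"
    then obtain x where x: "x \<in> B" "y = \<pi> x" by auto
    have "y \<in> grade M (hdeg F x)"
      using x \<pi>D(5)[OF B.basis_homogeneous[OF x(1)]] B.basis_carrier by (auto simp: M_def)
    then show "y \<in> (\<Union>j. grade M j)" by blast
  qed
  have gen: "carrier M \<subseteq> spn R M ?T"
  proof
    fix y assume y: "y \<in> carrier M"
    then obtain x where x: "x \<in> carrier F" "y = \<pi> x" by (auto simp: Mc)
    have yF: "y \<in> carrier F" using x \<pi>D(2) by simp
    have "coord R F B y b' = coord R F B y b' \<otimes>\<^bsub>R\<^esub> (v \<otimes>\<^bsub>R\<^esub> ?u)" using v(2) B.coord_closed[OF yF] by simp
    also have "\<dots> = \<phi> y \<otimes>\<^bsub>R\<^esub> ?u" using B.coord_closed[OF yF] vR uR by (simp add: \<phi>_def R.m_assoc)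
    also have "\<dots> = \<zero>\<^bsub>R\<^esub>" using \<phi>\<pi>[OF x(1)] x(2) uR by simp
    finally have c0: "coord R F B y b' = \<zero>\<^bsub>R\<^esub>" .
    then have "coord R F B y \<in> coefs R (B - {b'})"
      using coefsD[OF B.coord_coefs[OF yF]] by (auto simp: coefs_def)
    then have ys: "y \<in> spn R F (B - {b'})" unfolding spn_def using B.coord_lincomb[OF yF] by (metis image_eqI)
    have sm: "submod R M (spn R M ?T)" by (rule M.spn_submod[OF TM])
    have "submod R F {x \<in> carrier F. \<pi> x \<in> spn R M ?T}"
      by (rule submodI)
        (use submodD[OF sm] \<pi>D graded_hom_zero[OF FG FG \<pi>h] F.smult_closed in \<open>auto simp: M_def\<close>)
    moreover have "B - {b'} \<subseteq> {x \<in> carrier F. \<pi> x \<in> spn R M ?T}"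
      using B.basis_carrier M.spn_incl[OF TM] by blast
    ultimately have "y \<in> {x \<in> carrier F. \<pi> x \<in> spn R M ?T}" using F.spn_least ys by blast
    then show "y \<in> spn R M ?T" using \<pi>\<pi>[OF x(1)] x(2) by simp
  qed
  obtain X where X: "homogeneous_basis R M X" "finite X" "card X \<le> card ?T"
    using R.retract_free[OF gb \<pi>h \<pi>\<pi> M_def _ TM Tg gen] B(2) by auto
  have "card ?T \<le> card (B - {b'})" by (rule card_image_le) (use B(2) in simp)
  also have "\<dots> < card B" by (rule card_Diff1_less[OF B(2) b'])
  finally show ?thesis using X \<pi>dh \<pi>\<pi> cyc unfolding M_def
    by (intro exI[of _ \<pi>] exI[of _ X]) auto
qed

text \<open>Split off contractible summands until the differential is minimal; the rank decreases each time. The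
  projections compose to an idempotent \<open>e\<close> that is injective on homology.\<close>

lemma minimisation:
  assumes R: "graded_local_ring R"
  shows "\<lbrakk>diff_module R a F; homogeneous_basis R F B; finite B\<rbrakk> \<Longrightarrow>
    \<exists>e X. e \<in> diff_hom R F F \<and> (\<forall>x\<in>carrier F. e (e x) = e x) \<and>
    (\<forall>z\<in>cycles F. e z = \<zero>\<^bsub>F\<^esub> \<longrightarrow> z \<in> boundaries F) \<and>
    homogeneous_basis R (restrict_module F (e ` carrier F)) X \<and> finite X \<and>
    diff F ` (e ` carrier F) \<subseteq> lin_combs (restrict_module F (e ` carrier F)) (graded_max_ideal R) (e ` carrier F)"
proof (induction "card B" arbitrary: F B rule: less_induct)
  case less
  interpret F: diff_module R a F by (rule less.prems(1))
  show ?case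
  proof (cases "diff F ` carrier F \<subseteq> lin_combs F (graded_max_ideal R) (carrier F)")
    case True
    have "(\<lambda>x. x) \<in> diff_hom R F F" using graded_hom_id by (simp add: diff_hom_def)
    moreover have "z \<in> boundaries F" if "z = \<zero>\<^bsub>F\<^esub>" for z using F.boundaries_closed(2) that by simp
    ultimately show ?thesis
      using True less.prems by (intro exI[of _ "\<lambda>x. x"] exI[of _ B]) (simp add: restrict_carrier[OF F.d_graded])
  next
    case False
    obtain \<pi> X where \<pi>: "\<pi> \<in> diff_hom R F F" and \<pi>\<pi>: "\<And>x. x \<in> carrier F \<Longrightarrow> \<pi> (\<pi> x) = \<pi> x"
      and cyc: "\<And>z. \<lbrakk>z \<in> cycles F; \<pi> z = \<zero>\<^bsub>F\<^esub>\<rbrakk> \<Longrightarrow> z \<in> boundaries F"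
      and X: "homogeneous_basis R (restrict_module F (\<pi> ` carrier F)) X" "finite X" "card X < card B"
      using split_off_contractible[OF R less.prems False] by blast
    note P = graded_homD[OF diff_homD(1)[OF \<pi>]] and Pd = diff_homD(2)[OF \<pi>]
    let ?S = "\<pi> ` carrier F"
    let ?M = "restrict_module F ?S"
    have img: "gsub R F ?S" by (rule graded_hom_image[OF F.d_graded F.d_graded diff_homD(1)[OF \<pi>] F.gsub_carrier])
    have SF: "x \<in> carrier F" if "x \<in> ?S" for x using that P(2) by auto
    have dS: "diff F x \<in> ?S" if x: "x \<in> ?S" for x
    proof -
      obtain y where "y \<in> carrier F" "x = \<pi> y" using x by auto
      then show ?thesis using Pd[of y] F.d_simps(1)[of y] by (metis imageI)
    qed
    have M: "diff_module R a ?M" by (rule restrict_diff_module[OF less.prems(1) img dS])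
    interpret M: diff_module R a ?M by (rule M)
    obtain e X' where e: "e \<in> diff_hom R ?M ?M" and ee: "\<And>x. x \<in> ?S \<Longrightarrow> e (e x) = e x"
      and ecyc: "\<And>z. \<lbrakk>z \<in> cycles ?M; e z = \<zero>\<^bsub>?M\<^esub>\<rbrakk> \<Longrightarrow> z \<in> boundaries ?M"
      and X': "homogeneous_basis R (restrict_module ?M (e ` ?S)) X'" "finite X'"
      and min: "diff F ` (e ` ?S) \<subseteq> lin_combs (restrict_module ?M (e ` ?S)) (graded_max_ideal R) (e ` ?S)"
      using less.hyps[OF X(3) M X(1,2)] by auto
    note E = graded_homD[OF diff_homD(1)[OF e], simplified] and Ed = diff_homD(2)[OF e, simplified]
    have \<pi>S: "\<pi> x = x" if "x \<in> ?S" for x using that \<pi>\<pi> by auto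
    have eS: "e ` ?S \<subseteq> ?S" using E(2) by blast
    have rr: "restrict_module ?M (e ` ?S) = restrict_module F (e ` ?S)" by (rule restrict_restrict[OF eS])
    let ?e = "\<lambda>x. e (\<pi> x)"
    have im: "?e ` carrier F = e ` ?S" by auto
    have "?e \<in> diff_hom R F F"
    proof -
      have eM: "e \<in> graded_hom R ?M F"
        by (rule graded_homI) (use E SF in auto)
      have "\<pi> \<in> graded_hom R F ?M"
        by (rule graded_homI) (use P F.md.G_in_carrier in auto)
      from graded_hom_comp[OF this eM] have "?e \<in> graded_hom R F F" .
      moreover have "?e (diff F x) = diff F (?e x)" if "x \<in> carrier F" for x
        using Pd[OF that] Ed[of "\<pi> x"] that by simp
      ultimately show ?thesis by (simp add: diff_hom_def)
    qed
    moreover have "?e (?e x) = ?e x" if x: "x \<in> carrier F" for x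
    proof -
      have px: "\<pi> x \<in> ?S" using x by (rule imageI)
      show ?thesis using \<pi>S[OF E(2)[OF px]] ee[OF px] by simp
    qed
    moreover have "z \<in> boundaries F" if z: "z \<in> cycles F" "?e z = \<zero>\<^bsub>F\<^esub>" for z
    proof -
      have zF: "z \<in> carrier F" "diff F z = \<zero>\<^bsub>F\<^esub>" using z(1) by (auto simp: cycles_def)
      have pz: "\<pi> z \<in> carrier F" by (rule P(2)[OF zF(1)])
      have dpz: "diff F (\<pi> z) = \<zero>\<^bsub>F\<^esub>"
        using Pd[OF zF(1)] zF(2) graded_hom_zero[OF F.d_graded F.d_graded diff_homD(1)[OF \<pi>]] by simp
      then have "\<pi> z \<in> cycles ?M" using zF(1) by (simp add: cycles_def)
      then have "\<pi> z \<in> boundaries ?M" using ecyc z(2) by simp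
      then have 1: "\<pi> z \<in> boundaries F" using SF by (auto simp: boundaries_def)
      have "\<pi> (z \<ominus>\<^bsub>F\<^esub> \<pi> z) = \<zero>\<^bsub>F\<^esub>"
        using graded_hom_minus[OF F.d_graded F.d_graded diff_homD(1)[OF \<pi>] zF(1) pz] \<pi>\<pi>[OF zF(1)] pz
        by (simp add: a_minus_def F.M.r_neg)
      moreover have "z \<ominus>\<^bsub>F\<^esub> \<pi> z \<in> cycles F"
        using zF pz dpz by (simp add: cycles_def F.d_minus F.M.minus_eq_zero_iff)
      ultimately have "z \<ominus>\<^bsub>F\<^esub> \<pi> z \<in> boundaries F" by (intro cyc)
      then have "z \<ominus>\<^bsub>F\<^esub> \<pi> z \<oplus>\<^bsub>F\<^esub> \<pi> z \<in> boundaries F" using 1 by (rule F.boundaries_closed(3))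
      then show ?thesis using F.M.minus_add_cancel[OF zF(1) pz] by simp
    qed
    ultimately show ?thesis
      using X' min unfolding rr by (intro exI[of _ ?e] exI[of _ X']) (simp only: im, blast)
  qed
qed

text \<open>Let a cycle of the cone over the image of \<open>e\<close> be the boundary of \<open>(d', x')\<close> in the cone over \<open>F\<close>.
  Then \<open>x' - e x'\<close> is a cycle that \<open>e\<close> sends to zero, so it is a boundary, and \<open>x'\<close> can be replaced by
  \<open>e x'\<close> after a change of \<open>d'\<close>.\<close>

lemma retract_resolution:
  assumes F: "diff_module R a F" and D: "diff_module R a D" and q: "quasi_iso R F D \<epsilon>"
    and e: "e \<in> diff_hom R F F" and ee: "\<And>x. x \<in> carrier F \<Longrightarrow> e (e x) = e x"
    and cyc: "\<And>z. \<lbrakk>z \<in> cycles F; e z = \<zero>\<^bsub>F\<^esub>\<rbrakk> \<Longrightarrow> z \<in> boundaries F"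
    and M: "M = restrict_module F (e ` carrier F)"
  shows "diff_module R a M" "quasi_iso R M D \<epsilon>" "split_injection R M F (\<lambda>x. x)"
proof -
  interpret F: diff_module R a F by fact
  interpret D: diff_module R a D by fact
  note E = graded_homD[OF diff_homD(1)[OF e]] and Ed = diff_homD(2)[OF e]
  have qh: "\<epsilon> \<in> diff_hom R F D" and ac: "cycles (cone a D F \<epsilon>) \<subseteq> boundaries (cone a D F \<epsilon>)"
    using q quasi_iso_iff[OF F D] by auto
  note Q = graded_homD[OF diff_homD(1)[OF qh]]
  let ?S = "e ` carrier F"
  have img: "gsub R F ?S" by (rule graded_hom_image[OF F.d_graded F.d_graded diff_homD(1)[OF e] F.gsub_carrier])
  have SF: "x \<in> carrier F" if "x \<in> ?S" for x using that E(2) by auto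
  have dS: "diff F x \<in> ?S" if x: "x \<in> ?S" for x
  proof -
    obtain y where "y \<in> carrier F" "x = e y" using x by auto
    then show ?thesis using Ed[of y] F.d_simps(1)[of y] by (metis imageI)
  qed
  show Md: "diff_module R a M" unfolding M by (rule restrict_diff_module[OF F img dS])
  have inc: "(\<lambda>x. x) \<in> diff_hom R M F"
    unfolding diff_hom_def by (rule CollectI, rule conjI, rule graded_homI) (use SF in \<open>auto simp: M\<close>)
  have eM: "e \<in> diff_hom R F M"
  proof -
    have "e \<in> graded_hom R F M" by (rule graded_homI) (use E F.md.G_in_carrier in \<open>auto simp: M\<close>)
    then show ?thesis using Ed by (simp add: diff_hom_def M)
  qed
  have eS: "e x = x" if "x \<in> ?S" for x using that ee by auto
  show "split_injection R M F (\<lambda>x. x)"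
    unfolding split_injection_def
  proof (intro conjI inc bexI[OF _ eM] ballI)
    fix x assume "x \<in> carrier M"
    then have "x \<in> ?S" unfolding M by simp
    then show "e x = x" by (rule eS)
  qed
  have \<epsilon>M: "\<epsilon> \<in> diff_hom R M D"
    using graded_hom_comp[OF diff_homD(1)[OF inc] diff_homD(1)[OF qh]] diff_homD(2)[OF qh] SF by (simp add: diff_hom_def M)
  show "quasi_iso R M D \<epsilon>"
    unfolding quasi_iso_iff[OF Md D]
  proof (intro conjI \<epsilon>M subrelI)
    fix d x assume "(d, x) \<in> cycles (cone a D M \<epsilon>)"
    then have dx: "d \<in> carrier D" "x \<in> ?S" "diff F x = \<zero>\<^bsub>F\<^esub>" "\<epsilon> x = diff D d"
      unfolding cone_cycles[OF D \<epsilon>M] by (auto simp: M)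
    then have "(d, x) \<in> cycles (cone a D F \<epsilon>)" unfolding cone_cycles[OF D qh] using SF by simp
    then have "(d, x) \<in> boundaries (cone a D F \<epsilon>)" using ac by blast
    then obtain d' x' where *: "d' \<in> carrier D" "x' \<in> carrier F" "d = \<epsilon> x' \<ominus>\<^bsub>D\<^esub> diff D d'" "x = diff F x'"
      unfolding cone_boundaries by blast
    have ex: "e x' \<in> carrier F" by (rule E(2)[OF *(2)])
    have xe: "x = diff F (e x')" using eS[OF dx(2)] Ed[OF *(2)] *(4) by simp
    have "e (x' \<ominus>\<^bsub>F\<^esub> e x') = \<zero>\<^bsub>F\<^esub>"
      using graded_hom_minus[OF F.d_graded F.d_graded diff_homD(1)[OF e] *(2) ex] ee[OF *(2)] ex
      by (simp add: a_minus_def F.M.r_neg)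
    moreover have "x' \<ominus>\<^bsub>F\<^esub> e x' \<in> cycles F"
      using *(2,4) ex xe F.d_simps(1)[OF ex] by (simp add: cycles_def F.d_minus F.M.minus_eq_zero_iff)
    ultimately have "x' \<ominus>\<^bsub>F\<^esub> e x' \<in> boundaries F" by (intro cyc)
    then obtain w where w: "w \<in> carrier F" "x' \<ominus>\<^bsub>F\<^esub> e x' = diff F w" by (auto simp: boundaries_def)
    have c: "\<epsilon> x' \<in> carrier D" "\<epsilon> (e x') \<in> carrier D" "\<epsilon> w \<in> carrier D" "diff D d' \<in> carrier D" "diff D (\<epsilon> w) \<in> carrier D"
      using Q(2) * ex w D.d_simps by auto
    have "\<epsilon> x' \<ominus>\<^bsub>D\<^esub> \<epsilon> (e x') = diff D (\<epsilon> w)"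
      using graded_hom_minus[OF F.d_graded D.d_graded diff_homD(1)[OF qh] *(2) ex] w diff_homD(2)[OF qh w(1)] by simp
    then have "\<epsilon> x' = \<epsilon> (e x') \<oplus>\<^bsub>D\<^esub> diff D (\<epsilon> w)"
      using D.M.minus_add_cancel[OF c(1,2)] c D.M.a_comm by metis
    then have "d = \<epsilon> (e x') \<oplus>\<^bsub>D\<^esub> diff D (\<epsilon> w) \<ominus>\<^bsub>D\<^esub> diff D d'" using *(3) by simp
    also have "\<dots> = \<epsilon> (e x') \<ominus>\<^bsub>D\<^esub> (diff D d' \<ominus>\<^bsub>D\<^esub> diff D (\<epsilon> w))" using c by algebra
    also have "\<dots> = \<epsilon> (e x') \<ominus>\<^bsub>D\<^esub> diff D (d' \<ominus>\<^bsub>D\<^esub> \<epsilon> w)" using *(1) c by (simp add: D.d_minus)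
    finally show "(d, x) \<in> boundaries (cone a D M \<epsilon>)"
      unfolding cone_boundaries using * c xe
      by (intro bexI[of _ "d' \<ominus>\<^bsub>D\<^esub> \<epsilon> w"] bexI[of _ "e x'"]) (auto simp: M)
  qed
qed

section \<open>Resolutions when the projective dimension is finite\<close>

text \<open>Every cycle is congruent modulo boundaries to a combination of representatives of the generators of
  \<open>H(D)\<close>.\<close>

lemma (in diff_module) homology_generators:
  assumes "finitely_generated R (homology D)"
  shows "\<exists>A. finite A \<and> A \<subseteq> cycles D \<and> cycles D \<subseteq> spn R D (boundaries D \<union> A)"
proof -
  let ?H = "homology D"
  interpret H: graded_module R ?H by (rule homology_graded_module)
  obtain A' where A': "finite A'" "A' \<subseteq> carrier ?H" "carrier ?H = lin_combs ?H (carrier R) A'"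
    using assms unfolding finitely_generated_def by (elim exE conjE) (rule that)
  then obtain A where A: "finite A" "A \<subseteq> cycles D" "A' = cls ` A"
    using finite_subset_image[of A' cls "cycles D"] by auto
  let ?W = "spn R D (boundaries D \<union> A)"
  have gen: "boundaries D \<union> A \<subseteq> cycles D" using A(2) boundaries_cycles by blast
  have genD: "boundaries D \<union> A \<subseteq> carrier D" using gen cycles_closed(1) by blast
  have W: "submod R D ?W" by (rule spn_submod[OF genD])
  have WZ: "?W \<subseteq> cycles D" by (rule spn_least[OF gsubD(1)[OF cycles_gsub] gen])
  note W' = submodD[OF W]
  have "submod R ?H (cls ` ?W)"
  proof (rule submodI)
    fix x assume "x \<in> cls ` ?W" then show "x \<in> carrier ?H" using WZ by auto
  next
    show "\<zero>\<^bsub>?H\<^esub> \<in> cls ` ?W" using W'(2) by (intro image_eqI[of _ _ "\<zero>\<^bsub>D\<^esub>"]) (simp_all add: cls_zero)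
  next
    fix x y assume "x \<in> cls ` ?W" "y \<in> cls ` ?W"
    then obtain w w' where "w \<in> ?W" "w' \<in> ?W" "x = cls w" "y = cls w'" by blast
    then show "x \<oplus>\<^bsub>?H\<^esub> y \<in> cls ` ?W" using W'(1,3) by (intro image_eqI[of _ _ "w \<oplus>\<^bsub>D\<^esub> w'"]) (simp_all add: cls_add)
  next
    fix r x assume r: "r \<in> carrier R" and "x \<in> cls ` ?W"
    then obtain w where "w \<in> ?W" "x = cls w" by blast
    then show "r \<odot>\<^bsub>?H\<^esub> x \<in> cls ` ?W" using W'(1,4) r by (intro image_eqI[of _ _ "r \<odot>\<^bsub>D\<^esub> w"]) (simp_all add: cls_smult)
  qed
  moreover have "A' \<subseteq> cls ` ?W" unfolding A(3) using spn_incl[OF genD] by blast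
  ultimately have "spn R ?H A' \<subseteq> cls ` ?W" by (rule H.spn_least)
  then have HW: "carrier ?H \<subseteq> cls ` ?W" using A'(3) H.lin_combs_carrier[OF A'(2)] by blast
  have "cycles D \<subseteq> ?W"
  proof
    fix z assume z: "z \<in> cycles D"
    then have "cls z \<in> carrier ?H" by simp
    then obtain w where w: "w \<in> ?W" "cls z = cls w" using HW by blast
    have c: "z \<in> carrier D" "w \<in> carrier D" using z w(1) W'(1) cycles_closed(1) by blast+
    have "z \<ominus>\<^bsub>D\<^esub> w \<in> boundaries D" using w(2) cls_eq_iff[OF c] by simp
    then have "z \<ominus>\<^bsub>D\<^esub> w \<in> ?W" using spn_incl[OF genD] by blast
    then have "z \<ominus>\<^bsub>D\<^esub> w \<oplus>\<^bsub>D\<^esub> w \<in> ?W" using w(1) by (rule W'(3))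
    then show "z \<in> ?W" using M.minus_add_cancel[OF c] by simp
  qed
  then show ?thesis using A by blast
qed

text \<open>The images under \<open>u\<close> of the generators of \<open>M\<close> involve only finitely many elements of \<open>B'\<close>. At any other
  \<open>b \<in> B'\<close> the coefficient of \<open>b - u (v b)\<close> is \<open>\<one>\<close>, although it must lie in \<open>\<mm>\<close>.\<close>

lemma finite_basis_of_comparison:
  assumes R: "graded_local_ring R" and M: "graded_module R M" and X: "finite X" "X \<subseteq> carrier M" "carrier M \<subseteq> spn R M X"
    and M': "gbasis R M' B'"
    and u: "u \<in> graded_hom R M M'" and v: "v \<in> graded_hom R M' M"
    and uv: "\<And>x. x \<in> carrier M' \<Longrightarrow> x \<ominus>\<^bsub>M'\<^esub> u (v x) \<in> lin_combs M' (graded_max_ideal R) (carrier M')"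
  shows "finite B'"
proof -
  interpret R: graded_local_ring R by fact
  interpret M: graded_module R M by fact
  interpret M': gbasis R M' B' by fact
  let ?co = "coord R M' B'"
  define E where "E = (\<Union>x\<in>X. {b. ?co (u x) b \<noteq> \<zero>\<^bsub>R\<^esub>})"
  let ?V = "{x \<in> carrier M. \<forall>b. b \<notin> E \<longrightarrow> ?co (u x) b = \<zero>\<^bsub>R\<^esub>}"
  note U = graded_homD[OF u] and V = graded_homD[OF v]
  have "finite E" unfolding E_def using X coefsD(3)[OF M'.coord_coefs[OF U(2)]] by blast
  have "submod R M ?V"
  proof (rule submodI)
    show "\<zero>\<^bsub>M\<^esub> \<in> ?V"
      using graded_hom_zero[OF M M'.graded_module_axioms u] by (simp add: M'.coord_zero)
  qed (use U M.smult_closed in \<open>auto simp: M'.coord_add M'.coord_smult\<close>)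
  moreover have "X \<subseteq> ?V" using X(2) by (auto simp: E_def)
  ultimately have all: "carrier M \<subseteq> ?V"
    using M.spn_least X(3) by blast
  have "B' \<subseteq> E"
  proof (rule subsetI, rule ccontr)
    fix b assume b: "b \<in> B'" "b \<notin> E"
    have bM: "b \<in> carrier M'" using b(1) M'.basis_carrier by blast
    have c: "u (v b) \<in> carrier M'" using U(2)[OF V(2)[OF bM]] .
    have z: "?co (u (v b)) b = \<zero>\<^bsub>R\<^esub>" using all V(2)[OF bM] b(2) by blast
    have "?co (b \<ominus>\<^bsub>M'\<^esub> u (v b)) b \<in> R.\<mm>"
      using R.mM_coord[OF M' M'.M.minus_closed[OF bM c]] uv[OF bM] by simp
    moreover have "?co (b \<ominus>\<^bsub>M'\<^esub> u (v b)) b = ?co b b \<ominus>\<^bsub>R\<^esub> ?co (u (v b)) b"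
      by (rule add_hom_minus[OF M'.M.abelian_group_axioms R.abelian_group_axioms M'.coord_add_hom bM c])
    moreover have "?co b b = \<one>\<^bsub>R\<^esub>" using M'.coord_basis[OF b(1)] by (simp add: unitvec_def)
    ultimately show False using z R.one_notin_gmax by (simp add: a_minus_def)
  qed
  then show ?thesis using \<open>finite E\<close> by (rule finite_subset)
qed

text \<open>The comparison maps between two minimal resolutions are inverse to each other modulo \<open>\<mm>\<close>. The last
  hypothesis lets the finiteness condition behind Nakayama's lemma be carried from \<open>M\<close> to \<open>M'\<close> by these maps.\<close>

lemma nakayama_minimal_resolution_unique:
  assumes R: "graded_local_ring R" and D: "diff_module R a D"
    and m: "minimal_free_resolution TYPE('w) R a D M \<epsilon>"
    and m': "minimal_free_resolution TYPE('v) R a D M' \<epsilon>'"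
    and nak: "graded_local_ring.nakayama R M"
    and nak': "\<And>B' u v. \<lbrakk>gbasis R M' B'; u \<in> graded_hom R M M'; v \<in> graded_hom R M' M;
      \<And>x. x \<in> carrier M' \<Longrightarrow> x \<ominus>\<^bsub>M'\<^esub> u (v x) \<in> lin_combs M' (graded_max_ideal R) (carrier M')\<rbrakk>
      \<Longrightarrow> graded_local_ring.nakayama R M'"
  shows "diff_isomorphic R M M'"
proof -
  obtain u v where u: "u \<in> diff_hom R M M'" and v: "v \<in> diff_hom R M' M"
    and vu: "\<forall>x\<in>carrier M. x \<ominus>\<^bsub>M\<^esub> v (u x) \<in> lin_combs M (graded_max_ideal R) (carrier M)"
    and uv: "\<forall>x\<in>carrier M'. x \<ominus>\<^bsub>M'\<^esub> u (v x) \<in> lin_combs M' (graded_max_ideal R) (carrier M')"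
    using minimal_resolutions_comparison[OF R D m m'] by (elim bexE conjE) (rule that)
  have fr: "graded_free R M" "graded_free R M'"
    using m m' by (simp_all add: minimal_free_resolution_def free_resolution_def free_diff_module_def)
  then obtain B' where "gbasis R M' B'" unfolding graded_free_def using gbasisI by blast
  from nak'[OF this diff_homD(1)[OF u] diff_homD(1)[OF v] bspec[OF uv]]
  show ?thesis by (intro nakayama_isomorphic[OF R fr nak _ u v bspec[OF vu] bspec[OF uv]])
qed

lemma finite_minimal_resolution_unique:
  fixes R :: "'r graded_ring" and D :: "('r, 'd) diff_module"
    and M :: "('r, 'm) diff_module" and M' :: "('r, 'n) diff_module"
  assumes R: "graded_local_ring R" and D: "diff_module R a D"
    and m: "minimal_free_resolution TYPE('w) R a D M \<epsilon>" and X: "homogeneous_basis R M X" "finite X"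
    and m': "minimal_free_resolution TYPE('v) R a D M' \<epsilon>'"
  shows "diff_isomorphic R M M'"
proof -
  have MG: "graded_module R M"
    using m by (simp add: minimal_free_resolution_def free_resolution_def free_diff_module_def graded_free_def)
  have nak: "graded_local_ring.nakayama R L" if "gbasis R L Y" "finite Y" for L :: "('r, 'l) diff_module" and Y
    using graded_local_ring.nakayama_finite[OF R gbasis.axioms(1)[OF that(1)] that(2) gbasis.basis_carrier[OF that(1)]]
      gbasis.spn_basis[OF that(1)] by simp
  have gb: "gbasis R M X" by (rule gbasisI[OF MG X(1)])
  have sp: "carrier M \<subseteq> spn R M X" using gbasis.spn_basis[OF gb] by simp
  show ?thesis
    by (rule nakayama_minimal_resolution_unique[OF R D m m' nak[OF gb X(2)]],
        rule nak, assumption, rule finite_basis_of_comparison[OF R MG X(2) gbasis.basis_carrier[OF gb] sp])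
qed

lemma (in resolving) finite_minimal_resolution_exists:
  assumes fg: "finitely_generated R (homology D)" and pd: "projective_dimension_le TYPE('p) R (homology D) n"
  shows "\<exists>(M :: ('r, nat \<Rightarrow> 'r) diff_module) \<epsilon> X.
    minimal_free_resolution TYPE(nat \<Rightarrow> 'r) R a D M \<epsilon> \<and> homogeneous_basis R M X \<and> finite X"
proof -
  obtain A where "finite A" "A \<subseteq> cycles D" "cycles D \<subseteq> spn R D (boundaries D \<union> A)"
    using homology_generators[OF fg] by blast
  from tower_exists[OF this] obtain N g where tw: "tower (\<lambda>_ _. True) N g" by blast
  let ?I = "{..<N (Suc (Suc n))}"
  let ?F = "FM R ?I g" and ?\<epsilon> = "geps R D (rg ?I g)"
  have fd: "flag_data R a D ?I g" by (rule tower_fd[OF tw])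
  have Fd: "diff_module R a ?F" by (rule FM_diff_module[OF fd])
  have q: "quasi_iso R ?F D ?\<epsilon>" by (rule FM_quasi_iso[OF fd tower_terminates[OF tw pd]])
  have R: "graded_local_ring R" by (rule L.graded_local_ring_axioms)
  obtain e X where e: "e \<in> diff_hom R ?F ?F" "\<forall>x\<in>carrier ?F. e (e x) = e x"
      "\<forall>z\<in>cycles ?F. e z = \<zero>\<^bsub>?F\<^esub> \<longrightarrow> z \<in> boundaries ?F"
    and X: "homogeneous_basis R (restrict_module ?F (e ` carrier ?F)) X" "finite X"
    and min: "diff ?F ` (e ` carrier ?F) \<subseteq>
      lin_combs (restrict_module ?F (e ` carrier ?F)) (graded_max_ideal R) (e ` carrier ?F)"
    using minimisation[OF R Fd FM_basis finite_imageI[OF finite_lessThan]] by (elim exE conjE) (rule that)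
  define M where "M = restrict_module ?F (e ` carrier ?F)"
  have Mr: "diff_module R a M" "quasi_iso R M D ?\<epsilon>" "split_injection R M ?F (\<lambda>x. x)"
    by (rule retract_resolution[OF Fd diff_module_axioms q e(1) bspec[OF e(2)] mp[OF bspec[OF e(3)]] M_def]; assumption)+
  have "graded_free R M"
    unfolding graded_free_def using diff_moduleD(1)[OF Mr(1)] X(1) unfolding M_def by blast
  moreover have "free_flag_resolution R a D ?F ?\<epsilon>"
    unfolding free_flag_resolution_def using FM_free_flag[OF fd] q by blast
  ultimately have "free_resolution TYPE(nat \<Rightarrow> 'r) R a D M ?\<epsilon>"
    unfolding free_resolution_def free_diff_module_def using Mr
    by (intro conjI exI[of _ ?F] exI[of _ "\<lambda>x. x"] exI[of _ ?\<epsilon>]) simp_all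
  moreover have "diff M ` carrier M \<subseteq> lin_combs M (graded_max_ideal R) (carrier M)"
    using min by (simp add: M_def)
  ultimately have "minimal_free_resolution TYPE(nat \<Rightarrow> 'r) R a D M ?\<epsilon>"
    unfolding minimal_free_resolution_def by blast
  then show ?thesis using X unfolding M_def by blast
qed

section \<open>Differentials of degree zero over a field\<close>

text \<open>Generators of degree greater than \<open>i\<close> drop out of the component of degree \<open>i\<close>, because the ring has no
  elements of negative degree.\<close>

lemma (in graded_module) homogeneous_in_gsub:
  assumes B: "gsub R M B" and Sd: "\<And>s. s \<in> S \<Longrightarrow> s \<in> grade M (\<delta> s)" and z: "z \<in> spn R M (B \<union> S)" "z \<in> grade M i"
    and low: "\<And>s. \<lbrakk>s \<in> S; \<delta> s \<le> i\<rbrakk> \<Longrightarrow> s \<in> B"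
  shows "z \<in> B"
proof -
  note B' = submodD[OF gsubD(1)[OF B]]
  have SM: "S \<subseteq> carrier M" using Sd md.G_in_carrier by blast
  obtain b c where bc: "b \<in> B" "c \<in> coefs R S" "z = b \<oplus>\<^bsub>M\<^esub> lincomb R M (\<lambda>x. x) c"
    using spn_Un[OF gsubD(1)[OF B] SM z(1)] by blast
  have id: "(\<lambda>x. x) \<in> S \<rightarrow> carrier M" using SM by blast
  have "mpart M i z = mpart M i b \<oplus>\<^bsub>M\<^esub> mpart M i (lincomb R M (\<lambda>x. x) c)"
    unfolding bc(3) by (rule md.dpart_add[OF B'(1)[OF bc(1)] lincomb_closed[OF bc(2) id]])
  moreover have "mpart M i z = z" using md.dpart_homog[OF z(2), of i] by simp
  moreover have "lincomb R M (\<lambda>x. x) (\<lambda>s. rpart R (i - \<delta> s) (c s)) \<in> B"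
  proof (rule lincomb_submod[OF gsubD(1)[OF B]])
    fix s assume s: "rpart R (i - \<delta> s) (c s) \<noteq> \<zero>\<^bsub>R\<^esub>"
    have cs: "c s \<in> carrier R" by (rule coefsD(1)[OF bc(2)])
    have "s \<in> S"
    proof (rule ccontr)
      assume "s \<notin> S"
      then show False using s coefsD(2)[OF bc(2), of s] by (simp add: rd.dpart_zero)
    qed
    moreover have "\<delta> s \<le> i"
    proof (rule ccontr)
      assume "\<not> \<delta> s \<le> i"
      then show False using s rpart_neg[of "i - \<delta> s" "c s"] cs by simp
    qed
    ultimately show "rpart R (i - \<delta> s) (c s) \<odot>\<^bsub>M\<^esub> s \<in> B"
      by (intro B'(4)[OF rd.dpart_carrier[OF cs]] low)
  qed
  ultimately show ?thesis using mpart_lincomb(2)[OF bc(2) Sd, of "\<lambda>x. x" i] B'(3)[OF gsubD(2)[OF B bc(1)]] by simp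
qed

text \<open>Finitely many elements of \<open>T\<close> span \<open>T\<close>, and no basis element lies in the span of others.\<close>

lemma (in graded_local_ring) finite_subset_of_basis:
  assumes "gbasis R M B" and T: "T \<subseteq> B" and X: "finite X" "X \<subseteq> carrier M" "T \<subseteq> spn R M X"
  shows "finite T"
proof -
  interpret M: gbasis R M B by fact
  obtain T' where T': "finite T'" "T' \<subseteq> T" "T \<subseteq> spn R M T'"
    using M.finitely_spanned_subset[OF _ X] noetherian unfolding noncomm_noetherian_def by blast
  have "T \<subseteq> T'"
  proof (rule subsetI, rule ccontr)
    fix b assume b: "b \<in> T" "b \<notin> T'"
    obtain c where c: "c \<in> coefs R T'" "b = lincomb R M (\<lambda>x. x) c" using T'(3) b(1) by (auto simp: spn_def)
    have "c \<in> coefs R B" using c(1) coefs_mono[of T' B R] T'(2) T by blast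
    then have "coord R M B b = c" using c(2) by (rule M.coord_eqI)
    moreover have "coord R M B b b = \<one>" using M.coord_basis[of b] b(1) T by (auto simp: unitvec_def)
    ultimately show False using coefsD(2)[OF c(1) b(2)] one_not_zero by simp
  qed
  then show ?thesis using T'(1) by (rule finite_subset)
qed

text \<open>A basis element of \<open>M'\<close> of degree less than \<open>j0\<close> is sent to zero by the comparison map to \<open>M\<close>, so it would lie
  in \<open>\<mm>M'\<close>. Hence \<open>M'\<close> is bounded below as well.\<close>

lemma bounded_below_minimal_resolution_unique:
  assumes R: "graded_local_ring R" and D: "diff_module R a D"
    and m: "minimal_free_resolution TYPE('w) R a D M \<epsilon>"
    and low: "\<And>j. j < j0 \<Longrightarrow> grade M j = {\<zero>\<^bsub>M\<^esub>}"
    and m0: "\<And>r. r \<in> graded_max_ideal R \<Longrightarrow> rpart R 0 r = \<zero>\<^bsub>R\<^esub>"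
    and m': "minimal_free_resolution TYPE('v) R a D M' \<epsilon>'"
  shows "diff_isomorphic R M M'"
proof -
  interpret R: graded_local_ring R by fact
  have MG: "graded_module R M"
    using m by (simp add: minimal_free_resolution_def free_resolution_def free_diff_module_def graded_free_def)
  show ?thesis
  proof (rule nakayama_minimal_resolution_unique[OF R D m m'])
    show "R.nakayama M" by (rule R.nakayama_bounded_below[OF MG low m0])
  next
    fix B' u v assume gb: "gbasis R M' B'" and u: "u \<in> graded_hom R M M'" and v: "v \<in> graded_hom R M' M"
      and uv: "\<And>x. x \<in> carrier M' \<Longrightarrow> x \<ominus>\<^bsub>M'\<^esub> u (v x) \<in> lin_combs M' (graded_max_ideal R) (carrier M')"
    interpret M': gbasis R M' B' by (rule gb)
    let ?co = "coord R M' B'"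
    have hb: "j0 \<le> hdeg M' b" if b: "b \<in> B'" for b
    proof (rule ccontr)
      assume *: "\<not> j0 \<le> hdeg M' b"
      have bM: "b \<in> carrier M'" using b M'.basis_carrier by blast
      have "v b \<in> grade M (hdeg M' b)" by (rule graded_homD(5)[OF v M'.basis_homogeneous[OF b]])
      then have "v b = \<zero>\<^bsub>M\<^esub>" using low[of "hdeg M' b"] * by simp
      then have "u (v b) = \<zero>\<^bsub>M'\<^esub>" using graded_hom_zero[OF MG M'.graded_module_axioms u] by simp
      then have "b \<in> R.mM M'" using uv[OF bM] bM by (simp add: a_minus_def M'.M.a_inv_zero)
      then have "?co b b \<in> R.\<mm>" using R.mM_coord[OF gb bM] by blast
      moreover have "?co b b = \<one>\<^bsub>R\<^esub>" using M'.coord_basis[OF b] by (simp add: unitvec_def)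
      ultimately show False using R.one_notin_gmax by simp
    qed
    have low': "grade M' j = {\<zero>\<^bsub>M'\<^esub>}" if j: "j < j0" for j
    proof -
      have "y = \<zero>\<^bsub>M'\<^esub>" if y: "y \<in> grade M' j" for y
      proof -
        have yM: "y \<in> carrier M'" by (rule M'.md.G_in_carrier[OF y])
        have "?co y b = \<zero>\<^bsub>R\<^esub>" for b
        proof (cases "b \<in> B'")
          case True
          then show ?thesis using R.rgr_neg_zero[OF _ M'.coord_homogeneous[OF y True]] hb[OF True] j by simp
        next
          case False
          then show ?thesis by (rule coefsD(2)[OF M'.coord_coefs[OF yM]])
        qed
        then have "?co y = (\<lambda>b. \<zero>\<^bsub>R\<^esub>)" by blast
        then show ?thesis using M'.coord_lincomb[OF yM] M'.lincomb_zero[of "\<lambda>x. x"] by simp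
      qed
      then show ?thesis using M'.md.G_zero[of j] by blast
    qed
    show "R.nakayama M'" by (rule R.nakayama_bounded_below[OF M'.graded_module_axioms low' m0])
  qed
qed

context resolving begin

lemma Cn_grade:
  "(d, x) \<in> grade (Cn I g) j \<longleftrightarrow> d \<in> grade D j \<and> x \<in> coefs R I \<and> (\<forall>i\<in>I. x i \<in> rgr R (j + a - gd g i))"
  using FM_grade[of x I g "j + a"] by simp

lemma earlier_stage_submod:
  assumes "submod R (Cn J g) W" shows "submod R (Cn I g) {z \<in> carrier (Cn I g). z \<in> W}"
proof -
  interpret C: graded_module R "Cn I g" by (rule cone_graded_module(1)[OF d_graded FM_graded])
  have "\<zero>\<^bsub>Cn J g\<^esub> = \<zero>\<^bsub>Cn I g\<^esub>" "x \<oplus>\<^bsub>Cn J g\<^esub> y = x \<oplus>\<^bsub>Cn I g\<^esub> y" "r \<odot>\<^bsub>Cn J g\<^esub> x = r \<odot>\<^bsub>Cn I g\<^esub> x" for x y r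
    by (simp_all add: cone_def)
  note W = submodD[OF assms, unfolded this]
  show ?thesis
  proof (rule submodI)
    show "\<zero>\<^bsub>Cn I g\<^esub> \<in> {z \<in> carrier (Cn I g). z \<in> W}" using C.M.zero_closed W(2) by blast
  next
    fix x y assume "x \<in> {z \<in> carrier (Cn I g). z \<in> W}" "y \<in> {z \<in> carrier (Cn I g). z \<in> W}"
    then show "x \<oplus>\<^bsub>Cn I g\<^esub> y \<in> {z \<in> carrier (Cn I g). z \<in> W}" using C.M.a_closed W(3) by blast
  next
    fix r x assume "r \<in> carrier R" "x \<in> {z \<in> carrier (Cn I g). z \<in> W}"
    then show "r \<odot>\<^bsub>Cn I g\<^esub> x \<in> {z \<in> carrier (Cn I g). z \<in> W}" using C.smult_closed W(4) by blast
  qed blast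
qed

text \<open>Stage \<open>k\<close> attaches only generators of degree \<open>j0 + k\<close>, and the homology of \<open>D\<close> vanishes in degrees less than
  \<open>j0\<close>.\<close>

context
  fixes j0 :: int and N :: "nat \<Rightarrow> nat" and g :: "('r, 'd) attaching"
  assumes fld: "field (degree_zero_ring R)" and a0: "a = 0"
    and tw: "tower (\<lambda>k j. j = j0 + int k) N g"
    and start: "\<forall>i<j0. cycles (Cn {..<N 0} g) \<inter> grade (Cn {..<N 0} g) i \<subseteq> boundaries (Cn {..<N 0} g)"
begin

lemma attaching_degree: "n \<in> {N k..<N (Suc k)} \<Longrightarrow> gd g n = j0 + int k"
proof -
  assume n: "n \<in> {N k..<N (Suc k)}"
  obtain S where S: "bij_betw (\<lambda>n. (gy g n, gx g n)) {N k..<N (Suc k)} {u \<in> S. hdeg (Cn {..<N k} g) u = j0 + int k}"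
    "\<forall>n\<in>{N k..<N (Suc k)}. gd g n = hdeg (Cn {..<N k} g) (gy g n, gx g n)" using tower_S[OF tw] by blast
  show ?thesis using bij_betwE[OF S(1)] S(2) n by simp
qed

lemma stage_mono: "k \<le> l \<Longrightarrow> N k \<le> N l"
  by (rule lift_Suc_mono_le[where f = N, OF tower_mono[OF tw]])

lemma stage_of:
  assumes "n < N k" shows "\<exists>l<k. n \<in> {N l..<N (Suc l)}"
  using assms
proof (induction k)
  case 0
  then show ?case using tower_0[OF tw] by simp
next
  case (Suc k)
  then show ?case by (cases "n < N k") (auto intro: less_SucI)
qed

lemma stage_degree: "n < N k \<Longrightarrow> j0 \<le> gd g n \<and> gd g n < j0 + int k"
  using stage_of[of n k] attaching_degree by force

text \<open>A cycle of degree at most \<open>j0 + k\<close> on the next stage has coefficients of degree at most zero at the new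
  generators. By minimality these coefficients lie in \<open>\<mm>\<close>, so they vanish over a field, and the cycle lives on
  stage \<open>k\<close>. There it is a combination of boundaries and of minimal generators, and those of degree \<open>j0 + k\<close>
  have just been attached.\<close>

lemma low_cycle_boundary:
  "\<lbrakk>z \<in> cycles (Cn {..<N k} g); z \<in> grade (Cn {..<N k} g) i; i < j0 + int k\<rbrakk> \<Longrightarrow> z \<in> boundaries (Cn {..<N k} g)"
proof (induction k arbitrary: z i)
  case 0
  then have "i < j0" by simp
  then show ?case using start 0 by blast
next
  case (Suc k)
  let ?I = "{..<N k}" and ?J = "{..<N (Suc k)}"
  let ?C = "Cn ?I g" and ?K = "Cn ?J g"
  have fI: "flag_data R a D ?I g" and fJ: "flag_data R a D ?J g" by (rule tower_fd[OF tw])+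
  have sub: "?I \<subseteq> ?J" and JI: "?J - ?I = {N k..<N (Suc k)}" using tower_I[OF tw] tower_J[OF tw] by auto
  interpret C: diff_module R a ?C by (rule Cn_diff_module[OF fI])
  obtain d x where z: "z = (d, x)" by (cases z)
  have zc: "(d, x) \<in> cycles ?K" and zg: "(d, x) \<in> grade ?K i" using Suc.prems z by auto
  have x: "d \<in> carrier D" "x \<in> coefs R ?J" "gdif R g x = (\<lambda>_. \<zero>\<^bsub>R\<^esub>)" "geps R D g x = diff D d"
    using zc unfolding Cn_cycles[OF fJ] by auto
  have xg: "d \<in> grade D i" "\<And>n. n \<in> ?J \<Longrightarrow> x n \<in> rgr R (i + a - gd g n)" using zg unfolding Cn_grade by auto
  let ?t = "\<lambda>n. if n \<in> ?J - ?I then x n else \<zero>\<^bsub>R\<^esub>"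
  have t: "?t \<in> coefs R {N k..<N (Suc k)}" using coefs_split(2)[OF x(2), of ?I] unfolding JI .
  have "lincomb R ?C (\<lambda>n. (gy g n, gx g n)) ?t \<in> boundaries ?C"
    by (rule new_cycle_relation[OF fI fJ sub _ zc]) (use JI attaching_x[OF tw] in auto)
  then have tm: "?t n \<in> \<mm>" for n by (rule attaching_relation[OF tw t])
  have new0: "x n = \<zero>\<^bsub>R\<^esub>" if n: "n \<in> ?J - ?I" for n
  proof -
    have nJ: "n \<in> {N k..<N (Suc k)}" using n unfolding JI .
    have "x n \<in> rgr R (i - (j0 + int k))" using xg(2)[of n] n attaching_degree[OF nJ] a0 by simp
    moreover have "x n \<in> \<mm>" using tm[of n] n by simp
    ultimately show ?thesis
      using field_gmax[OF fld, of "x n"] rgr_neg_zero[of "i - (j0 + int k)" "x n"] Suc.prems(3)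
      by (cases "i = j0 + int k") auto
  qed
  have "x n = \<zero>\<^bsub>R\<^esub>" if "n \<notin> ?I" for n using new0[of n] coefsD(2)[OF x(2), of n] that by (cases "n \<in> ?J") auto
  then have xI: "x \<in> coefs R ?I" using coefsD[OF x(2)] by (simp add: coefs_def)
  have cI: "(d, x) \<in> cycles ?C" unfolding Cn_cycles[OF fI] using x xI by simp
  obtain S where S: "minimal_cycles (N k) g S"
    "bij_betw (\<lambda>n. (gy g n, gx g n)) {N k..<N (Suc k)} {u \<in> S. hdeg ?C u = j0 + int k}" using tower_S[OF tw] by blast
  have SZ: "S \<subseteq> cycles ?C" and Sg: "S \<subseteq> (\<Union>j. grade ?C j)" and sp: "cycles ?C \<subseteq> spn R ?C (boundaries ?C \<union> S)"
    using S(1) unfolding minimal_cycles_def by blast+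
  interpret K: diff_module R a ?K by (rule Cn_diff_module[OF fJ])
  have bb: "boundaries ?C \<subseteq> boundaries ?K" by (rule Cn_boundaries_mono[OF fI fJ sub])
  have Sd: "s \<in> grade ?C (hdeg ?C s)" if "s \<in> S" for s using Sg that by (intro grade_hdeg) blast
  have SdK: "s \<in> grade ?K (hdeg ?C s)" if s: "s \<in> S" for s
  proof -
    obtain d x where dx: "s = (d, x)" by (cases s)
    have x: "x \<in> coefs R ?I" "d \<in> grade D (hdeg ?C s)" "\<forall>n\<in>?I. x n \<in> rgr R (hdeg ?C s + a - gd g n)"
      using Sd[OF s] unfolding dx Cn_grade by auto
    moreover have "x n \<in> rgr R (hdeg ?C s + a - gd g n)" for n
      using x coefsD(2)[OF x(1), of n] rd.G_zero by (cases "n \<in> ?I") auto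
    ultimately show ?thesis using coefs_mono[OF sub, of R] unfolding dx Cn_grade by blast
  qed
  have BS: "boundaries ?K \<union> S \<subseteq> carrier ?K" using K.boundaries_closed(1) SdK K.md.G_in_carrier by blast
  have "boundaries ?C \<union> S \<subseteq> {z \<in> carrier ?C. z \<in> spn R ?K (boundaries ?K \<union> S)}"
    using K.spn_incl[OF BS] bb SZ C.boundaries_closed(1) C.cycles_closed(1) by blast
  from C.spn_least[OF earlier_stage_submod[OF K.spn_submod[OF BS]] this]
  have zK: "(d, x) \<in> spn R ?K (boundaries ?K \<union> S)" using sp cI by blast
  have "(d, x) \<in> boundaries ?K"
  proof (rule K.homogeneous_in_gsub[OF K.boundaries_gsub SdK zK zg])
    fix s assume s: "s \<in> S" "hdeg ?C s \<le> i"
    show "s \<in> boundaries ?K"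
    proof (cases "hdeg ?C s = j0 + int k")
      case True
      then have "s \<in> {u \<in> S. hdeg ?C u = j0 + int k}" using s(1) by simp
      then obtain n where n: "n \<in> {N k..<N (Suc k)}" "s = (gy g n, gx g n)"
        using bij_betw_imp_surj_on[OF S(2)] by blast
      show ?thesis unfolding n(2) by (rule attaching_cycle_boundary[OF fJ]) (use n(1) in simp)
    next
      case False
      then have "hdeg ?C s < j0 + int k" using s(2) Suc.prems(3) by simp
      then show ?thesis using Suc.IH[OF subsetD[OF SZ s(1)] Sd[OF s(1)]] bb by blast
    qed
  qed
  then show ?case using z by simp
qed

abbreviation "I\<^sub>\<omega> \<equiv> \<Union>k. {..<N k}"

lemma limit_flag_data: "flag_data R a D I\<^sub>\<omega> g"
  unfolding flag_data_def
proof
  fix n assume "n \<in> I\<^sub>\<omega>"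
  then obtain k where n: "n \<in> {..<N k}" by blast
  note F = flag_dataD[OF tower_fd[OF tw] n]
  show "{..<n} \<subseteq> I\<^sub>\<omega> \<and> gx g n \<in> coefs R {..<n} \<and> (\<forall>i<n. gx g n i \<in> rgr R (gd g n + a - gd g i)) \<and>
    gy g n \<in> grade D (gd g n) \<and> gdif R g (gx g n) = (\<lambda>_. \<zero>\<^bsub>R\<^esub>) \<and> geps R D g (gx g n) = diff D (gy g n)"
    by (intro conjI allI impI F(2-6) order_trans[OF F(1)] UN_upper UNIV_I)
qed

lemma finite_subset_stage:
  assumes "finite A" "A \<subseteq> I\<^sub>\<omega>" shows "\<exists>k. A \<subseteq> {..<N k}"
  using assms
proof (induction A)
  case (insert n A)
  then obtain k l where "A \<subseteq> {..<N k}" "n < N l" by blast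
  then have "insert n A \<subseteq> {..<N (max k l)}" using stage_mono[of k "max k l"] stage_mono[of l "max k l"] by auto
  then show ?case by blast
qed simp

text \<open>A homogeneous cycle involves finitely many generators, so it lies on a stage, which can be taken so late
  that the cycle is a boundary.\<close>

lemma limit_acyclic: "cycles (Cn I\<^sub>\<omega> g) \<subseteq> boundaries (Cn I\<^sub>\<omega> g)"
proof
  let ?C = "Cn I\<^sub>\<omega> g"
  interpret C: diff_module R a ?C by (rule Cn_diff_module[OF limit_flag_data])
  fix z assume z: "z \<in> cycles ?C"
  show "z \<in> boundaries ?C"
  proof (rule C.md.mem_if_dparts[OF C.submod_add_subgroup[OF gsubD(1)[OF C.boundaries_gsub]] C.cycles_closed(1)[OF z]])
    fix j
    obtain d x where dx: "mpart ?C j z = (d, x)" by (cases "mpart ?C j z")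
    have zc: "(d, x) \<in> cycles ?C" using gsubD(2)[OF C.cycles_gsub z, of j] dx by simp
    have zg: "(d, x) \<in> grade ?C j" using C.md.dpart_in[OF C.cycles_closed(1)[OF z], of j] dx by simp
    have x: "d \<in> carrier D" "x \<in> coefs R I\<^sub>\<omega>" "gdif R g x = (\<lambda>_. \<zero>\<^bsub>R\<^esub>)" "geps R D g x = diff D d"
      using zc unfolding Cn_cycles[OF limit_flag_data] by auto
    obtain k where k: "{n. x n \<noteq> \<zero>\<^bsub>R\<^esub>} \<subseteq> {..<N k}" using finite_subset_stage[OF coefsD(3,4)[OF x(2)]] by blast
    define l where "l = max k (nat (j - j0) + 1)"
    let ?I = "{..<N l}"
    have fI: "flag_data R a D ?I g" by (rule tower_fd[OF tw])
    have "{n. x n \<noteq> \<zero>\<^bsub>R\<^esub>} \<subseteq> ?I" using k stage_mono[of k l] unfolding l_def by fastforce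
    then have xI: "x \<in> coefs R ?I" using coefsD[OF x(2)] by (auto simp: coefs_def)
    have "(d, x) \<in> cycles (Cn ?I g)" unfolding Cn_cycles[OF fI] using x xI by simp
    moreover have "(d, x) \<in> grade (Cn ?I g) j" using zg xI unfolding Cn_grade by blast
    moreover have "j < j0 + int l" unfolding l_def by linarith
    ultimately have "(d, x) \<in> boundaries (Cn ?I g)" by (rule low_cycle_boundary)
    then show "mpart ?C j z \<in> boundaries ?C"
      using Cn_boundaries_mono[OF fI limit_flag_data] dx by auto
  qed
qed

text \<open>A generator of stage \<open>k\<close> is attached along a cycle that involves only generators of smaller degree. Since
  \<open>a = 0\<close>, their coefficients have positive degree.\<close>

lemma limit_minimal:
  "diff (FM R I\<^sub>\<omega> g) ` carrier (FM R I\<^sub>\<omega> g) \<subseteq> mM (FM R I\<^sub>\<omega> g)"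
proof
  fix y assume "y \<in> diff (FM R I\<^sub>\<omega> g) ` carrier (FM R I\<^sub>\<omega> g)"
  then obtain c where c: "c \<in> coefs R I\<^sub>\<omega>" "y = gdif R g c" using gdif_rg[OF limit_flag_data] by auto
  have gm: "gx g n i \<in> \<mm>" if n: "n \<in> I\<^sub>\<omega>" for n i
  proof -
    obtain k where k: "n \<in> {N k..<N (Suc k)}" using n stage_of by blast
    show ?thesis
    proof (cases "i < N k")
      case True
      then have "gd g i < gd g n" using stage_degree attaching_degree[OF k] by simp
      moreover have "gx g n i \<in> rgr R (gd g n - gd g i)"
        using flag_dataD(3)[OF limit_flag_data n, of i] True k a0 by simp
      ultimately show ?thesis by (intro positive_degree_gmax) auto
    next
      case False
      then show ?thesis using coefsD(2)[OF attaching_x[OF tw k], of i] gmax_zero by simp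
    qed
  qed
  have "gdif R g c i \<in> \<mm>" for i
    unfolding gdif_def
  proof (rule gmax_finsum, rule)
    fix n assume "n \<in> {n. c n \<noteq> \<zero>\<^bsub>R\<^esub>}"
    then have "n \<in> I\<^sub>\<omega>" using coefsD(4)[OF c(1)] by blast
    then show "c n \<otimes>\<^bsub>R\<^esub> gx g n i \<in> \<mm>" by (intro gmax_lmult[OF coefsD(1)[OF c(1)]] gm)
  qed
  then show "y \<in> mM (FM R I\<^sub>\<omega> g)"
    unfolding c(2) by (intro FM_mM gdif_add(3)[OF limit_flag_data c(1) c(1)])
qed

lemma limit_grade_low: "j < j0 \<Longrightarrow> grade (FM R I\<^sub>\<omega> g) j = {\<zero>\<^bsub>FM R I\<^sub>\<omega> g\<^esub>}"
proof -
  assume j: "j < j0"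
  interpret F: graded_module R "FM R I\<^sub>\<omega> g" by (rule FM_graded)
  have "c = (\<lambda>_. \<zero>\<^bsub>R\<^esub>)" if c: "c \<in> grade (FM R I\<^sub>\<omega> g) j" for c
  proof
    fix n
    have c': "c \<in> coefs R I\<^sub>\<omega>" "\<forall>n\<in>I\<^sub>\<omega>. c n \<in> rgr R (j - gd g n)" using c unfolding FM_grade by auto
    show "c n = \<zero>\<^bsub>R\<^esub>"
    proof (cases "n \<in> I\<^sub>\<omega>")
      case True
      then have "j0 \<le> gd g n" using stage_degree by blast
      then show ?thesis using rgr_neg_zero[OF _ bspec[OF c'(2) True]] j by simp
    qed (rule coefsD(2)[OF c'(1)])
  qed
  then show ?thesis using F.md.G_zero[of j] unfolding FM_simps by blast
qed

text \<open>Elements of degree \<open>j\<close> involve only generators of degree at most \<open>j\<close>, of which there are finitely many.\<close>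

lemma limit_basis_finite:
  assumes B: "homogeneous_basis R (FM R I\<^sub>\<omega> g) B"
  shows "finite (B \<inter> grade (FM R I\<^sub>\<omega> g) j)"
proof -
  let ?F = "FM R I\<^sub>\<omega> g"
  let ?X = "{n \<in> I\<^sub>\<omega>. gd g n \<le> j}"
  have gb: "gbasis R ?F B" by (rule gbasisI[OF FM_graded B])
  interpret F: gbasis R ?F B by (rule gb)
  have "?X \<subseteq> {..<N (nat (j - j0) + 1)}"
  proof
    fix n assume n: "n \<in> ?X"
    then obtain k where k: "n \<in> {N k..<N (Suc k)}" using stage_of by blast
    then have "j0 + int k \<le> j" using attaching_degree n by fastforce
    then have "Suc k \<le> nat (j - j0) + 1" by linarith
    then show "n \<in> {..<N (nat (j - j0) + 1)}" using k stage_mono[of "Suc k" "nat (j - j0) + 1"] by auto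
  qed
  then have X: "finite ?X" by (rule finite_subset) simp
  have XF: "unitvec R ` ?X \<subseteq> carrier ?F" unfolding FM_simps by (intro image_subsetI L.coefs_unitvec) blast
  have "B \<inter> grade ?F j \<subseteq> spn R ?F (unitvec R ` ?X)"
  proof
    fix c assume "c \<in> B \<inter> grade ?F j"
    then have "c \<in> grade ?F j" by simp
    then have c: "c \<in> coefs R I\<^sub>\<omega>" "\<forall>n\<in>I\<^sub>\<omega>. c n \<in> rgr R (j - gd g n)" unfolding FM_grade by blast+
    have "lincomb R ?F (unitvec R) c \<in> spn R ?F (unitvec R ` ?X)"
    proof (rule F.lincomb_submod[OF F.spn_submod[OF XF]])
      fix n assume n: "c n \<noteq> \<zero>\<^bsub>R\<^esub>"
      then have nI: "n \<in> I\<^sub>\<omega>" using coefsD(2)[OF c(1)] by blast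
      have "gd g n \<le> j" using rgr_neg_zero[OF _ bspec[OF c(2) nI]] n by force
      then have "unitvec R n \<in> spn R ?F (unitvec R ` ?X)" using nI by (intro F.spn_incl[OF XF]) blast
      then show "c n \<odot>\<^bsub>?F\<^esub> unitvec R n \<in> spn R ?F (unitvec R ` ?X)"
        by (rule submodD(4)[OF F.spn_submod[OF XF] coefsD(1)[OF c(1)]])
    qed
    then show "c \<in> spn R ?F (unitvec R ` ?X)" 
      unfolding FM_def fmod_lincomb_unitvec[OF c(1)] .
  qed
  then show ?thesis by (intro finite_subset_of_basis[OF gb _ finite_imageI[OF X] XF]) auto
qed

end

lemma bounded_below_minimal_resolution_exists:
  assumes fg: "finitely_generated R (homology D)" and fld: "field (degree_zero_ring R)" and a0: "a = 0"
  shows "\<exists>(M :: ('r, nat \<Rightarrow> 'r) diff_module) \<epsilon> j0.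
    minimal_free_resolution TYPE(nat \<Rightarrow> 'r) R a D M \<epsilon> \<and> (\<forall>j<j0. grade M j = {\<zero>\<^bsub>M\<^esub>}) \<and>
    (\<forall>B. homogeneous_basis R M B \<longrightarrow> (\<forall>j. finite (B \<inter> grade M j)))"
proof -
  obtain A where A: "finite A" "A \<subseteq> cycles D" "cycles D \<subseteq> spn R D (boundaries D \<union> A)"
    using homology_generators[OF fg] by blast
  have fd0: "flag_data R a D {..<0} undefined" by (simp add: flag_data_def)
  let ?C0 = "Cn {..<0} undefined"
  interpret C: diff_module R a ?C0 by (rule Cn_diff_module[OF fd0])
  obtain S where S: "minimal_cycles 0 undefined S" using minimal_cycles_exist[OF fd0 A] by blast
  then have Sg: "S \<subseteq> (\<Union>j. grade ?C0 j)" and Sf: "finite S" and sp: "cycles ?C0 \<subseteq> spn R ?C0 (boundaries ?C0 \<union> S)"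
    unfolding minimal_cycles_def by blast+
  \<comment> \<open>The element \<open>0\<close> covers the case that \<open>H(D)\<close> is zero and \<open>S\<close> is empty.\<close>
  obtain j0 where j0: "\<And>s. s \<in> S \<Longrightarrow> j0 \<le> hdeg ?C0 s"
  proof
    show "\<And>s. s \<in> S \<Longrightarrow> Min (insert 0 (hdeg ?C0 ` S)) \<le> hdeg ?C0 s" using Sf by (intro Min_le) auto
  qed
  have start0: "z \<in> boundaries ?C0" if "z \<in> cycles ?C0" "z \<in> grade ?C0 i" "i < j0" for z i
    by (rule C.homogeneous_in_gsub[where S = S and \<delta> = "hdeg ?C0", OF C.boundaries_gsub _ _ that(2)])
      (use sp that j0 grade_hdeg[OF subsetD[OF Sg]] in force)+
  obtain N g where tw: "tower (\<lambda>k j. j = j0 + int k) N g" using tower_exists[OF A] by blast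
  have eq: "Cn {..<N 0} g = ?C0" unfolding tower_0[OF tw] by (rule Cn_cong) simp
  have start: "\<forall>i<j0. cycles (Cn {..<N 0} g) \<inter> grade (Cn {..<N 0} g) i \<subseteq> boundaries (Cn {..<N 0} g)"
    unfolding eq using start0 by blast
  note lim = fld a0 tw start
  let ?M = "FM R (\<Union>k. {..<N k}) g" and ?\<epsilon> = "geps R D (rg (\<Union>k. {..<N k}) g)"
  have fd: "flag_data R a D (\<Union>k. {..<N k}) g" by (rule limit_flag_data[OF lim])
  have q: "quasi_iso R ?M D ?\<epsilon>" by (rule FM_quasi_iso[OF fd limit_acyclic[OF lim]])
  have Md: "diff_module R a ?M" by (rule FM_diff_module[OF fd])
  have "free_diff_module R a ?M"
    unfolding free_diff_module_def graded_free_def using Md FM_graded FM_basis by blast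
  moreover have "free_flag_resolution R a D ?M ?\<epsilon>"
    unfolding free_flag_resolution_def using FM_free_flag[OF fd] q by blast
  moreover have "split_injection R ?M ?M (\<lambda>x. x)"
    unfolding split_injection_def diff_hom_def
    by (intro conjI CollectI ballI bexI[of _ "\<lambda>x. x"] graded_hom_id refl)
  ultimately have "free_resolution TYPE(nat \<Rightarrow> 'r) R a D ?M ?\<epsilon>"
    unfolding free_resolution_def using q
    by (intro conjI exI[of _ ?M] exI[of _ "\<lambda>x. x"] exI[of _ ?\<epsilon>]) simp_all
  then have "minimal_free_resolution TYPE(nat \<Rightarrow> 'r) R a D ?M ?\<epsilon>"
    unfolding minimal_free_resolution_def using limit_minimal[OF lim] by blast
  then show ?thesis
    using limit_grade_low[OF lim] limit_basis_finite[OF lim]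
    by (intro exI[of _ ?M] exI[of _ ?\<epsilon>] exI[of _ j0]) simp
qed

end

theorem theorem1p2:
  fixes R :: "'r graded_ring" and D :: "('r, 'd) diff_module" and a :: int
  assumes "graded_local_ring R"
    and "diff_module R a D"
    and "finitely_generated R (homology D)"
  shows "(finite_projective_dimension TYPE('p) R (homology D) \<longrightarrow>
      (\<exists>(M :: ('r, nat \<Rightarrow> 'r) diff_module) \<epsilon>.
        minimal_free_resolution TYPE(nat \<Rightarrow> 'r) R a D M \<epsilon> \<and>
        (\<forall>(M' :: ('r, 'm) diff_module) \<epsilon>'.
          minimal_free_resolution TYPE('w) R a D M' \<epsilon>' \<longrightarrow> diff_isomorphic R M M') \<and>
        finite_rank R M)) \<and>
    (field (degree_zero_ring R) \<and> a = 0 \<longrightarrow>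
      (\<exists>(M :: ('r, nat \<Rightarrow> 'r) diff_module) \<epsilon>.
        minimal_free_resolution TYPE(nat \<Rightarrow> 'r) R a D M \<epsilon> \<and>
        (\<forall>(M' :: ('r, 'm) diff_module) \<epsilon>'.
          minimal_free_resolution TYPE('w) R a D M' \<epsilon>' \<longrightarrow> diff_isomorphic R M M') \<and>
        (\<forall>B. homogeneous_basis R M B \<longrightarrow>
          (\<forall>j. finite (B \<inter> grade M j)) \<and> (\<exists>j\<^sub>0. \<forall>j<j\<^sub>0. B \<inter> grade M j = {}))))"
  (is "(_ \<longrightarrow> ?A) \<and> (_ \<longrightarrow> ?B)")
proof (intro conjI impI)
  note R = assms(1) and D = assms(2)
  interpret L: graded_local_ring R by (rule R)
  interpret resolving R a D by (intro resolving.intro R D)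
  {
    assume "finite_projective_dimension TYPE('p) R (homology D)"
    then obtain n where pd: "projective_dimension_le TYPE('p) R (homology D) n"
      unfolding finite_projective_dimension_def by blast
    obtain M :: "('r, nat \<Rightarrow> 'r) diff_module" and \<epsilon> X
      where M: "minimal_free_resolution TYPE(nat \<Rightarrow> 'r) R a D M \<epsilon>" "homogeneous_basis R M X" "finite X"
      using finite_minimal_resolution_exists[OF assms(3) pd] by (elim exE conjE) (rule that)
    show ?A
    proof (intro exI conjI allI impI)
      show "minimal_free_resolution TYPE(nat \<Rightarrow> 'r) R a D M \<epsilon>" by (rule M(1))
      show "finite_rank R M" unfolding finite_rank_def using M(2,3) by blast
      show "diff_isomorphic R M M'" if "minimal_free_resolution TYPE('w) R a D M' \<epsilon>'"
        for M' :: "('r, 'm) diff_module" and \<epsilon>'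
        by (rule finite_minimal_resolution_unique[OF R D M that])
    qed
  next
    assume fa: "field (degree_zero_ring R) \<and> a = 0"
    obtain M :: "('r, nat \<Rightarrow> 'r) diff_module" and \<epsilon> j0
      where M: "minimal_free_resolution TYPE(nat \<Rightarrow> 'r) R a D M \<epsilon>" "\<forall>j<j0. grade M j = {\<zero>\<^bsub>M\<^esub>}"
        "\<forall>B. homogeneous_basis R M B \<longrightarrow> (\<forall>j. finite (B \<inter> grade M j))"
      using bounded_below_minimal_resolution_exists[OF assms(3) conjunct1[OF fa] conjunct2[OF fa]]
      by (elim exE conjE) (rule that)
    have low: "grade M j = {\<zero>\<^bsub>M\<^esub>}" if "j < j0" for j using M(2) that by blast
    have m0: "rpart R 0 r = \<zero>\<^bsub>R\<^esub>" if r: "r \<in> graded_max_ideal R" for r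
    proof (rule L.field_gmax[OF conjunct1[OF fa]])
      have rR: "r \<in> carrier R" by (rule L.gmax_carrier[OF r])
      show "rpart R 0 r \<in> rgr R 0" by (rule L.rd.dpart_in[OF rR])
      then show "rpart R 0 r \<in> graded_max_ideal R"
        using r L.rd.dpart_homog[of "rpart R 0 r" 0 0] L.rd.dpart_carrier[OF rR] by (simp add: L.mem_gmax_iff)
    qed
    have MG: "graded_module R M"
      using M(1) by (simp add: minimal_free_resolution_def free_resolution_def free_diff_module_def graded_free_def)
    show ?B
    proof (intro exI conjI allI impI)
      show "minimal_free_resolution TYPE(nat \<Rightarrow> 'r) R a D M \<epsilon>" by (rule M(1))
      show "diff_isomorphic R M M'" if "minimal_free_resolution TYPE('w) R a D M' \<epsilon>'"
        for M' :: "('r, 'm) diff_module" and \<epsilon>'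
        by (rule bounded_below_minimal_resolution_unique[OF R D M(1) low m0 that])
      show "finite (B \<inter> grade M j)" if "homogeneous_basis R M B" for B j using M(3) that by blast
      fix B j assume "homogeneous_basis R M B" "j < j0"
      then show "B \<inter> grade M j = {}" using L.basis_zero_notin[OF gbasisI[OF MG]] low by auto
    qed
  }
qed

end
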